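(* Let $A=\Bbbk Q/I$ be a gentle or locally gentle algebra over a field $\Bbbk$ with $A\not\cong\Bbbk[x]$. Then the group $H_A/(H_A\cap\operatorname{Inn}^*(A))$ is isomorphic to: (a) $\operatorname{GL}_2(\Bbbk)$ if $A\cong\Bbbk K$, where $K$ is the Kronecker quiver; (b) a semidirect product $\mathbb Z/2\mathbb Z\ltimes(\Bbbk^\times)^{|Q_1|}$ (with $(\Bbbk^\times)^{|Q_1|}$ normal) if $A\not\cong \Bbbk K$ and $Q$ is either a linear chain of double arrows or an oriented cycle of double arrows; (c) otherwise, a semidirect product $(\Bbbk^\times)^{|Q_1|}\ltimes\Bbbk^n$ (with $\Bbbk^n$ normal), where $n$ is the number of arrows $\alpha\in Q_1$ for which $\bar\gamma_\alpha$ exists.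
   Context: Quivers $Q=(Q_0,Q_1,s,t)$ are finite, connected, with at least one arrow. A path of length $n\ge 1$ is $p=\alpha_1\cdots\alpha_n$ with $\alpha_i\in Q_1$, $t(\alpha_i)=s(\alpha_{i+1})$; $F(p)=\alpha_1$, $L(p)=\alpha_n$, $s(p)=s(\alpha_1)$, $t(p)=t(\alpha_n)$. For each vertex $v$ there is a stationary path $\epsilon_v$ of length $0$. Paths are parallel if they have the same source and the same target. $\Bbbk Q$ is the path algebra (product = concatenation). $A=\Bbbk Q/I$ is gentle (if finite-dimensional) or locally gentle (if infinite-dimensional) if: (i) every vertex has in-degree $\le 2$ and out-degree $\le 2$; (ii') whenever $s(\alpha)=t(\beta)=t(\beta')$ with $\beta\ne\beta'$ arrows, exactly one of $\beta\alpha,\beta'\alpha$ is in $I$; (iii') whenever $t(\alpha)=s(\beta)=s(\beta')$ with $\beta\neq\beta'$, exactly one of $\alpha\beta,\alpha\beta'$ is in $I$; (iv') $I$ is generated by paths of length $2$. $\mathcal B$ is the basis of $A$ of paths not in $I$; $A_+$ is the span of the nonstationary paths in $\mathcal B$. A finite maximal path is a path $p\in\mathcal B$ with $\alpha p=0=p\alpha$ in $A$ for all $\alpha\in Q_1$. For each arrow $\alpha$ there is at most one finite maximal path which is parallel to $\alpha$ and neither starts nor ends with $\alpha$; if it exists it is denoted $\bar\gamma_\alpha$. $H_A$ is the group of $\Bbbk$-algebra automorphisms of $A$ fixing every $\epsilon_v$. For a unit $u$, $\Delta_u(z)=u^{-1}zu$, and $\operatorname{Inn}^*(A)=\{\Delta_{1+y}: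 y\in A_+,\ 1+y\in A^\times\}$. The Kronecker quiver $K$ has two vertices and exactly two arrows, both from the first to the second. A linear chain of double arrows is a quiver with vertices $1,\dots,k+1$ ($k\ge1$), exactly two arrows $i\to i+1$ for each $1\le i\le k$, and no other arrows. An oriented cycle of double arrows is a quiver with vertex set $\mathbb Z/k\mathbb Z$ ($k\ge1$), exactly two arrows $i\to i+1$ for each $i\in\mathbb Z/k\mathbb Z$, and no other arrows (for $k=1$: one vertex with two loops). *)

theory Defs
  imports
    "Graph_Theory.Graph_Theory"
    "Jordan_Normal_Form.Matrix"
    "HOL-Algebra.Algebra"
    "HOL-Library.Poly_Mapping"
    "HOL-Computational_Algebra.Polynomial"
begin

text \<open>
  A quiver is a \<open>pre_digraph\<close>: \<open>verts\<close>, \<open>arcs\<close>, \<open>tail\<close>, \<open>head\<close> are \<open>Q\<^sub>0\<close>, \<open>Q\<^sub>1\<close>, \<open>s\<close>, \<open>t\<close>.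
  The library's \<open>connected\<close> is weak connectedness.
\<close>

definition quiver :: "('v, 'a) pre_digraph \<Rightarrow> bool" where
  "quiver Q \<longleftrightarrow> fin_digraph Q \<and> connected Q \<and> arcs Q \<noteq> {}"


section \<open>Paths and path algebras\<close>

text \<open>
  A path is encoded as its source together with its list of arrows, so that the stationary path
  at \<open>v\<close> is \<open>(v, [])\<close> and the arrow \<open>a\<close> is the path \<open>(tail Q a, [a])\<close>.
\<close>

type_synonym ('v, 'a) qpath = "'v \<times> 'a list"

definition path_src :: "('v, 'a) qpath \<Rightarrow> 'v" where
  "path_src p = fst p"

definition path_tgt :: "('v, 'a) pre_digraph \<Rightarrow> ('v, 'a) qpath \<Rightarrow> 'v" where
  "path_tgt Q p = pre_digraph.awlast Q (fst p) (snd p)"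

definition path_length :: "('v, 'a) qpath \<Rightarrow> nat" where
  "path_length p = length (snd p)"

definition paths :: "('v, 'a) pre_digraph \<Rightarrow> ('v, 'a) qpath set" where
  "paths Q = {p. \<exists>v. pre_digraph.awalk Q (fst p) (snd p) v}"

definition arrow_path :: "('v, 'a) pre_digraph \<Rightarrow> 'a \<Rightarrow> ('v, 'a) qpath" where
  "arrow_path Q a = (tail Q a, [a])"

definition parallel :: "('v, 'a) pre_digraph \<Rightarrow> ('v, 'a) qpath \<Rightarrow> ('v, 'a) qpath \<Rightarrow> bool" where
  "parallel Q p q \<longleftrightarrow> path_src p = path_src q \<and> path_tgt Q p = path_tgt Q q"

definition starts_with :: "('v, 'a) qpath \<Rightarrow> 'a \<Rightarrow> bool" where
  "starts_with p a \<longleftrightarrow> snd p \<noteq> [] \<and> hd (snd p) = a"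

definition ends_with :: "('v, 'a) qpath \<Rightarrow> 'a \<Rightarrow> bool" where
  "ends_with p a \<longleftrightarrow> snd p \<noteq> [] \<and> last (snd p) = a"

text \<open>
  Elements of the path algebra are finitely supported functions from paths to scalars. The product
  extends concatenation bilinearly: \<open>p q\<close> is nonzero iff \<open>q\<close> starts where \<open>p\<close> ends.
\<close>

definition path_mult ::
  "('v, 'a) pre_digraph \<Rightarrow> (('v, 'a) qpath \<Rightarrow>\<^sub>0 'k::field) \<Rightarrow> (('v, 'a) qpath \<Rightarrow>\<^sub>0 'k) \<Rightarrow> (('v, 'a) qpath \<Rightarrow>\<^sub>0 'k)"
where
  "path_mult Q f g =
     (\<Sum>p\<in>Poly_Mapping.keys f. \<Sum>q\<in>Poly_Mapping.keys g.
        if path_tgt Q p = path_src q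
        then Poly_Mapping.single (fst p, snd p @ snd q) (Poly_Mapping.lookup f p * Poly_Mapping.lookup g q)
        else 0)"

definition path_algebra ::
  "('v, 'a) pre_digraph \<Rightarrow> ('k::field, ('v, 'a) qpath \<Rightarrow>\<^sub>0 'k) module"
where
  "path_algebra Q =
     \<lparr>carrier = {f. Poly_Mapping.keys f \<subseteq> paths Q},
      monoid.mult = path_mult Q,
      one = (\<Sum>v\<in>verts Q. Poly_Mapping.single (v, []) 1),
      ring.zero = 0,
      add = (+),
      module.smult = (\<lambda>c. Poly_Mapping.map ((*) c))\<rparr>"

definition path_elem :: "('v, 'a) qpath \<Rightarrow> (('v, 'a) qpath \<Rightarrow>\<^sub>0 'k::field)" where
  "path_elem p = Poly_Mapping.single p 1"


section \<open>Algebras over a field\<close>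

text \<open>
  The record \<open>module\<close> carries a ring together with a scalar multiplication. (The locale \<open>algebra\<close> of
  HOL-Algebra only covers commutative algebras.) The scalar multiplication of a quotient is the
  analogue of \<open>rcoset_mult\<close>: it sends \<open>I + x\<close> to \<open>I + c x\<close>.
\<close>

definition quotient_algebra :: "('k, 'b) module \<Rightarrow> 'b set \<Rightarrow> ('k, 'b set) module" where
  "quotient_algebra A I =
     ring.extend (A Quot I) (module.fields (\<lambda>c Y. \<Union>y\<in>Y. I +>\<^bsub>A\<^esub> (c \<odot>\<^bsub>A\<^esub> y)))"

definition algebra_hom :: "('k, 'b) module \<Rightarrow> ('k, 'c) module \<Rightarrow> ('b \<Rightarrow> 'c) set" where
  "algebra_hom A B =
     {h \<in> ring_hom A B. \<forall>c. \<forall>x\<in>carrier A. h (c \<odot>\<^bsub>A\<^esub> x) = c \<odot>\<^bsub>B\<^esub> h x}"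

definition algebra_isomorphic :: "('k, 'b) module \<Rightarrow> ('k, 'c) module \<Rightarrow> bool" where
  "algebra_isomorphic A B \<longleftrightarrow> (\<exists>h \<in> algebra_hom A B. bij_betw h (carrier A) (carrier B))"

definition linear_span :: "('k, 'b) module \<Rightarrow> 'b set \<Rightarrow> 'b set" where
  "linear_span A S =
     {finsum A (\<lambda>b. c b \<odot>\<^bsub>A\<^esub> b) F | c F. finite F \<and> F \<subseteq> S}"

definition finite_dimensional :: "('k, 'b) module \<Rightarrow> bool" where
  "finite_dimensional A \<longleftrightarrow>
     (\<exists>S. finite S \<and> S \<subseteq> carrier A \<and> linear_span A S = carrier A)"

definition polynomial_algebra :: "('k::field, 'k poly) module" where
  "polynomial_algebra =
     \<lparr>carrier = UNIV, monoid.mult = (*), one = 1, ring.zero = 0, add = (+),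
      module.smult = Polynomial.smult\<rparr>"


section \<open>Gentle and locally gentle algebras\<close>

abbreviation bound_quiver_algebra ::
  "('v, 'a) pre_digraph \<Rightarrow> (('v, 'a) qpath \<Rightarrow>\<^sub>0 'k::field) set \<Rightarrow> ('k, (('v, 'a) qpath \<Rightarrow>\<^sub>0 'k) set) module"
where
  "bound_quiver_algebra Q I \<equiv> quotient_algebra (path_algebra Q) I"

definition gentle_conditions ::
  "('v, 'a) pre_digraph \<Rightarrow> (('v, 'a) qpath \<Rightarrow>\<^sub>0 'k::field) set \<Rightarrow> bool"
where
  "gentle_conditions Q I \<longleftrightarrow>
     quiver Q \<and>
     (\<forall>v\<in>verts Q. in_degree Q v \<le> 2 \<and> out_degree Q v \<le> 2) \<and>
     (\<forall>a\<in>arcs Q. \<forall>b\<in>arcs Q. \<forall>b'\<in>arcs Q.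
        b \<noteq> b' \<and> tail Q a = head Q b \<and> tail Q a = head Q b' \<longrightarrow>
        (path_elem (tail Q b, [b, a]) \<in> I) \<noteq> (path_elem (tail Q b', [b', a]) \<in> I)) \<and>
     (\<forall>a\<in>arcs Q. \<forall>b\<in>arcs Q. \<forall>b'\<in>arcs Q.
        b \<noteq> b' \<and> head Q a = tail Q b \<and> head Q a = tail Q b' \<longrightarrow>
        (path_elem (tail Q a, [a, b]) \<in> I) \<noteq> (path_elem (tail Q a, [a, b']) \<in> I)) \<and>
     (\<exists>S \<subseteq> {p \<in> paths Q. path_length p = 2}.
        I = Idl\<^bsub>path_algebra Q :: ('k, ('v, 'a) qpath \<Rightarrow>\<^sub>0 'k) module\<^esub> (path_elem ` S))"

definition gentle ::
  "('v, 'a) pre_digraph \<Rightarrow> (('v, 'a) qpath \<Rightarrow>\<^sub>0 'k::field) set \<Rightarrow> bool"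
where
  "gentle Q I \<longleftrightarrow> gentle_conditions Q I \<and> finite_dimensional (bound_quiver_algebra Q I)"

definition locally_gentle ::
  "('v, 'a) pre_digraph \<Rightarrow> (('v, 'a) qpath \<Rightarrow>\<^sub>0 'k::field) set \<Rightarrow> bool"
where
  "locally_gentle Q I \<longleftrightarrow> gentle_conditions Q I \<and> \<not> finite_dimensional (bound_quiver_algebra Q I)"

text \<open>The image of a path in \<open>A = kQ/I\<close>.\<close>

definition path_class ::
  "('v, 'a) pre_digraph \<Rightarrow> (('v, 'a) qpath \<Rightarrow>\<^sub>0 'k::field) set \<Rightarrow> ('v, 'a) qpath \<Rightarrow> (('v, 'a) qpath \<Rightarrow>\<^sub>0 'k) set"
where
  "path_class Q I p = I +>\<^bsub>path_algebra Q :: ('k, ('v, 'a) qpath \<Rightarrow>\<^sub>0 'k) module\<^esub> path_elem p"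

text \<open>The paths not in \<open>I\<close>; their classes form the basis \<open>\<B>\<close> of \<open>A\<close>.\<close>

definition basis_paths ::
  "('v, 'a) pre_digraph \<Rightarrow> (('v, 'a) qpath \<Rightarrow>\<^sub>0 'k::field) set \<Rightarrow> ('v, 'a) qpath set"
where
  "basis_paths Q I = {p \<in> paths Q. path_elem p \<notin> I}"

definition A_plus ::
  "('v, 'a) pre_digraph \<Rightarrow> (('v, 'a) qpath \<Rightarrow>\<^sub>0 'k::field) set \<Rightarrow> (('v, 'a) qpath \<Rightarrow>\<^sub>0 'k) set set"
where
  "A_plus Q I =
     linear_span (bound_quiver_algebra Q I)
       (path_class Q I ` {p \<in> basis_paths Q I. path_length p \<ge> 1})"

definition finite_maximal_path ::
  "('v, 'a) pre_digraph \<Rightarrow> (('v, 'a) qpath \<Rightarrow>\<^sub>0 'k::field) set \<Rightarrow> ('v, 'a) qpath \<Rightarrow> bool"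
where
  "finite_maximal_path Q I p \<longleftrightarrow>
     p \<in> basis_paths Q I \<and>
     (let A = bound_quiver_algebra Q I in
       \<forall>a\<in>arcs Q.
         path_class Q I (arrow_path Q a) \<otimes>\<^bsub>A\<^esub> path_class Q I p = \<zero>\<^bsub>A\<^esub> \<and>
         path_class Q I p \<otimes>\<^bsub>A\<^esub> path_class Q I (arrow_path Q a) = \<zero>\<^bsub>A\<^esub>)"

definition gamma_bar_exists ::
  "('v, 'a) pre_digraph \<Rightarrow> (('v, 'a) qpath \<Rightarrow>\<^sub>0 'k::field) set \<Rightarrow> 'a \<Rightarrow> bool"
where
  "gamma_bar_exists Q I a \<longleftrightarrow>
     (\<exists>p. finite_maximal_path Q I p \<and> parallel Q p (arrow_path Q a) \<and>
          \<not> starts_with p a \<and> \<not> ends_with p a)"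


section \<open>The automorphism group fixing the vertices, and inner automorphisms\<close>

text \<open>
  As in the library's \<open>AutoGroup\<close>, automorphisms are functions extensional on the carrier, and the
  group multiplication is composition.
\<close>

definition H_group ::
  "('v, 'a) pre_digraph \<Rightarrow> (('v, 'a) qpath \<Rightarrow>\<^sub>0 'k::field) set \<Rightarrow>
   ((('v, 'a) qpath \<Rightarrow>\<^sub>0 'k) set \<Rightarrow> (('v, 'a) qpath \<Rightarrow>\<^sub>0 'k) set) monoid"
where
  "H_group Q I =
     (let A = bound_quiver_algebra Q I in
       BijGroup (carrier A)
         \<lparr>carrier := {h \<in> Bij (carrier A) \<inter> algebra_hom A A.
            \<forall>v\<in>verts Q. h (path_class Q I (v, [])) = path_class Q I (v, [])}\<rparr>)"

definition inner_aut :: "('k, 'b) module \<Rightarrow> 'b \<Rightarrow> 'b \<Rightarrow> 'b" where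
  "inner_aut A u = (\<lambda>z\<in>carrier A. inv\<^bsub>A\<^esub> u \<otimes>\<^bsub>A\<^esub> z \<otimes>\<^bsub>A\<^esub> u)"

definition Inn_star ::
  "('v, 'a) pre_digraph \<Rightarrow> (('v, 'a) qpath \<Rightarrow>\<^sub>0 'k::field) set \<Rightarrow>
   ((('v, 'a) qpath \<Rightarrow>\<^sub>0 'k) set \<Rightarrow> (('v, 'a) qpath \<Rightarrow>\<^sub>0 'k) set) set"
where
  "Inn_star Q I =
     (let A = bound_quiver_algebra Q I in
       {inner_aut A (\<one>\<^bsub>A\<^esub> \<oplus>\<^bsub>A\<^esub> y) | y. y \<in> A_plus Q I \<and> \<one>\<^bsub>A\<^esub> \<oplus>\<^bsub>A\<^esub> y \<in> Units A})"


section \<open>Special quivers\<close>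

definition kronecker_quiver :: "(nat, bool) pre_digraph" where
  "kronecker_quiver = \<lparr>verts = {0, 1}, arcs = UNIV, tail = (\<lambda>_. 0), head = (\<lambda>_. 1)\<rparr>"

text \<open>The two arrows \<open>i \<rightarrow> i + 1\<close> are \<open>(i, False)\<close> and \<open>(i, True)\<close>.\<close>

definition double_chain :: "nat \<Rightarrow> (nat, nat \<times> bool) pre_digraph" where
  "double_chain k = \<lparr>verts = {1..k + 1}, arcs = {1..k} \<times> UNIV, tail = fst, head = (\<lambda>a. fst a + 1)\<rparr>"

definition double_cycle :: "nat \<Rightarrow> (nat, nat \<times> bool) pre_digraph" where
  "double_cycle k =
     \<lparr>verts = {0..<k}, arcs = {0..<k} \<times> UNIV, tail = fst, head = (\<lambda>a. (fst a + 1) mod k)\<rparr>"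

definition is_double_chain :: "('v, 'a) pre_digraph \<Rightarrow> bool" where
  "is_double_chain Q \<longleftrightarrow> (\<exists>k\<ge>1. digraph_iso Q (double_chain k))"

definition is_double_cycle :: "('v, 'a) pre_digraph \<Rightarrow> bool" where
  "is_double_cycle Q \<longleftrightarrow> (\<exists>k\<ge>1. digraph_iso Q (double_cycle k))"


section \<open>Groups occurring in the classification\<close>

definition GL2 :: "'k::field itself \<Rightarrow> 'k mat monoid" where
  "GL2 _ = units_of (ring_mat TYPE('k) 2 ())"

definition mult_group_power :: "'k::field itself \<Rightarrow> nat \<Rightarrow> (nat \<Rightarrow> 'k) monoid" where
  "mult_group_power _ m =
     product_group {..<m} (\<lambda>_. \<lparr>carrier = UNIV - {0 :: 'k}, monoid.mult = (*), one = 1\<rparr>)"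

definition add_group_power :: "'k::field itself \<Rightarrow> nat \<Rightarrow> (nat \<Rightarrow> 'k) monoid" where
  "add_group_power _ n =
     product_group {..<n} (\<lambda>_. \<lparr>carrier = (UNIV :: 'k set), monoid.mult = (+), one = 0\<rparr>)"

text \<open>The external semidirect product of \<open>N\<close> and \<open>K\<close> in which \<open>N\<close> is normal and \<open>K\<close> acts on \<open>N\<close> via \<open>\<phi>\<close>.\<close>

definition semidirect_product ::
  "'n monoid \<Rightarrow> 'h monoid \<Rightarrow> ('h \<Rightarrow> 'n \<Rightarrow> 'n) \<Rightarrow> ('n \<times> 'h) monoid"
where
  "semidirect_product N K \<phi> =
     \<lparr>carrier = carrier N \<times> carrier K,
      monoid.mult = (\<lambda>(x, g) (y, h). (x \<otimes>\<^bsub>N\<^esub> \<phi> g y, g \<otimes>\<^bsub>K\<^esub> h)),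
      one = (\<one>\<^bsub>N\<^esub>, \<one>\<^bsub>K\<^esub>)\<rparr>"

definition iso_to_semidirect_product ::
  "('g, 'm) monoid_scheme \<Rightarrow> 'n monoid \<Rightarrow> 'h monoid \<Rightarrow> bool"
where
  "iso_to_semidirect_product G N K \<longleftrightarrow>
     (\<exists>\<phi> \<in> hom K (AutoGroup N). G \<cong> semidirect_product N K \<phi>)"

end

theory Submission
  imports Defs
begin

text \<open>
  Since \<open>I\<close> is generated by paths of length two, the classes of the paths that contain no relation form
  a basis of \<open>A\<close>. The algebra is therefore modelled on finitely supported functions on these paths,
  with truncated concatenation as product (\<open>cls_M\<close>, \<open>cls_mult\<close>), and the group \<open>H\<close> becomes the group of
  the algebra automorphisms of this model that fix the vertices (\<open>lift\<close>, \<open>lift_Inn_iff\<close>). Such an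
  automorphism is determined by the images of the arrows, and conversely images in the right corners
  that kill the relations extend (\<open>vend_ext\<close>).

  Because every vertex has at most two arrows in and two arrows out, following non-relations splits the
  arrows into threads: an arrow has at most one continuation and at most one predecessor. An automorphism
  maps an arrow \<open>a\<close> to a linear part, which only involves arrows parallel to \<open>a\<close>, plus longer paths. If
  some diagonal entry of the linear part vanishes, then all arrows come in parallel pairs, and outside
  the Kronecker case all diagonal entries vanish together (\<open>not_kron_degenerate\<close>); composing with the
  exchange of the arrows in each pair then repairs all of them.

  If no diagonal entry vanishes, the automorphism is a product of an inner one and a standard one, which
  sends \<open>a\<close> to \<open>\<lambda>\<^sub>a (a + \<mu>\<^sub>a \<gamma>\<^sub>a)\<close> with \<open>\<gamma>\<^sub>a\<close> the maximal path parallel to \<open>a\<close> (\<open>decomposition\<close>). After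
  scaling, and after removing the maximal paths that lie on another thread, the image of an arrow stays on
  its own thread (\<open>thread_preserved\<close>). On the cyclic threads the automorphism is a matrix over a polynomial
  ring; a vertex passed twice by one cycle contributes a rank one idempotent, whose factorization over
  \<open>k[s]\<close> gives a conjugating unit (\<open>vertex_unit\<close>), and then a degree count shows that the arrows are fixed
  (\<open>cyc_arrow_fixed\<close>). The finite threads are straightened degree by degree: the terms of lowest degree
  are either commutators with closed paths or multiples of \<open>\<gamma>\<^sub>a\<close> (\<open>stage_unit\<close>, \<open>stage_step\<close>).

  Conversely an inner automorphism has identity linear part and no component along \<open>\<gamma>\<^sub>a\<close> (\<open>inner_lin\<close>,
  \<open>inner_emap\<close>). Hence the standard automorphisms, enlarged by the exchange in the doubled case and replaced
  by the linear substitutions in the Kronecker case, form a complement of the inner ones, and the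
  quotient is isomorphic to this complement (\<open>complement_iso\<close>). What remains is to recognize the three
  cases from the quiver: \<open>double_iff\<close> and \<open>isomorphic_kronecker_iff\<close>.
\<close>

section \<open>The path algebra as a convolution algebra\<close>

abbreviation coef :: "('p \<Rightarrow>\<^sub>0 'k::zero) \<Rightarrow> 'p \<Rightarrow> 'k" where
  "coef \<equiv> Poly_Mapping.lookup"

definition scale :: "'k::field \<Rightarrow> ('p \<Rightarrow>\<^sub>0 'k) \<Rightarrow> ('p \<Rightarrow>\<^sub>0 'k)" where
  "scale c = Poly_Mapping.map ((*) c)"

definition restrict_to :: "'p set \<Rightarrow> ('p \<Rightarrow>\<^sub>0 'k::field) \<Rightarrow> ('p \<Rightarrow>\<^sub>0 'k)" where
  "restrict_to B = Poly_Mapping.mapp (\<lambda>p c. if p \<in> B then c else 0)"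

lemma coef_scale [simp]: "coef (scale c x) p = c * coef x p"
  by (simp add: scale_def Poly_Mapping.map.rep_eq when_def)

lemma coef_restrict_to [simp]: "coef (restrict_to B x) p = (if p \<in> B then coef x p else 0)"
  by (auto simp: restrict_to_def lookup_mapp when_def in_keys_iff)

lemma scale_0 [simp]: "scale 0 x = 0" and scale_1 [simp]: "scale 1 x = x"
  and scale_zero [simp]: "scale c 0 = 0"
  and scale_scale: "scale c (scale d x) = scale (c * d) x"
  and scale_add: "scale c (x + y) = scale c x + scale c y"
  and scale_diff: "scale c (x - y) = scale c x - scale c y"
  and scale_add_left: "scale (c + d) x = scale c x + scale d x"
  and scale_minus: "scale c (- x) = - scale c x"
  and scale_minus_left: "scale (- c) x = - scale c x"
  by (rule poly_mapping_eqI; simp add: lookup_add lookup_minus algebra_simps)+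

lemma scale_sum: "scale c (\<Sum>i\<in>J. f i) = (\<Sum>i\<in>J. scale c (f i))"
  by (induction J rule: infinite_finite_induct) (auto simp: scale_add)

lemma keys_sum_subset:
  assumes "\<And>i. i \<in> J \<Longrightarrow> Poly_Mapping.keys (f i) \<subseteq> K"
  shows "Poly_Mapping.keys (\<Sum>i\<in>J. f i :: 'p \<Rightarrow>\<^sub>0 'k::ab_group_add) \<subseteq> K"
  using assms by (induction J rule: infinite_finite_induct)
    (auto dest!: subsetD[OF Poly_Mapping.keys_add])

text \<open>The target of a path only sees its last arrow; the stationary case is the base of recursion.\<close>

lemma awlast_eq: "pre_digraph.awlast Q v es = (if es = [] then v else head Q (last es))"
proof (induction es arbitrary: v)
  case Nil
  then show ?case by (simp add: pre_digraph.awalk_verts.simps)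
next
  case (Cons e es)
  have "pre_digraph.awalk_verts Q u es \<noteq> []" for u
    by (cases es) (simp_all add: pre_digraph.awalk_verts.simps)
  then show ?case
    using Cons[of "head Q e"] by (auto simp: pre_digraph.awalk_verts.simps)
qed

lemma path_tgt_eq: "path_tgt Q (v, es) = (if es = [] then v else head Q (last es))"
  by (simp add: path_tgt_def awlast_eq)

lemma path_tgt_append: "path_tgt Q (v, xs @ ys) = path_tgt Q (path_tgt Q (v, xs), ys)"
  by (simp add: path_tgt_eq)

text \<open>
  A product of paths equal to \<open>(v, es)\<close> is a cut of the list \<open>es\<close>; so multiplication is
  convolution over the cut positions, and every later argument compares coefficients this way.
\<close>

lemma coef_path_mult:
  fixes f g :: "('v, 'a) qpath \<Rightarrow>\<^sub>0 'k::field"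
  shows "coef (path_mult Q f g) (v, es) =
    (\<Sum>i\<le>length es. coef f (v, take i es) * coef g (path_tgt Q (v, take i es), drop i es))"
proof -
  let ?P = "{(p, q). path_tgt Q p = path_src q \<and> (fst p, snd p @ snd q) = (v, es)}"
  let ?c = "\<lambda>i. ((v, take i es), (path_tgt Q (v, take i es), drop i es))"
  let ?h = "\<lambda>pq. coef f (fst pq) * coef g (snd pq)"
  have P: "?P = ?c ` {..length es}"
  proof (intro equalityI subsetI)
    fix pq assume "pq \<in> ?P"
    then obtain p q where *: "pq = (p, q)" "path_tgt Q p = path_src q" "v = fst p" "es = snd p @ snd q"
      by auto
    show "pq \<in> ?c ` {..length es}"
      by (rule image_eqI[of _ _ "length (snd p)"])
        (use * in \<open>auto simp: prod_eq_iff path_src_def path_tgt_def\<close>)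
  qed (auto simp: path_src_def)
  have "coef (path_mult Q f g) (v, es) =
      (\<Sum>p\<in>Poly_Mapping.keys f. \<Sum>q\<in>Poly_Mapping.keys g. if (p, q) \<in> ?P then ?h (p, q) else 0)"
    unfolding path_mult_def lookup_sum
    by (intro sum.cong refl) (auto simp: lookup_single when_def)
  also have "\<dots> = (\<Sum>pq\<in>Poly_Mapping.keys f \<times> Poly_Mapping.keys g. if pq \<in> ?P then ?h pq else 0)"
    by (subst sum.cartesian_product) (auto intro!: sum.cong)
  also have "\<dots> = (\<Sum>pq\<in>?c ` {..length es}. ?h pq)"
    unfolding P
    by (rule sum.mono_neutral_cong) (auto simp: in_keys_iff P)
  also have "\<dots> = (\<Sum>i\<le>length es. ?h (?c i))"
    by (rule sum.reindex_cong[OF _ refl refl])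
      (auto simp: inj_on_def, metis length_take min.absorb2)
  finally show ?thesis by simp
qed

lemma path_mult_add_left: "path_mult Q (f + f') g = path_mult Q f g + path_mult Q f' g"
  and path_mult_add_right: "path_mult Q f (g + g') = path_mult Q f g + path_mult Q f g'"
  and path_mult_scale_left: "path_mult Q (scale c f) g = scale c (path_mult Q f g)"
  and path_mult_scale_right: "path_mult Q f (scale c g) = scale c (path_mult Q f g)"
  by (rule poly_mapping_eqI; clarsimp simp: coef_path_mult lookup_add algebra_simps sum.distrib sum_distrib_left)+

lemma path_mult_assoc:
  fixes f g h :: "('v, 'a) qpath \<Rightarrow>\<^sub>0 'k::field"
  shows "path_mult Q (path_mult Q f g) h = path_mult Q f (path_mult Q g h)"
proof (rule poly_mapping_eqI, clarify)
  fix v :: 'v and es :: "'a list"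
  let ?t = "\<lambda>i. path_tgt Q (v, take i es)"
  let ?F = "\<lambda>j k. coef f (v, take j es) * coef g (?t j, take k (drop j es)) * coef h (?t (j + k), drop (j + k) es)"
  have "coef (path_mult Q (path_mult Q f g) h) (v, es) = (\<Sum>i\<le>length es. \<Sum>j\<le>i. ?F j (i - j))"
    unfolding coef_path_mult sum_distrib_right
    by (auto intro!: sum.cong simp: min_def take_drop)
  also have "\<dots> = (\<Sum>j\<le>length es. \<Sum>k\<le>length es - j. ?F j k)"
    unfolding sum.Sigma[OF finite_atMost ballI[OF finite_atMost]]
    by (rule sum.reindex_bij_witness[of _ "\<lambda>(j, k). (j + k, j)" "\<lambda>(i, j). (j, i - j)"]) auto
  also have "\<dots> = coef (path_mult Q f (path_mult Q g h)) (v, es)"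
    unfolding coef_path_mult sum_distrib_left
    by (auto intro!: sum.cong simp: path_tgt_append[symmetric] take_add[symmetric] add.commute)
  finally show "coef (path_mult Q (path_mult Q f g) h) (v, es) = coef (path_mult Q f (path_mult Q g h)) (v, es)" .
qed

section \<open>Monomial bound quivers\<close>

locale bound_quiver = fin_digraph Q
  for Q :: "('v, 'a) pre_digraph" +
  fixes S :: "('v, 'a) qpath set"
begin

text \<open>\<open>nz a b\<close> says that the path \<open>a b\<close> exists and is not a relation.\<close>

definition nz :: "'a \<Rightarrow> 'a \<Rightarrow> bool" where
  "nz a b \<longleftrightarrow> a \<in> arcs Q \<and> b \<in> arcs Q \<and> head Q a = tail Q b \<and> (tail Q a, [a, b]) \<notin> S"

text \<open>The paths without a relation: the basis of the quotient.\<close>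

definition B :: "('v, 'a) qpath set" where
  "B = {p. fst p \<in> verts Q \<and> set (snd p) \<subseteq> arcs Q \<and>
           (snd p \<noteq> [] \<longrightarrow> tail Q (hd (snd p)) = fst p) \<and> successively nz (snd p)}"

abbreviation tgt :: "('v, 'a) qpath \<Rightarrow> 'v" where "tgt \<equiv> path_tgt Q"

definition M :: "(('v, 'a) qpath \<Rightarrow>\<^sub>0 'k::field) set" where
  "M = {f. Poly_Mapping.keys f \<subseteq> B}"

text \<open>Concatenation, where products that contain a relation are dropped.\<close>

definition mul :: "(('v, 'a) qpath \<Rightarrow>\<^sub>0 'k::field) \<Rightarrow> (('v, 'a) qpath \<Rightarrow>\<^sub>0 'k) \<Rightarrow> (('v, 'a) qpath \<Rightarrow>\<^sub>0 'k)"
    (infixl \<open>\<star>\<close> 70) where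
  "f \<star> g = restrict_to B (path_mult Q f g)"

definition unit :: "('v, 'a) qpath \<Rightarrow>\<^sub>0 'k::field" where
  "unit = (\<Sum>v\<in>verts Q. path_elem (v, []))"

abbreviation ar :: "'a \<Rightarrow> ('v, 'a) qpath" where "ar \<equiv> arrow_path Q"

lemma awalk_iff:
  "awalk v es w \<longleftrightarrow> v \<in> verts Q \<and> set es \<subseteq> arcs Q \<and> (es \<noteq> [] \<longrightarrow> tail Q (hd es) = v) \<and>
     successively (\<lambda>a b. head Q a = tail Q b) es \<and> tgt (v, es) = w"
proof (induction es arbitrary: v)
  case (Cons e es)
  have "awalk v (e # es) w \<longleftrightarrow> e \<in> arcs Q \<and> tail Q e = v \<and> awalk (head Q e) es w"
    by (auto simp: awalk_def)
  also have "\<dots> \<longleftrightarrow> e \<in> arcs Q \<and> tail Q e = v \<and> set es \<subseteq> arcs Q \<and>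
     successively (\<lambda>a b. head Q a = tail Q b) (e # es) \<and> tgt (v, e # es) = w"
    by (subst Cons) (auto simp: path_tgt_eq successively_Cons dest: hd_in_set)
  finally show ?case by auto
qed (auto simp: awalk_def path_tgt_eq)

lemma paths_iff:
  "(v, es) \<in> paths Q \<longleftrightarrow> v \<in> verts Q \<and> set es \<subseteq> arcs Q \<and> (es \<noteq> [] \<longrightarrow> tail Q (hd es) = v) \<and>
     successively (\<lambda>a b. head Q a = tail Q b) es"
  by (auto simp: paths_def awalk_iff)

lemma B_iff: "(v, es) \<in> B \<longleftrightarrow> v \<in> verts Q \<and> set es \<subseteq> arcs Q \<and> (es \<noteq> [] \<longrightarrow> tail Q (hd es) = v) \<and>
     successively nz es"
  by (simp add: B_def)

lemma B_Nil [simp]: "(v, []) \<in> B \<longleftrightarrow> v \<in> verts Q"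
  by (simp add: B_iff)

lemma B_arrow [simp]: "(v, [a]) \<in> B \<longleftrightarrow> a \<in> arcs Q \<and> v = tail Q a"
  by (auto simp: B_iff)

lemma nz_arcs: "nz a b \<Longrightarrow> a \<in> arcs Q \<and> b \<in> arcs Q \<and> head Q a = tail Q b"
  by (simp add: nz_def)

lemma B_subset_paths: "B \<subseteq> paths Q"
  by (auto simp: B_iff paths_iff elim!: successively_mono dest: nz_arcs)

lemma B_append:
  "(v, xs @ ys) \<in> B \<longleftrightarrow> (v, xs) \<in> B \<and> (tgt (v, xs), ys) \<in> B \<and>
     (xs \<noteq> [] \<and> ys \<noteq> [] \<longrightarrow> nz (last xs) (hd ys))"
  by (cases "xs = []"; cases "ys = []")
    (auto simp: B_iff path_tgt_eq successively_append_iff dest: nz_arcs last_in_set)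

lemma B_take: "(v, es) \<in> B \<Longrightarrow> (v, take i es) \<in> B"
  and B_drop: "(v, es) \<in> B \<Longrightarrow> (tgt (v, take i es), drop i es) \<in> B"
  using B_append[of v "take i es" "drop i es"] by auto

lemma B_tgt: "(v, es) \<in> B \<Longrightarrow> tgt (v, es) \<in> verts Q"
  by (auto simp: B_iff path_tgt_eq dest: last_in_set)

lemma coef_mul:
  "coef (f \<star> g) (v, es) = (if (v, es) \<in> B then
     \<Sum>i\<le>length es. coef f (v, take i es) * coef g (tgt (v, take i es), drop i es) else 0)"
  by (simp add: mul_def coef_path_mult)

lemma MI: "(\<And>p. coef x p \<noteq> 0 \<Longrightarrow> p \<in> B) \<Longrightarrow> x \<in> M"
  and MD: "x \<in> M \<Longrightarrow> coef x p \<noteq> 0 \<Longrightarrow> p \<in> B"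
  and M_coef: "x \<in> M \<Longrightarrow> p \<notin> B \<Longrightarrow> coef x p = 0"
  by (auto simp: M_def in_keys_iff)

lemma M_closed [simp, intro]:
  "x \<star> y \<in> M" "0 \<in> M" "x \<in> M \<Longrightarrow> y \<in> M \<Longrightarrow> x + y \<in> M" "x \<in> M \<Longrightarrow> y \<in> M \<Longrightarrow> x - y \<in> M"
  "x \<in> M \<Longrightarrow> - x \<in> M" "x \<in> M \<Longrightarrow> scale c x \<in> M" "p \<in> B \<Longrightarrow> path_elem p \<in> M" "restrict_to B z \<in> M"
proof -
  show "x \<star> y \<in> M" "0 \<in> M" "p \<in> B \<Longrightarrow> path_elem p \<in> M" "restrict_to B z \<in> M"
    by (auto intro!: MI simp: mul_def path_elem_def lookup_single when_def split: if_splits)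
  show "x \<in> M \<Longrightarrow> - x \<in> M" "x \<in> M \<Longrightarrow> scale c x \<in> M"
    by (auto intro!: MI dest: MD)
  show "x + y \<in> M" "x - y \<in> M" if "x \<in> M" "y \<in> M"
    using that by (auto intro!: MI simp: lookup_add lookup_minus) (metis M_coef add.left_neutral diff_0_right)+
qed

lemma M_sum [intro]: "(\<And>i. i \<in> J \<Longrightarrow> f i \<in> M) \<Longrightarrow> (\<Sum>i\<in>J. f i) \<in> M"
  by (simp add: M_def keys_sum_subset)

lemma unit_M [simp, intro]: "unit \<in> M"
  by (auto simp: unit_def)

lemma restrict_M [simp]: "x \<in> M \<Longrightarrow> restrict_to B x = x"
  by (rule poly_mapping_eqI) (auto simp: M_coef)

lemma restrict_path_mult:
  "restrict_to B (path_mult Q (restrict_to B f) g) = restrict_to B (path_mult Q f g)"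
  "restrict_to B (path_mult Q f (restrict_to B g)) = restrict_to B (path_mult Q f g)"
  by (rule poly_mapping_eqI; clarsimp simp: coef_path_mult B_take B_drop intro!: sum.cong)+

lemma mul_assoc: "(f \<star> g) \<star> h = f \<star> (g \<star> h)"
  by (simp add: mul_def restrict_path_mult path_mult_assoc)

lemma mul_add_left: "(f + f') \<star> g = f \<star> g + f' \<star> g"
  and mul_add_right: "f \<star> (g + g') = f \<star> g + f \<star> g'"
  and mul_diff_left: "(f - f') \<star> g = f \<star> g - f' \<star> g"
  and mul_diff_right: "f \<star> (g - g') = f \<star> g - f \<star> g'"
  and mul_scale_left: "scale c f \<star> g = scale c (f \<star> g)"
  and mul_scale_right: "f \<star> scale c g = scale c (f \<star> g)"
  and mul_zero_left [simp]: "0 \<star> g = 0"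
  and mul_zero_right [simp]: "f \<star> 0 = 0"
  and mul_minus_left: "(- f) \<star> g = - (f \<star> g)"
  and mul_minus_right: "f \<star> (- g) = - (f \<star> g)"
  by (rule poly_mapping_eqI; clarsimp simp: coef_mul lookup_add lookup_minus algebra_simps
      sum.distrib sum_distrib_left sum_negf sum_subtractf)+

lemma mul_sum_left: "(\<Sum>i\<in>J. f i) \<star> g = (\<Sum>i\<in>J. f i \<star> g)"
  and mul_sum_right: "g \<star> (\<Sum>i\<in>J. f i) = (\<Sum>i\<in>J. g \<star> f i)"
  by (induction J rule: infinite_finite_induct; simp add: mul_add_left mul_add_right)+

lemma coef_path_elem: "coef (path_elem p :: _ \<Rightarrow>\<^sub>0 'k::field) q = (if p = q then 1 else 0)"
  by (auto simp: path_elem_def lookup_single when_def)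

lemma coef_unit: "coef (unit :: _ \<Rightarrow>\<^sub>0 'k::field) (v, es) = (if v \<in> verts Q \<and> es = [] then 1 else 0)"
  unfolding unit_def lookup_sum coef_path_elem
  by (cases "es = []") auto

lemma coef_vertex_mul:
  assumes "x \<in> M"
  shows "coef (path_elem (w, []) \<star> x) (v, es) = (if v = w then coef x (v, es) else 0)"
proof -
  have "coef (path_elem (w, []) \<star> x) (v, es) = (if (v, es) \<in> B then
     \<Sum>i\<le>length es. if i = 0 then (if v = w then coef x (v, es) else 0) else 0 else 0)"
    unfolding coef_mul
  proof (intro if_cong refl sum.cong)
    fix i assume "i \<in> {..length es}"
    then show "coef (path_elem (w, [])) (v, take i es) * coef x (tgt (v, take i es), drop i es) =
        (if i = 0 then (if v = w then coef x (v, es) else 0) else 0)"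
      by (cases "i = 0") (auto simp: coef_path_elem path_tgt_eq)
  qed
  then show ?thesis
    using assms by (auto simp: M_coef)
qed

lemma coef_mul_vertex:
  assumes "x \<in> M"
  shows "coef (x \<star> path_elem (w, [])) p = (if tgt p = w then coef x p else 0)"
proof (cases p)
  case (Pair v es)
  have "coef (x \<star> path_elem (w, [])) (v, es) = (if (v, es) \<in> B then
     \<Sum>i\<le>length es. if i = length es then (if tgt (v, es) = w then coef x (v, es) else 0) else 0 else 0)"
    unfolding coef_mul
  proof (intro if_cong refl sum.cong)
    fix i assume "i \<in> {..length es}"
    then show "coef x (v, take i es) * coef (path_elem (w, [])) (tgt (v, take i es), drop i es) =
        (if i = length es then (if tgt (v, es) = w then coef x (v, es) else 0) else 0)"
      by (cases "i = length es") (auto simp: coef_path_elem)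
  qed
  then show ?thesis
    using assms Pair by (auto simp: M_coef)
qed

lemma unit_mul [simp]:
  assumes "x \<in> M" shows "unit \<star> x = x"
proof (rule poly_mapping_eqI, clarify)
  fix v es
  show "coef (unit \<star> x) (v, es) = coef x (v, es)"
    using MD[OF assms, of "(v, es)"]
    by (auto simp: unit_def mul_sum_left lookup_sum coef_vertex_mul assms B_iff)
qed

lemma mul_unit [simp]:
  assumes "x \<in> M" shows "x \<star> unit = x"
proof (rule poly_mapping_eqI)
  fix p
  show "coef (x \<star> unit) p = coef x p"
    using MD[OF assms, of p] B_tgt[of "fst p" "snd p"]
    by (auto simp: unit_def mul_sum_right lookup_sum coef_mul_vertex assms)
qed

lemma mul_path_elem:
  "path_elem p \<star> path_elem q = (
     if tgt p = fst q \<and> (fst p, snd p @ snd q) \<in> B then path_elem (fst p, snd p @ snd q) else (0 :: _ \<Rightarrow>\<^sub>0 'k::field))"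
proof -
  have "path_mult Q (path_elem p) (path_elem q) =
     (if tgt p = fst q then path_elem (fst p, snd p @ snd q) else (0 :: _ \<Rightarrow>\<^sub>0 'k))"
    unfolding path_mult_def path_elem_def by (simp add: path_src_def)
  then show ?thesis
    unfolding mul_def by (auto intro!: poly_mapping_eqI simp: coef_path_elem)
qed

lemma expand_paths:
  fixes x :: "('v, 'a) qpath \<Rightarrow>\<^sub>0 'k::field"
  shows "x = (\<Sum>p\<in>Poly_Mapping.keys x. scale (coef x p) (path_elem p))"
proof (rule poly_mapping_eqI)
  fix q
  have "coef (\<Sum>p\<in>Poly_Mapping.keys x. scale (coef x p) (path_elem p)) q =
     (\<Sum>p\<in>Poly_Mapping.keys x. if p = q then coef x p else 0)"
    unfolding lookup_sum by (intro sum.cong refl) (simp add: path_elem_def lookup_single when_def)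
  also have "\<dots> = coef x q"
    by (simp add: in_keys_iff)
  finally show "coef x q = coef (\<Sum>p\<in>Poly_Mapping.keys x. scale (coef x p) (path_elem p)) q"
    by simp
qed

end

section \<open>The quotient algebra and its model\<close>

lemma path_algebra_simps [simp]:
  "carrier (path_algebra Q) = {f. Poly_Mapping.keys f \<subseteq> paths Q}"
  "monoid.mult (path_algebra Q) = path_mult Q"
  "\<one>\<^bsub>path_algebra Q\<^esub> = (\<Sum>v\<in>verts Q. Poly_Mapping.single (v, []) 1)"
  "\<zero>\<^bsub>path_algebra Q\<^esub> = 0"
  "add (path_algebra Q) = (+)"
  "module.smult (path_algebra Q) = scale"
  by (auto simp: path_algebra_def scale_def)

lemma restrict_to_zero [simp]: "restrict_to B 0 = 0"
  and restrict_to_add: "restrict_to B (x + y) = restrict_to B x + restrict_to B y"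
  and restrict_to_diff: "restrict_to B (x - y) = restrict_to B x - restrict_to B y"
  and restrict_to_minus: "restrict_to B (- x) = - restrict_to B x"
  and restrict_to_scale: "restrict_to B (scale c x) = scale c (restrict_to B x)"
  by (rule poly_mapping_eqI; simp add: lookup_add lookup_minus)+

lemma not_successively_split:
  "\<not> successively P es \<Longrightarrow> \<exists>xs a b ys. es = xs @ [a, b] @ ys \<and> \<not> P a b"
proof (induction P es rule: successively.induct)
  case (3 P x y xs)
  show ?case
  proof (cases "P x y")
    case True
    with 3 obtain us a b ws where "y # xs = us @ [a, b] @ ws" "\<not> P a b"
      by auto
    then have "x # y # xs = (x # us) @ [a, b] @ ws \<and> \<not> P a b" by simp
    then show ?thesis by blast
  next
    case False
    then have "x # y # xs = [] @ [x, y] @ xs \<and> \<not> P x y" by simp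
    then show ?thesis by blast
  qed
qed auto

context fin_digraph
begin

interpretation free: bound_quiver G "{}"
  by (simp add: bound_quiver_def fin_digraph_axioms)

lemma free_B: "free.B = paths G"
proof (intro equalityI subsetI)
  fix p assume p: "p \<in> paths G"
  obtain v es where "p = (v, es)" by fastforce
  moreover have "successively free.nz es"
    if "successively (\<lambda>a b. head G a = tail G b) es" "set es \<subseteq> arcs G"
    by (rule successively_mono[OF that(1)]) (use that(2) in \<open>auto simp: free.nz_def\<close>)
  ultimately show "p \<in> free.B"
    using p by (auto simp: free.paths_iff free.B_iff)
qed (use free.B_subset_paths in auto)

lemma free_M: "free.M = {f. Poly_Mapping.keys f \<subseteq> paths G}"
  by (simp add: free.M_def free_B)

lemma free_mul:
  assumes "f \<in> free.M" "g \<in> free.M"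
  shows "free.mul f g = path_mult G f g"
proof (rule poly_mapping_eqI, clarify)
  fix v es
  have "(v, es) \<in> free.B" if nz: "coef (path_mult G f g) (v, es) \<noteq> 0"
  proof -
    from nz obtain i where "i \<le> length es"
      "coef f (v, take i es) * coef g (path_tgt G (v, take i es), drop i es) \<noteq> 0"
      unfolding coef_path_mult by (meson atMost_iff sum.not_neutral_contains_not_neutral)
    then have *: "(v, take i es) \<in> free.B" "(path_tgt G (v, take i es), drop i es) \<in> free.B"
      using assms by (auto dest: free.MD)
    have "free.nz (last (take i es)) (hd (drop i es))" if "take i es \<noteq> []" "drop i es \<noteq> []"
      using * that by (auto simp: free.B_iff free.nz_def path_tgt_eq dest: last_in_set hd_in_set)
    then show ?thesis
      using * free.B_append[of v "take i es" "drop i es"] by auto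
  qed
  then show "coef (free.mul f g) (v, es) = coef (path_mult G f g) (v, es)"
    by (auto simp: free.mul_def)
qed

lemma ring_path_algebra: "ring (path_algebra G :: ('k::field, ('a, 'b) qpath \<Rightarrow>\<^sub>0 'k) module)"
    (is "ring ?P")
proof -
  have carr: "carrier ?P = free.M"
    by (simp add: free_M)
  have one: "\<one>\<^bsub>?P\<^esub> = free.unit"
    by (simp add: free.unit_def path_elem_def)
  have mult: "x \<otimes>\<^bsub>?P\<^esub> y = free.mul x y" if "x \<in> free.M" "y \<in> free.M" for x y
    using free_mul[OF that] by simp
  show ?thesis
  proof (rule ringI)
    show "abelian_group ?P"
    proof (rule abelian_groupI)
      fix x assume "x \<in> carrier ?P"
      then show "\<exists>y\<in>carrier ?P. y \<oplus>\<^bsub>?P\<^esub> x = \<zero>\<^bsub>?P\<^esub>"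
        unfolding carr by (intro bexI[of _ "- x"]) auto
    next
      fix x y assume "x \<in> carrier ?P" "y \<in> carrier ?P"
      then show "x \<oplus>\<^bsub>?P\<^esub> y \<in> carrier ?P"
        unfolding carr by (simp add: free.M_closed)
    qed (auto simp: algebra_simps)
    show "monoid ?P"
      by (rule monoidI; unfold carr one)
        (simp_all add: mult free.mul_assoc free.M_closed free.unit_M del: path_algebra_simps)
  qed (simp_all add: path_mult_add_left path_mult_add_right)
qed

end

locale bound_quiver_ideal = bound_quiver Q S
  for Q :: "('v, 'a) pre_digraph" and S +
  fixes I :: "(('v, 'a) qpath \<Rightarrow>\<^sub>0 'k::field) set"
  assumes S_len: "S \<subseteq> {p \<in> paths Q. path_length p = 2}"
    and I_eq: "I = Idl\<^bsub>path_algebra Q :: ('k, ('v, 'a) qpath \<Rightarrow>\<^sub>0 'k) module\<^esub> (path_elem ` S)"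
begin

abbreviation PA :: "('k, ('v, 'a) qpath \<Rightarrow>\<^sub>0 'k) module" where "PA \<equiv> path_algebra Q"

lemma M_subset_PA: "M \<subseteq> carrier PA"
  using B_subset_paths by (auto simp: M_def)

lemma scale_PA: "x \<in> carrier PA \<Longrightarrow> scale c x \<in> carrier PA"
  by (force simp: in_keys_iff)

lemma single_mult_path_elem:
  assumes "tgt p = fst q"
  shows "path_mult Q (path_elem p) (path_elem q) = path_elem (fst p, snd p @ snd q)"
  using assms unfolding path_mult_def path_elem_def by (simp add: path_src_def)

text \<open>
  Elements of the ideal are the sums of multiples of relations, so their basis coefficients vanish.
  Conversely a path outside \<open>B\<close> has a relation as a factor.
\<close>

lemma I_iff: "f \<in> I \<longleftrightarrow> f \<in> carrier PA \<and> restrict_to B f = 0"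
proof -
  interpret PA: ring PA by (rule ring_path_algebra)
  let ?Z = "{f \<in> carrier PA. restrict_to B f = 0}"
  have S_carr: "path_elem ` S \<subseteq> carrier PA"
    using S_len by (auto simp: path_elem_def)
  have "ideal ?Z PA"
  proof (rule idealI)
    show "subgroup ?Z (add_monoid PA)"
    proof (rule PA.add.subgroupI)
      show "?Z \<subseteq> carrier PA" by auto
      show "?Z \<noteq> {}" by (auto intro!: exI[of _ 0] poly_mapping_eqI)
      fix f assume f: "f \<in> ?Z"
      have "\<ominus>\<^bsub>PA\<^esub> f = - f"
        using f by (intro PA.minus_equality) auto
      then show "\<ominus>\<^bsub>PA\<^esub> f \<in> ?Z"
        using f by (simp add: restrict_to_minus)
    next
      fix f g assume "f \<in> ?Z" "g \<in> ?Z"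
      then show "f \<oplus>\<^bsub>PA\<^esub> g \<in> ?Z"
        using PA.a_closed[of f g] by (simp add: restrict_to_add)
    qed
    fix f x assume f: "f \<in> ?Z" and x: "x \<in> carrier PA"
    have "restrict_to B (path_mult Q (restrict_to B f) x) = 0" "restrict_to B (path_mult Q x (restrict_to B f)) = 0"
      using f by (simp_all add: poly_mapping_eq_iff fun_eq_iff coef_path_mult)
    then show "x \<otimes>\<^bsub>PA\<^esub> f \<in> ?Z" "f \<otimes>\<^bsub>PA\<^esub> x \<in> ?Z"
      using f x PA.m_closed[of f x] PA.m_closed[of x f] by (auto simp: restrict_path_mult)
  qed (rule ring_path_algebra)
  moreover have "path_elem ` S \<subseteq> ?Z"
  proof safe
    fix v es assume p: "(v, es) \<in> S"
    then have "(v, es) \<in> paths Q" "length es = 2"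
      using S_len by (auto simp: path_length_def)
    then obtain a b where es: "es = [a, b]" "v = tail Q a"
      by (auto simp: length_Suc_conv numeral_2_eq_2 paths_iff)
    have "(v, es) \<notin> B"
      using p es by (auto simp: B_iff nz_def)
    then show "restrict_to B (path_elem (v, es)) = 0"
      by (auto simp: poly_mapping_eq_iff fun_eq_iff coef_path_elem)
  qed (use S_carr in auto)
  ultimately have 1: "I \<subseteq> ?Z"
    unfolding I_eq by (rule PA.genideal_minimal)
  interpret I: ideal I PA
    unfolding I_eq by (rule PA.genideal_ideal) fact
  have gen: "path_elem p \<in> I" if "p \<in> S" for p
    unfolding I_eq using PA.genideal_self[OF S_carr] that by auto
  have bad: "path_elem (v, es) \<in> I" if p: "(v, es) \<in> paths Q" "(v, es) \<notin> B" for v es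
  proof -
    have "\<not> successively nz es"
      using p by (auto simp: paths_iff B_iff)
    from not_successively_split[OF this] obtain xs a b ys where es: "es = xs @ [a, b] @ ys" "\<not> nz a b"
      by blast
    have ab: "a \<in> arcs Q" "b \<in> arcs Q" "head Q a = tail Q b"
      using p es by (auto simp: paths_iff successively_append_iff)
    have "path_elem (tail Q a, [a, b]) \<in> I"
      using es ab by (intro gen) (auto simp: nz_def)
    moreover have "path_elem (v, xs) \<in> carrier PA" "path_elem (head Q b, ys) \<in> carrier PA"
      using p ab unfolding es(1) by (auto simp: path_elem_def paths_iff successively_append_iff successively_Cons)
    ultimately have "path_mult Q (path_mult Q (path_elem (v, xs)) (path_elem (tail Q a, [a, b]))) (path_elem (head Q b, ys)) \<in> I"
      using I.I_l_closed I.I_r_closed by simp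
    moreover have "tgt (v, xs) = tail Q a"
      using p es ab by (cases "xs = []") (auto simp: path_tgt_eq paths_iff successively_append_iff)
    ultimately show ?thesis
      by (simp add: single_mult_path_elem path_tgt_eq es(1))
  qed
  have "f \<in> I" if "f \<in> ?Z" for f
  proof -
    have sc: "scale c (path_elem (v, es)) \<in> I" if p: "(v, es) \<in> paths Q" "(v, es) \<notin> B" for v es c
    proof -
      have "path_mult Q (scale c (path_elem (v, []))) (path_elem (v, es)) \<in> I"
        using bad[OF p] p by (intro I.I_l_closed[simplified]) (auto simp: in_keys_iff coef_path_elem paths_iff split: if_splits)
      then show ?thesis
        by (simp add: path_mult_scale_left single_mult_path_elem path_tgt_eq)
    qed
    have "(\<Sum>p\<in>J. scale (coef f p) (path_elem p)) \<in> I" if "finite J" "J \<subseteq> Poly_Mapping.keys f" for J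
      using that
    proof (induction J rule: finite_induct)
      case empty
      show ?case using I.zero_closed by simp
    next
      case (insert p J)
      have "coef (restrict_to B f) p = 0" "coef f p \<noteq> 0"
        using insert.prems \<open>f \<in> ?Z\<close> by (auto simp: in_keys_iff)
      then have "p \<in> paths Q" "p \<notin> B"
        using \<open>f \<in> ?Z\<close> by (auto simp: in_keys_iff split: if_splits)
      then show ?case
        using insert I.a_closed[OF sc[of "fst p" "snd p"]] by auto
    qed
    then show ?thesis
      using expand_paths[of f] by (metis finite_keys subset_refl)
  qed
  with 1 show ?thesis by blast
qed

lemma path_elem_I: "p \<in> paths Q \<Longrightarrow> path_elem p \<in> I \<longleftrightarrow> p \<notin> B"
proof -
  assume p: "p \<in> paths Q"
  have "restrict_to B (path_elem p) = (0 :: _ \<Rightarrow>\<^sub>0 'k) \<longleftrightarrow> p \<notin> B"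
  proof
    assume "restrict_to B (path_elem p) = (0 :: _ \<Rightarrow>\<^sub>0 'k)"
    then have "coef (restrict_to B (path_elem p) :: _ \<Rightarrow>\<^sub>0 'k) p = 0" by simp
    then show "p \<notin> B" by (simp add: coef_path_elem split: if_splits)
  qed (auto intro!: poly_mapping_eqI simp: coef_path_elem)
  then show ?thesis
    using p by (auto simp: I_iff path_elem_def)
qed

lemma basis_paths_eq: "basis_paths Q I = B"
  using path_elem_I B_subset_paths by (auto simp: basis_paths_def)

lemma nz_iff: "nz a b \<longleftrightarrow> a \<in> arcs Q \<and> b \<in> arcs Q \<and> head Q a = tail Q b \<and> path_elem (tail Q a, [a, b]) \<notin> I"
proof -
  have "path_elem (tail Q a, [a, b]) \<in> I \<longleftrightarrow> (tail Q a, [a, b]) \<notin> B" if "a \<in> arcs Q" "b \<in> arcs Q" "head Q a = tail Q b"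
    using that by (intro path_elem_I) (auto simp: paths_iff)
  then show ?thesis
    by (auto simp: B_iff nz_arcs)
qed

abbreviation A :: "('k, (('v, 'a) qpath \<Rightarrow>\<^sub>0 'k) set) module" where
  "A \<equiv> bound_quiver_algebra Q I"

definition cls :: "(('v, 'a) qpath \<Rightarrow>\<^sub>0 'k) \<Rightarrow> (('v, 'a) qpath \<Rightarrow>\<^sub>0 'k) set" where
  "cls x = I +>\<^bsub>PA\<^esub> x"

lemma ideal_I: "ideal I PA"
  unfolding I_eq
  by (rule ring.genideal_ideal[OF ring_path_algebra]) (use S_len in \<open>auto simp: path_elem_def\<close>)

lemma cls_eq_iff:
  assumes "x \<in> carrier PA" "y \<in> carrier PA"
  shows "cls x = cls y \<longleftrightarrow> restrict_to B x = restrict_to B y"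
proof -
  interpret I: ideal I PA by (rule ideal_I)
  have "\<ominus>\<^bsub>PA\<^esub> y = - y"
    using assms by (intro I.minus_equality) auto
  then have "x \<ominus>\<^bsub>PA\<^esub> y = x - y"
    by (simp add: a_minus_def)
  moreover have "x - y \<in> carrier PA"
    using I.minus_closed[OF assms] calculation by simp
  moreover have "restrict_to B (x - y) = 0 \<longleftrightarrow> restrict_to B x = restrict_to B y"
    by (simp add: restrict_to_diff)
  ultimately show ?thesis
    using I.quotient_eq_iff_same_a_r_cos[OF ideal_I assms] unfolding cls_def I_iff by auto
qed

lemma A_simps:
  "carrier A = cls ` carrier PA"
  "\<one>\<^bsub>A\<^esub> = cls \<one>\<^bsub>PA\<^esub>"
  "\<zero>\<^bsub>A\<^esub> = I"
  "add A = set_add PA"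
  "monoid.mult A = rcoset_mult PA I"
  "module.smult A = (\<lambda>c Y. \<Union>y\<in>Y. cls (scale c y))"
  by (auto simp: quotient_algebra_def ring.defs module.defs FactRing_def A_RCOSETS_def' cls_def)

lemma cls_restrict: "x \<in> carrier PA \<Longrightarrow> cls (restrict_to B x) = cls x"
  using M_subset_PA by (subst cls_eq_iff) auto

text \<open>Every coset has exactly one representative supported on the basis paths.\<close>

lemma cls_M: "bij_betw cls M (carrier A)"
proof -
  have "inj_on cls M"
  proof (rule inj_onI)
    fix x y assume xy: "x \<in> M" "y \<in> M" "cls x = cls y"
    then have "restrict_to B x = restrict_to B y"
      using cls_eq_iff[of x y] M_subset_PA by auto
    then show "x = y" using xy by simp
  qed
  moreover have "cls ` M = cls ` carrier PA"
  proof (intro equalityI subsetI)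
    fix Y assume "Y \<in> cls ` carrier PA"
    then obtain x where "x \<in> carrier PA" "Y = cls (restrict_to B x)"
      by (metis cls_restrict imageE)
    then show "Y \<in> cls ` M" by (metis M_closed(8) imageI)
  qed (use M_subset_PA in auto)
  ultimately show ?thesis
    by (simp add: bij_betw_def A_simps)
qed

lemma cls_mult: "x \<in> M \<Longrightarrow> y \<in> M \<Longrightarrow> cls x \<otimes>\<^bsub>A\<^esub> cls y = cls (x \<star> y)"
proof -
  interpret I: ideal I PA by (rule ideal_I)
  assume "x \<in> M" "y \<in> M"
  then have xy: "x \<in> carrier PA" "y \<in> carrier PA" using M_subset_PA by auto
  then have "cls x \<otimes>\<^bsub>A\<^esub> cls y = cls (path_mult Q x y)"
    unfolding A_simps cls_def using I.rcoset_mult_add[of x y] by simp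
  also have "\<dots> = cls (x \<star> y)"
    unfolding mul_def using I.m_closed[OF xy] by (simp add: cls_restrict)
  finally show ?thesis .
qed

lemma cls_add: "x \<in> M \<Longrightarrow> y \<in> M \<Longrightarrow> cls x \<oplus>\<^bsub>A\<^esub> cls y = cls (x + y)"
proof -
  interpret I: ideal I PA by (rule ideal_I)
  assume "x \<in> M" "y \<in> M"
  then have xy: "x \<in> carrier PA" "y \<in> carrier PA" using M_subset_PA by auto
  then show ?thesis
    unfolding A_simps cls_def using I.a_rcos_sum[of x y] by simp
qed

lemma cls_smult: "x \<in> M \<Longrightarrow> c \<odot>\<^bsub>A\<^esub> cls x = cls (scale c x)"
proof -
  interpret I: ideal I PA by (rule ideal_I)
  assume "x \<in> M"
  then have x: "x \<in> carrier PA" using M_subset_PA by auto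
  have "cls (scale c y) = cls (scale c x)" if "y \<in> cls x" for y
  proof -
    have y: "y \<in> carrier PA" "cls y = cls x"
      using that x I.a_repr_independence[OF _ x I.a_subgroup] I.a_r_coset_subset_G[OF I.a_subset x]
      unfolding cls_def by auto
    then have "restrict_to B y = restrict_to B x"
      using cls_eq_iff x by blast
    then have "restrict_to B (scale c y) = restrict_to B (scale c x)"
      by (simp add: restrict_to_scale)
    then show ?thesis
      using cls_eq_iff x y scale_PA by blast
  qed
  moreover have "x \<in> cls x"
    unfolding cls_def using I.a_rcos_self[OF x] .
  ultimately show ?thesis
    unfolding A_simps by blast
qed

lemma cls_unit: "\<one>\<^bsub>A\<^esub> = cls unit"
  by (simp add: A_simps unit_def path_elem_def)

lemma cls_zero: "\<zero>\<^bsub>A\<^esub> = cls 0"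
proof -
  interpret I: ideal I PA by (rule ideal_I)
  show ?thesis
    unfolding A_simps cls_def using I.a_coset_join2[OF I.zero_closed I.a_subgroup additive_subgroup.zero_closed[OF ideal.axioms(1)[OF ideal_I]]] by simp
qed

lemma path_class_eq: "path_class Q I p = cls (path_elem p)"
  by (simp add: path_class_def cls_def)

end

section \<open>Automorphisms of the model\<close>

context bound_quiver
begin

text \<open>The arrow ideal: the elements without stationary terms.\<close>

definition Mp :: "(('v, 'a) qpath \<Rightarrow>\<^sub>0 'k::field) set" where
  "Mp = {x \<in> M. \<forall>v. coef x (v, []) = 0}"

definition vaut :: "((('v, 'a) qpath \<Rightarrow>\<^sub>0 'k::field) \<Rightarrow> (('v, 'a) qpath \<Rightarrow>\<^sub>0 'k)) \<Rightarrow> bool" where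
  "vaut g \<longleftrightarrow> (\<forall>x\<in>M. \<forall>y\<in>M. g (x + y) = g x + g y) \<and> (\<forall>c. \<forall>x\<in>M. g (scale c x) = scale c (g x)) \<and>
     (\<forall>x\<in>M. \<forall>y\<in>M. g (x \<star> y) = g x \<star> g y) \<and>
     (\<forall>v\<in>verts Q. g (path_elem (v, [])) = path_elem (v, [])) \<and> bij_betw g M M"

text \<open>
  Conjugation by \<open>1 + y\<close> with \<open>y\<close> in the arrow ideal; the inverse \<open>z\<close> is part
  of the data.
\<close>

definition inner :: "((('v, 'a) qpath \<Rightarrow>\<^sub>0 'k::field) \<Rightarrow> (('v, 'a) qpath \<Rightarrow>\<^sub>0 'k)) \<Rightarrow> bool" where
  "inner g \<longleftrightarrow> (\<exists>y\<in>Mp. \<exists>z\<in>M. (unit + y) \<star> z = unit \<and> z \<star> (unit + y) = unit \<and>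
     (\<forall>x\<in>M. g x = z \<star> x \<star> (unit + y)))"

lemma Mp_M: "x \<in> Mp \<Longrightarrow> x \<in> M" by (simp add: Mp_def)

lemma coef_mul_Nil: "v \<in> verts Q \<Longrightarrow> coef (x \<star> y) (v, []) = coef x (v, []) * coef y (v, [])"
  by (simp add: coef_mul path_tgt_eq)

lemma Mp_closed [intro, simp]:
  "x \<in> Mp \<Longrightarrow> y \<in> Mp \<Longrightarrow> x + y \<in> Mp" "x \<in> Mp \<Longrightarrow> y \<in> Mp \<Longrightarrow> x - y \<in> Mp"
  "x \<in> Mp \<Longrightarrow> - x \<in> Mp" "x \<in> Mp \<Longrightarrow> scale c x \<in> Mp" "0 \<in> Mp"
  by (auto simp: Mp_def lookup_add lookup_minus)

lemma Mp_mul [intro, simp]: "x \<in> Mp \<Longrightarrow> x \<star> y \<in> Mp" "y \<in> Mp \<Longrightarrow> x \<star> y \<in> Mp"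
  by (auto simp: Mp_def coef_mul)

lemma Mp_path_elem: "p \<in> B \<Longrightarrow> snd p \<noteq> [] \<Longrightarrow> path_elem p \<in> Mp"
  by (auto simp: Mp_def coef_path_elem)

lemma Mp_sum: "(\<And>i. i \<in> J \<Longrightarrow> f i \<in> Mp) \<Longrightarrow> (\<Sum>i\<in>J. f i) \<in> Mp"
  by (induction J rule: infinite_finite_induct) auto

context
  fixes g :: "(('v, 'a) qpath \<Rightarrow>\<^sub>0 'k::field) \<Rightarrow> (('v, 'a) qpath \<Rightarrow>\<^sub>0 'k)"
  assumes g: "vaut g"
begin

lemma vaut_add: "x \<in> M \<Longrightarrow> y \<in> M \<Longrightarrow> g (x + y) = g x + g y"
  and vaut_scale: "x \<in> M \<Longrightarrow> g (scale c x) = scale c (g x)"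
  and vaut_mul: "x \<in> M \<Longrightarrow> y \<in> M \<Longrightarrow> g (x \<star> y) = g x \<star> g y"
  and vaut_vertex: "v \<in> verts Q \<Longrightarrow> g (path_elem (v, [])) = path_elem (v, [])"
  and vaut_bij: "bij_betw g M M"
  using g by (simp_all add: vaut_def)

lemma vaut_M [simp, intro]: "x \<in> M \<Longrightarrow> g x \<in> M"
  using vaut_bij by (auto simp: bij_betw_def)

lemma vaut_zero [simp]: "g 0 = 0"
  using vaut_scale[of 0 0] by simp

lemma vaut_minus: "x \<in> M \<Longrightarrow> g (- x) = - g x"
  using vaut_scale[of x "-1"] by (simp add: scale_minus_left)

lemma vaut_diff: "x \<in> M \<Longrightarrow> y \<in> M \<Longrightarrow> g (x - y) = g x - g y"
  using vaut_add[of x "- y"] by (simp add: vaut_minus)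

lemma vaut_sum: "(\<And>i. i \<in> J \<Longrightarrow> f i \<in> M) \<Longrightarrow> g (\<Sum>i\<in>J. f i) = (\<Sum>i\<in>J. g (f i))"
proof (induction J rule: infinite_finite_induct)
  case (insert x F)
  then show ?case
    using vaut_add[of "f x" "sum f F"] by (auto simp: M_sum)
qed auto

lemma vaut_unit: "g unit = unit"
  unfolding unit_def by (subst vaut_sum) (auto simp: vaut_vertex)

end

lemma vaut_comp:
  assumes "vaut g" "vaut h" shows "vaut (g \<circ> h)"
  using assms bij_betw_trans[OF vaut_bij[OF assms(2)] vaut_bij[OF assms(1)]]
  by (simp add: vaut_def[of "g \<circ> h"] vaut_add vaut_scale vaut_mul vaut_vertex)

lemma vaut_id: "vaut id" "vaut (\<lambda>x. x)"
  by (simp_all add: vaut_def bij_betw_def)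

lemma vaut_inv:
  assumes g: "vaut g" shows "vaut (inv_into M g)"
proof -
  have bij: "bij_betw (inv_into M g) M M"
    by (rule bij_betw_inv_into[OF vaut_bij[OF g]])
  have M: "inv_into M g x \<in> M" if "x \<in> M" for x
    using bij that by (auto simp: bij_betw_def)
  have r: "g (inv_into M g x) = x" if "x \<in> M" for x
    using bij_betw_inv_into_right[OF vaut_bij[OF g] that] .
  have l: "inv_into M g y = x" if "x \<in> M" "y = g x" for x y
    using bij_betw_inv_into_left[OF vaut_bij[OF g]] that by simp
  show ?thesis
    unfolding vaut_def using bij
    by (auto intro!: l simp: vaut_add[OF g] vaut_scale[OF g] vaut_mul[OF g] vaut_vertex[OF g] M r)
qed

lemma vaut_inv_right: "vaut g \<Longrightarrow> x \<in> M \<Longrightarrow> g (inv_into M g x) = x"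
  and vaut_inv_left: "vaut g \<Longrightarrow> x \<in> M \<Longrightarrow> inv_into M g (g x) = x"
  using bij_betw_inv_into_right bij_betw_inv_into_left vaut_bij by metis+

lemma vaut_cong: "(\<And>x. x \<in> M \<Longrightarrow> g x = h x) \<Longrightarrow> vaut g = vaut h"
  unfolding vaut_def by (intro conj_cong ball_cong all_cong1 bij_betw_cong) auto

lemma inner_vaut:
  assumes y: "y \<in> M" "z \<in> M" "y \<star> z = unit" "z \<star> y = unit"
    and fixes_vertices: "\<And>v. v \<in> verts Q \<Longrightarrow> z \<star> path_elem (v, []) \<star> y = path_elem (v, [])"
  shows "vaut (\<lambda>x. z \<star> x \<star> y)"
proof -
  have 1: "y \<star> (z \<star> x \<star> y) \<star> z = x" if "x \<in> M" for x
  proof -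
    have "y \<star> (z \<star> x \<star> y) \<star> z = (y \<star> z) \<star> x \<star> (y \<star> z)" by (simp only: mul_assoc)
    then show ?thesis using y that by simp
  qed
  have 2: "z \<star> (y \<star> x \<star> z) \<star> y = x" if "x \<in> M" for x
  proof -
    have "z \<star> (y \<star> x \<star> z) \<star> y = (z \<star> y) \<star> x \<star> (z \<star> y)" by (simp only: mul_assoc)
    then show ?thesis using y that by simp
  qed
  have 3: "z \<star> (a \<star> b) \<star> y = (z \<star> a \<star> y) \<star> (z \<star> b \<star> y)" if "a \<in> M" "b \<in> M" for a b
  proof -
    have "(z \<star> a \<star> y) \<star> (z \<star> b \<star> y) = z \<star> a \<star> (y \<star> z) \<star> (b \<star> y)" by (simp only: mul_assoc)
    then show ?thesis using y that by (simp add: mul_assoc)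
  qed
  have "bij_betw (\<lambda>x. z \<star> x \<star> y) M M"
    by (rule bij_betw_byWitness[where f' = "\<lambda>x. y \<star> x \<star> z"]) (auto simp: 1 2)
  then show ?thesis
    unfolding vaut_def using fixes_vertices
    by (auto simp: mul_add_left mul_add_right mul_scale_left mul_scale_right 3)
qed

end

context bound_quiver_ideal
begin

definition rep :: "(('v, 'a) qpath \<Rightarrow>\<^sub>0 'k) set \<Rightarrow> (('v, 'a) qpath \<Rightarrow>\<^sub>0 'k)" where
  "rep Y = inv_into M cls Y"

text \<open>
  Automorphisms of the model act on representatives. The restriction to the carrier makes \<open>lift g\<close>
  extensional, as the elements of \<open>H\<close> are.
\<close>

definition lift :: "((('v, 'a) qpath \<Rightarrow>\<^sub>0 'k) \<Rightarrow> (('v, 'a) qpath \<Rightarrow>\<^sub>0 'k)) \<Rightarrow>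
    (('v, 'a) qpath \<Rightarrow>\<^sub>0 'k) set \<Rightarrow> (('v, 'a) qpath \<Rightarrow>\<^sub>0 'k) set" where
  "lift g = (\<lambda>Y\<in>carrier A. cls (g (rep Y)))"

lemma rep_M [simp]: "Y \<in> carrier A \<Longrightarrow> rep Y \<in> M"
  unfolding rep_def using bij_betw_inv_into[OF cls_M] by (auto simp: bij_betw_def)

lemma cls_rep [simp]: "Y \<in> carrier A \<Longrightarrow> cls (rep Y) = Y"
  unfolding rep_def using bij_betw_inv_into_right[OF cls_M] .

lemma rep_cls [simp]: "x \<in> M \<Longrightarrow> rep (cls x) = x"
  unfolding rep_def using bij_betw_inv_into_left[OF cls_M] .

lemma cls_carrier [simp]: "x \<in> M \<Longrightarrow> cls x \<in> carrier A"
  using cls_M by (auto simp: bij_betw_def)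

lemma carrier_A_cases:
  assumes "Y \<in> carrier A" obtains x where "x \<in> M" "Y = cls x"
  using assms cls_M by (auto simp: bij_betw_def)

lemma cls_inj: "x \<in> M \<Longrightarrow> y \<in> M \<Longrightarrow> cls x = cls y \<longleftrightarrow> x = y"
  by (metis rep_cls)

lemma lift_cls [simp]: "x \<in> M \<Longrightarrow> lift g (cls x) = cls (g x)"
  by (simp add: lift_def)

lemma monoid_A: "monoid A"
proof (rule monoidI; (elim carrier_A_cases)?)
  show "\<one>\<^bsub>A\<^esub> \<in> carrier A" by (simp add: cls_unit)
qed (simp_all add: cls_mult cls_unit mul_assoc)

lemma rep_bij: "bij_betw rep (carrier A) M"
  by (rule bij_betw_byWitness[where f' = cls]) auto

lemma H_carrier_iff:
  "h \<in> carrier (H_group Q I) \<longleftrightarrow> h \<in> extensional (carrier A) \<and> vaut (\<lambda>x. rep (h (cls x))) \<and>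
     (\<forall>Y\<in>carrier A. h Y \<in> carrier A)"
proof -
  have *: "h \<in> carrier (H_group Q I) \<longleftrightarrow> h \<in> extensional (carrier A) \<and> bij_betw h (carrier A) (carrier A) \<and>
      h \<in> algebra_hom A A \<and> (\<forall>v\<in>verts Q. h (cls (path_elem (v, []))) = cls (path_elem (v, [])))"
    by (auto simp: H_group_def Let_def Bij_def path_class_eq)
  show ?thesis
  proof (cases "\<forall>Y\<in>carrier A. h Y \<in> carrier A")
    case True
    have bij: "bij_betw h (carrier A) (carrier A) \<longleftrightarrow> bij_betw (\<lambda>x. rep (h (cls x))) M M"
    proof
      assume "bij_betw h (carrier A) (carrier A)"
      then show "bij_betw (\<lambda>x. rep (h (cls x))) M M"
        using bij_betw_trans[OF bij_betw_trans[OF cls_M] rep_bij] by (simp add: comp_def)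
    next
      assume "bij_betw (\<lambda>x. rep (h (cls x))) M M"
      from bij_betw_trans[OF bij_betw_trans[OF rep_bij this] cls_M]
      have "bij_betw (cls \<circ> (\<lambda>x. rep (h (cls x))) \<circ> rep) (carrier A) (carrier A)"
        by (simp add: comp_assoc)
      then show "bij_betw h (carrier A) (carrier A)"
        by (rule bij_betw_cong[THEN iffD1, rotated]) (use True in simp)
    qed
    have e_mult: "Z = Y \<otimes>\<^bsub>A\<^esub> W \<longleftrightarrow> rep Z = rep Y \<star> rep W"
      and e_add: "Z = Y \<oplus>\<^bsub>A\<^esub> W \<longleftrightarrow> rep Z = rep Y + rep W"
      if "Z \<in> carrier A" "Y \<in> carrier A" "W \<in> carrier A" for Z Y W
      using that by (auto elim!: carrier_A_cases simp: cls_mult cls_add cls_inj)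
    have e_smult: "Z = c \<odot>\<^bsub>A\<^esub> Y \<longleftrightarrow> rep Z = scale c (rep Y)"
      and e_rep: "Z = Y \<longleftrightarrow> rep Z = rep Y"
      if "Z \<in> carrier A" "Y \<in> carrier A" for Z Y c
      using that by (auto elim!: carrier_A_cases simp: cls_smult cls_inj)
    have ball: "(\<forall>Y\<in>carrier A. P Y) \<longleftrightarrow> (\<forall>x\<in>M. P (cls x))" for P
      by (metis cls_carrier cls_rep rep_M)
    have "h \<in> algebra_hom A A \<longleftrightarrow> (\<forall>x\<in>M. \<forall>y\<in>M. h (cls (x \<star> y)) = h (cls x) \<otimes>\<^bsub>A\<^esub> h (cls y)) \<and>
        (\<forall>x\<in>M. \<forall>y\<in>M. h (cls (x + y)) = h (cls x) \<oplus>\<^bsub>A\<^esub> h (cls y)) \<and> h (cls unit) = cls unit \<and>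
        (\<forall>c. \<forall>x\<in>M. h (cls (scale c x)) = c \<odot>\<^bsub>A\<^esub> h (cls x))"
    proof -
      have "h \<in> algebra_hom A A \<longleftrightarrow> (\<forall>x\<in>carrier A. \<forall>y\<in>carrier A. h (x \<otimes>\<^bsub>A\<^esub> y) = h x \<otimes>\<^bsub>A\<^esub> h y) \<and>
        (\<forall>x\<in>carrier A. \<forall>y\<in>carrier A. h (x \<oplus>\<^bsub>A\<^esub> y) = h x \<oplus>\<^bsub>A\<^esub> h y) \<and> h \<one>\<^bsub>A\<^esub> = \<one>\<^bsub>A\<^esub> \<and>
        (\<forall>c. \<forall>x\<in>carrier A. h (c \<odot>\<^bsub>A\<^esub> x) = c \<odot>\<^bsub>A\<^esub> h x)"
        using True unfolding algebra_hom_def ring_hom_def by blast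
      then show ?thesis
        unfolding ball cls_unit by (simp add: cls_mult cls_add cls_smult)
    qed
    also have "\<dots> \<longleftrightarrow> (\<forall>x\<in>M. \<forall>y\<in>M. rep (h (cls (x \<star> y))) = rep (h (cls x)) \<star> rep (h (cls y))) \<and>
        (\<forall>x\<in>M. \<forall>y\<in>M. rep (h (cls (x + y))) = rep (h (cls x)) + rep (h (cls y))) \<and> rep (h (cls unit)) = unit \<and>
        (\<forall>c. \<forall>x\<in>M. rep (h (cls (scale c x))) = scale c (rep (h (cls x))))"
      by (intro conj_cong ball_cong all_cong1 refl; (subst e_mult e_add e_smult)?) (use True in \<open>auto simp: e_rep[of "h (cls unit)" "cls unit"]\<close>)
    finally have hom: "h \<in> algebra_hom A A \<longleftrightarrow> \<dots>" .
    have vert: "h (cls (path_elem (v, []))) = cls (path_elem (v, [])) \<longleftrightarrow> rep (h (cls (path_elem (v, [])))) = path_elem (v, [])"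
      if "v \<in> verts Q" for v
      using that True by (subst e_rep) auto
    have "vaut (\<lambda>x. rep (h (cls x))) \<Longrightarrow> rep (h (cls unit)) = unit"
      using vaut_unit by blast
    then show ?thesis
      unfolding * hom bij using True vert by (auto simp: vaut_def)
  next
    case False
    then show ?thesis
      unfolding * by (auto simp: bij_betw_def)
  qed
qed

lemma lift_in_H: "vaut g \<Longrightarrow> lift g \<in> carrier (H_group Q I)"
  unfolding H_carrier_iff
proof (intro conjI ballI)
  assume g: "vaut g"
  have "rep (lift g (cls x)) = g x" if "x \<in> M" for x
    using that vaut_M[OF g] by simp
  then show "vaut (\<lambda>x. rep (lift g (cls x)))"
    using g by (subst vaut_cong[of _ g]) auto
  show "lift g Y \<in> carrier A" if "Y \<in> carrier A" for Y
    using that vaut_M[OF g] by (simp add: lift_def)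
qed (simp add: lift_def)

lemma H_cases:
  assumes "h \<in> carrier (H_group Q I)"
  obtains g where "vaut g" "h = lift g"
proof
  show "vaut (\<lambda>x. rep (h (cls x)))" using assms by (simp add: H_carrier_iff)
  show "h = lift (\<lambda>x. rep (h (cls x)))"
  proof (rule extensionalityI[of _ "carrier A"])
    show "h \<in> extensional (carrier A)" using assms by (simp add: H_carrier_iff)
    fix Y assume "Y \<in> carrier A"
    then show "h Y = lift (\<lambda>x. rep (h (cls x))) Y"
      using assms by (auto simp: lift_def H_carrier_iff)
  qed (simp add: lift_def)
qed

lemma lift_eq_iff:
  assumes "vaut g" "vaut g'"
  shows "lift g = lift g' \<longleftrightarrow> (\<forall>x\<in>M. g x = g' x)"
proof
  assume "lift g = lift g'"
  then have "cls (g x) = cls (g' x)" if "x \<in> M" for x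
    using lift_cls that by metis
  then show "\<forall>x\<in>M. g x = g' x"
    using assms by (simp add: cls_inj)
next
  assume "\<forall>x\<in>M. g x = g' x"
  then show "lift g = lift g'"
    unfolding lift_def by (intro restrict_ext) simp
qed

lemma lift_mult: "vaut g \<Longrightarrow> vaut g' \<Longrightarrow> lift g \<otimes>\<^bsub>H_group Q I\<^esub> lift g' = lift (g \<circ> g')"
proof -
  assume g: "vaut g" "vaut g'"
  have "lift g \<in> Bij (carrier A)" "lift g' \<in> Bij (carrier A)"
    using lift_in_H g by (auto simp: H_group_def Let_def)
  then have "lift g \<otimes>\<^bsub>H_group Q I\<^esub> lift g' = compose (carrier A) (lift g) (lift g')"
    by (simp add: H_group_def Let_def BijGroup_def)
  also have "\<dots> = lift (g \<circ> g')"
    using g by (intro extensionalityI[of _ "carrier A"]) (auto simp: compose_def lift_def)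
  finally show ?thesis .
qed

lemma lift_one: "\<one>\<^bsub>H_group Q I\<^esub> = lift id"
  by (auto simp: H_group_def Let_def BijGroup_def lift_def intro!: restrict_ext)

lemma group_H: "group (H_group Q I)"
proof (rule groupI)
  fix x assume "x \<in> carrier (H_group Q I)"
  then obtain g where g: "vaut g" "x = lift g" by (rule H_cases)
  have "lift (inv_into M g) \<otimes>\<^bsub>H_group Q I\<^esub> x = \<one>\<^bsub>H_group Q I\<^esub>"
    unfolding g(2) lift_one using g
    by (subst lift_mult) (auto simp: vaut_inv lift_eq_iff vaut_comp vaut_id vaut_inv_left)
  then show "\<exists>y\<in>carrier (H_group Q I). y \<otimes>\<^bsub>H_group Q I\<^esub> x = \<one>\<^bsub>H_group Q I\<^esub>"
    using lift_in_H vaut_inv g by blast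
qed (auto elim!: H_cases simp: lift_in_H lift_mult vaut_comp vaut_id lift_one comp_assoc)

text \<open>Finite linear combinations of nonstationary basis paths are the classes of the arrow ideal.\<close>

lemma A_plus_eq: "A_plus Q I = cls ` Mp"
proof -
  have fs: "finsum A f F = cls (\<Sum>x\<in>F. rep (f x))"
    if "finite F" "\<And>x. x \<in> F \<Longrightarrow> f x \<in> carrier A" for F :: "(('v, 'a) qpath \<Rightarrow>\<^sub>0 'k) set set" and f
  proof -
    have "abelian_monoid A"
    proof (rule abelian_monoidI; (elim carrier_A_cases)?)
    qed (auto simp: cls_add cls_zero algebra_simps)
    then interpret abelian_monoid A .
    show ?thesis using that
    proof (induction F rule: finite_induct)
      case (insert x F)
      have "(\<Sum>x\<in>F. rep (f x)) \<in> M" using insert by auto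
      moreover have "finsum A f (insert x F) = f x \<oplus>\<^bsub>A\<^esub> finsum A f F"
        using insert by (intro finsum_insert) auto
      moreover have "f x \<oplus>\<^bsub>A\<^esub> cls (\<Sum>x\<in>F. rep (f x)) = cls (rep (f x) + (\<Sum>x\<in>F. rep (f x)))"
        using insert calculation(1) by (subst cls_add[symmetric]) auto
      ultimately show ?case
        using insert by simp
    qed (simp add: cls_zero)
  qed
  let ?P = "{p \<in> B. path_length p \<ge> 1}"
  have P: "(path_elem p :: _ \<Rightarrow>\<^sub>0 'k) \<in> Mp" if "p \<in> ?P" for p
    using that by (intro Mp_path_elem) (auto simp: path_length_def)
  have "A_plus Q I = linear_span A ((\<lambda>p. cls (path_elem p)) ` ?P)"
    unfolding A_plus_def basis_paths_eq path_class_eq ..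
  also have "\<dots> = cls ` Mp"
  proof (intro equalityI subsetI)
    fix Y assume "Y \<in> linear_span A ((\<lambda>p. cls (path_elem p)) ` ?P)"
    then obtain c F where F: "Y = finsum A (\<lambda>b. c b \<odot>\<^bsub>A\<^esub> b) F" "finite F" "F \<subseteq> (\<lambda>p. cls (path_elem p)) ` ?P"
      unfolding linear_span_def by auto
    have *: "rep (c b \<odot>\<^bsub>A\<^esub> b) \<in> Mp \<and> c b \<odot>\<^bsub>A\<^esub> b \<in> carrier A" if "b \<in> F" for b
    proof -
      obtain p where p: "p \<in> ?P" "b = cls (path_elem p)" using F(3) \<open>b \<in> F\<close> by auto
      show ?thesis
        using P[OF p(1)] Mp_M[OF P[OF p(1)]] by (simp add: p(2) cls_smult Mp_closed)
    qed
    then show "Y \<in> cls ` Mp"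
      unfolding F(1) by (subst fs[OF F(2)]) (auto intro!: imageI Mp_sum)
  next
    fix Y assume "Y \<in> cls ` Mp"
    then obtain x where x: "x \<in> Mp" "Y = cls x" by auto
    let ?F = "(\<lambda>p. cls (path_elem p)) ` Poly_Mapping.keys x"
    have kP: "p \<in> ?P" if "p \<in> Poly_Mapping.keys x" for p
      using that x MD[OF Mp_M[OF x(1)]] by (cases p) (auto simp: in_keys_iff Mp_def path_length_def Suc_le_eq)
    have inj: "inj_on (\<lambda>p. cls (path_elem p :: _ \<Rightarrow>\<^sub>0 'k)) (Poly_Mapping.keys x)"
    proof (rule inj_onI)
      fix p q assume pq: "p \<in> Poly_Mapping.keys x" "q \<in> Poly_Mapping.keys x"
        "cls (path_elem p :: _ \<Rightarrow>\<^sub>0 'k) = cls (path_elem q)"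
      then have "(path_elem p :: _ \<Rightarrow>\<^sub>0 'k) = path_elem q"
        using kP by (subst (asm) cls_inj) auto
      then show "p = q" by (metis coef_path_elem zero_neq_one)
    qed
    define c where "c Z = coef x (inv_into (Poly_Mapping.keys x) (\<lambda>p. cls (path_elem p :: _ \<Rightarrow>\<^sub>0 'k)) Z)" for Z
    have c: "c (cls (path_elem p)) = coef x p" if "p \<in> Poly_Mapping.keys x" for p
      unfolding c_def using inv_into_f_f[OF inj that] by simp
    have "finsum A (\<lambda>b. c b \<odot>\<^bsub>A\<^esub> b) ?F = cls (\<Sum>b\<in>?F. rep (c b \<odot>\<^bsub>A\<^esub> b))"
      using kP by (intro fs) (auto simp: cls_smult)
    also have "(\<Sum>b\<in>?F. rep (c b \<odot>\<^bsub>A\<^esub> b)) = (\<Sum>p\<in>Poly_Mapping.keys x. rep (c (cls (path_elem p)) \<odot>\<^bsub>A\<^esub> cls (path_elem p)))"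
      by (rule sum.reindex[OF inj, unfolded comp_def])
    also have "\<dots> = x"
      by (subst expand_paths[of x], intro sum.cong refl) (use kP in \<open>simp add: c cls_smult\<close>)
    finally show "Y \<in> linear_span A ((\<lambda>p. cls (path_elem p)) ` ?P)"
      unfolding linear_span_def x(2) using kP by (intro CollectI exI[of _ c] exI[of _ ?F]) auto
  qed
  finally show ?thesis .
qed

lemma lift_Inn_iff:
  assumes g: "vaut g"
  shows "lift g \<in> Inn_star Q I \<longleftrightarrow> inner g"
proof -
  interpret A: monoid A by (rule monoid_A)
  have inn: "lift g = inner_aut A (cls u) \<longleftrightarrow> (\<forall>x\<in>M. g x = z \<star> x \<star> u)"
    if u: "u \<in> M" "z \<in> M" "u \<star> z = unit" "z \<star> u = unit" for u z
  proof -
    have inv: "inv\<^bsub>A\<^esub> (cls u) = cls z"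
      using u by (intro A.inv_char) (simp_all add: cls_mult cls_unit)
    have "inner_aut A (cls u) = lift (\<lambda>x. z \<star> x \<star> u)"
      unfolding inner_aut_def lift_def inv
    proof (rule restrict_ext)
      fix Y assume "Y \<in> carrier A"
      then obtain x where "x \<in> M" "Y = cls x" by (rule carrier_A_cases)
      then show "cls z \<otimes>\<^bsub>A\<^esub> Y \<otimes>\<^bsub>A\<^esub> cls u = cls (z \<star> rep Y \<star> u)"
        using u by (simp add: cls_mult)
    qed
    moreover have "lift g = lift (\<lambda>x. z \<star> x \<star> u) \<longleftrightarrow> (\<forall>x\<in>M. g x = z \<star> x \<star> u)"
    proof
      assume eq: "lift g = lift (\<lambda>x. z \<star> x \<star> u)"
      have "cls (g x) = cls (z \<star> x \<star> u)" if "x \<in> M" for x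
        using lift_cls[OF that, of g] lift_cls[OF that, of "\<lambda>x. z \<star> x \<star> u"] eq by simp
      then show "\<forall>x\<in>M. g x = z \<star> x \<star> u"
        using g by (simp add: cls_inj)
    next
      assume "\<forall>x\<in>M. g x = z \<star> x \<star> u"
      then show "lift g = lift (\<lambda>x. z \<star> x \<star> u)"
        unfolding lift_def by (intro restrict_ext) simp
    qed
    ultimately show ?thesis by simp
  qed
  have units: "cls u \<in> Units A \<longleftrightarrow> (\<exists>z\<in>M. u \<star> z = unit \<and> z \<star> u = unit)" if "u \<in> M" for u
  proof
    assume "cls u \<in> Units A"
    then obtain Y where "Y \<in> carrier A" "cls u \<otimes>\<^bsub>A\<^esub> Y = \<one>\<^bsub>A\<^esub>" "Y \<otimes>\<^bsub>A\<^esub> cls u = \<one>\<^bsub>A\<^esub>"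
      unfolding Units_def by auto
    then show "\<exists>z\<in>M. u \<star> z = unit \<and> z \<star> u = unit"
      using that by (auto elim!: carrier_A_cases simp: cls_mult cls_unit cls_inj)
  next
    assume "\<exists>z\<in>M. u \<star> z = unit \<and> z \<star> u = unit"
    then obtain z where "z \<in> M" "u \<star> z = unit" "z \<star> u = unit" by auto
    then show "cls u \<in> Units A"
      unfolding Units_def using that by (auto intro!: bexI[of _ "cls z"] simp: cls_mult cls_unit)
  qed
  have "lift g \<in> Inn_star Q I \<longleftrightarrow> (\<exists>y\<in>Mp. lift g = inner_aut A (cls (unit + y)) \<and> cls (unit + y) \<in> Units A)"
  proof -
    have "lift g \<in> Inn_star Q I \<longleftrightarrow> (\<exists>Y\<in>cls ` Mp. lift g = inner_aut A (\<one>\<^bsub>A\<^esub> \<oplus>\<^bsub>A\<^esub> Y) \<and> \<one>\<^bsub>A\<^esub> \<oplus>\<^bsub>A\<^esub> Y \<in> Units A)"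
      unfolding Inn_star_def Let_def A_plus_eq by blast
    moreover have "\<one>\<^bsub>A\<^esub> \<oplus>\<^bsub>A\<^esub> cls y = cls (unit + y)" if "y \<in> Mp" for y
      using that by (simp add: cls_unit cls_add Mp_M)
    ultimately show ?thesis by simp
  qed
  also have "\<dots> \<longleftrightarrow> inner g"
  proof -
    have "lift g = inner_aut A (cls (unit + y)) \<and> cls (unit + y) \<in> Units A \<longleftrightarrow>
        (\<exists>z\<in>M. (unit + y) \<star> z = unit \<and> z \<star> (unit + y) = unit \<and> (\<forall>x\<in>M. g x = z \<star> x \<star> (unit + y)))"
      if "y \<in> Mp" for y
      using units[of "unit + y"] inn[of "unit + y"] Mp_M[OF that] by blast
    then show ?thesis
      unfolding inner_def by simp
  qed
  finally show ?thesis .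
qed

end

section \<open>Endomorphisms from images of arrows\<close>

context bound_quiver
begin

text \<open>Endomorphisms fixing the vertices: the universal property first yields these, bijectivity follows later.\<close>

definition vend :: "((('v, 'a) qpath \<Rightarrow>\<^sub>0 'k::field) \<Rightarrow> (('v, 'a) qpath \<Rightarrow>\<^sub>0 'k)) \<Rightarrow> bool" where
  "vend g \<longleftrightarrow> (\<forall>x\<in>M. \<forall>y\<in>M. g (x + y) = g x + g y) \<and> (\<forall>c. \<forall>x\<in>M. g (scale c x) = scale c (g x)) \<and>
     (\<forall>x\<in>M. \<forall>y\<in>M. g (x \<star> y) = g x \<star> g y) \<and>
     (\<forall>v\<in>verts Q. g (path_elem (v, [])) = path_elem (v, [])) \<and> (\<forall>x\<in>M. g x \<in> M)"

lemma vaut_iff_vend: "vaut g \<longleftrightarrow> vend g \<and> bij_betw g M M"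
  by (auto simp: vaut_def vend_def bij_betw_def)

lemma vaut_vend: "vaut g \<Longrightarrow> vend g" by (simp add: vaut_iff_vend)

primrec path_image :: "('a \<Rightarrow> (('v, 'a) qpath \<Rightarrow>\<^sub>0 'k::field)) \<Rightarrow> 'v \<Rightarrow> 'a list \<Rightarrow> (('v, 'a) qpath \<Rightarrow>\<^sub>0 'k)" where
  "path_image img v [] = path_elem (v, [])"
| "path_image img v (a # es) = img a \<star> path_image img (head Q a) es"

text \<open>The linear map that replaces every arrow of a path by its prescribed image.\<close>

definition ext :: "('a \<Rightarrow> (('v, 'a) qpath \<Rightarrow>\<^sub>0 'k::field)) \<Rightarrow> (('v, 'a) qpath \<Rightarrow>\<^sub>0 'k) \<Rightarrow> (('v, 'a) qpath \<Rightarrow>\<^sub>0 'k)" where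
  "ext img x = (\<Sum>p\<in>Poly_Mapping.keys x. scale (coef x p) (path_image img (fst p) (snd p)))"

text \<open>The corner in which an image of \<open>a\<close> has to lie for the map to fix the vertices.\<close>

definition par :: "'a \<Rightarrow> (('v, 'a) qpath \<Rightarrow>\<^sub>0 'k::field) set" where
  "par a = {x \<in> M. \<forall>p. coef x p \<noteq> 0 \<longrightarrow> fst p = tail Q a \<and> tgt p = head Q a}"

lemma par_M: "x \<in> par a \<Longrightarrow> x \<in> M" by (simp add: par_def)

lemma par_tail: "x \<in> par a \<Longrightarrow> path_elem (tail Q a, []) \<star> x = x"
  by (intro poly_mapping_eqI; clarify) (auto simp: par_def coef_vertex_mul)

lemma par_head: "x \<in> par a \<Longrightarrow> x \<star> path_elem (head Q a, []) = x"
  by (intro poly_mapping_eqI) (auto simp: par_def coef_mul_vertex)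

lemma parI:
  assumes "x \<in> M" "path_elem (tail Q a, []) \<star> x = x" "x \<star> path_elem (head Q a, []) = x"
  shows "x \<in> par a"
proof -
  have *: "fst p = tail Q a \<and> tgt p = head Q a" if "coef x p \<noteq> 0" for p
  proof (cases p)
    case (Pair v es)
    have "coef (path_elem (tail Q a, []) \<star> x) p \<noteq> 0" "coef (x \<star> path_elem (head Q a, [])) p \<noteq> 0"
      using assms that by simp_all
    then show ?thesis
      using assms(1) Pair by (simp_all add: coef_vertex_mul coef_mul_vertex split: if_splits)
  qed
  show ?thesis unfolding par_def using assms(1) * by blast
qed

lemma ext_superset:
  assumes "finite K" "Poly_Mapping.keys x \<subseteq> K"
  shows "ext img x = (\<Sum>p\<in>K. scale (coef x p) (path_image img (fst p) (snd p)))"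
  unfolding ext_def using assms by (intro sum.mono_neutral_left) (auto simp: in_keys_iff)

lemma ext_add: "ext img (x + y) = ext img x + ext img y"
proof -
  let ?K = "Poly_Mapping.keys x \<union> Poly_Mapping.keys y"
  have "ext img z = (\<Sum>p\<in>?K. scale (coef z p) (path_image img (fst p) (snd p)))"
    if "z \<in> {x, y, x + y}" for z
    using that by (intro ext_superset) (auto dest!: subsetD[OF Poly_Mapping.keys_add])
  then show ?thesis
    by (simp add: lookup_add scale_add_left sum.distrib)
qed

lemma ext_scale: "ext img (scale c x) = scale c (ext img x)"
proof -
  have "ext img (scale c x) = (\<Sum>p\<in>Poly_Mapping.keys x. scale (coef (scale c x) p) (path_image img (fst p) (snd p)))"
    by (intro ext_superset) (auto simp: in_keys_iff)
  then show ?thesis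
    by (simp add: ext_def scale_sum scale_scale)
qed

lemma ext_zero [simp]: "ext img 0 = 0" by (simp add: ext_def)

lemma ext_sum: "ext img (\<Sum>i\<in>J. f i) = (\<Sum>i\<in>J. ext img (f i))"
  by (induction J rule: infinite_finite_induct) (auto simp: ext_add)

lemma ext_path_elem: "ext img (path_elem p) = path_image img (fst p) (snd p)"
  by (simp add: ext_def path_elem_def)

lemma path_elem_Cons:
  "(v, a # es) \<in> B \<Longrightarrow> path_elem (v, a # es) = path_elem (ar a) \<star> path_elem (head Q a, es)"
  by (auto simp: mul_path_elem arrow_path_def path_tgt_eq B_iff)

lemma B_Cons: "(v, a # es) \<in> B \<Longrightarrow> (head Q a, es) \<in> B \<and> a \<in> arcs Q \<and> v = tail Q a"
  using B_append[of v "[a]" es] by (auto simp: path_tgt_eq)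

lemma ar_B [simp]: "a \<in> arcs Q \<Longrightarrow> ar a \<in> B"
  by (simp add: arrow_path_def)

lemma vend_path_elem:
  assumes g: "vend g" and "(v, es) \<in> B"
  shows "g (path_elem (v, es)) = path_image (\<lambda>a. g (path_elem (ar a))) v es"
  using assms(2)
proof (induction es arbitrary: v)
  case (Cons a es)
  then have "(head Q a, es) \<in> B" "a \<in> arcs Q" "v = tail Q a" using B_Cons by auto
  then show ?case
    using Cons g by (simp add: path_elem_Cons vend_def)
qed (use g in \<open>auto simp: vend_def\<close>)

lemma vend_zero: "vend g \<Longrightarrow> g 0 = 0"
  unfolding vend_def by (metis M_closed(2) scale_0)

lemma vend_sum:
  "vend g \<Longrightarrow> (\<And>i. i \<in> J \<Longrightarrow> f i \<in> M) \<Longrightarrow> g (\<Sum>i\<in>J. f i) = (\<Sum>i\<in>J. g (f i))"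
proof (induction J rule: infinite_finite_induct)
  case (insert x F)
  then show ?case
    by (simp add: vend_def M_sum)
qed (simp_all add: vend_zero)

lemma keys_M: "x \<in> M \<Longrightarrow> p \<in> Poly_Mapping.keys x \<Longrightarrow> p \<in> B"
  by (auto simp: M_def)

lemma vend_expand:
  fixes x :: "('v, 'a) qpath \<Rightarrow>\<^sub>0 'k::field"
  assumes g: "vend g" and x: "x \<in> M"
  shows "g x = (\<Sum>p\<in>Poly_Mapping.keys x. scale (coef x p) (g (path_elem p)))"
proof -
  have "g x = g (\<Sum>p\<in>Poly_Mapping.keys x. scale (coef x p) (path_elem p))"
    by (simp flip: expand_paths)
  also have "\<dots> = (\<Sum>p\<in>Poly_Mapping.keys x. g (scale (coef x p) (path_elem p)))"
    using keys_M[OF x] by (intro vend_sum[OF g] M_closed(6) M_closed(7)) auto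
  also have "\<dots> = (\<Sum>p\<in>Poly_Mapping.keys x. scale (coef x p) (g (path_elem p)))"
  proof (intro sum.cong refl)
    fix p assume "p \<in> Poly_Mapping.keys x"
    then have "(path_elem p :: _ \<Rightarrow>\<^sub>0 'k) \<in> M" using keys_M[OF x] by simp
    then show "g (scale (coef x p) (path_elem p)) = scale (coef x p) (g (path_elem p))"
      using g by (simp add: vend_def)
  qed
  finally show ?thesis .
qed

lemma vend_eq_ext:
  assumes g: "vend g" and x: "x \<in> M"
  shows "g x = ext (\<lambda>a. g (path_elem (ar a))) x"
  unfolding ext_def vend_expand[OF assms]
  by (intro sum.cong refl) (metis keys_M prod.collapse vend_path_elem[OF g] x)

lemma path_image_cong:
  "(\<And>a. a \<in> set es \<Longrightarrow> f a = g a) \<Longrightarrow> path_image f v es = path_image g v es"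
  by (induction es arbitrary: v) auto

lemma ext_cong:
  assumes "\<And>a. a \<in> arcs Q \<Longrightarrow> f a = g a" "x \<in> M"
  shows "ext f x = ext g x"
proof -
  have "set (snd p) \<subseteq> arcs Q" if "p \<in> Poly_Mapping.keys x" for p
    using keys_M[OF assms(2) that] by (simp add: B_def)
  then show ?thesis
    unfolding ext_def using assms(1) by (intro sum.cong refl arg_cong2[where f = scale] path_image_cong) auto
qed

lemma vend_eqI:
  assumes "vend g" "vend h" "\<And>a. a \<in> arcs Q \<Longrightarrow> g (path_elem (ar a)) = h (path_elem (ar a))" "x \<in> M"
  shows "g x = h x"
  unfolding vend_eq_ext[OF assms(1,4)] vend_eq_ext[OF assms(2,4)]
  by (rule ext_cong) (use assms in auto)

lemma vend_par: "vend g \<Longrightarrow> a \<in> arcs Q \<Longrightarrow> g (path_elem (ar a)) \<in> par a"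
proof (rule parI)
  assume g: "vend g" and a: "a \<in> arcs Q"
  have "path_elem (tail Q a, []) \<star> path_elem (ar a) = path_elem (ar a)"
    "path_elem (ar a) \<star> path_elem (head Q a, []) = path_elem (ar a)"
    using a by (simp_all add: mul_path_elem arrow_path_def path_tgt_eq)
  then show "path_elem (tail Q a, []) \<star> g (path_elem (ar a)) = g (path_elem (ar a))"
    "g (path_elem (ar a)) \<star> path_elem (head Q a, []) = g (path_elem (ar a))"
    using g a unfolding vend_def by (metis M_closed(7) B_Nil ar_B tail_in_verts head_in_verts)+
qed (auto simp: vend_def)

lemma vend_comp: "vend g \<Longrightarrow> vend h \<Longrightarrow> vend (g \<circ> h)"
  by (simp add: vend_def)

text \<open>
  The path algebra is free on the arrows, so an endomorphism of the quotient fixing the vertices is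
  a choice of images in the right corners that kills the monomial relations.
\<close>

lemma path_image_mul:
  assumes img: "\<And>a. a \<in> arcs Q \<Longrightarrow> img a \<in> par a"
    and p: "(v, es) \<in> B"
  shows "path_image img v es \<in> M" "path_elem (v, []) \<star> path_image img v es = path_image img v es"
    "path_image img v es \<star> path_elem (tgt (v, es), []) = path_image img v es"
  using p
proof (induction es arbitrary: v)
  case Nil
  { case 1 then show ?case by simp
  next case 2 then show ?case by (simp add: mul_path_elem path_tgt_eq)
  next case 3 then show ?case by (simp add: mul_path_elem path_tgt_eq) }
next
  case (Cons a es)
  { case 1 then show ?case by simp
  next case 2
    then have "v = tail Q a" "a \<in> arcs Q" using B_Cons by auto
    then show ?case by (simp flip: mul_assoc add: par_tail[OF img])
  next case 3
    then have "path_image img (head Q a) es \<star> path_elem (tgt (head Q a, es), []) = path_image img (head Q a) es"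
      using Cons B_Cons by blast
    moreover have "tgt (v, a # es) = tgt (head Q a, es)"
      by (simp add: path_tgt_eq)
    ultimately show ?case by (simp add: mul_assoc) }
qed

lemma path_image_append:
  assumes img: "\<And>a. a \<in> arcs Q \<Longrightarrow> img a \<in> par a"
    and p: "(v, es @ fs) \<in> B"
  shows "path_image img v (es @ fs) = path_image img v es \<star> path_image img (tgt (v, es)) fs"
  using p
proof (induction es arbitrary: v)
  case Nil
  then show ?case using path_image_mul(2)[OF img] by (simp add: path_tgt_eq)
next
  case (Cons a es)
  then show ?case using B_Cons[of v a "es @ fs"] by (simp add: mul_assoc path_tgt_eq)
qed

lemma vend_ext:
  fixes img :: "'a \<Rightarrow> (('v, 'a) qpath \<Rightarrow>\<^sub>0 'k::field)"
  assumes img: "\<And>a. a \<in> arcs Q \<Longrightarrow> img a \<in> par a"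
    and rel: "\<And>a b. a \<in> arcs Q \<Longrightarrow> b \<in> arcs Q \<Longrightarrow> head Q a = tail Q b \<Longrightarrow> \<not> nz a b \<Longrightarrow> img a \<star> img b = 0"
  shows "vend (ext img)" "a \<in> arcs Q \<Longrightarrow> ext img (path_elem (ar a)) = img a"
proof -
  have im: "path_image img (fst p) (snd p) \<in> M" if "p \<in> B" for p
    using path_image_mul(1)[OF img, of "fst p" "snd p"] that by simp
  have ext_M: "ext img x \<in> M" if "x \<in> M" for x
    unfolding ext_def using keys_M[OF that] im by auto
  have basis: "ext img (path_elem p \<star> path_elem q) = ext img (path_elem p) \<star> ext img (path_elem q)"
    if p: "p \<in> B" and q: "q \<in> B" for p q
  proof -
    obtain v es w fs where pq: "p = (v, es)" "q = (w, fs)" by fastforce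
    let ?E = "path_image img v es" and ?F = "path_image img w fs"
    note E = path_image_mul[OF img p[unfolded pq]] and F = path_image_mul[OF img q[unfolded pq]]
    consider "tgt p \<noteq> w" | "tgt p = w" "(v, es @ fs) \<in> B" | "tgt p = w" "(v, es @ fs) \<notin> B" by blast
    then show ?thesis
    proof cases
      case 1
      have "?E \<star> ?F = ?E \<star> (path_elem (tgt p, []) \<star> path_elem (w, [])) \<star> ?F"
        using E(3) F(2) pq by (metis mul_assoc)
      also have "\<dots> = 0"
        using 1 by (simp add: mul_path_elem path_tgt_eq)
      finally show ?thesis
        using 1 pq by (simp add: ext_path_elem mul_path_elem)
    next
      case 2
      then show ?thesis
        using path_image_append[OF img 2(2)] pq by (simp add: ext_path_elem mul_path_elem)
    next
      case 3
      have ne: "es \<noteq> []" "fs \<noteq> []" "\<not> nz (last es) (hd fs)"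
        using 3 p q pq B_append[of v es fs] by (auto simp: path_tgt_eq)
      obtain es' a where es: "es = es' @ [a]" using ne(1) by (metis rev_exhaust)
      obtain b fs' where fs: "fs = b # fs'" using ne(2) by (cases fs) auto
      have ab: "a \<in> arcs Q" "b \<in> arcs Q" "head Q a = tail Q b" "w = tail Q b"
        using p q pq es fs 3 by (auto simp: B_iff path_tgt_eq)
      have "?E = path_image img v es' \<star> path_image img (tgt (v, es')) [a]"
        unfolding es by (rule path_image_append[OF img]) (use p pq es in auto)
      also have "\<dots> = path_image img v es' \<star> img a"
        using par_head[OF img[OF ab(1)]] by simp
      finally have "?E \<star> ?F = path_image img v es' \<star> (img a \<star> img b) \<star> path_image img (head Q b) fs'"
        by (simp add: fs mul_assoc)
      also have "\<dots> = 0"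
        using rel[OF ab(1-3)] ne es fs by simp
      finally show ?thesis
        using 3 pq by (simp add: ext_path_elem mul_path_elem)
    qed
  qed
  have mult: "ext img (x \<star> y) = ext img x \<star> ext img y" if x: "x \<in> M" and y: "y \<in> M" for x y
  proof -
    have xy: "x \<star> y = (\<Sum>p\<in>Poly_Mapping.keys x. \<Sum>q\<in>Poly_Mapping.keys y. scale (coef x p * coef y q) (path_elem p \<star> path_elem q))"
      by (subst expand_paths[of x], subst expand_paths[of y])
        (simp add: mul_sum_left mul_sum_right mul_scale_left mul_scale_right scale_scale scale_sum,
          subst sum.swap, simp add: mult.commute)
    show ?thesis
      unfolding xy ext_sum ext_scale
      by (simp add: ext_def[of img x] ext_def[of img y] mul_sum_left mul_sum_right mul_scale_left mul_scale_right
          scale_scale scale_sum basis keys_M[OF x] keys_M[OF y] flip: ext_path_elem,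
          subst sum.swap, simp add: mult.commute)
  qed
  show "vend (ext img)"
    unfolding vend_def by (auto simp: ext_add ext_scale mult ext_M ext_path_elem)
  show "a \<in> arcs Q \<Longrightarrow> ext img (path_elem (ar a)) = img a"
    by (simp add: ext_path_elem arrow_path_def par_head[OF img])
qed

end

section \<open>Gentle quivers\<close>

locale gentle_quiver = bound_quiver Q S
  for Q :: "('v, 'a) pre_digraph" and S +
  assumes conn: "connected Q"
    and arcs_ne: "arcs Q \<noteq> {}"
    and in_deg: "v \<in> verts Q \<Longrightarrow> in_degree Q v \<le> 2"
    and out_deg: "v \<in> verts Q \<Longrightarrow> out_degree Q v \<le> 2"
    and two_in: "\<lbrakk>a \<in> arcs Q; b \<in> arcs Q; b' \<in> arcs Q; b \<noteq> b'; head Q b = tail Q a; head Q b' = tail Q a\<rbrakk>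
      \<Longrightarrow> nz b a \<longleftrightarrow> \<not> nz b' a"
    and two_out: "\<lbrakk>a \<in> arcs Q; b \<in> arcs Q; b' \<in> arcs Q; b \<noteq> b'; head Q a = tail Q b; head Q a = tail Q b'\<rbrakk>
      \<Longrightarrow> nz a b \<longleftrightarrow> \<not> nz a b'"
    and not_loop: "verts Q = {v} \<Longrightarrow> arcs Q = {a} \<Longrightarrow> \<not> nz a a"
begin

lemma succ_unique: "nz a b \<Longrightarrow> nz a b' \<Longrightarrow> b = b'"
  using two_out[of a b b'] nz_arcs[of a b] nz_arcs[of a b'] by blast

lemma pred_unique: "nz b a \<Longrightarrow> nz b' a \<Longrightarrow> b = b'"
  using two_in[of a b b'] nz_arcs[of b a] nz_arcs[of b' a] by blast

lemma card3: "card U \<le> 2 \<Longrightarrow> finite U \<Longrightarrow> a \<in> U \<Longrightarrow> b \<in> U \<Longrightarrow> c \<in> U \<Longrightarrow> a = b \<or> a = c \<or> b = c"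
proof (rule ccontr)
  assume "card U \<le> 2" "finite U" "a \<in> U" "b \<in> U" "c \<in> U" and ne: "\<not> (a = b \<or> a = c \<or> b = c)"
  then have "card {a, b, c} \<le> 2" using card_mono[of U "{a, b, c}"] by auto
  then show False using ne by auto
qed

lemma out3:
  assumes "a \<in> arcs Q" "b \<in> arcs Q" "c \<in> arcs Q" "tail Q a = tail Q b" "tail Q a = tail Q c"
  shows "a = b \<or> a = c \<or> b = c"
  using card3[of "out_arcs Q (tail Q a)" a b c] out_deg[of "tail Q a"] assms by (auto simp: out_degree_def)

lemma in3:
  assumes "a \<in> arcs Q" "b \<in> arcs Q" "c \<in> arcs Q" "head Q a = head Q b" "head Q a = head Q c"
  shows "a = b \<or> a = c \<or> b = c"
  using card3[of "in_arcs Q (head Q a)" a b c] in_deg[of "head Q a"] assms by (auto simp: in_degree_def)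

lemma verts_connected:
  assumes U: "u \<in> U" "u \<in> verts Q"
    and step: "\<And>a. a \<in> arcs Q \<Longrightarrow> tail Q a \<in> U \<longleftrightarrow> head Q a \<in> U"
    and v: "v \<in> verts Q"
  shows "v \<in> U"
proof -
  let ?G = "with_proj (mk_symmetric Q)"
  have "reachable ?G u v"
    using conn U(2) v by (auto simp: connected_def strongly_connected_def mk_symmetric_def)
  then have "(u, v) \<in> (arcs_ends ?G)\<^sup>*" by (rule reachable_rtranclI)
  then show ?thesis
  proof (induction rule: rtrancl_induct)
    case (step y z)
    then have "\<exists>a\<in>arcs Q. (y, z) = (tail Q a, head Q a) \<or> (y, z) = (head Q a, tail Q a)"
      by (auto simp: arcs_ends_conv mk_symmetric_def)
    then show ?case
      using step(3) assms(3) by auto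
  qed (rule U(1))
qed

lemma arcs_connected:
  assumes P: "P a\<^sub>0" "a\<^sub>0 \<in> arcs Q"
    and step: "\<And>a b. \<lbrakk>a \<in> arcs Q; b \<in> arcs Q; P a;
      tail Q a = tail Q b \<or> tail Q a = head Q b \<or> head Q a = tail Q b \<or> head Q a = head Q b\<rbrakk> \<Longrightarrow> P b"
    and b: "b \<in> arcs Q"
  shows "P b"
proof -
  let ?U = "{v. \<exists>a\<in>arcs Q. P a \<and> (tail Q a = v \<or> head Q a = v)}"
  have "tail Q b \<in> ?U"
  proof (rule verts_connected[of "tail Q a\<^sub>0"])
    fix a assume "a \<in> arcs Q"
    then show "tail Q a \<in> ?U \<longleftrightarrow> head Q a \<in> ?U"
      using step[of _ a] by fastforce
  qed (use P b in auto)
  then show ?thesis using step[of _ b] b by auto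
qed

lemma parD: "x \<in> par a \<Longrightarrow> coef x (v, es) \<noteq> 0 \<Longrightarrow> (v, es) \<in> B \<and> v = tail Q a \<and> tgt (v, es) = head Q a"
  using MD[of x "(v, es)"] by (auto simp: par_def)

section \<open>Coefficients of products\<close>

definition Mge :: "nat \<Rightarrow> (('v, 'a) qpath \<Rightarrow>\<^sub>0 'k::field) set" where
  "Mge n = {x \<in> M. \<forall>p. coef x p \<noteq> 0 \<longrightarrow> n \<le> length (snd p)}"

lemma Mge_0: "x \<in> M \<Longrightarrow> x \<in> Mge 0" by (simp add: Mge_def)

lemma Mge_1: "x \<in> Mge (Suc 0) \<longleftrightarrow> x \<in> Mp"
  by (force simp: Mge_def Mp_def Suc_le_eq)

lemma MgeD: "x \<in> Mge n \<Longrightarrow> length (snd p) < n \<Longrightarrow> coef x p = 0"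
  by (metis (mono_tags, lifting) Mge_def leD mem_Collect_eq)

lemma Mge_M: "x \<in> Mge n \<Longrightarrow> x \<in> M" by (simp add: Mge_def)

lemma Mge_mono: "x \<in> Mge n \<Longrightarrow> m \<le> n \<Longrightarrow> x \<in> Mge m" by (force simp: Mge_def)

lemma Mge_mul: assumes "x \<in> Mge n" "y \<in> Mge m" shows "x \<star> y \<in> Mge (n + m)"
proof -
  have "n + m \<le> length es" if "coef (x \<star> y) (v, es) \<noteq> 0" for v es
  proof -
    from that obtain i where i: "i \<le> length es" "coef x (v, take i es) \<noteq> 0" "coef y (tgt (v, take i es), drop i es) \<noteq> 0"
      unfolding coef_mul by (auto split: if_splits elim!: sum.not_neutral_contains_not_neutral)
    have "n \<le> i" "m \<le> length es - i"
      using MgeD[OF assms(1), of "(v, take i es)"] MgeD[OF assms(2), of "(tgt (v, take i es), drop i es)"] i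
      by (auto simp: not_less[symmetric])
    then show ?thesis using i by simp
  qed
  then show ?thesis by (auto simp: Mge_def)
qed

text \<open>For factors without constant terms only proper cuts of a path contribute.\<close>

lemma coef_mul_Mp:
  assumes "x \<in> Mp" "y \<in> Mp" "(v, es) \<in> B"
  shows "coef (x \<star> y) (v, es) =
    (\<Sum>i\<in>{0<..<length es}. coef x (v, take i es) * coef y (tgt (v, take i es), drop i es))"
proof -
  have "coef x (v, take i es) * coef y (tgt (v, take i es), drop i es) = 0" if "i \<in> {..length es} - {0<..<length es}" for i
  proof -
    have "i = 0 \<or> i = length es" using that by auto
    then show ?thesis using assms(1,2) by (auto simp: Mp_def)
  qed
  then show ?thesis
    using assms(3) unfolding coef_mul by (auto intro!: sum.mono_neutral_right)
qed

lemma coef_mul_lead: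
  assumes "x \<in> Mge n" "y \<in> Mge m" "(v, es) \<in> B" "length es = n + m"
  shows "coef (x \<star> y) (v, es) = coef x (v, take n es) * coef y (tgt (v, take n es), drop n es)"
proof -
  have "coef x (v, take i es) * coef y (tgt (v, take i es), drop i es) = 0" if "i \<in> {..length es} - {n}" for i
  proof (cases "i < n")
    case True
    then have "coef x (v, take i es) = 0" by (intro MgeD[OF assms(1)]) auto
    then show ?thesis by simp
  next
    case False
    then have "length (drop i es) < m" using that assms(4) by auto
    then have "coef y (tgt (v, take i es), drop i es) = 0" by (intro MgeD[OF assms(2)]) auto
    then show ?thesis by simp
  qed
  then have "(\<Sum>i\<le>length es. coef x (v, take i es) * coef y (tgt (v, take i es), drop i es)) =
      (\<Sum>i\<in>{n}. coef x (v, take i es) * coef y (tgt (v, take i es), drop i es))"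
    using assms(4) by (intro sum.mono_neutral_right) (simp, simp, blast)
  then show ?thesis using assms(3) by (simp add: coef_mul)
qed

section \<open>Automorphisms preserve the arrow ideal\<close>

abbreviation im :: "((('v, 'a) qpath \<Rightarrow>\<^sub>0 'k::field) \<Rightarrow> (('v, 'a) qpath \<Rightarrow>\<^sub>0 'k)) \<Rightarrow> 'a \<Rightarrow> (('v, 'a) qpath \<Rightarrow>\<^sub>0 'k)" where
  "im g a \<equiv> g (path_elem (ar a))"

lemma im_rel: "vend g \<Longrightarrow> a \<in> arcs Q \<Longrightarrow> b \<in> arcs Q \<Longrightarrow> \<not> nz a b \<Longrightarrow> im g a \<star> im g b = 0"
proof -
  assume g: "vend g" and ab: "a \<in> arcs Q" "b \<in> arcs Q" "\<not> nz a b"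
  have "im g a \<star> im g b = g (path_elem (ar a) \<star> path_elem (ar b))"
    using g ab by (simp add: vend_def)
  also have "path_elem (ar a) \<star> path_elem (ar b) = (0 :: _ \<Rightarrow>\<^sub>0 'b)"
    using ab by (auto simp: mul_path_elem arrow_path_def path_tgt_eq B_iff)
  finally show ?thesis by (simp add: vend_zero[OF g])
qed

lemma im_nz: assumes g: "vaut g" and a: "a \<in> arcs Q" shows "im g a \<noteq> 0"
proof
  assume "im g a = 0"
  then have "im g a = g 0" using g by (simp add: vaut_zero)
  then have "path_elem (ar a) = (0 :: _ \<Rightarrow>\<^sub>0 'b)"
    using vaut_bij[OF g] a by (auto simp: bij_betw_def dest!: inj_onD)
  then have "coef (path_elem (ar a) :: _ \<Rightarrow>\<^sub>0 'b) (ar a) = 0" by simp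
  then show False by (simp add: coef_path_elem)
qed

lemma lead_left:
  assumes "x \<in> M" "coef x (v, []) \<noteq> 0" "y \<in> M" "path_elem (v, []) \<star> y = y" "x \<star> y = 0"
  shows "y = 0"
proof (rule ccontr)
  assume "y \<noteq> 0"
  then obtain p0 where "coef y p0 \<noteq> 0" by (metis lookup_zero poly_mapping_eqI)
  define p where "p = arg_min (\<lambda>p. length (snd p)) (\<lambda>p. coef y p \<noteq> 0)"
  have p: "coef y p \<noteq> 0" "\<And>q. coef y q \<noteq> 0 \<Longrightarrow> length (snd p) \<le> length (snd q)"
    unfolding p_def using arg_min_nat_lemma[of "\<lambda>p. coef y p \<noteq> 0" p0 "\<lambda>p. length (snd p)"] \<open>coef y p0 \<noteq> 0\<close> by auto
  obtain w es where wes: "p = (w, es)" by fastforce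
  have "coef (path_elem (v, []) \<star> y) (w, es) \<noteq> 0" using p(1) wes assms by simp
  then have "w = v" using assms(3) by (simp add: coef_vertex_mul split: if_splits)
  have "y \<in> Mge (length es)" using assms(3) p(2) wes by (auto simp: Mge_def)
  then have "coef (x \<star> y) (v, es) = coef x (v, []) * coef y (v, es)"
    using coef_mul_lead[OF Mge_0[OF assms(1)], of y "length es" v es] MD[OF assms(3)] p(1) wes \<open>w = v\<close>
    by (auto simp: path_tgt_eq)
  then show False using assms(2,5) p(1) wes \<open>w = v\<close> by simp
qed

lemma lead_right:
  assumes "x \<in> M" "coef x (v, []) \<noteq> 0" "y \<in> M" "y \<star> path_elem (v, []) = y" "y \<star> x = 0"
  shows "y = 0"
proof (rule ccontr)
  assume "y \<noteq> 0"
  then obtain p0 where "coef y p0 \<noteq> 0" by (metis lookup_zero poly_mapping_eqI)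
  define p where "p = arg_min (\<lambda>p. length (snd p)) (\<lambda>p. coef y p \<noteq> 0)"
  have p: "coef y p \<noteq> 0" "\<And>q. coef y q \<noteq> 0 \<Longrightarrow> length (snd p) \<le> length (snd q)"
    unfolding p_def using arg_min_nat_lemma[of "\<lambda>p. coef y p \<noteq> 0" p0 "\<lambda>p. length (snd p)"] \<open>coef y p0 \<noteq> 0\<close> by auto
  obtain w es where wes: "p = (w, es)" by fastforce
  have "coef (y \<star> path_elem (v, [])) (w, es) \<noteq> 0" using p(1) wes assms by simp
  then have t: "tgt (w, es) = v" using assms(3) by (simp add: coef_mul_vertex split: if_splits)
  have "y \<in> Mge (length es)" using assms(3) p(2) wes by (auto simp: Mge_def)
  then have "coef (y \<star> x) (w, es) = coef y (w, es) * coef x (v, [])"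
    using coef_mul_lead[OF _ Mge_0[OF assms(1)], of y "length es" w es] MD[OF assms(3)] p(1) wes t
    by auto
  then show False using assms(2,5) p(1) wes by simp
qed

text \<open>
  A stationary term can only occur for a loop \<open>a\<close> whose square is not a relation. As \<open>a\<close> is not the whole
  quiver, another arrow \<open>b\<close> at its vertex forms a relation with \<open>a\<close>; the stationary term can be cancelled in
  the image of this relation, so \<open>b\<close> would be sent to zero.
\<close>

lemma im_Mp:
  assumes g: "vaut g" and a: "a \<in> arcs Q" shows "im g a \<in> Mp"
proof -
  have par: "im g b \<in> par b" if "b \<in> arcs Q" for b
    using vend_par[OF vaut_vend[OF g] that] .
  have "coef (im g a) (v, []) = 0" for v
  proof (rule ccontr)
    assume c: "coef (im g a) (v, []) \<noteq> 0"
    then have v: "tail Q a = v" "head Q a = v"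
      using parD[OF par[OF a] c] by (auto simp: path_tgt_eq)
    have vv: "v \<in> verts Q" using a v by auto
    have nz: "nz a a"
    proof (rule ccontr)
      assume "\<not> nz a a"
      then have "im g a \<star> im g a = 0" using im_rel[OF vaut_vend[OF g] a a] by simp
      then have "coef (im g a) (v, []) * coef (im g a) (v, []) = 0"
        using coef_mul_Nil[OF vv, of "im g a" "im g a"] by simp
      then show False using c by simp
    qed
    have "\<exists>b\<in>arcs Q. b \<noteq> a \<and> (tail Q b = v \<or> head Q b = v)"
    proof (rule ccontr)
      assume no: "\<not> ?thesis"
      have "b = a" if "b \<in> arcs Q" for b
      proof (rule arcs_connected[of "\<lambda>b. b = a", OF refl a _ that])
        fix b c assume "c \<in> arcs Q" "b = a"
          "tail Q b = tail Q c \<or> tail Q b = head Q c \<or> head Q b = tail Q c \<or> head Q b = head Q c"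
        then have "tail Q c = v \<or> head Q c = v" using v by metis
        then show "c = a" using no \<open>c \<in> arcs Q\<close> by blast
      qed
      then have "arcs Q = {a}" using a by blast
      moreover have "w \<in> {v}" if w: "w \<in> verts Q" for w
      proof (rule verts_connected[OF _ vv _ w])
        fix b assume "b \<in> arcs Q"
        then have "b = a" using \<open>arcs Q = {a}\<close> by simp
        then show "tail Q b \<in> {v} \<longleftrightarrow> head Q b \<in> {v}" using v by simp
      qed simp
      then have "verts Q = {v}" using vv by blast
      ultimately show False using not_loop nz by blast
    qed
    then obtain b where b: "b \<in> arcs Q" "b \<noteq> a" "tail Q b = v \<or> head Q b = v" by auto
    from b(3) have "im g b = 0"
    proof
      assume t: "tail Q b = v"
      then have "\<not> nz a b" using two_out[of a b a] a b v nz by auto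
      then have "im g a \<star> im g b = 0" using im_rel[OF vaut_vend[OF g] a b(1)] by simp
      then show ?thesis
        using lead_left[OF par_M[OF par[OF a]] c par_M[OF par[OF b(1)]]] par_tail[OF par[OF b(1)]] t by simp
    next
      assume t: "head Q b = v"
      then have "\<not> nz b a" using two_in[of a b a] a b v nz by auto
      then have "im g b \<star> im g a = 0" using im_rel[OF vaut_vend[OF g] b(1) a] by simp
      then show ?thesis
        using lead_right[OF par_M[OF par[OF a]] c par_M[OF par[OF b(1)]]] par_head[OF par[OF b(1)]] t by simp
    qed
    then show False using im_nz[OF g b(1)] by simp
  qed
  then show ?thesis using par_M[OF par[OF a]] by (simp add: Mp_def)
qed

lemma vaut_path_Mge:
  assumes g: "vaut g" and p: "(v, es) \<in> B"
  shows "g (path_elem (v, es)) \<in> Mge (length es)"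
  using p
proof (induction es arbitrary: v)
  case (Cons a es)
  then have "(head Q a, es) \<in> B" "a \<in> arcs Q" using B_Cons by auto
  then have "im g a \<star> g (path_elem (head Q a, es)) \<in> Mge (1 + length es)"
    using Cons im_Mp[OF g] by (intro Mge_mul) (auto simp: Mge_1)
  then show ?case
    using Cons B_Cons[of v a es] by (simp add: path_elem_Cons vaut_mul[OF g])
qed (auto simp: vaut_vertex[OF g] intro: Mge_0)

lemma vaut_expand: "vaut g \<Longrightarrow> x \<in> M \<Longrightarrow> g x = (\<Sum>p\<in>Poly_Mapping.keys x. scale (coef x p) (g (path_elem p)))"
  using vend_expand[OF vaut_vend] .

lemma coef_vaut: "vaut g \<Longrightarrow> x \<in> M \<Longrightarrow> coef (g x) q = (\<Sum>p\<in>Poly_Mapping.keys x. coef x p * coef (g (path_elem p)) q)"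
  by (subst vaut_expand) (simp_all add: lookup_sum)

lemma vaut_Mge:
  assumes g: "vaut g" and x: "x \<in> Mge n" shows "g x \<in> Mge n"
proof -
  have "coef (g x) q = 0" if "length (snd q) < n" for q
  proof -
    have "coef x p * coef (g (path_elem p)) q = 0" if "p \<in> Poly_Mapping.keys x" for p
      using MgeD[OF x, of p] MgeD[OF vaut_path_Mge[OF g, of "fst p" "snd p"], of q] \<open>length (snd q) < n\<close>
        keys_M[OF Mge_M[OF x] that] by (cases "length (snd p) < n") auto
    then show ?thesis unfolding coef_vaut[OF g Mge_M[OF x]] by (rule sum.neutral[OF ballI])
  qed
  then show ?thesis
    using vaut_M[OF g Mge_M[OF x]] by (auto simp: Mge_def not_less[symmetric])
qed

lemma vaut_Mp: "vaut g \<Longrightarrow> x \<in> Mp \<Longrightarrow> g x \<in> Mp"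
  using vaut_Mge[of g x 1] by (simp add: Mge_1)

section \<open>The linear part\<close>

text \<open>The entry at \<open>b\<close> of the linear part: the coefficient of the arrow \<open>b\<close> in the image of \<open>a\<close>.\<close>

definition lin :: "((('v, 'a) qpath \<Rightarrow>\<^sub>0 'k::field) \<Rightarrow> (('v, 'a) qpath \<Rightarrow>\<^sub>0 'k)) \<Rightarrow> 'a \<Rightarrow> 'a \<Rightarrow> 'k" where
  "lin g a b = coef (im g a) (ar b)"

text \<open>The arrow ideal is preserved, so the terms of lowest length are governed by the linear part alone.\<close>

lemma coef_vaut_lead:
  assumes g: "vaut g" and "(v, es) \<in> B" "(w, fs) \<in> B" "length fs = length es" "v = w"
  shows "coef (g (path_elem (v, es))) (w, fs) = (\<Prod>(a, b)\<leftarrow>zip es fs. lin g a b)"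
  using assms(2-)
proof (induction es arbitrary: v w fs)
  case Nil
  then show ?case by (simp add: vaut_vertex[OF g] coef_path_elem)
next
  case (Cons a es)
  then obtain b fs' where fs: "fs = b # fs'" by (cases fs) auto
  have a: "(head Q a, es) \<in> B" "a \<in> arcs Q" "v = tail Q a"
    and b: "(head Q b, fs') \<in> B" "b \<in> arcs Q" "w = tail Q b"
    using B_Cons Cons.prems fs by blast+
  have "coef (g (path_elem (v, a # es))) (w, fs) = coef (im g a \<star> g (path_elem (head Q a, es))) (w, fs)"
    using Cons.prems a by (simp add: path_elem_Cons vaut_mul[OF g])
  also have "\<dots> = lin g a b * coef (g (path_elem (head Q a, es))) (head Q b, fs')"
    using coef_mul_lead[OF im_Mp[OF g a(2), folded Mge_1] vaut_path_Mge[OF g a(1)], of w fs] Cons.prems fs b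
    by (simp add: lin_def arrow_path_def path_tgt_eq)
  also have "lin g a b * coef (g (path_elem (head Q a, es))) (head Q b, fs') = lin g a b * (\<Prod>(a, b)\<leftarrow>zip es fs'. lin g a b)"
  proof (cases "lin g a b = 0")
    case False
    then have "head Q a = head Q b"
      using parD[OF vend_par[OF vaut_vend[OF g] a(2)], of "tail Q b" "[b]"] by (auto simp: lin_def arrow_path_def path_tgt_eq)
    then show ?thesis using Cons.IH[OF a(1) b(1)] Cons.prems fs by simp
  qed simp
  finally show ?case by (simp add: fs)
qed

lemma lin_par: "vaut g \<Longrightarrow> a \<in> arcs Q \<Longrightarrow> lin g a b \<noteq> 0 \<Longrightarrow> b \<in> arcs Q \<and> tail Q b = tail Q a \<and> head Q b = head Q a"
  using parD[OF vend_par[OF vaut_vend], of g a "tail Q b" "[b]"]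
  by (auto simp: lin_def arrow_path_def path_tgt_eq)

lemma coef_vaut_arrow:
  assumes g: "vaut g" and x: "x \<in> Mp" and b: "b \<in> arcs Q"
  shows "coef (g x) (ar b) = (\<Sum>a\<in>arcs Q. coef x (ar a) * lin g a b)"
proof -
  have inj: "inj_on ar (arcs Q)" by (auto simp: inj_on_def arrow_path_def)
  have z: "coef x p * coef (g (path_elem p)) (ar b) = 0" if "p \<in> Poly_Mapping.keys x - ar ` arcs Q" for p
  proof -
    obtain v es where p: "p = (v, es)" by fastforce
    have pB: "(v, es) \<in> B" using that p keys_M[OF Mp_M[OF x]] by auto
    have "es \<noteq> []" using that x p by (auto simp: Mp_def in_keys_iff)
    moreover have "es \<noteq> [a]" for a using that p pB by (auto simp: arrow_path_def)
    ultimately have "1 < length es" by (cases es rule: remdups_adj.cases) auto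
    then show ?thesis
      using MgeD[OF vaut_path_Mge[OF g pB], of "ar b"] p by (simp add: arrow_path_def)
  qed
  have "coef (g x) (ar b) = (\<Sum>p\<in>Poly_Mapping.keys x. coef x p * coef (g (path_elem p)) (ar b))"
    by (rule coef_vaut[OF g Mp_M[OF x]])
  also have "\<dots> = (\<Sum>p\<in>Poly_Mapping.keys x \<union> ar ` arcs Q. coef x p * coef (g (path_elem p)) (ar b))"
    by (rule sum.mono_neutral_left) (auto simp: in_keys_iff)
  also have "\<dots> = (\<Sum>p\<in>ar ` arcs Q. coef x p * coef (g (path_elem p)) (ar b))"
    by (rule sum.mono_neutral_right) (use z in auto)
  also have "\<dots> = (\<Sum>a\<in>arcs Q. coef x (ar a) * lin g a b)"
    by (simp add: sum.reindex[OF inj] lin_def)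
  finally show ?thesis .
qed

lemma lin_comp:
  assumes "vaut g" "vaut h" "a \<in> arcs Q" "b \<in> arcs Q"
  shows "lin (g \<circ> h) a b = (\<Sum>c\<in>arcs Q. lin h a c * lin g c b)"
  using coef_vaut_arrow[OF assms(1) im_Mp[OF assms(2,3)] assms(4)] by (simp add: lin_def)

lemma lin_id: "lin id a b = (if a = b then 1 else 0)" "lin (\<lambda>x. x) a b = (if a = b then 1 else 0)"
  by (auto simp: lin_def coef_path_elem arrow_path_def)

lemma lin_cong: "(\<And>x. x \<in> M \<Longrightarrow> g x = h x) \<Longrightarrow> a \<in> arcs Q \<Longrightarrow> lin g a b = lin h a b"
  by (simp add: lin_def)

end

section \<open>Threads and maximal paths\<close>

context gentle_quiver
begin

lemma chain_nth: "successively nz es \<Longrightarrow> Suc i < length es \<Longrightarrow> nz (es ! i) (es ! Suc i)"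
  by (simp add: successively_conv_nth)

lemma B_chain: "(v, es) \<in> B \<Longrightarrow> successively nz es"
  by (simp add: B_iff)

lemma chain_from_first:
  assumes "successively nz es" "successively nz fs" "es \<noteq> []" "fs \<noteq> []" "hd es = hd fs"
  shows "i < length es \<Longrightarrow> i < length fs \<Longrightarrow> es ! i = fs ! i"
proof (induction i)
  case 0
  then show ?case using assms by (simp add: hd_conv_nth)
next
  case (Suc i)
  then show ?case
    using succ_unique[OF chain_nth[OF assms(1)] , of i "fs ! Suc i"] chain_nth[OF assms(2), of i] by simp
qed

definition maximal :: "('v, 'a) qpath \<Rightarrow> bool" where
  "maximal p \<longleftrightarrow> p \<in> B \<and> snd p \<noteq> [] \<and> (\<forall>c. \<not> nz (last (snd p)) c) \<and> (\<forall>c. \<not> nz c (hd (snd p)))"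

text \<open>The path usually written \<open>\<gamma>\<close> with a bar and index \<open>a\<close>.\<close>

definition gbar :: "'a \<Rightarrow> ('v, 'a) qpath \<Rightarrow> bool" where
  "gbar a p \<longleftrightarrow> maximal p \<and> fst p = tail Q a \<and> tgt p = head Q a \<and> hd (snd p) \<noteq> a \<and> last (snd p) \<noteq> a"

text \<open>Non-relations have unique continuations, so a maximal path is determined by its first arrow.\<close>

lemma maximal_eqI:
  assumes "maximal p" "maximal q" "hd (snd p) = hd (snd q)"
  shows "p = q"
proof -
  have *: "length (snd q) \<le> length (snd p)" if "maximal p" "maximal q" "hd (snd p) = hd (snd q)" for p q
  proof (rule ccontr)
    assume "\<not> ?thesis"
    then have l: "length (snd p) < length (snd q)" by simp
    let ?n = "length (snd p) - 1"
    have ne: "snd p \<noteq> []" "snd q \<noteq> []" and c: "successively nz (snd p)" "successively nz (snd q)"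
      using that by (auto simp: maximal_def B_def)
    have n: "?n < length (snd p)" "Suc ?n < length (snd q)" using ne l by (auto simp: Suc_le_eq)
    have "snd p ! ?n = snd q ! ?n"
      using chain_from_first[OF c ne that(3), of ?n] n by auto
    then have "nz (last (snd p)) (snd q ! Suc ?n)"
      using chain_nth[OF c(2) n(2)] ne by (simp add: last_conv_nth)
    then show False using that(1) by (simp add: maximal_def)
  qed
  have l: "length (snd p) = length (snd q)"
    using *[of p q] *[of q p] assms by simp
  have "snd p = snd q"
    using assms l by (intro nth_equalityI chain_from_first) (auto simp: maximal_def B_def)
  moreover have "fst p = fst q"
    using assms by (auto simp: maximal_def B_def)
  ultimately show ?thesis by (simp add: prod_eq_iff)
qed

lemma B_hd: "(v, es) \<in> B \<Longrightarrow> es \<noteq> [] \<Longrightarrow> hd es \<in> arcs Q \<and> last es \<in> arcs Q \<and> v = tail Q (hd es) \<and> tgt (v, es) = head Q (last es)"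
  by (auto simp: B_iff path_tgt_eq dest: hd_in_set last_in_set)

lemma B_hd': "p \<in> B \<Longrightarrow> snd p \<noteq> [] \<Longrightarrow> hd (snd p) \<in> arcs Q \<and> last (snd p) \<in> arcs Q \<and>
    fst p = tail Q (hd (snd p)) \<and> tgt p = head Q (last (snd p))"
  using B_hd[of "fst p" "snd p"] by simp

lemma gbar_unique:
  assumes "a \<in> arcs Q" "gbar a p" "gbar a q" shows "p = q"
proof -
  have "hd (snd p) = hd (snd q)"
    using out3[of a "hd (snd p)" "hd (snd q)"] assms B_hd'[of p] B_hd'[of q]
    unfolding gbar_def maximal_def by metis
  then show ?thesis using maximal_eqI assms by (auto simp: gbar_def)
qed

text \<open>Arrows on the same thread: connected through non-relations in either direction.\<close>

definition thr :: "'a \<Rightarrow> 'a \<Rightarrow> bool" where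
  "thr = (\<lambda>a b. nz a b \<or> nz b a)\<^sup>*\<^sup>*"

lemma thr_refl [simp]: "thr a a" by (simp add: thr_def)

lemma thr_trans: "thr a b \<Longrightarrow> thr b c \<Longrightarrow> thr a c" by (simp add: thr_def)

lemma thr_sym: "thr a b \<Longrightarrow> thr b a"
  unfolding thr_def by (rule sympD[OF symp_rtranclp]) (auto simp: symp_def)

lemma nz_thr: "nz a b \<Longrightarrow> thr a b" by (auto simp: thr_def)

lemma thr_isolated:
  assumes "\<And>c. \<not> nz b c" "\<And>c. \<not> nz c b" "thr a b" shows "a = b"
  using assms(3) unfolding thr_def by (cases rule: rtranclp.cases) (use assms(1,2) in auto)

lemma path_thr: "successively nz es \<Longrightarrow> x \<in> set es \<Longrightarrow> thr (hd es) x"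
proof (induction es)
  case (Cons a es)
  then show ?case
    by (cases es) (auto intro: thr_trans nz_thr)
qed simp

lemma path_thr2: "(v, es) \<in> B \<Longrightarrow> x \<in> set es \<Longrightarrow> y \<in> set es \<Longrightarrow> thr x y"
  using path_thr[of es x] path_thr[of es y] by (auto simp: B_iff intro: thr_trans thr_sym)

section \<open>Shape of the image of an arrow\<close>

definition nondeg :: "((('v, 'a) qpath \<Rightarrow>\<^sub>0 'k::field) \<Rightarrow> (('v, 'a) qpath \<Rightarrow>\<^sub>0 'k)) \<Rightarrow> bool" where
  "nondeg g \<longleftrightarrow> vaut g \<and> (\<forall>a\<in>arcs Q. lin g a a \<noteq> 0)"

text \<open>
  Only maximal paths on other threads are forbidden here: those on the thread of \<open>a\<close> can be produced
  by conjugation, so forbidding them would not be stable.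
\<close>

definition nrm :: "((('v, 'a) qpath \<Rightarrow>\<^sub>0 'k::field) \<Rightarrow> (('v, 'a) qpath \<Rightarrow>\<^sub>0 'k)) \<Rightarrow> bool" where
  "nrm g \<longleftrightarrow> vaut g \<and> (\<forall>a\<in>arcs Q. lin g a a = 1) \<and> 
     (\<forall>a\<in>arcs Q. \<forall>p. gbar a p \<longrightarrow> \<not> thr a (hd (snd p)) \<longrightarrow> coef (im g a) p = 0)"

lemma nrm_nondeg: "nrm g \<Longrightarrow> nondeg g" by (simp add: nrm_def nondeg_def)

lemma im_coefD:
  assumes "vaut g" "a \<in> arcs Q" "coef (im g a) (v, es) \<noteq> 0"
  shows "(v, es) \<in> B" "es \<noteq> []" "v = tail Q a" "tgt (v, es) = head Q a"
    "hd es \<in> arcs Q" "last es \<in> arcs Q" "tail Q (hd es) = tail Q a" "head Q (last es) = head Q a"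
proof -
  show 1: "(v, es) \<in> B" "v = tail Q a" "tgt (v, es) = head Q a"
    using parD[OF vend_par[OF vaut_vend[OF assms(1)] assms(2)] assms(3)] by auto
  show 2: "es \<noteq> []" using im_Mp[OF assms(1,2)] assms(3) by (auto simp: Mp_def)
  show "hd es \<in> arcs Q" "last es \<in> arcs Q" "tail Q (hd es) = tail Q a" "head Q (last es) = head Q a"
    using B_hd[OF 1(1) 2] 1 by auto
qed

lemma B_snoc: "(v, es) \<in> B \<Longrightarrow> es \<noteq> [] \<Longrightarrow> nz (last es) c \<Longrightarrow> (v, es @ [c]) \<in> B"
  using nz_arcs[of "last es" c] by (subst B_append) (auto simp: B_iff path_tgt_eq)

lemma B_cons: "(v, es) \<in> B \<Longrightarrow> es \<noteq> [] \<Longrightarrow> nz c (hd es) \<Longrightarrow> (tail Q c, c # es) \<in> B"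
  using nz_arcs[of c "hd es"] B_append[of "tail Q c" "[c]" es] B_hd[of v es] by (auto simp: path_tgt_eq)

text \<open>
  If a path in the image of \<open>a\<close> ends with another arrow than \<open>a\<close> and can be prolonged by \<open>c\<close>, then
  \<open>a c\<close> is a relation, so the prolonged path must cancel in the product of the images of \<open>a\<close> and \<open>c\<close>.
\<close>

lemma prolong_right:
  assumes g: "nondeg g" and a: "a \<in> arcs Q" and es: "coef (im g a) (v, es) \<noteq> 0" "last es \<noteq> a" "nz (last es) c"
  shows "\<exists>i. 0 < i \<and> i < length es \<and> coef (im g a) (v, take i es) \<noteq> 0 \<and>
    coef (im g c) (tgt (v, take i es), drop i es @ [c]) \<noteq> 0"
proof (rule ccontr)
  assume no: "\<not> ?thesis"
  have v: "vaut g" using g by (simp add: nondeg_def)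
  note e = im_coefD[OF v a es(1)]
  have c: "c \<in> arcs Q" "tail Q c = head Q a" using nz_arcs[OF es(3)] e by auto
  have "nz (last es) c \<longleftrightarrow> \<not> nz a c"
    by (rule two_in) (use es(2) e(6,8) c a in simp_all)
  then have "\<not> nz a c" using es(3) by simp
  then have "coef (im g a \<star> im g c) (v, es @ [c]) = 0"
    using im_rel[OF vaut_vend[OF v] a c(1)] by simp
  moreover have "coef (im g a \<star> im g c) (v, es @ [c]) =
      (\<Sum>i\<in>{length es}. coef (im g a) (v, take i (es @ [c])) * coef (im g c) (tgt (v, take i (es @ [c])), drop i (es @ [c])))"
    unfolding coef_mul_Mp[OF im_Mp[OF v a] im_Mp[OF v c(1)] B_snoc[OF e(1,2) es(3)]]
  proof (rule sum.mono_neutral_right)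
    show "\<forall>i\<in>{0<..<length (es @ [c])} - {length es}. coef (im g a) (v, take i (es @ [c])) *
        coef (im g c) (tgt (v, take i (es @ [c])), drop i (es @ [c])) = 0"
    proof
      fix i assume "i \<in> {0<..<length (es @ [c])} - {length es}"
      then have "0 < i" "i < length es" by auto
      then show "coef (im g a) (v, take i (es @ [c])) * coef (im g c) (tgt (v, take i (es @ [c])), drop i (es @ [c])) = 0"
        using no by auto
    qed
  qed (use e(2) in auto)
  moreover have "\<dots> = coef (im g a) (v, es) * lin g c c"
    using e c by (simp add: lin_def arrow_path_def)
  ultimately show False using es(1) g c(1) by (auto simp: nondeg_def)
qed

lemma prolong_left:
  assumes g: "nondeg g" and a: "a \<in> arcs Q" and es: "coef (im g a) (v, es) \<noteq> 0" "hd es \<noteq> a" "nz c (hd es)"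
  shows "\<exists>i. 0 < i \<and> i < length es \<and> coef (im g a) (tgt (v, take i es), drop i es) \<noteq> 0 \<and>
    coef (im g c) (tail Q c, c # take i es) \<noteq> 0"
proof (rule ccontr)
  assume no: "\<not> ?thesis"
  have v: "vaut g" using g by (simp add: nondeg_def)
  note e = im_coefD[OF v a es(1)]
  have c: "c \<in> arcs Q" "head Q c = tail Q a" using nz_arcs[OF es(3)] e by auto
  have "nz c (hd es) \<longleftrightarrow> \<not> nz c a"
    by (rule two_out) (use es(2) e(5,7) c a in simp_all)
  then have "\<not> nz c a" using es(3) by simp
  then have "coef (im g c \<star> im g a) (tail Q c, c # es) = 0"
    using im_rel[OF vaut_vend[OF v] c(1) a] by simp
  moreover have "coef (im g c \<star> im g a) (tail Q c, c # es) =
      (\<Sum>i\<in>{1}. coef (im g c) (tail Q c, take i (c # es)) * coef (im g a) (tgt (tail Q c, take i (c # es)), drop i (c # es)))"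
    unfolding coef_mul_Mp[OF im_Mp[OF v c(1)] im_Mp[OF v a] B_cons[OF e(1,2) es(3)]]
  proof (rule sum.mono_neutral_right)
    show "\<forall>i\<in>{0<..<length (c # es)} - {1}. coef (im g c) (tail Q c, take i (c # es)) *
        coef (im g a) (tgt (tail Q c, take i (c # es)), drop i (c # es)) = 0"
    proof
      fix i assume i: "i \<in> {0<..<length (c # es)} - {1}"
      then obtain j where j: "i = Suc j" "0 < j" "j < length es" by (cases i) auto
      have "tgt (tail Q c, take i (c # es)) = tgt (v, take j es)"
        using j e(2) by (simp add: path_tgt_eq)
      then show "coef (im g c) (tail Q c, take i (c # es)) *
        coef (im g a) (tgt (tail Q c, take i (c # es)), drop i (c # es)) = 0"
        using no j by auto
    qed
  qed (use e(2) in auto)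
  moreover have "\<dots> = lin g c c * coef (im g a) (v, es)"
    using e c by (simp add: lin_def arrow_path_def path_tgt_eq)
  ultimately show False using es(1) g c(1) by (auto simp: nondeg_def)
qed

text \<open>
  Follow a term on a foreign thread as far as possible to both sides. By \<open>prolong_right\<close> and \<open>prolong_left\<close>
  a prolongation is paid for by a shorter term of the same image, so a shortest bad term is maximal.
\<close>

lemma thread_preserved:
  assumes g: "nondeg g" and a: "a \<in> arcs Q" and no: "\<And>p. gbar a p \<Longrightarrow> \<not> thr a (hd (snd p)) \<Longrightarrow> coef (im g a) p = 0"
    and "coef (im g a) (v, es) \<noteq> 0"
  shows "thr a (hd es)"
  using assms(4)
proof (induction "length es" arbitrary: v es rule: less_induct)
  case less
  have v: "vaut g" using g by (simp add: nondeg_def)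
  note e = im_coefD[OF v a less.prems]
  show ?case
  proof (rule ccontr)
    assume nthr: "\<not> thr a (hd es)"
    have nset: "\<not> thr a x" if "x \<in> set es" for x
      using path_thr2[OF e(1) that, of "hd es"] e(2) nthr thr_trans by auto
    have "hd es \<noteq> a" "last es \<noteq> a" using nset[of "hd es"] nset[of "last es"] e(2) by auto
    moreover have "\<not> gbar a (v, es)" using no[of "(v, es)"] less.prems nthr by auto
    ultimately consider c where "nz (last es) c" | c where "nz c (hd es)"
      using e by (auto simp: gbar_def maximal_def)
    then show False
    proof cases
      case 1
      obtain i where i: "0 < i" "i < length es" "coef (im g a) (v, take i es) \<noteq> 0"
        using prolong_right[OF g a less.prems \<open>last es \<noteq> a\<close> 1] by auto
      have "thr a (hd (take i es))" using less.hyps[of "take i es"] i by auto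
      then show False using nthr i by simp
    next
      case 2
      obtain i where i: "0 < i" "i < length es" "coef (im g a) (tgt (v, take i es), drop i es) \<noteq> 0"
        using prolong_left[OF g a less.prems \<open>hd es \<noteq> a\<close> 2] by auto
      have "thr a (hd (drop i es))" using less.hyps[of "drop i es"] i by auto
      moreover have "hd (drop i es) \<in> set es" using i by (simp add: hd_drop_conv_nth)
      ultimately show False using nset by blast
    qed
  qed
qed

lemma lin_offdiag:
  assumes g: "nondeg g" and a: "a \<in> arcs Q" and "a \<noteq> b" "\<not> gbar a (ar b)"
  shows "lin g a b = 0"
proof (rule ccontr)
  assume l: "lin g a b \<noteq> 0"
  have v: "vaut g" using g by (simp add: nondeg_def)
  have c: "coef (im g a) (tail Q b, [b]) \<noteq> 0" using l by (simp add: lin_def arrow_path_def)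
  have "\<not> maximal (tail Q b, [b])" 
    using assms im_coefD[OF v a c] by (auto simp: gbar_def arrow_path_def)
  then obtain d where "nz b d \<or> nz d b"
    using im_coefD[OF v a c] by (auto simp: maximal_def)
  then show False
    using prolong_right[OF g a c] prolong_left[OF g a c] assms(3) by auto
qed

lemma nrm_lin:
  assumes g: "nrm g" and a: "a \<in> arcs Q"
  shows "lin g a b = (if a = b then 1 else 0)"
proof (cases "a = b")
  case False
  have "lin g a b = 0"
  proof (cases "gbar a (ar b)")
    case True
    then have "\<not> thr a b" using thr_isolated[of b a] \<open>a \<noteq> b\<close> by (auto simp: gbar_def maximal_def arrow_path_def)
    then show ?thesis using True g a by (auto simp: nrm_def lin_def arrow_path_def)
  next
    case False
    then show ?thesis using lin_offdiag[OF nrm_nondeg[OF g] a \<open>a \<noteq> b\<close>] by simp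
  qed
  then show ?thesis using False by simp
qed (use assms in \<open>auto simp: nrm_def\<close>)

section \<open>Degenerate linear parts\<close>

definition partner :: "'a \<Rightarrow> 'a \<Rightarrow> bool" where
  "partner a b \<longleftrightarrow> a \<in> arcs Q \<and> b \<in> arcs Q \<and> b \<noteq> a \<and> tail Q b = tail Q a \<and> head Q b = head Q a"

text \<open>The Kronecker quiver, read off from the arrows: connectedness leaves no room for further vertices.\<close>

definition kron :: bool where
  "kron \<longleftrightarrow> (\<exists>a b. arcs Q = {a, b} \<and> partner a b \<and> tail Q a \<noteq> head Q a)"

lemma partner_sym: "partner a b \<Longrightarrow> partner b a" by (auto simp: partner_def)

lemma partner_unique: "partner a b \<Longrightarrow> partner a c \<Longrightarrow> b = c"
  using out3[of a b c] unfolding partner_def by metis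

lemma coef_mul_arrows:
  assumes "vaut g" "a \<in> arcs Q" "c \<in> arcs Q" "nz b d"
  shows "coef (im g a \<star> im g c) (tail Q b, [b, d]) = lin g a b * lin g c d"
  using coef_mul_lead[of "im g a" 1 "im g c" 1 "tail Q b" "[b, d]"] assms im_Mp[OF assms(1)] nz_arcs[OF assms(4)]
  by (simp add: Mge_1 lin_def arrow_path_def path_tgt_eq B_iff)

text \<open>The linear part is invertible, so a vanishing diagonal entry is compensated by a parallel arrow.\<close>

lemma lin_degenerate:
  assumes g: "vaut g" and a: "a \<in> arcs Q" "lin g a a = 0"
  obtains b where "partner a b" "lin g a b \<noteq> 0" "lin g b a \<noteq> 0"
proof -
  let ?h = "inv_into M g"
  have h: "vaut ?h" by (rule vaut_inv[OF g])
  have "lin (g \<circ> ?h) a a = lin id a a" "lin (?h \<circ> g) a a = lin id a a"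
    using vaut_inv_left[OF g] vaut_inv_right[OF g] a(1) by (auto intro!: lin_cong)
  then have "(\<Sum>c\<in>arcs Q. lin ?h a c * lin g c a) \<noteq> 0" "(\<Sum>c\<in>arcs Q. lin g a c * lin ?h c a) \<noteq> 0"
    using lin_comp[OF g h a(1) a(1)] lin_comp[OF h g a(1) a(1)] by (simp_all add: lin_id)
  then obtain b c where b: "b \<in> arcs Q" "lin g a b \<noteq> 0" and c: "c \<in> arcs Q" "lin g c a \<noteq> 0"
    by (auto elim!: sum.not_neutral_contains_not_neutral)
  have "partner a b" "partner a c"
    using lin_par[OF g a(1) b(2)] lin_par[OF g c(1) c(2)] b c a by (auto simp: partner_def)
  then show thesis using that[of b] partner_unique b c by auto
qed

text \<open>
  If \<open>a\<close> is exchanged with its parallel arrow, a relation starting with \<open>a\<close> can only be preserved when the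
  next arrow is exchanged as well.
\<close>

lemma degenerate_next:
  assumes g: "vaut g" and a: "a \<in> arcs Q" "lin g a a = 0" and c: "c \<in> arcs Q" "head Q a = tail Q c"
  shows "lin g c c = 0"
proof -
  obtain b where b: "partner a b" "lin g a b \<noteq> 0" "lin g b a \<noteq> 0"
    using lin_degenerate[OF g a] .
  have "nz a c \<longleftrightarrow> \<not> nz b c"
    by (rule two_in) (use a b(1) c in \<open>auto simp: partner_def\<close>)
  then consider "nz a c" "\<not> nz b c" | "nz b c" "\<not> nz a c" by blast
  then show ?thesis
  proof cases
    case 1
    then show ?thesis
      using coef_mul_arrows[OF g _ c(1) 1(1), of b] im_rel[OF vaut_vend[OF g] _ c(1) 1(2)] b by (auto simp: partner_def)
  next
    case 2
    then show ?thesis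
      using coef_mul_arrows[OF g a(1) c(1) 2(1)] im_rel[OF vaut_vend[OF g] a(1) c(1) 2(2)] b by auto
  qed
qed

lemma degenerate_prev:
  assumes g: "vaut g" and a: "a \<in> arcs Q" "lin g a a = 0" and c: "c \<in> arcs Q" "head Q c = tail Q a"
  shows "lin g c c = 0"
proof -
  obtain b where b: "partner a b" "lin g a b \<noteq> 0" "lin g b a \<noteq> 0"
    using lin_degenerate[OF g a] .
  have "nz c a \<longleftrightarrow> \<not> nz c b"
    by (rule two_out) (use a b(1) c in \<open>auto simp: partner_def\<close>)
  then consider "nz c a" "\<not> nz c b" | "nz c b" "\<not> nz c a" by blast
  then show ?thesis
  proof cases
    case 1
    then show ?thesis
      using coef_mul_arrows[OF g c(1) _ 1(1), of b] im_rel[OF vaut_vend[OF g] c(1) _ 1(2)] b by (auto simp: partner_def)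
  next
    case 2
    then show ?thesis
      using coef_mul_arrows[OF g c(1) a(1) 2(1)] im_rel[OF vaut_vend[OF g] c(1) a(1) 2(2)] b by auto
  qed
qed

lemma degenerate_all_partners:
  assumes g: "vaut g" and a\<^sub>0: "a\<^sub>0 \<in> arcs Q" "lin g a\<^sub>0 a\<^sub>0 = 0" and c: "c \<in> arcs Q"
  shows "\<exists>b. partner c b"
proof -
  let ?P = "\<lambda>a. \<exists>b. partner a b \<and> (lin g a a = 0 \<or> lin g b b = 0)"
  have P: "?P a" if "a \<in> arcs Q" "lin g a a = 0" for a
    using lin_degenerate[OF g that] that by blast
  have "?P c"
  proof (rule arcs_connected[of ?P, OF P[OF a\<^sub>0] a\<^sub>0(1) _ c])
    fix a d assume a: "a \<in> arcs Q" and d: "d \<in> arcs Q" and "?P a"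
      and share: "tail Q a = tail Q d \<or> tail Q a = head Q d \<or> head Q a = tail Q d \<or> head Q a = head Q d"
    then obtain b where b: "partner a b" "lin g a a = 0 \<or> lin g b b = 0" by blast
    then have bb: "b \<in> arcs Q" "tail Q b = tail Q a" "head Q b = head Q a" "a \<noteq> b" by (auto simp: partner_def)
    have "?P d" if "d = a \<or> d = b" using that b partner_sym by blast
    then show "?P d"
      using share out3[of a b d] in3[of a b d] P[OF d] a d bb b(2)
        degenerate_next[OF g a _ d] degenerate_next[OF g bb(1) _ d]
        degenerate_prev[OF g a _ d] degenerate_prev[OF g bb(1) _ d] by metis
  qed
  then show ?thesis by blast
qed

lemma kronI:
  assumes p: "partner a b" and no: "\<And>d. d \<in> arcs Q \<Longrightarrow> tail Q d \<noteq> head Q a \<and> head Q d \<noteq> tail Q a"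
  shows kron
proof -
  have pp: "a \<in> arcs Q" "b \<in> arcs Q" "b \<noteq> a" "tail Q b = tail Q a" "head Q b = head Q a"
    using p by (auto simp: partner_def)
  have "c = a \<or> c = b" if "c \<in> arcs Q" for c
  proof (rule arcs_connected[of "\<lambda>c. c = a \<or> c = b" a, OF _ pp(1) _ that])
    fix c d assume d: "d \<in> arcs Q" and "c = a \<or> c = b"
      and "tail Q c = tail Q d \<or> tail Q c = head Q d \<or> head Q c = tail Q d \<or> head Q c = head Q d"
    then have "tail Q a = tail Q d \<or> head Q a = head Q d" using no[OF d] pp by metis
    then show "d = a \<or> d = b" using out3[of a b d] in3[of a b d] pp d by metis
  qed simp
  then have "arcs Q = {a, b}" using pp by blast
  moreover have "tail Q a \<noteq> head Q a" using no[OF pp(1)] by simp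
  ultimately show kron unfolding kron_def using p by blast
qed

text \<open>
  Degeneracy spreads along composable arrows. Inside a pair it needs a neighbouring arrow to spread from
  one member to the other, and only the Kronecker quiver has none.
\<close>

lemma not_kron_degenerate:
  assumes nk: "\<not> kron" and g: "vaut g" and a\<^sub>0: "a\<^sub>0 \<in> arcs Q" "lin g a\<^sub>0 a\<^sub>0 = 0" and c: "c \<in> arcs Q"
  shows "lin g c c = 0"
proof (rule arcs_connected[of "\<lambda>a. lin g a a = 0", OF a\<^sub>0(2,1) _ c])
  fix a d assume a: "a \<in> arcs Q" "lin g a a = 0" and d: "d \<in> arcs Q"
    and share: "tail Q a = tail Q d \<or> tail Q a = head Q d \<or> head Q a = tail Q d \<or> head Q a = head Q d"
  obtain b where b: "partner a b" using lin_degenerate[OF g a] .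
  then have bb: "b \<in> arcs Q" "tail Q b = tail Q a" "head Q b = head Q a" "a \<noteq> b" by (auto simp: partner_def)
  obtain e where e: "e \<in> arcs Q" "tail Q e = head Q a \<or> head Q e = tail Q a"
    using kronI[OF b] nk by blast
  have "lin g b b = 0"
    using e(2)
  proof
    assume "tail Q e = head Q a"
    then show ?thesis
      using degenerate_prev[OF g e(1) degenerate_next[OF g a e(1)] bb(1)] bb by simp
  next
    assume "head Q e = tail Q a"
    then show ?thesis
      using degenerate_next[OF g e(1) degenerate_prev[OF g a e(1)] bb(1)] bb by simp
  qed
  then show "lin g d d = 0"
    using share out3[of a b d] in3[of a b d] a d bb degenerate_next[OF g a d] degenerate_prev[OF g a d] by metis
qed

text \<open>Keeps the action on maximal paths diagonal even where such a path is a single arrow.\<close>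

lemma gbar_arrow:
  assumes nk: "\<not> kron" and a: "a \<in> arcs Q" and b: "b \<in> arcs Q" "gbar a (ar b)"
  shows "\<not> gbar b p"
proof
  assume p: "gbar b p"
  have p': "snd p \<noteq> []" "p \<in> B" "\<And>c. \<not> nz (last (snd p)) c" "\<And>c. \<not> nz c (hd (snd p))"
    using p by (auto simp: gbar_def maximal_def)
  have ab: "tail Q b = tail Q a" "head Q b = head Q a" "b \<noteq> a" "\<And>c. \<not> nz b c" "\<And>c. \<not> nz c b"
    using b by (auto simp: gbar_def maximal_def arrow_path_def path_tgt_eq)
  have h: "hd (snd p) = a" "last (snd p) = a"
    using out3[of "hd (snd p)" a b] in3[of "last (snd p)" a b] B_hd'[OF p'(2,1)] p p' ab a b
    unfolding gbar_def by metis+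
  have "partner a b" using a b ab by (auto simp: partner_def)
  then have kron
  proof (rule kronI)
    fix d assume d: "d \<in> arcs Q"
    have na: "\<not> nz a d" "\<not> nz d a" using h p' by metis+
    show "tail Q d \<noteq> head Q a \<and> head Q d \<noteq> tail Q a"
      using two_in[of d a b] two_out[of d a b] na ab d a b(1) by metis
  qed
  then show False using nk by simp
qed

end

section \<open>Rank one idempotents over a polynomial ring\<close>

lemma poly_bezout:
  fixes a c :: "'k::field poly"
  shows "\<exists>g r s. g = r * a + s * c \<and> g dvd a \<and> g dvd c"
proof (induction "euclidean_size c" arbitrary: a c rule: less_induct)
  case less
  show ?case
  proof (cases "c = 0")
    case True
    then show ?thesis by (intro exI[of _ a] exI[of _ 1] exI[of _ 0]) auto
  next
    case False
    then obtain g r s where g: "g = r * c + s * (a mod c)" "g dvd c" "g dvd a mod c"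
      using less[of "a mod c" c] mod_size_less[OF False] by blast
    have "g = s * a + (r - s * (a div c)) * c"
      by (simp add: g(1) minus_div_mult_eq_mod[symmetric] algebra_simps)
    moreover have "g dvd a" using g dvd_mod_imp_dvd by blast
    ultimately show ?thesis using g(2) by blast
  qed
qed

text \<open>
  A two by two matrix of trace one and determinant zero is an idempotent of rank one. By Bezout the gcd of
  a row is a combination of its entries, which splits the matrix as column times row over \<open>k[s]\<close>.
\<close>

lemma idempotent_factor:
  fixes a b c d :: "'k::field poly"
  assumes sum: "a + d = 1" and prod: "a * d = [:0, 1:] * (b * c)" and a0: "coeff a 0 = 1"
  obtains u\<^sub>1\<^sub>1 u\<^sub>1\<^sub>2 u\<^sub>2\<^sub>1 u\<^sub>2\<^sub>2 where
    "u\<^sub>1\<^sub>1 * u\<^sub>2\<^sub>2 - [:0, 1:] * (u\<^sub>1\<^sub>2 * u\<^sub>2\<^sub>1) = 1"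
    "a = u\<^sub>2\<^sub>2 * u\<^sub>1\<^sub>1" "b = u\<^sub>2\<^sub>2 * u\<^sub>1\<^sub>2" "c = - (u\<^sub>2\<^sub>1 * u\<^sub>1\<^sub>1)" "d = - ([:0, 1:] * (u\<^sub>2\<^sub>1 * u\<^sub>1\<^sub>2))"
    "coeff u\<^sub>1\<^sub>1 0 = 1" "coeff u\<^sub>2\<^sub>2 0 = 1"
proof -
  obtain g r s a' c' where g: "g = r * a + s * c" "a = g * a'" "c = g * c'"
    using poly_bezout[of a c] unfolding dvd_def by blast
  have ga: "coeff g 0 * coeff a' 0 = 1" using a0 g(2) by (simp add: coeff_mult_0)
  define k where "k = coeff g 0"
  have k: "k \<noteq> 0" using ga by (auto simp: k_def)
  have g0: "g \<noteq> 0" using ga by auto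
  define u1 where "u1 = smult (1 / k) g"
  define u2 where "u2 = smult k a'"
  define v where "v = - smult k c'"
  have u0: "coeff u1 0 = 1" "coeff u2 0 = 1" using ga k by (auto simp: u1_def u2_def k_def)
  then have ne: "u1 \<noteq> 0" "u2 \<noteq> 0" by auto
  have a: "a = u2 * u1" and c: "c = - (v * u1)"
    using k g by (simp_all add: u1_def u2_def v_def mult.commute)
  have "g * 1 = g * (r * a' + s * c')" using g by (simp add: algebra_simps)
  then have "r * a' + s * c' = 1" using g0 by (metis mult_cancel_left)
  then obtain p q where pq: "p * u2 + q * v = 1"
    using k by (intro that[of "smult (1 / k) r" "- smult (1 / k) s"]) (simp add: u2_def v_def)
  have "u1 * (u2 * d) = u1 * (- ([:0, 1:] * b * v))"
    using prod unfolding a c by (simp add: algebra_simps)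
  then have d: "u2 * d = - ([:0, 1:] * b * v)" using ne by (metis mult_cancel_left)
  have "[:0, 1:] * b = [:0, 1:] * b * (p * u2 + q * v)" by (simp add: pq)
  also have "\<dots> = u2 * ([:0, 1:] * b * p) - q * (- ([:0, 1:] * b * v))"
    by (simp only: ring_distribs) simp
  also have "\<dots> = u2 * ([:0, 1:] * b * p) - u2 * (q * d)"
    by (simp only: d[symmetric] mult.left_commute)
  also have "\<dots> = u2 * ([:0, 1:] * b * p - q * d)"
    by (simp only: right_diff_distrib)
  finally have tb: "[:0, 1:] * b = u2 * ([:0, 1:] * b * p - q * d)" .
  then have "coeff ([:0, 1:] * b) 0 = coeff u2 0 * coeff ([:0, 1:] * b * p - q * d) 0"
    by (metis coeff_mult_0)
  then have "coeff ([:0, 1:] * b * p - q * d) 0 = 0" using u0 by (simp add: coeff_mult_0)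
  then obtain u12 where u12: "[:0, 1:] * b * p - q * d = pCons 0 u12"
    by (metis coeff_pCons_0 pCons_cases)
  then have u12: "[:0, 1:] * b * p - q * d = [:0, 1:] * u12"
    by simp
  have "[:0, 1:] * b = [:0, 1:] * (u2 * u12)" 
    using tb unfolding u12 by (simp only: mult.left_commute)
  then have b: "b = u2 * u12" by (metis mult_cancel_left pCons_eq_0_iff one_neq_zero)
  have "u2 * d = u2 * (- ([:0, 1:] * (v * u12)))"
    by (simp only: d b) (simp add: ac_simps)
  then have d': "d = - ([:0, 1:] * (v * u12))" using ne by (metis mult_cancel_left)
  show thesis
  proof (rule that[OF _ a b c d' u0])
    have "u2 * u1 + - ([:0, 1:] * (v * u12)) = 1" using sum by (simp only: a d')
    then show "u1 * u2 - [:0, 1:] * (u12 * v) = 1"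
      by (simp only: diff_conv_add_uminus mult.commute)
  qed
qed

lemma coeff_spread:
  assumes "m > 0"
  shows "coeff (pcompose q (monom 1 m)) n = (if m dvd n then coeff q (n div m) else (0 :: 'k::field))"
proof (induction q arbitrary: n)
  case (pCons a q)
  have "coeff (pcompose (pCons a q) (monom 1 m)) n = coeff [:a:] n + (if n < m then 0 else coeff (pcompose q (monom 1 m)) (n - m))"
    by (simp add: pcompose_pCons coeff_monom_mult)
  also have "\<dots> = (if m dvd n then coeff (pCons a q) (n div m) else 0)"
  proof (cases "n < m")
    case True
    then show ?thesis
      by (cases n) (auto dest: dvd_imp_le)
  next
    case False
    then obtain j where n: "n = m + j" using le_Suc_ex not_less by blast
    moreover have "coeff [:a:] n = 0" "coeff (pCons a q) (Suc i) = coeff q i" for i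
      using n assms by (cases n; simp)+
    ultimately show ?thesis using assms
      by (simp add: pCons)
  qed
  finally show ?case .
qed simp

text \<open>A polynomial whose exponents lie in one residue class modulo \<open>m\<close> is a shift of a polynomial in \<open>s = x\<^sup>m\<close>.\<close>

lemma poly_spread:
  fixes p :: "'k::field poly"
  assumes "m > 0" "\<And>n. coeff p n \<noteq> 0 \<Longrightarrow> r \<le> n \<and> m dvd (n - r)"
  obtains q where "p = monom 1 r * pcompose q (monom 1 m)" "\<And>k. coeff q k = coeff p (r + m * k)"
proof -
  have fin: "MOST k. coeff p (r + m * k) = 0"
  proof -
    have "coeff p (r + m * k) = 0" if "k > degree p" for k
      using that assms(1) by (intro coeff_eq_0) (metis add_lessD1 add.commute less_le_trans mult_le_mono1 nat_mult_1 Suc_leI One_nat_def trans_le_add2)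
    then show ?thesis unfolding MOST_nat by blast
  qed
  define q where "q = Abs_poly (\<lambda>k. coeff p (r + m * k))"
  have q: "coeff q k = coeff p (r + m * k)" for k
    unfolding q_def using fin by (simp add: Abs_poly_inverse)
  have "p = monom 1 r * pcompose q (monom 1 m)"
  proof (rule poly_eqI)
    fix n
    show "coeff p n = coeff (monom 1 r * pcompose q (monom 1 m)) n"
      using assms(2)[of n]
      by (cases "coeff p n = 0") (auto simp: coeff_monom_mult coeff_spread[OF assms(1)] q)
  qed
  then show thesis using that q by blast
qed

section \<open>Cyclic threads\<close>

context gentle_quiver
begin

text \<open>Arrows on a cyclic thread: repeated continuation returns to the arrow.\<close>

definition cyc :: "'a \<Rightarrow> bool" where "cyc a \<longleftrightarrow> nz\<^sup>+\<^sup>+ a a"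

definition nx :: "'a \<Rightarrow> 'a" where "nx a = (THE b. nz a b)"

lemma nx_eq: "nz a b \<Longrightarrow> nx a = b"
  unfolding nx_def using succ_unique by blast

lemma cyc_next:
  assumes "cyc a" "nz a b" shows "cyc b"
proof -
  obtain c where "nz a c" "nz\<^sup>*\<^sup>* c a" using assms(1) unfolding cyc_def by (meson tranclpD)
  then show ?thesis
    using succ_unique assms(2) unfolding cyc_def by (metis rtranclp_into_tranclp1)
qed

lemma cyc_prev:
  assumes "cyc a" "nz b a" shows "cyc b"
proof -
  obtain c where "nz\<^sup>*\<^sup>* a c" "nz c a"
    using assms(1) unfolding cyc_def by (cases rule: tranclp.cases) (auto dest: tranclp_into_rtranclp)
  then show ?thesis
    using pred_unique assms(2) unfolding cyc_def by (metis rtranclp_into_tranclp2)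
qed

lemma cyc_nx: "cyc a \<Longrightarrow> nz a (nx a)"
  unfolding cyc_def by (metis nx_eq tranclpD)

lemma cyc_nx_cyc: "cyc a \<Longrightarrow> cyc (nx a)"
  using cyc_next cyc_nx by blast

lemma cyc_arcs: "cyc a \<Longrightarrow> a \<in> arcs Q"
  using cyc_nx nz_arcs by blast

lemma thr_cyc: "thr a b \<Longrightarrow> cyc a \<Longrightarrow> cyc b"
  unfolding thr_def by (induction rule: rtranclp_induct) (auto intro: cyc_next cyc_prev)

lemma cyc_it: "cyc a \<Longrightarrow> cyc ((nx ^^ n) a)"
  by (induction n) (auto intro: cyc_nx_cyc)

lemma thr_it: "cyc a \<Longrightarrow> thr a ((nx ^^ n) a)"
  by (induction n) (auto intro: thr_trans[OF _ nz_thr[OF cyc_nx[OF cyc_it]]])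

lemma it_it: "(nx ^^ j) ((nx ^^ i) a) = (nx ^^ (i + j)) a"
  by (metis add.commute comp_apply funpow_add)

text \<open>On a cyclic thread a path is determined by its first arrow and its length.\<close>

definition pth :: "'a \<Rightarrow> nat \<Rightarrow> ('v, 'a) qpath" where
  "pth a n = (tail Q a, map (\<lambda>i. (nx ^^ i) a) [0..<n])"

lemma fst_pth [simp]: "fst (pth a n) = tail Q a" and length_pth [simp]: "length (snd (pth a n)) = n"
  and pth_0: "pth a 0 = (tail Q a, [])"
  by (simp_all add: pth_def)

lemma hd_pth: "0 < n \<Longrightarrow> hd (snd (pth a n)) = a"
  by (simp add: pth_def hd_map upt_conv_Cons)

lemma pth_B: assumes "cyc a" shows "pth a n \<in> B"
proof -
  have "nz ((nx ^^ i) a) ((nx ^^ Suc i) a)" for i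
    using cyc_nx[OF cyc_it[OF assms]] by simp
  then have "successively nz (snd (pth a n))"
    by (simp add: pth_def successively_conv_nth del: upt_Suc funpow.simps)
  moreover have "set (snd (pth a n)) \<subseteq> arcs Q"
    using cyc_arcs[OF cyc_it[OF assms]] by (auto simp: pth_def)
  moreover have "hd (snd (pth a n)) = a" if "snd (pth a n) \<noteq> []"
    using that hd_pth[of n a] by (cases n) (auto simp: pth_0)
  ultimately show ?thesis
    using cyc_arcs[OF assms] by (simp add: B_def)
qed

lemma tgt_pth: assumes "cyc a" shows "tgt (pth a n) = tail Q ((nx ^^ n) a)"
proof (cases n)
  case (Suc k)
  then show ?thesis
    using nz_arcs[OF cyc_nx[OF cyc_it[OF assms, of k]]] by (simp add: pth_def path_tgt_eq)
qed (simp add: pth_def path_tgt_eq)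

lemma take_pth: "i \<le> n \<Longrightarrow> take i (snd (pth a n)) = snd (pth a i)"
  by (simp add: pth_def take_map)

lemma drop_pth: "i \<le> n \<Longrightarrow> drop i (snd (pth a n)) = snd (pth ((nx ^^ i) a) (n - i))"
  by (rule nth_equalityI) (auto simp: pth_def it_it)

lemma path_eq_pth:
  assumes "p \<in> B" "snd p \<noteq> []" "cyc (hd (snd p))"
  shows "p = pth (hd (snd p)) (length (snd p))"
proof -
  let ?q = "pth (hd (snd p)) (length (snd p))"
  have "snd p = snd ?q"
  proof (rule nth_equalityI)
    show "snd p ! i = snd ?q ! i" if "i < length (snd p)" for i
    proof (rule chain_from_first)
      show "successively nz (snd p)" "successively nz (snd ?q)"
        using assms(1) pth_B[OF assms(3)] by (auto simp: B_def)
      show "snd ?q \<noteq> []" using assms(2) by (metis length_0_conv length_pth)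
      show "hd (snd p) = hd (snd ?q)" using assms(2) by (simp add: hd_pth)
    qed (use assms(2) that in simp_all)
  qed simp
  moreover have "fst p = fst ?q" using B_hd'[OF assms(1,2)] by simp
  ultimately show ?thesis by (simp add: prod_eq_iff)
qed

lemma pth_eq_iff: "0 < n \<Longrightarrow> pth a n = pth b k \<longleftrightarrow> a = b \<and> n = k"
  by (metis hd_pth length_pth)

lemma tranclp_it: "nz\<^sup>+\<^sup>+ a b \<Longrightarrow> \<exists>n>0. (nx ^^ n) a = b"
proof (induction rule: tranclp_induct)
  case (base y)
  then show ?case using nx_eq by (intro exI[of _ 1]) auto
next
  case (step y z)
  then show ?case by (metis funpow.simps(2) comp_apply nx_eq zero_less_Suc)
qed

definition per :: "'a \<Rightarrow> nat" where "per a = (LEAST m. 0 < m \<and> (nx ^^ m) a = a)"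

lemma per: assumes "cyc a" shows "0 < per a" "(nx ^^ per a) a = a"
  using LeastI_ex[OF tranclp_it[OF assms[unfolded cyc_def]]] unfolding per_def by auto

lemma it_mult_per: "cyc a \<Longrightarrow> (nx ^^ (per a * k)) a = a"
  by (induction k) (simp_all add: per flip: it_it)

lemma it_eq_iff: assumes "cyc a" shows "(nx ^^ n) a = a \<longleftrightarrow> per a dvd n"
proof
  assume n: "(nx ^^ n) a = a"
  have "(nx ^^ (n mod per a)) a = (nx ^^ (n mod per a)) ((nx ^^ (per a * (n div per a))) a)"
    by (simp add: it_mult_per[OF assms])
  also have "\<dots> = a" using n by (simp add: it_it)
  finally have "\<not> 0 < n mod per a"
    using not_less_Least[of "n mod per a" "\<lambda>m. 0 < m \<and> (nx ^^ m) a = a"] per(1)[OF assms]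
    unfolding per_def[symmetric] by auto
  then show "per a dvd n" by auto
qed (auto simp: it_mult_per assms)

lemma nx_inj: "cyc a \<Longrightarrow> cyc b \<Longrightarrow> nx a = nx b \<Longrightarrow> a = b"
  using cyc_nx pred_unique by metis

lemma it_inj: "cyc a \<Longrightarrow> cyc b \<Longrightarrow> (nx ^^ n) a = (nx ^^ n) b \<Longrightarrow> a = b"
  by (induction n) (auto dest!: nx_inj[rotated 2] intro: cyc_it)

lemma it_reach: assumes "thr a b" "cyc a" shows "\<exists>n>0. (nx ^^ n) a = b"
  using assms unfolding thr_def
proof (induction rule: rtranclp_induct)
  case base
  then show ?case using per by blast
next
  case (step b c)
  then obtain n where n: "0 < n" "(nx ^^ n) a = b" by auto
  from step(2) show ?case
  proof
    assume "nz b c"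
    then have "(nx ^^ Suc n) a = c" using n nx_eq by simp
    then show ?thesis by blast
  next
    assume cb: "nz c b"
    obtain k where k: "n = Suc k" using n by (cases n) auto
    have "nz ((nx ^^ k) a) b" using cyc_nx[OF cyc_it[OF assms(2), of k]] n k by simp
    then have c: "c = (nx ^^ k) a" using cb pred_unique by blast
    have "(nx ^^ (per a + k)) a = c" by (simp add: c per[OF assms(2)] flip: it_it)
    then show ?thesis using per(1)[OF assms(2)] by (intro exI[of _ "per a + k"]) simp
  qed
qed

lemma per_thr: assumes "thr a b" "cyc a" shows "per b = per a"
proof -
  obtain n where n: "(nx ^^ n) a = b" using it_reach[OF assms] by auto
  have "(nx ^^ k) b = b \<longleftrightarrow> (nx ^^ k) a = a" for k
  proof -
    have "(nx ^^ k) b = (nx ^^ n) ((nx ^^ k) a)" using n it_it by (metis add.commute)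
    then show ?thesis using n it_inj[OF cyc_it[OF assms(2)] assms(2)] by metis
  qed
  then show ?thesis unfolding per_def by simp
qed

section \<open>Matrices of polynomials over the cyclic threads\<close>

text \<open>
  The entry at \<open>a\<close> and \<open>b\<close> collects the paths that start with \<open>a\<close> and are followed by \<open>b\<close>, the exponent being
  the length. Recording the following arrow instead of the last one makes products into matrix products.
\<close>

definition P :: "(('v, 'a) qpath \<Rightarrow>\<^sub>0 'k::field) \<Rightarrow> 'a \<Rightarrow> 'a \<Rightarrow> 'k poly" where
  "P x a b = Abs_poly (\<lambda>n. if (nx ^^ n) a = b then coef x (pth a n) else 0)"

lemma coeff_P: "coeff (P x a b) n = (if (nx ^^ n) a = b then coef x (pth a n) else 0)"
proof -
  have "inj (pth a)" by (rule injI) (metis length_pth)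
  then have "finite (pth a -` Poly_Mapping.keys x)" by (intro finite_vimageI) auto
  moreover have "{n. (if (nx ^^ n) a = b then coef x (pth a n) else 0) \<noteq> 0} \<subseteq> pth a -` Poly_Mapping.keys x"
    by (auto simp: in_keys_iff)
  ultimately have "MOST n. (if (nx ^^ n) a = b then coef x (pth a n) else 0) = 0"
    unfolding MOST_iff_cofinite using finite_subset by blast
  then show ?thesis unfolding P_def by (simp add: Abs_poly_inverse)
qed

lemma P_add: "P (x + y) a b = P x a b + P y a b" and P_diff: "P (x - y) a b = P x a b - P y a b"
  and P_zero [simp]: "P 0 a b = 0" and P_scale: "P (scale c x) a b = smult c (P x a b)"
  by (rule poly_eqI; simp add: coeff_P lookup_add lookup_minus)+

lemma P_mul:
  assumes a: "cyc a"
  shows "P (x \<star> y) a b = (\<Sum>c\<in>{c\<in>arcs Q. cyc c}. P x a c * P y c b)"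
proof (rule poly_eqI)
  fix n
  let ?C = "{c\<in>arcs Q. cyc c}"
  have "coeff (\<Sum>c\<in>?C. P x a c * P y c b) n = (\<Sum>c\<in>?C. \<Sum>i\<le>n. coeff (P x a c) i * coeff (P y c b) (n - i))"
    by (simp add: coeff_sum coeff_mult)
  also have "\<dots> = (\<Sum>i\<le>n. \<Sum>c\<in>?C. coeff (P x a c) i * coeff (P y c b) (n - i))"
    by (rule sum.swap)
  also have "\<dots> = (\<Sum>i\<le>n. \<Sum>c\<in>?C. if c = (nx ^^ i) a then coef x (pth a i) * coeff (P y c b) (n - i) else 0)"
    by (intro sum.cong refl) (auto simp: coeff_P)
  also have "\<dots> = (\<Sum>i\<le>n. coef x (pth a i) * coeff (P y ((nx ^^ i) a) b) (n - i))"
    using cyc_it[OF a] cyc_arcs[OF cyc_it[OF a]] by (intro sum.cong refl) simp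
  also have "\<dots> = (\<Sum>i\<le>n. if (nx ^^ n) a = b then coef x (pth a i) * coef y (pth ((nx ^^ i) a) (n - i)) else 0)"
    by (intro sum.cong refl) (auto simp: coeff_P it_it)
  also have "\<dots> = coeff (P (x \<star> y) a b) n"
  proof -
    have "coef (x \<star> y) (pth a n) = (\<Sum>i\<le>n. coef x (pth a i) * coef y (pth ((nx ^^ i) a) (n - i)))"
    proof -
      obtain es where p: "pth a n = (tail Q a, es)" "es = snd (pth a n)" by (simp add: pth_def)
      have "coef (x \<star> y) (tail Q a, es) = (\<Sum>i\<le>n. coef x (tail Q a, take i es) * coef y (tgt (tail Q a, take i es), drop i es))"
      proof -
        have "length es = n" using p(2) by simp
        moreover have "(tail Q a, es) \<in> B" using pth_B[OF a, of n] unfolding p(1) .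
        ultimately show ?thesis by (simp add: coef_mul)
      qed
      also have "\<dots> = (\<Sum>i\<le>n. coef x (pth a i) * coef y (pth ((nx ^^ i) a) (n - i)))"
      proof (intro sum.cong refl)
        fix i assume "i \<in> {..n}"
        then have "(tail Q a, take i es) = pth a i" "drop i es = snd (pth ((nx ^^ i) a) (n - i))"
          unfolding p(2) by (simp_all add: take_pth drop_pth prod_eq_iff)
        then show "coef x (tail Q a, take i es) * coef y (tgt (tail Q a, take i es), drop i es) =
            coef x (pth a i) * coef y (pth ((nx ^^ i) a) (n - i))"
          by (simp add: tgt_pth[OF a]) (metis fst_pth prod.collapse)
      qed
      finally show ?thesis by (simp add: p(1))
    qed
    then show ?thesis by (simp add: coeff_P)
  qed
  finally show "coeff (P (x \<star> y) a b) n = coeff (\<Sum>c\<in>?C. P x a c * P y c b) n" ..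
qed

lemma P_path: "0 < k \<Longrightarrow> P (path_elem (pth c k)) a b = (if a = c \<and> (nx ^^ k) c = b then monom 1 k else 0)"
  by (rule poly_eqI) (auto simp: coeff_P coef_path_elem pth_eq_iff)

lemma P_vertex: "P (path_elem (w, [])) a b = (if tail Q a = w \<and> a = b then 1 else 0)"
proof (rule poly_eqI)
  fix n
  have "(w, []) = pth a n \<longleftrightarrow> n = 0 \<and> tail Q a = w"
    by (auto simp: pth_def)
  then show "coeff (P (path_elem (w, [])) a b) n = coeff (if tail Q a = w \<and> a = b then 1 else 0) n"
    by (auto simp: coeff_P coef_path_elem)
qed

section \<open>Elements supported on some threads\<close>

text \<open>Elements of the arrow ideal supported on the threads selected by \<open>T\<close>.\<close>

definition MT :: "('a \<Rightarrow> bool) \<Rightarrow> (('v, 'a) qpath \<Rightarrow>\<^sub>0 'k::field) set" where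
  "MT T = {x \<in> Mp. \<forall>p. coef x p \<noteq> 0 \<longrightarrow> T (hd (snd p))}"

definition thrc :: "('a \<Rightarrow> bool) \<Rightarrow> bool" where
  "thrc T \<longleftrightarrow> (\<forall>a b. T a \<longrightarrow> thr a b \<longrightarrow> T b)"

lemma thrc_thr: "thrc (thr a)" and thrc_not: "thrc T \<Longrightarrow> thrc (\<lambda>a. \<not> T a)" and thrc_cyc: "thrc cyc"
  unfolding thrc_def by (blast intro: thr_trans thr_sym thr_cyc)+

lemma MT_Mp: "x \<in> MT T \<Longrightarrow> x \<in> Mp" and MT_M: "x \<in> MT T \<Longrightarrow> x \<in> M"
  by (auto simp: MT_def Mp_def)

lemma MTD: "x \<in> MT T \<Longrightarrow> coef x p \<noteq> 0 \<Longrightarrow> p \<in> B \<and> snd p \<noteq> [] \<and> T (hd (snd p))"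
  using MD[of x p] unfolding MT_def Mp_def by (cases p) auto

lemma MTI: "(\<And>p. coef x p \<noteq> 0 \<Longrightarrow> p \<in> B \<and> snd p \<noteq> [] \<and> T (hd (snd p))) \<Longrightarrow> x \<in> MT T"
  unfolding MT_def Mp_def by (auto intro!: MI) fastforce+

lemma MT_closed [intro, simp]:
  "0 \<in> MT T" "x \<in> MT T \<Longrightarrow> y \<in> MT T \<Longrightarrow> x + y \<in> MT T" "x \<in> MT T \<Longrightarrow> y \<in> MT T \<Longrightarrow> x - y \<in> MT T"
  "x \<in> MT T \<Longrightarrow> - x \<in> MT T" "x \<in> MT T \<Longrightarrow> scale c x \<in> MT T"
  by (simp_all add: MT_def lookup_add lookup_minus) (metis add.right_neutral diff_zero diff_self)+

lemma MT_sum: "(\<And>i. i \<in> J \<Longrightarrow> f i \<in> MT T) \<Longrightarrow> (\<Sum>i\<in>J. f i) \<in> MT T"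
  by (induction J rule: infinite_finite_induct) auto

lemma MT_path: "p \<in> B \<Longrightarrow> snd p \<noteq> [] \<Longrightarrow> T (hd (snd p)) \<Longrightarrow> path_elem p \<in> MT T"
  by (auto intro!: MTI simp: coef_path_elem split: if_splits)

lemma MT_mono: "x \<in> MT T \<Longrightarrow> (\<And>a. T a \<Longrightarrow> T' a) \<Longrightarrow> x \<in> MT T'"
  by (auto simp: MT_def)

lemma mul_coef_cut:
  assumes "coef (x \<star> y) (v, es) \<noteq> 0"
  obtains i where "i \<le> length es" "(v, es) \<in> B" "coef x (v, take i es) \<noteq> 0" "coef y (tgt (v, take i es), drop i es) \<noteq> 0"
  using assms unfolding coef_mul by (auto split: if_splits elim!: sum.not_neutral_contains_not_neutral)

lemma MT_mul_right: assumes "x \<in> MT T" shows "x \<star> y \<in> MT T"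
proof (rule MTI)
  fix p assume nz: "coef (x \<star> y) p \<noteq> 0"
  obtain v es where p: "p = (v, es)" by fastforce
  obtain i where i: "(v, es) \<in> B" "coef x (v, take i es) \<noteq> 0" using mul_coef_cut nz p by metis
  then show "p \<in> B \<and> snd p \<noteq> [] \<and> T (hd (snd p))"
    using MTD[OF assms i(2)] p by auto
qed

lemma MT_mul_left: assumes T: "thrc T" and "x \<in> MT T" shows "y \<star> x \<in> MT T"
proof (rule MTI)
  fix p assume nz: "coef (y \<star> x) p \<noteq> 0"
  obtain v es where p: "p = (v, es)" by fastforce
  obtain i where i: "(v, es) \<in> B" "coef x (tgt (v, take i es), drop i es) \<noteq> 0" using mul_coef_cut nz p by metis
  have d: "drop i es \<noteq> []" "T (hd (drop i es))" using MTD[OF assms(2) i(2)] by auto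
  then have "hd (drop i es) \<in> set es" by (metis hd_in_set in_set_dropD)
  then have "thr (hd (drop i es)) (hd es)" using path_thr2[OF i(1)] d by (metis drop_Nil hd_in_set)
  then show "p \<in> B \<and> snd p \<noteq> [] \<and> T (hd (snd p))"
    using d i p T by (auto simp: thrc_def)
qed

lemma nrm_vaut: "nrm g \<Longrightarrow> vaut g" by (simp add: nrm_def)

lemma nrm_im_MT: assumes "nrm g" "a \<in> arcs Q" shows "im g a \<in> MT (thr a)"
proof (rule MTI)
  fix p assume nz: "coef (im g a) p \<noteq> 0"
  obtain v es where p: "p = (v, es)" by fastforce
  have "thr a (hd es)"
    by (rule thread_preserved[OF nrm_nondeg[OF assms(1)] assms(2)]) (use assms nz p in \<open>auto simp: nrm_def\<close>)
  then show "p \<in> B \<and> snd p \<noteq> [] \<and> thr a (hd (snd p))"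
    using im_coefD[OF nrm_vaut[OF assms(1)] assms(2), of v es] nz p by simp
qed

lemma nrm_MT: assumes g: "nrm g" and T: "thrc T" and x: "x \<in> MT T" shows "g x \<in> MT T"
proof -
  have "g (path_elem p) \<in> MT T" if p: "p \<in> Poly_Mapping.keys x" for p
  proof -
    obtain v es where ve: "p = (v, es)" by fastforce
    have pp: "(v, es) \<in> B" "es \<noteq> []" "T (hd es)" using MTD[OF x, of p] p ve by (auto simp: in_keys_iff)
    obtain a fs where es: "es = a # fs" using pp(2) by (cases es) auto
    have a: "a \<in> arcs Q" "(head Q a, fs) \<in> B" using B_Cons pp(1) es by auto
    have "im g a \<in> MT T"
      by (rule MT_mono[OF nrm_im_MT[OF g a(1)]]) (use T pp es in \<open>auto simp: thrc_def\<close>)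
    then have "im g a \<star> g (path_elem (head Q a, fs)) \<in> MT T" by (rule MT_mul_right)
    then show ?thesis
      using pp(1) a by (simp add: ve es path_elem_Cons vaut_mul[OF nrm_vaut[OF g]])
  qed
  then show ?thesis
    unfolding vaut_expand[OF nrm_vaut[OF g] MT_M[OF x]] by (intro MT_sum MT_closed(5))
qed

lemma MT_mul_disjoint: assumes "x \<in> MT T" "y \<in> MT T'" "thrc T" "\<And>a. T a \<Longrightarrow> \<not> T' a" shows "x \<star> y = 0"
proof (rule ccontr)
  assume "x \<star> y \<noteq> 0"
  then obtain v es where nz: "coef (x \<star> y) (v, es) \<noteq> 0" by (metis lookup_zero poly_mapping_eqI surj_pair)
  obtain i where i: "(v, es) \<in> B" "coef x (v, take i es) \<noteq> 0" "coef y (tgt (v, take i es), drop i es) \<noteq> 0"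
    using mul_coef_cut[OF nz] by metis
  have d: "take i es \<noteq> []" "drop i es \<noteq> []" "T (hd (take i es))" "T' (hd (drop i es))"
    using MTD[OF assms(1) i(2)] MTD[OF assms(2) i(3)] by auto
  have "hd (take i es) \<in> set es" "hd (drop i es) \<in> set es" using d by (metis hd_in_set in_set_takeD in_set_dropD)+
  then have "thr (hd (take i es)) (hd (drop i es))" using path_thr2[OF i(1)] by blast
  then show False using d assms(3,4) unfolding thrc_def by blast
qed

lemma P_MT: "x \<in> MT T \<Longrightarrow> \<not> T a \<Longrightarrow> P x a b = 0"
proof (rule poly_eqI)
  fix n assume x: "x \<in> MT T" "\<not> T a"
  have "coef x (pth a n) = 0"
  proof (rule ccontr)
    assume "coef x (pth a n) \<noteq> 0"
    then show False using MTD[OF x(1), of "pth a n"] x(2) hd_pth[of n a] by (cases n) (auto simp: pth_0)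
  qed
  then show "coeff (P x a b) n = coeff 0 n" by (simp add: coeff_P)
qed

lemma MT_eq_0:
  assumes "x \<in> MT T" "\<And>a. T a \<Longrightarrow> cyc a" "\<And>a b. T a \<Longrightarrow> cyc b \<Longrightarrow> P x a b = 0"
  shows "x = 0"
proof (rule ccontr)
  assume "x \<noteq> 0"
  then obtain p where nz: "coef x p \<noteq> 0" by (metis lookup_zero poly_mapping_eqI)
  let ?a = "hd (snd p)" and ?n = "length (snd p)"
  have p: "p \<in> B" "snd p \<noteq> []" "T ?a" using MTD[OF assms(1) nz] by auto
  have "p = pth ?a ?n" using path_eq_pth p assms(2) by blast
  then have "coeff (P x ?a ((nx ^^ ?n) ?a)) ?n \<noteq> 0" using nz by (simp add: coeff_P)
  then show False using assms(3)[OF p(3) cyc_it[OF assms(2)[OF p(3)]]] by simp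
qed

end

section \<open>Straightening the cyclic threads\<close>

context gentle_quiver
begin

text \<open>The corner at the vertex \<open>w\<close>.\<close>

definition Cw :: "'v \<Rightarrow> (('v, 'a) qpath \<Rightarrow>\<^sub>0 'k::field) set" where
  "Cw w = {x \<in> M. \<forall>p. coef x p \<noteq> 0 \<longrightarrow> fst p = w \<and> tgt p = w}"

lemma Cw_M: "x \<in> Cw w \<Longrightarrow> x \<in> M" by (simp add: Cw_def)

lemma CwD: "x \<in> Cw w \<Longrightarrow> coef x p \<noteq> 0 \<Longrightarrow> fst p = w \<and> tgt p = w"
  unfolding Cw_def by blast

lemma Cw_left: "x \<in> Cw w \<Longrightarrow> path_elem (w, []) \<star> x = x"
  by (intro poly_mapping_eqI; clarify) (auto simp: Cw_def coef_vertex_mul)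

lemma Cw_right: "x \<in> Cw w \<Longrightarrow> x \<star> path_elem (w, []) = x"
  by (intro poly_mapping_eqI) (auto simp: Cw_def coef_mul_vertex)

lemma CwI:
  assumes "x \<in> M" "path_elem (w, []) \<star> x = x" "x \<star> path_elem (w, []) = x"
  shows "x \<in> Cw w"
proof -
  have *: "fst p = w \<and> tgt p = w" if "coef x p \<noteq> 0" for p
  proof (cases p)
    case (Pair v es)
    have "coef (path_elem (w, []) \<star> x) p \<noteq> 0" "coef (x \<star> path_elem (w, [])) p \<noteq> 0"
      using assms that by simp_all
    then show ?thesis
      using assms(1) Pair by (simp_all add: coef_vertex_mul coef_mul_vertex split: if_splits)
  qed
  show ?thesis unfolding Cw_def using assms(1) * by blast
qed

lemma Cw_mul: "x \<in> Cw w \<Longrightarrow> y \<in> Cw w \<Longrightarrow> x \<star> y \<in> Cw w"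
  by (rule CwI) (simp_all add: Cw_left Cw_right mul_assoc, simp add: Cw_left flip: mul_assoc)

lemma Cw_add: "x \<in> Cw w \<Longrightarrow> y \<in> Cw w \<Longrightarrow> x + y \<in> Cw w"
  and Cw_diff: "x \<in> Cw w \<Longrightarrow> y \<in> Cw w \<Longrightarrow> x - y \<in> Cw w"
  and Cw_scale: "x \<in> Cw w \<Longrightarrow> scale c x \<in> Cw w"
  by (rule CwI; simp add: Cw_M mul_add_left mul_add_right mul_diff_left mul_diff_right
      mul_scale_left mul_scale_right Cw_left Cw_right)+

lemma Cw_path: "p \<in> B \<Longrightarrow> fst p = w \<Longrightarrow> tgt p = w \<Longrightarrow> path_elem p \<in> Cw w"
  by (auto simp: Cw_def coef_path_elem split: if_splits)

lemma Cw_vertex: "w \<in> verts Q \<Longrightarrow> path_elem (w, []) \<in> Cw w"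
  by (rule Cw_path) (auto simp: path_tgt_eq)

lemma Cw_0: "0 \<in> Cw w" by (simp add: Cw_def)

lemma Cw_sum: "(\<And>i. i \<in> J \<Longrightarrow> f i \<in> Cw w) \<Longrightarrow> (\<Sum>i\<in>J. f i) \<in> Cw w"
  by (induction J rule: infinite_finite_induct) (auto intro: Cw_add Cw_0)

lemma vaut_Cw: assumes g: "vaut g" and w: "w \<in> verts Q" and x: "x \<in> Cw w" shows "g x \<in> Cw w"
proof -
  have "path_elem (w, []) \<star> g x = g (path_elem (w, []) \<star> x)" "g x \<star> path_elem (w, []) = g (x \<star> path_elem (w, []))"
    using w x by (simp_all add: vaut_mul[OF g] vaut_vertex[OF g] Cw_M)
  then show ?thesis using x by (intro CwI) (simp_all add: Cw_left Cw_right vaut_M[OF g] Cw_M)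
qed

lemma P_Cw: assumes x: "x \<in> Cw w" and c: "cyc c" "P x c d \<noteq> 0"
  shows "tail Q c = w" "tail Q d = w" "thr c d"
proof -
  obtain n where "coeff (P x c d) n \<noteq> 0" using c(2) by (metis coeff_0 poly_eqI)
  then have n: "(nx ^^ n) c = d" "coef x (pth c n) \<noteq> 0" by (auto simp: coeff_P split: if_splits)
  then show "tail Q c = w" "tail Q d = w" "thr c d"
    using CwD[OF x, of "pth c n"] tgt_pth[OF c(1), of n] thr_it[OF c(1), of n] by auto
qed

definition cb :: "'a \<Rightarrow> ('v, 'a) qpath" where "cb a = pth a (per a)"

definition Oc :: "'a \<Rightarrow> 'a set" where "Oc b = {c \<in> arcs Q. tail Q c = tail Q b \<and> thr b c}"

text \<open>
  The sum of the full cycles that the thread of \<open>b\<close> makes at the vertex; a thread passes a vertex at most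
  twice, and the sum commutes with the elements of that thread in the corner.
\<close>

definition Zc :: "'a \<Rightarrow> (('v, 'a) qpath \<Rightarrow>\<^sub>0 'k::field)" where "Zc b = (\<Sum>c\<in>Oc b. path_elem (cb c))"

lemma finite_Oc [simp]: "finite (Oc b)" by (simp add: Oc_def)

lemma Oc_self: "cyc b \<Longrightarrow> b \<in> Oc b" by (simp add: Oc_def cyc_arcs)

lemma OcD: "c \<in> Oc b \<Longrightarrow> cyc b \<Longrightarrow> c \<in> arcs Q \<and> tail Q c = tail Q b \<and> thr b c \<and> cyc c \<and> per c = per b"
  using thr_cyc per_thr by (auto simp: Oc_def)

lemma cb_closed:
  assumes "cyc c"
  shows "cb c \<in> B" "fst (cb c) = tail Q c" "tgt (cb c) = tail Q c" "snd (cb c) \<noteq> []" "hd (snd (cb c)) = c"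
    "length (snd (cb c)) = per c"
  using per[OF assms] pth_B[OF assms] tgt_pth[OF assms, of "per c"] hd_pth[of "per c" c]
  unfolding cb_def by (auto, metis length_0_conv length_pth less_irrefl)

lemma cb_Cw: "cyc c \<Longrightarrow> path_elem (cb c) \<in> Cw (tail Q c)"
  using cb_closed by (intro Cw_path) auto

lemma cb_MT: "cyc c \<Longrightarrow> T c \<Longrightarrow> path_elem (cb c) \<in> MT T"
  using cb_closed by (intro MT_path) auto

lemma Zc_Cw: "cyc b \<Longrightarrow> Zc b \<in> Cw (tail Q b)"
  unfolding Zc_def by (intro Cw_sum) (metis OcD cb_Cw)

lemma Zc_MT: "cyc b \<Longrightarrow> Zc b \<in> MT (thr b)"
  unfolding Zc_def by (intro MT_sum) (metis OcD cb_MT)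

lemma P_cb: "cyc c \<Longrightarrow> P (path_elem (cb c)) a d = (if a = c \<and> c = d then monom 1 (per c) else 0)"
  unfolding cb_def using per by (simp add: P_path)

lemma P_sum: "P (\<Sum>i\<in>J. f i) a b = (\<Sum>i\<in>J. P (f i) a b)"
  by (induction J rule: infinite_finite_induct) (auto simp: P_add)

lemma P_Zc: assumes b: "cyc b" shows "P (Zc b) c d = (if c \<in> Oc b \<and> c = d then monom 1 (per b) else 0)"
proof -
  have "P (Zc b) c d = (\<Sum>e\<in>Oc b. if e = c then (if c = d then monom 1 (per b) else 0) else 0)"
    unfolding Zc_def P_sum using OcD[OF _ b] by (intro sum.cong refl) (auto simp: P_cb)
  then show ?thesis by (cases "c \<in> Oc b"; cases "c = d") auto
qed

lemma P_mul_Zc_left: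
  assumes b: "cyc b" and c: "c \<in> Oc b"
  shows "P (Zc b \<star> x) c d = monom 1 (per b) * P x c d"
proof -
  have "P (Zc b \<star> x) c d = (\<Sum>e\<in>{e \<in> arcs Q. cyc e}. if e = c then monom 1 (per b) * P x c d else 0)"
    unfolding P_mul[OF OcD[OF c b, THEN conjunct2, THEN conjunct2, THEN conjunct2, THEN conjunct1]]
    using c by (intro sum.cong refl) (auto simp: P_Zc[OF b])
  then show ?thesis using OcD[OF c b] by simp
qed

lemma Zc_central:
  assumes b: "cyc b" and x: "x \<in> Cw (tail Q b)"
  shows "Zc b \<star> x = x \<star> Zc b"
proof -
  have "Zc b \<star> x - x \<star> Zc b = 0"
  proof (rule MT_eq_0[of _ "thr b"])
    show "Zc b \<star> x - x \<star> Zc b \<in> MT (thr b)"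
      using Zc_MT[OF b] by (intro MT_closed MT_mul_right MT_mul_left thrc_thr)
    show "cyc a" if "thr b a" for a using thr_cyc that b by blast
    fix c d assume c: "thr b c" and d: "cyc d"
    have cc: "cyc c" using thr_cyc c b by blast
    have "P (x \<star> Zc b) c d = (\<Sum>e\<in>{e \<in> arcs Q. cyc e}. if e = d then (if d \<in> Oc b then P x c d * monom 1 (per b) else 0) else 0)"
      unfolding P_mul[OF cc] by (intro sum.cong refl) (auto simp: P_Zc[OF b])
    then have 1: "P (x \<star> Zc b) c d = (if d \<in> Oc b then P x c d * monom 1 (per b) else 0)"
      using d cyc_arcs by simp
    have "P (Zc b \<star> x) c d = (\<Sum>e\<in>{e \<in> arcs Q. cyc e}. if e = c then (if c \<in> Oc b then monom 1 (per b) * P x c d else 0) else 0)"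
      unfolding P_mul[OF cc] by (intro sum.cong refl) (auto simp: P_Zc[OF b])
    then have 2: "P (Zc b \<star> x) c d = (if c \<in> Oc b then monom 1 (per b) * P x c d else 0)"
      using cc cyc_arcs by simp
    have "c \<in> Oc b \<and> d \<in> Oc b" if "P x c d \<noteq> 0"
      using P_Cw[OF x cc that] c cyc_arcs[OF cc] cyc_arcs[OF d] thr_trans by (auto simp: Oc_def)
    then show "P (Zc b \<star> x - x \<star> Zc b) c d = 0"
      unfolding P_diff 1 2 by (cases "P x c d = 0") (auto simp: mult.commute)
  qed
  then show ?thesis by simp
qed

lemma monom_cancel: "monom (1 :: 'k::field) r * p = monom 1 r * q \<Longrightarrow> p = q"
  by (metis monom_eq_0_iff mult_cancel_left one_neq_zero)

lemma image_Zc_scalar: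
  fixes g :: "(('v, 'a) qpath \<Rightarrow>\<^sub>0 'k::field) \<Rightarrow> (('v, 'a) qpath \<Rightarrow>\<^sub>0 'k)"
  assumes g: "vaut g" and b: "cyc b" and c: "c \<in> Oc b" and d: "cyc d"
  shows "P (g (Zc b)) c d = (if c = d then P (g (Zc b)) b b else 0)"
proof -
  let ?w = "tail Q b" and ?G = "g (Zc b)"
  have w: "?w \<in> verts Q" using cyc_arcs[OF b] by simp
  have cc: "cyc c" "tail Q c = ?w" "thr b c" using OcD[OF c b] by auto
  have comm: "?G \<star> y = y \<star> ?G" if y: "y \<in> Cw ?w" for y
  proof -
    let ?y = "inv_into M g y"
    have y': "?y \<in> Cw ?w" by (rule vaut_Cw[OF vaut_inv[OF g] w y])
    have gy: "g ?y = y" using vaut_inv_right[OF g] Cw_M[OF y] by blast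
    have "g (Zc b \<star> ?y) = g (?y \<star> Zc b)" using Zc_central[OF b y'] by simp
    then show ?thesis
      by (simp add: vaut_mul[OF g] Cw_M[OF y'] Cw_M[OF Zc_Cw[OF b]] gy)
  qed
  obtain r where r: "0 < r" "(nx ^^ r) b = c" using it_reach[OF cc(3) b] by auto
  let ?y = "path_elem (pth b r) :: ('v, 'a) qpath \<Rightarrow>\<^sub>0 'k"
  have Py: "P ?y e f = (if e = b \<and> f = c then monom 1 r else 0)" for e f
    using r by (auto simp: P_path)
  have "?y \<in> Cw ?w"
    by (rule Cw_path) (use pth_B[OF b] tgt_pth[OF b, of r] r cc in auto)
  then have "P (?G \<star> ?y) b d = P (?y \<star> ?G) b d" by (simp add: comm)
  moreover have "P (?G \<star> ?y) b d = (\<Sum>e\<in>{e \<in> arcs Q. cyc e}. if e = b then P ?G b b * (if c = d then monom 1 r else 0) else 0)"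
    unfolding P_mul[OF b] by (intro sum.cong refl) (auto simp: Py)
  moreover have "P (?y \<star> ?G) b d = (\<Sum>e\<in>{e \<in> arcs Q. cyc e}. if e = c then monom 1 r * P ?G c d else 0)"
    unfolding P_mul[OF b] by (intro sum.cong refl) (auto simp: Py)
  ultimately have "monom 1 r * P ?G c d = P ?G b b * (if c = d then monom 1 r else 0)"
    using b cc cyc_arcs by simp
  then have "monom 1 r * P ?G c d = monom 1 r * (if c = d then P ?G b b else 0)"
    by (simp add: mult.commute split: if_splits)
  then show ?thesis by (rule monom_cancel)
qed

lemma coef_image_cb:
  assumes g: "vaut g" and lin: "\<And>a b. a \<in> arcs Q \<Longrightarrow> lin g a b = (if a = b then 1 else 0)"
    and b: "cyc b" and c: "cyc c" "per c = per b" "tail Q c = tail Q b"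
  shows "coef (g (path_elem (cb c))) (pth b (per b)) = (if b = c then 1 else 0)"
proof -
  let ?es = "snd (cb c)" and ?fs = "snd (pth b (per b))"
  have "coef (g (path_elem (tail Q c, ?es))) (tail Q b, ?fs) = (\<Prod>(x, y)\<leftarrow>zip ?es ?fs. lin g x y)"
  proof (rule coef_vaut_lead[OF g])
    show "(tail Q c, ?es) \<in> B" "(tail Q b, ?fs) \<in> B"
      using cb_closed[OF c(1)] pth_B[OF b, of "per b"] by (metis prod.collapse fst_pth)+
  qed (use c in \<open>auto simp: cb_closed\<close>)
  moreover have "(\<Prod>(x, y)\<leftarrow>zip ?es ?fs. lin g x y) = (if b = c then 1 else 0)"
  proof (cases "b = c")
    case True
    have "(\<Prod>(x, y)\<leftarrow>zip es es. lin g x y) = 1" if "set es \<subseteq> arcs Q" for es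
      using that by (induction es) (auto simp: lin)
    then show ?thesis using True cb_closed(1)[OF c(1)] by (auto simp: cb_def B_def)
  next
    case False
    obtain x xs y ys where xy: "?es = x # xs" "?fs = y # ys"
      using cb_closed[OF c(1)] cb_closed[OF b] unfolding cb_def by (metis list.exhaust)
    then have "x = c" "y = b"
      using cb_closed(5)[OF c(1)] cb_closed(5)[OF b] unfolding cb_def by auto
    then show ?thesis using xy False lin cyc_arcs[OF c(1)] by simp
  qed
  moreover have "(tail Q c, ?es) = cb c" "(tail Q b, ?fs) = pth b (per b)"
    using cb_closed[OF c(1)] by (metis prod.collapse fst_pth)+
  ultimately show ?thesis by simp
qed

lemma cb_Mge: "cyc c \<Longrightarrow> per c = m \<Longrightarrow> vaut g \<Longrightarrow> g (path_elem (cb c)) \<in> Mge m"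
  by (metis cb_closed(1,6) prod.collapse vaut_path_Mge)

lemma Mge_sum: "(\<And>i. i \<in> J \<Longrightarrow> f i \<in> Mge n) \<Longrightarrow> (\<Sum>i\<in>J. f i) \<in> Mge n"
proof (induction J rule: infinite_finite_induct)
  case (insert x F)
  then have "f x \<in> Mge n" "sum f F \<in> Mge n" by auto
  then have "coef (f x + sum f F) p = 0" if "length (snd p) < n" for p
    using that MgeD[of "f x" n p] MgeD[of "sum f F" n p] by (simp add: lookup_add)
  then have "f x + sum f F \<in> Mge n"
    using \<open>f x \<in> Mge n\<close> \<open>sum f F \<in> Mge n\<close> by (auto simp: Mge_def not_less[symmetric])
  then show ?case using insert by simp
qed (simp_all add: Mge_def)

lemma image_Zc_lead:
  assumes g: "vaut g" and lin: "\<And>a b. a \<in> arcs Q \<Longrightarrow> lin g a b = (if a = b then 1 else 0)"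
    and b: "cyc b" and c: "c \<in> Oc b"
  shows "g (Zc b) \<in> Mge (per b)" "coef (g (Zc b)) (pth c (per b)) = 1"
proof -
  have Z: "g (Zc b) = (\<Sum>c\<in>Oc b. g (path_elem (cb c)))"
    unfolding Zc_def using cb_closed OcD[OF _ b] by (intro vaut_sum[OF g] M_closed(7)) blast
  show "g (Zc b) \<in> Mge (per b)"
    unfolding Z using OcD[OF _ b] by (intro Mge_sum cb_Mge g) auto
  have "coef (g (Zc b)) (pth c (per c)) = (\<Sum>d\<in>Oc b. if c = d then 1 else 0)"
    unfolding Z lookup_sum using OcD[OF _ b] c
    by (intro sum.cong refl coef_image_cb[OF g lin]) auto
  then show "coef (g (Zc b)) (pth c (per b)) = 1"
    using c OcD[OF c b] by simp
qed

lemma nrm_inv_lin: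
  assumes g: "nrm g" and a: "a \<in> arcs Q"
  shows "lin (inv_into M g) a b = (if a = b then 1 else 0)"
proof (cases "b \<in> arcs Q")
  case True
  let ?h = "inv_into M g"
  have "lin (?h \<circ> g) a b = lin id a b"
    using vaut_inv_left[OF nrm_vaut[OF g]] a by (auto intro!: lin_cong)
  moreover have "lin (?h \<circ> g) a b = (\<Sum>c\<in>arcs Q. if c = a then lin ?h a b else 0)"
    unfolding lin_comp[OF vaut_inv[OF nrm_vaut[OF g]] nrm_vaut[OF g] a True]
    by (intro sum.cong refl) (auto simp: nrm_lin[OF g a])
  ultimately show ?thesis using a by (simp add: lin_id)
next
  case False
  then show ?thesis using lin_par[OF vaut_inv[OF nrm_vaut[OF g]] a, of b] a by auto
qed

text \<open>The element with prescribed coefficients on the paths that start with \<open>b\<close>; the constant term is dropped.\<close>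

definition el :: "'a \<Rightarrow> 'k::field poly \<Rightarrow> (('v, 'a) qpath \<Rightarrow>\<^sub>0 'k)" where
  "el b f = (\<Sum>n\<in>{0<..degree f}. scale (coeff f n) (path_elem (pth b n)))"

lemma el_MT: "cyc b \<Longrightarrow> T b \<Longrightarrow> el b f \<in> MT T"
  unfolding el_def using pth_B hd_pth by (intro MT_sum MT_closed MT_path) (auto simp flip: length_greater_0_conv)

lemma coeff_P_el:
  assumes "cyc b"
  shows "coeff (P (el b f) a c) n = (if a = b \<and> 0 < n \<and> (nx ^^ n) b = c then coeff f n else 0)"
proof -
  have "coeff (P (el b f) a c) n = (\<Sum>k\<in>{0<..degree f}. if k = n then (if a = b \<and> (nx ^^ n) b = c then coeff f n else 0) else 0)"
    unfolding el_def P_sum coeff_sum by (intro sum.cong refl) (auto simp: P_scale P_path)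
  then show ?thesis by (auto simp: coeff_eq_0)
qed

lemma coef_el_pth: "coef (el b f) p \<noteq> 0 \<Longrightarrow> \<exists>n>0. p = pth b n \<and> coeff f n \<noteq> 0"
  unfolding el_def lookup_sum by (auto simp: coef_path_elem split: if_splits elim!: sum.not_neutral_contains_not_neutral)

lemma el_Cw:
  assumes b: "cyc b" and f: "\<And>n. coeff f n \<noteq> 0 \<Longrightarrow> 0 < n \<Longrightarrow> tail Q ((nx ^^ n) b) = tail Q b"
  shows "el b f \<in> Cw (tail Q b)"
proof -
  have "fst p = tail Q b \<and> tgt p = tail Q b" if "coef (el b f) p \<noteq> 0" for p
    using coef_el_pth[OF that] f tgt_pth[OF b] by auto
  moreover have "el b f \<in> M" by (rule MT_M[OF el_MT[of b "\<lambda>_. True"]]) (use b in auto)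
  ultimately show ?thesis unfolding Cw_def by blast
qed

text \<open>
  \<open>Zc b\<close> is central in the corner at its vertex, so its image is \<open>F\<close> times the identity matrix. Its
  preimage is again a multiple of \<open>Zc b\<close> modulo the other threads, whence \<open>F\<close> divides \<open>s\<^sup>m\<close>.
\<close>

lemma nrm_Zc:
  assumes g: "nrm g" and b: "cyc b"
  shows "g (Zc b) = Zc b"
proof -
  note v = nrm_vaut[OF g]
  let ?m = "per b" and ?h = "inv_into M g" and ?w = "tail Q b" and ?G = "g (Zc b)"
  have w: "?w \<in> verts Q" using cyc_arcs[OF b] by simp
  have h: "vaut ?h" by (rule vaut_inv[OF v])
  define \<xi> where "\<xi> = ?h (Zc b)"
  have \<xi>M: "\<xi> \<in> M" unfolding \<xi>_def using vaut_M[OF h] Cw_M[OF Zc_Cw[OF b]] by blast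
  have lead: "\<xi> \<in> Mge ?m" "coef \<xi> (pth c ?m) = 1" if "c \<in> Oc b" for c
    unfolding \<xi>_def using image_Zc_lead[OF h nrm_inv_lin[OF g] b that] by auto
  have \<xi>C: "\<xi> \<in> Cw ?w" unfolding \<xi>_def by (rule vaut_Cw[OF h w Zc_Cw[OF b]])
  define R where "R c = (\<Sum>d\<in>{d \<in> arcs Q. cyc d}. P \<xi> c d)" for c
  have R: "coeff (R c) n = coef \<xi> (pth c n)" if "cyc c" for c n
  proof -
    have "coeff (R c) n = (\<Sum>d\<in>{d \<in> arcs Q. cyc d}. if d = (nx ^^ n) c then coef \<xi> (pth c n) else 0)"
      unfolding R_def coeff_sum by (intro sum.cong refl) (auto simp: coeff_P)
    then show ?thesis using cyc_it[OF that] cyc_arcs[OF cyc_it[OF that]] by simp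
  qed
  define \<eta> where "\<eta> = path_elem (?w, []) + (\<Sum>c\<in>Oc b. el c (poly_shift ?m (R c)))"
  have \<eta>M: "\<eta> \<in> M"
    unfolding \<eta>_def using w OcD[OF _ b] MT_M[OF el_MT[of _ "\<lambda>_. True"]] by (intro M_closed(3) M_closed(7) M_sum) auto
  have P\<eta>: "coeff (P \<eta> c d) n = (if n = 0 then (if c = d then 1 else 0)
      else if (nx ^^ n) c = d then coef \<xi> (pth c (n + ?m)) else 0)" if c: "c \<in> Oc b" for c d n
  proof -
    have cc: "cyc c" "tail Q c = ?w" using OcD[OF c b] by auto
    have "coeff (P \<eta> c d) n = coeff (if c = d then 1 else 0) n +
        (\<Sum>e\<in>Oc b. if c = e then (if 0 < n \<and> (nx ^^ n) c = d then coeff (R c) (n + ?m) else 0) else 0)"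
      unfolding \<eta>_def P_add P_sum coeff_add coeff_sum P_vertex using OcD[OF _ b] cc
      by (intro arg_cong2[where f = "(+)"] sum.cong refl) (auto simp: coeff_P_el coeff_poly_shift)
    then show ?thesis using c cc by (auto simp: R)
  qed
  have "\<xi> - Zc b \<star> \<eta> \<in> MT (\<lambda>a. \<not> thr b a)"
  proof (rule MTI)
    fix p assume nz: "coef (\<xi> - Zc b \<star> \<eta>) p \<noteq> 0"
    have "Zc b \<star> \<eta> \<in> Mp" by (rule MT_Mp[OF MT_mul_right[OF Zc_MT[OF b]]])
    then have M: "\<xi> - Zc b \<star> \<eta> \<in> Mge 1"
      using lead(1)[OF Oc_self[OF b]] per(1)[OF b] Mge_mono[of \<xi> ?m 1]
      by (simp add: Mge_1)
    then have p: "p \<in> B" "snd p \<noteq> []" using MD[OF Mge_M[OF M] nz] MgeD[OF M, of p] nz by auto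
    have "\<not> thr b (hd (snd p))"
    proof
      let ?c = "hd (snd p)" and ?n = "length (snd p)"
      assume thr: "thr b ?c"
      then have c: "cyc ?c" using thr_cyc b by blast
      have pp: "p = pth ?c ?n" by (rule path_eq_pth[OF p c])
      let ?d = "(nx ^^ ?n) ?c"
      have "?c \<in> Oc b"
      proof (rule ccontr)
        assume "?c \<notin> Oc b"
        then have "fst p \<noteq> ?w" using thr B_hd'[OF p] by (auto simp: Oc_def)
        moreover have "coef \<xi> p = 0" "coef (Zc b \<star> \<eta>) p = 0"
        proof -
          show "coef \<xi> p = 0" using CwD[OF \<xi>C, of p] \<open>fst p \<noteq> ?w\<close> by auto
          have "Zc b \<star> \<eta> = path_elem (?w, []) \<star> (Zc b \<star> \<eta>)"
            by (simp add: Cw_left[OF Zc_Cw[OF b]] flip: mul_assoc)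
          then show "coef (Zc b \<star> \<eta>) p = 0"
            using \<open>fst p \<noteq> ?w\<close> coef_vertex_mul[of "Zc b \<star> \<eta>" ?w "fst p" "snd p"] by simp
        qed
        ultimately show False using nz by (simp add: lookup_minus)
      qed
      then have "coeff (P (Zc b \<star> \<eta>) ?c ?d) ?n = (if ?n < ?m then 0 else coeff (P \<eta> ?c ?d) (?n - ?m))"
        by (simp add: P_mul_Zc_left[OF b] coeff_monom_mult)
      also have "\<dots> = coef \<xi> p"
      proof -
        consider "?n < ?m" | "?n = ?m" | "?n > ?m" by linarith
        then show ?thesis
        proof cases
          case 1
          then show ?thesis using MgeD[OF lead(1)[OF \<open>?c \<in> Oc b\<close>], of p] by simp
        next
          case 2
          have "per ?c = ?m" using OcD[OF \<open>?c \<in> Oc b\<close> b] by blast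
          then have "?d = ?c" using 2 per(2)[OF c] by simp
          then show ?thesis using 2 lead(2)[OF \<open>?c \<in> Oc b\<close>] pp by (simp add: P\<eta>[OF \<open>?c \<in> Oc b\<close>])
        next
          case 3
          have "(nx ^^ (?n - ?m)) ?c = (nx ^^ (?n - ?m)) ((nx ^^ ?m) ?c)"
            using OcD[OF \<open>?c \<in> Oc b\<close> b] per(2)[OF c] by simp
          also have "\<dots> = ?d" using 3 by (simp add: it_it)
          finally show ?thesis using 3 pp by (simp add: P\<eta>[OF \<open>?c \<in> Oc b\<close>])
        qed
      qed
      finally have "coef (Zc b \<star> \<eta>) (pth ?c ?n) = coef \<xi> p" by (simp add: coeff_P)
      then show False using nz pp by (simp add: lookup_minus)
    qed
    then show "p \<in> B \<and> snd p \<noteq> [] \<and> \<not> thr b (hd (snd p))" using p by simp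
  qed
  then have "g (\<xi> - Zc b \<star> \<eta>) \<in> MT (\<lambda>a. \<not> thr b a)"
    by (rule nrm_MT[OF g thrc_not[OF thrc_thr]])
  then have "P (g (\<xi> - Zc b \<star> \<eta>)) b b = 0" by (rule P_MT) simp
  moreover have "g (\<xi> - Zc b \<star> \<eta>) = Zc b - ?G \<star> g \<eta>"
  proof -
    have "g \<xi> = Zc b" unfolding \<xi>_def by (rule vaut_inv_right[OF v Cw_M[OF Zc_Cw[OF b]]])
    then show ?thesis
      using \<xi>M \<eta>M by (simp add: vaut_diff[OF v] vaut_mul[OF v] Cw_M[OF Zc_Cw[OF b]])
  qed
  ultimately have "P (Zc b) b b = P (?G \<star> g \<eta>) b b" by (simp add: P_diff)
  also have "\<dots> = (\<Sum>e\<in>{e \<in> arcs Q. cyc e}. if e = b then P ?G b b * P (g \<eta>) b b else 0)"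
    unfolding P_mul[OF b]
  proof (intro sum.cong refl)
    fix e assume "e \<in> {e \<in> arcs Q. cyc e}"
    then show "P ?G b e * P (g \<eta>) e b = (if e = b then P ?G b b * P (g \<eta>) b b else 0)"
      using image_Zc_scalar[OF v b Oc_self[OF b], of e] by auto
  qed
  also have "\<dots> = P ?G b b * P (g \<eta>) b b" using b cyc_arcs by simp
  finally have FK: "monom 1 ?m = P ?G b b * P (g \<eta>) b b"
    using Oc_self[OF b] by (simp add: P_Zc[OF b])
  note Glead = image_Zc_lead[OF v nrm_lin[OF g] b Oc_self[OF b]]
  have F: "P ?G b b = monom 1 ?m"
  proof (rule poly_eqI)
    fix n
    have ne: "P ?G b b \<noteq> 0" "P (g \<eta>) b b \<noteq> 0" using FK by (auto simp: monom_eq_0_iff)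
    have "degree (P ?G b b) + degree (P (g \<eta>) b b) = ?m"
      using degree_mult_eq[OF ne] FK by (metis degree_monom_eq one_neq_zero)
    then have "coeff (P ?G b b) n = 0" if "n > ?m" using that by (intro coeff_eq_0) simp
    moreover have "coeff (P ?G b b) n = 0" if "n < ?m" using MgeD[OF Glead(1), of "pth b n"] that by (simp add: coeff_P)
    moreover have "coeff (P ?G b b) ?m = 1" using Glead(2) per[OF b] by (simp add: coeff_P)
    ultimately show "coeff (P ?G b b) n = coeff (monom 1 ?m) n" by (cases n ?m rule: linorder_cases) auto
  qed
  have "?G - Zc b = 0"
  proof (rule MT_eq_0[of _ "thr b"])
    show "?G - Zc b \<in> MT (thr b)"
      using Zc_MT[OF b] nrm_MT[OF g thrc_thr Zc_MT[OF b]] by blast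
    show "cyc a" if "thr b a" for a using thr_cyc that b by blast
    fix c d assume c: "thr b c" and d: "cyc d"
    have cc: "cyc c" using thr_cyc c b by blast
    show "P (?G - Zc b) c d = 0"
    proof (cases "c \<in> Oc b")
      case True
      then show ?thesis
        unfolding P_diff image_Zc_scalar[OF v b True d] P_Zc[OF b] F by auto
    next
      case False
      then have "tail Q c \<noteq> ?w" using c cyc_arcs[OF cc] by (auto simp: Oc_def)
      then have "P (?G - Zc b) c d = 0"
        using P_Cw(1)[OF Cw_diff[OF vaut_Cw[OF v w Zc_Cw[OF b]] Zc_Cw[OF b]] cc] by blast
      then show ?thesis .
    qed
  qed
  then show ?thesis by simp
qed

end

context gentle_quiver
begin

lemma Cw_MT_eq_0:
  assumes x: "x \<in> Cw (tail Q b)" "x \<in> MT (thr b)" and b: "cyc b"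
    and P: "\<And>c d. c \<in> Oc b \<Longrightarrow> d \<in> Oc b \<Longrightarrow> P x c d = 0"
  shows "x = 0"
proof (rule MT_eq_0[OF x(2)])
  show "cyc a" if "thr b a" for a using thr_cyc that b by blast
  fix c d assume c: "thr b c" and d: "cyc d"
  have cc: "cyc c" using thr_cyc c b by blast
  show "P x c d = 0"
  proof (rule ccontr)
    assume nz: "P x c d \<noteq> 0"
    have "c \<in> Oc b" "d \<in> Oc b"
      using P_Cw[OF x(1) cc nz] c cyc_arcs[OF cc] cyc_arcs[OF d] thr_trans by (auto simp: Oc_def)
    then show False using P nz by blast
  qed
qed

lemma P_mul_Cw:
  assumes x: "x \<in> Cw (tail Q b)" and b: "cyc b" and c: "c \<in> Oc b"
  shows "P (x \<star> y) c d = (\<Sum>e\<in>Oc b. P x c e * P y e d)"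
proof -
  have cc: "cyc c" "thr b c" using OcD[OF c b] by auto
  have "P x c e = 0" if e: "e \<in> {e \<in> arcs Q. cyc e} - Oc b" for e
  proof (rule ccontr)
    assume "P x c e \<noteq> 0"
    then show False using P_Cw[OF x cc(1)] e cc(2) thr_trans by (auto simp: Oc_def)
  qed
  then show ?thesis
    unfolding P_mul[OF cc(1)] using OcD[OF _ b] by (intro sum.mono_neutral_right) auto
qed

lemma it_reach_iff:
  assumes b: "cyc b" and r: "(nx ^^ r) b = c" "0 < r" "r < per b"
  shows "(nx ^^ n) b = c \<longleftrightarrow> r \<le> n \<and> per b dvd (n - r)"
proof (cases "r \<le> n")
  case True
  have c: "cyc c" "per c = per b" using cyc_it[OF b, of r] per_thr[OF thr_it[OF b, of r] b] r by auto
  have "(nx ^^ n) b = (nx ^^ (n - r)) c" using True r(1) it_it[of "n - r" r b] by simp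
  then show ?thesis using True it_eq_iff[OF c(1), of "n - r"] c(2) by simp
next
  case False
  have "(nx ^^ n) b \<noteq> c"
  proof
    assume n: "(nx ^^ n) b = c"
    have c: "cyc c" "per c = per b" using cyc_it[OF b, of r] per_thr[OF thr_it[OF b, of r] b] r by auto
    have "(nx ^^ (r - n)) c = (nx ^^ r) b" using False n it_it[of "r - n" n b] by simp
    then have "per b dvd (r - n)" using it_eq_iff[OF c(1), of "r - n"] c(2) r(1) by simp
    then show False using False r(3) by (auto dest: dvd_imp_le)
  qed
  then show ?thesis using False by simp
qed

lemma P_el_single:
  assumes "cyc b" "\<And>n. coeff f n \<noteq> 0 \<Longrightarrow> (nx ^^ n) b = d"
  shows "P (el b f) a e = (if a = b \<and> e = d then f - [:coeff f 0:] else 0)"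
proof (rule poly_eqI)
  fix n
  have "coeff (f - [:coeff f 0:]) n = (if 0 < n then coeff f n else 0)" by (cases n) auto
  then show "coeff (P (el b f) a e) n = coeff (if a = b \<and> e = d then f - [:coeff f 0:] else 0) n"
    using assms(2)[of n] by (auto simp: coeff_P_el[OF assms(1)])
qed

lemma matrix_element:
  fixes f\<^sub>1 f\<^sub>2 f\<^sub>3 f\<^sub>4 :: "'k::field poly"
  assumes b: "cyc b" and c: "Oc b = {b, c}" "b \<noteq> c"
    and f: "\<And>n. coeff f\<^sub>1 n \<noteq> 0 \<Longrightarrow> (nx ^^ n) b = b" "\<And>n. coeff f\<^sub>2 n \<noteq> 0 \<Longrightarrow> (nx ^^ n) b = c"
      "\<And>n. coeff f\<^sub>3 n \<noteq> 0 \<Longrightarrow> (nx ^^ n) c = b" "\<And>n. coeff f\<^sub>4 n \<noteq> 0 \<Longrightarrow> (nx ^^ n) c = c"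
    and one: "coeff f\<^sub>1 0 = 1" "coeff f\<^sub>4 0 = 1"
  obtains U where "U \<in> Cw (tail Q b)" "U - path_elem (tail Q b, []) \<in> MT (thr b)"
    "P U b b = f\<^sub>1" "P U b c = f\<^sub>2" "P U c b = f\<^sub>3" "P U c c = f\<^sub>4"
proof -
  let ?w = "tail Q b"
  have w: "?w \<in> verts Q" using cyc_arcs[OF b] by simp
  have cO: "c \<in> Oc b" using c by simp
  have cc: "cyc c" "tail Q c = ?w" "thr b c" using OcD[OF cO b] by auto
  have zero: "coeff f\<^sub>2 0 = 0" "coeff f\<^sub>3 0 = 0" using f(2)[of 0] f(3)[of 0] c(2) by auto
  let ?Y = "el b f\<^sub>1 + el b f\<^sub>2 + el c f\<^sub>3 + el c f\<^sub>4"
  have tl: "tail Q ((nx ^^ n) b) = ?w" if "coeff f\<^sub>1 n \<noteq> 0 \<or> coeff f\<^sub>2 n \<noteq> 0" for n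
    using that f(1,2)[of n] cc by auto
  have tl': "tail Q ((nx ^^ n) c) = tail Q c" if "coeff f\<^sub>3 n \<noteq> 0 \<or> coeff f\<^sub>4 n \<noteq> 0" for n
    using that f(3,4)[of n] cc by auto
  have Y: "?Y \<in> MT (thr b)"
    using el_MT[OF b, of "thr b"] el_MT[OF cc(1), of "thr b"] cc by (intro MT_closed) auto
  have "el b f\<^sub>1 \<in> Cw ?w" "el b f\<^sub>2 \<in> Cw ?w"
    using tl by (auto intro!: el_Cw[OF b])
  moreover have "el c f\<^sub>3 \<in> Cw (tail Q c)" "el c f\<^sub>4 \<in> Cw (tail Q c)"
    using tl' by (auto intro!: el_Cw[OF cc(1)])
  ultimately have YC: "?Y \<in> Cw ?w" unfolding cc(2) by (intro Cw_add)
  show thesis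
  proof (rule that[of "path_elem (?w, []) + ?Y"])
    show "path_elem (?w, []) + ?Y \<in> Cw ?w" using YC Cw_vertex[OF w] by (rule Cw_add[rotated])
    show "path_elem (?w, []) + ?Y - path_elem (?w, []) \<in> MT (thr b)" using Y by simp
    have *: "P (el b f\<^sub>1) e d = (if e = b \<and> d = b then f\<^sub>1 - 1 else 0)" "P (el b f\<^sub>2) e d = (if e = b \<and> d = c then f\<^sub>2 else 0)"
      "P (el c f\<^sub>3) e d = (if e = c \<and> d = b then f\<^sub>3 else 0)" "P (el c f\<^sub>4) e d = (if e = c \<and> d = c then f\<^sub>4 - 1 else 0)" for e d
      using P_el_single[of b f\<^sub>1 b e d, OF b f(1)] P_el_single[of b f\<^sub>2 c e d, OF b f(2)]
        P_el_single[of c f\<^sub>3 b e d, OF cc(1) f(3)] P_el_single[of c f\<^sub>4 c e d, OF cc(1) f(4)] one zero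
      by (auto simp: one_pCons)
    show "P (path_elem (?w, []) + ?Y) b b = f\<^sub>1" "P (path_elem (?w, []) + ?Y) b c = f\<^sub>2"
      "P (path_elem (?w, []) + ?Y) c b = f\<^sub>3" "P (path_elem (?w, []) + ?Y) c c = f\<^sub>4"
      using c(2) cc(2) by (simp_all add: P_add * P_vertex)
  qed
qed

text \<open>
  At a vertex passed twice by a cyclic thread, the two full cycles go to \<open>s\<^sup>m\<close> times complementary
  rank one idempotents, and the factorisation of such an idempotent provides the conjugating unit.
\<close>

lemma vertex_unit:
  fixes g :: "(('v, 'a) qpath \<Rightarrow>\<^sub>0 'k::field) \<Rightarrow> (('v, 'a) qpath \<Rightarrow>\<^sub>0 'k)"
  assumes g: "nrm g" and w: "w \<in> verts Q"
  shows "\<exists>U V. U \<in> Cw w \<and> V \<in> Cw w \<and> U \<star> V = path_elem (w, []) \<and> V \<star> U = path_elem (w, []) \<and>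
    U - path_elem (w, []) \<in> MT cyc \<and> V - path_elem (w, []) \<in> MT cyc \<and>
    (\<forall>b. cyc b \<and> tail Q b = w \<longrightarrow> U \<star> g (path_elem (cb b)) \<star> V = path_elem (cb b))"
proof (cases "\<exists>b c. cyc b \<and> tail Q b = w \<and> b \<noteq> c \<and> c \<in> Oc b")
  case False
  let ?E = "path_elem (w, []) :: ('v, 'a) qpath \<Rightarrow>\<^sub>0 'k"
  have "?E \<star> g (path_elem (cb b)) \<star> ?E = path_elem (cb b)" if b: "cyc b" "tail Q b = w" for b
  proof -
    have "Oc b = {b}" using False b Oc_self[OF b(1)] by (auto simp: set_eq_iff)
    then have "Zc b = (path_elem (cb b) :: _ \<Rightarrow>\<^sub>0 'k)" by (simp add: Zc_def)
    then have "g (path_elem (cb b)) = path_elem (cb b)" using nrm_Zc[OF g b(1)] by simp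
    then show ?thesis by (simp add: Cw_left[OF cb_Cw[OF b(1)], unfolded b(2)] Cw_right[OF cb_Cw[OF b(1)], unfolded b(2)])
  qed
  moreover have "?E \<star> ?E = ?E" using Cw_left[OF Cw_vertex[OF w]] .
  ultimately show ?thesis
    using Cw_vertex[OF w] by (intro exI[of _ ?E]) auto
next
  case True
  then obtain b c where b: "cyc b" "tail Q b = w" and bc: "b \<noteq> c" "c \<in> Oc b" by blast
  note v = nrm_vaut[OF g]
  have cc: "cyc c" "tail Q c = w" "thr b c" "per c = per b" "c \<in> arcs Q" using OcD[OF bc(2) b(1)] b by auto
  have O: "Oc b = {b, c}"
  proof
    show "Oc b \<subseteq> {b, c}"
    proof
      fix d assume "d \<in> Oc b"
      then show "d \<in> {b, c}"
        using out3[of b c d] cyc_arcs[OF b(1)] cc b bc by (auto simp: Oc_def)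
    qed
  qed (use bc Oc_self[OF b(1)] in auto)
  define m where "m = per b"
  define Gb where "Gb = g (path_elem (cb b))"
  define Gc where "Gc = g (path_elem (cb c))"
  define \<sigma> where "\<sigma> = monom (1 :: 'k) m"
  have m: "0 < m" unfolding m_def using per[OF b(1)] by simp
  have cbM: "(path_elem (cb b) :: _ \<Rightarrow>\<^sub>0 'k) \<in> M" "(path_elem (cb c) :: _ \<Rightarrow>\<^sub>0 'k) \<in> M"
    using cb_closed(1) b cc by auto
  have XC: "Gb \<in> Cw (tail Q b)" "Gc \<in> Cw (tail Q b)"
    unfolding Gb_def Gc_def using vaut_Cw[OF v w cb_Cw[OF b(1), unfolded b(2)]] vaut_Cw[OF v w cb_Cw[OF cc(1), unfolded cc(2)]] b(2) by auto
  have XT: "Gb \<in> MT (thr b)"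
    unfolding Gb_def using nrm_MT[OF g thrc_thr] cb_MT[OF b(1)] thr_refl by blast
  have XX: "Gb + Gc = Zc b"
    using nrm_Zc[OF g b(1)] bc(1) vaut_add[OF v cbM] by (simp add: Zc_def O Gb_def Gc_def)
  have PX: "P Gc e d = (if e = d then \<sigma> else 0) - P Gb e d" if "e \<in> Oc b" for e d
  proof -
    have "P Gb e d + P Gc e d = P (Zc b) e d" by (simp flip: XX P_add)
    then show ?thesis using that by (auto simp: P_Zc[OF b(1)] \<sigma>_def m_def algebra_simps)
  qed
  have sumO: "(\<Sum>e\<in>Oc b. h e) = h b + h c" for h :: "'a \<Rightarrow> 'k poly"
    unfolding O using bc(1) by simp
  have PM: "P (x \<star> y) e d = P x e b * P y b d + P x e c * P y c d" if "x \<in> Cw (tail Q b)" "e \<in> {b, c}"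
    for x y :: "('v, 'a) qpath \<Rightarrow>\<^sub>0 'k" and e d
    using P_mul_Cw[OF that(1) b(1), of e] that(2) O unfolding sumO by simp
  let ?y = "path_elem (cb b) \<star> path_elem (cb c) :: ('v, 'a) qpath \<Rightarrow>\<^sub>0 'k"
  have cbcb: "?y = 0"
  proof (rule Cw_MT_eq_0[OF _ _ b(1)])
    show "?y \<in> Cw (tail Q b)"
      by (intro Cw_mul) (simp_all add: cb_Cw[OF b(1), unfolded b(2)] cb_Cw[OF cc(1), unfolded cc(2)] b(2))
    show "?y \<in> MT (thr b)"
      by (rule MT_mul_right[OF cb_MT[OF b(1)]]) simp
    show "P ?y e d = 0" if "e \<in> Oc b" "d \<in> Oc b" for e d
      using that bc(1) O by (subst PM[OF cb_Cw[OF b(1)]]) (auto simp: P_cb b cc)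
  qed
  have "Gb \<star> Gc = 0" unfolding Gb_def Gc_def using cbcb vaut_mul[OF v cbM] v by simp
  then have XX0: "P Gb e b * P Gc b d + P Gb e c * P Gc c d = 0" if "e \<in> {b, c}" for e d
    using PM[OF XC(1) that, of Gc d] by simp
  define A B' C D where "A = P Gb b b" "B' = P Gb b c" "C = P Gb c b" "D = P Gb c c"
  note ABCD = A_B'_C_D_def
  have eqs: "A * (\<sigma> - A) = B' * C" "B' * (\<sigma> - A - D) = 0" "C * (\<sigma> - A - D) = 0" "D * (\<sigma> - D) = B' * C"
    using XX0[of b b] XX0[of b c] XX0[of c b] XX0[of c c] bc O
    by (auto simp: PX ABCD algebra_simps)
  have low: "coeff (P Gb e d) n = 0" if "n < m" for e d n
    using MgeD[OF cb_Mge[OF b(1) refl v], of "pth e n"] that by (auto simp: coeff_P Gb_def m_def)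
  have lead: "coeff A m = 1" "coeff D m = 0"
    using coef_image_cb[OF v nrm_lin[OF g] b(1) b(1)] coef_image_cb[OF v nrm_lin[OF g] cc(1) b(1)] bc b cc per[OF b(1)] per[OF cc(1)]
    by (auto simp: ABCD coeff_P Gb_def m_def)
  have AD: "A + D = \<sigma>"
  proof (cases "B' = 0 \<and> C = 0")
    case True
    have "A \<noteq> 0" using lead by auto
    then have "A = \<sigma>" using eqs(1) True by auto
    moreover have "D \<noteq> \<sigma>" using lead(2) by (auto simp: \<sigma>_def)
    then have "D = 0" using eqs(4) True by auto
    ultimately show ?thesis by simp
  next
    case False
    then have "\<sigma> - A - D = 0" using eqs(2,3) by auto
    then show ?thesis by (simp add: algebra_simps)
  qed
  have prod: "A * D = B' * C" using eqs(1) AD by (metis add_diff_cancel_left')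
  obtain r where r: "(nx ^^ r) b = c" "0 < r" "r < m"
  proof -
    obtain n where n: "(nx ^^ n) b = c" using it_reach[OF cc(3) b(1)] by auto
    have "(nx ^^ (n mod m)) b = (nx ^^ (n mod m)) ((nx ^^ (m * (n div m))) b)"
      by (simp add: it_mult_per[OF b(1)] m_def)
    also have "\<dots> = c" using n by (simp add: it_it)
    finally have "(nx ^^ (n mod m)) b = c" .
    moreover have "n mod m \<noteq> 0" using calculation bc(1) by (metis funpow_0)
    ultimately show thesis using that[of "n mod m"] m by simp
  qed
  define r' where "r' = m - r"
  have r': "(nx ^^ r') c = b" "0 < r'" "r' < m" "r + r' = m"
    using r it_it[of r' r b] per(2)[OF b(1)] by (auto simp: r'_def m_def)
  have itb: "(nx ^^ n) b = b \<longleftrightarrow> m dvd n" "(nx ^^ n) c = c \<longleftrightarrow> m dvd n"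
    "(nx ^^ n) b = c \<longleftrightarrow> r \<le> n \<and> m dvd (n - r)" "(nx ^^ n) c = b \<longleftrightarrow> r' \<le> n \<and> m dvd (n - r')" for n
    using it_eq_iff[OF b(1)] it_eq_iff[OF cc(1)] it_reach_iff[OF b(1) r(1,2)] it_reach_iff[OF cc(1) r'(1,2)]
      r r' cc(4) by (auto simp: m_def)
  define sp where "sp q = pcompose q (monom (1 :: 'k) m)" for q
  have spc: "coeff (sp q) n = (if m dvd n then coeff q (n div m) else 0)" for q n
    unfolding sp_def by (rule coeff_spread[OF m])
  have sp_inj: "p = q" if "sp p = sp q" for p q
  proof (rule poly_eqI)
    fix n show "coeff p n = coeff q n" using arg_cong[OF that, of "\<lambda>p. coeff p (m * n)"] m by (simp add: spc)
  qed
  have sph: "sp (p + q) = sp p + sp q" "sp (p - q) = sp p - sp q" "sp (- p) = - sp p" "sp (p * q) = sp p * sp q" "sp 1 = 1" for p q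
    unfolding sp_def by (simp_all add: pcompose_add pcompose_diff pcompose_uminus pcompose_mult pcompose_1)
  have spt: "sp [:0, 1:] = \<sigma>" unfolding sp_def \<sigma>_def by (simp add: pcompose_pCons)
  have hi: "m \<le> n" if "coeff (P Gb e d) n \<noteq> 0" for e d n
    using low[of n e d] that by (auto simp: not_less[symmetric])
  have sup: "\<exists>k. n = q + m * k + m" if "coeff (P Gb e d) n \<noteq> 0" "q \<le> n" "m dvd (n - q)" "q < m" for e d n q
  proof -
    obtain k where k: "n - q = m * k" using \<open>m dvd (n - q)\<close> by (auto elim: dvdE)
    have "n - q \<noteq> 0" using hi[OF that(1)] that(4) by simp
    then have "k \<noteq> 0" using k by auto
    then obtain j where "k = Suc j" by (cases k) auto
    then show ?thesis using k that(2) by (intro exI[of _ j]) (simp add: algebra_simps)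
  qed
  have deco: "\<exists>f. P Gb e d = monom 1 (m + q) * sp f \<and> (\<forall>k. coeff f k = coeff (P Gb e d) (m + q + m * k))"
    if q: "q < m" "\<And>n. (nx ^^ n) e = d \<longleftrightarrow> q \<le> n \<and> m dvd (n - q)" for e d q
  proof -
    have *: "m + q \<le> n \<and> m dvd (n - (m + q))" if nz: "coeff (P Gb e d) n \<noteq> 0" for n
    proof -
      have "(nx ^^ n) e = d" using nz by (auto simp: coeff_P split: if_splits)
      then obtain k where "n = q + m * k + m" using sup[OF nz, of q] q by auto
      then show ?thesis by simp
    qed
    obtain f where "P Gb e d = monom 1 (m + q) * pcompose f (monom 1 m)" "\<And>k. coeff f k = coeff (P Gb e d) (m + q + m * k)"
      using poly_spread[OF m *] by blast
    then show ?thesis unfolding sp_def by blast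
  qed
  obtain a where a: "A = \<sigma> * sp a" "coeff a 0 = 1"
    using deco[of 0 b b] itb m lead by (auto simp: ABCD \<sigma>_def)
  obtain d where d: "D = \<sigma> * sp d"
    using deco[of 0 c c] itb m by (auto simp: ABCD \<sigma>_def)
  define \<rho> \<rho>' where "\<rho> = monom (1 :: 'k) r" "\<rho>' = monom (1 :: 'k) r'"
  note rho = \<rho>_\<rho>'_def
  have rr: "\<rho> * \<rho>' = \<sigma>" using r' by (simp add: rho \<sigma>_def mult_monom)
  obtain be where be: "B' = \<sigma> * \<rho> * sp be"
    using deco[of r b c] itb r by (auto simp: ABCD \<sigma>_def rho mult_monom)
  obtain ga where ga: "C = \<sigma> * \<rho>' * sp ga"
    using deco[of r' c b] itb r' by (auto simp: ABCD \<sigma>_def rho mult_monom)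
  have \<sigma>0: "\<sigma> \<noteq> 0" by (simp add: \<sigma>_def monom_eq_0_iff)
  have "\<sigma> * sp (a + d) = \<sigma> * sp 1" using AD by (simp add: a d sph algebra_simps)
  then have ad: "a + d = 1" using \<sigma>0 sp_inj by simp
  have "\<sigma> * \<sigma> * sp (a * d) = \<sigma> * \<sigma> * sp ([:0, 1:] * (be * ga))"
  proof -
    have "\<sigma> * \<sigma> * sp (a * d) = A * D" by (simp add: a d sph ac_simps)
    also have "\<dots> = \<sigma> * \<sigma> * (\<rho> * \<rho>') * (sp be * sp ga)" unfolding prod be ga by (simp only: ac_simps)
    also have "\<dots> = \<sigma> * \<sigma> * sp ([:0, 1:] * (be * ga))" unfolding rr sph(4) spt by (simp only: ac_simps)
    finally show ?thesis .
  qed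
  then have adbc: "a * d = [:0, 1:] * (be * ga)" using \<sigma>0 sp_inj by (metis mult_cancel_left mult_eq_0_iff)
  obtain u1 u2 u3 u4 where u: "u1 * u4 - [:0, 1:] * (u2 * u3) = 1" "a = u4 * u1" "be = u4 * u2"
    "ga = - (u3 * u1)" "d = - ([:0, 1:] * (u3 * u2))" "coeff u1 0 = 1" "coeff u4 0 = 1"
    using idempotent_factor[OF ad adbc a(2)] .
  have det: "sp u1 * sp u4 - \<sigma> * (sp u2 * sp u3) = 1"
    using arg_cong[OF u(1), of sp] by (simp only: sph spt)
  have cm: "coeff (monom 1 q * sp f) n \<noteq> 0 \<Longrightarrow> q \<le> n \<and> m dvd (n - q)" for q n f
    by (auto simp: coeff_monom_mult spc split: if_splits)
  have c1: "coeff (sp f) n \<noteq> 0 \<Longrightarrow> m dvd n" for f n by (auto simp: spc split: if_splits)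
  have c0: "coeff (sp f) 0 = coeff f 0" for f by (simp add: spc)
  obtain U where U: "U \<in> Cw (tail Q b)" "U - path_elem (tail Q b, []) \<in> MT (thr b)"
    "P U b b = sp u1" "P U b c = \<rho> * sp u2" "P U c b = \<rho>' * sp u3" "P U c c = sp u4"
    by (rule matrix_element[OF b(1) O bc(1), of "sp u1" "\<rho> * sp u2" "\<rho>' * sp u3" "sp u4"])
      (use cm c1 itb u(6,7) in \<open>auto simp: rho c0\<close>)
  obtain V where V: "V \<in> Cw (tail Q b)" "V - path_elem (tail Q b, []) \<in> MT (thr b)"
    "P V b b = sp u4" "P V b c = \<rho> * sp (- u2)" "P V c b = \<rho>' * sp (- u3)" "P V c c = sp u1"
    by (rule matrix_element[OF b(1) O bc(1), of "sp u4" "\<rho> * sp (- u2)" "\<rho>' * sp (- u3)" "sp u1"])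
      (use cm c1 itb u(6,7) in \<open>auto simp: rho c0\<close>)
  let ?E = "path_elem (w, []) :: ('v, 'a) qpath \<Rightarrow>\<^sub>0 'k"
  have EC: "?E \<in> Cw (tail Q b)" using Cw_vertex[OF w] b(2) by simp
  have PE: "P ?E e d = (if e = d then 1 else 0)" if "e \<in> {b, c}" for e d
    using that b cc by (auto simp: P_vertex)
  have UVT: "x \<star> y - ?E \<in> MT (thr b)" "x \<star> y - ?E \<in> Cw (tail Q b)"
    if "x \<in> Cw (tail Q b)" "y \<in> Cw (tail Q b)" "x - ?E \<in> MT (thr b)" "y - ?E \<in> MT (thr b)" for x y
  proof -
    have eq: "x \<star> y - ?E = (x - ?E) \<star> y + (y - ?E)"
      using Cw_left[OF that(2)] b(2) by (simp add: mul_diff_left)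
    show "x \<star> y - ?E \<in> MT (thr b)" unfolding eq by (intro MT_closed(2) MT_mul_right that)
    show "x \<star> y - ?E \<in> Cw (tail Q b)" using that EC by (intro Cw_diff Cw_mul)
  qed
  have UE: "U - ?E \<in> MT (thr b)" "V - ?E \<in> MT (thr b)" using U(2) V(2) b(2) by auto
  have rs: "\<rho>' * \<rho> = \<sigma>" using rr by (simp add: mult.commute)
  have UV: "U \<star> V = ?E"
  proof -
    have "U \<star> V - ?E = 0"
    proof (rule Cw_MT_eq_0[OF UVT(2,1)[OF U(1) V(1) UE] b(1)])
      fix e d assume "e \<in> Oc b" "d \<in> Oc b"
      then have ed: "e \<in> {b, c}" "d \<in> {b, c}" using O by auto
      have "P (U \<star> V) e d = (if e = d then 1 else 0)"
        unfolding PM[OF U(1) ed(1)] using ed bc(1) det rr rs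
        by (auto simp: U(3-6) V(3-6) sph algebra_simps; metis mult.assoc mult.commute)
      then show "P (U \<star> V - ?E) e d = 0" using PE[OF ed(1)] by (simp add: P_diff)
    qed
    then show ?thesis by simp
  qed
  have VU: "V \<star> U = ?E"
  proof -
    have "V \<star> U - ?E = 0"
    proof (rule Cw_MT_eq_0[OF UVT(2,1)[OF V(1) U(1) UE(2,1)] b(1)])
      fix e d assume "e \<in> Oc b" "d \<in> Oc b"
      then have ed: "e \<in> {b, c}" "d \<in> {b, c}" using O by auto
      have "P (V \<star> U) e d = (if e = d then 1 else 0)"
        unfolding PM[OF V(1) ed(1)] using ed bc(1) det rr rs
        by (auto simp: U(3-6) V(3-6) sph algebra_simps; metis mult.assoc mult.commute)
      then show "P (V \<star> U - ?E) e d = 0" using PE[OF ed(1)] by (simp add: P_diff)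
    qed
    then show ?thesis by simp
  qed
  have UX: "U \<star> Gb = path_elem (cb b) \<star> U"
  proof -
    have "U \<star> Gb - path_elem (cb b) \<star> U = 0"
    proof (rule Cw_MT_eq_0[OF _ _ b(1)])
      show "U \<star> Gb - path_elem (cb b) \<star> U \<in> Cw (tail Q b)"
        by (intro Cw_diff Cw_mul U(1) XC(1) cb_Cw[OF b(1)])
      show "U \<star> Gb - path_elem (cb b) \<star> U \<in> MT (thr b)"
        by (intro MT_closed MT_mul_left[OF thrc_thr XT] MT_mul_right[OF cb_MT[OF b(1)]]) simp
      fix e d assume "e \<in> Oc b" "d \<in> Oc b"
      then have ed: "e \<in> {b, c}" "d \<in> {b, c}" using O by auto
      have AA: "P Gb b b = \<sigma> * (sp u4 * sp u1)" "P Gb b c = \<sigma> * \<rho> * (sp u4 * sp u2)"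
        "P Gb c b = - (\<sigma> * \<rho>' * (sp u3 * sp u1))" "P Gb c c = - (\<sigma> * (\<sigma> * (sp u3 * sp u2)))"
        using a(1) be ga d unfolding u(2-5) sph spt ABCD by simp_all
      have d1: "sp u1 * sp u4 = 1 + \<sigma> * (sp u2 * sp u3)" using det by (simp add: algebra_simps)
      have "sp u1 * (\<sigma> * (sp u4 * sp u1)) + \<rho> * sp u2 * - (\<sigma> * \<rho>' * (sp u3 * sp u1)) =
          \<sigma> * sp u1 * (sp u1 * sp u4 - (\<rho> * \<rho>') * (sp u2 * sp u3))" by (simp add: algebra_simps)
      then have e1: "sp u1 * (\<sigma> * (sp u4 * sp u1)) + \<rho> * sp u2 * - (\<sigma> * \<rho>' * (sp u3 * sp u1)) = \<sigma> * sp u1"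
        unfolding rr det by simp
      have "sp u1 * (\<sigma> * \<rho> * (sp u4 * sp u2)) + \<rho> * sp u2 * - (\<sigma> * (\<sigma> * (sp u3 * sp u2))) =
          \<sigma> * (\<rho> * sp u2) * (sp u1 * sp u4 - \<sigma> * (sp u2 * sp u3))" by (simp add: algebra_simps)
      then have e2: "sp u1 * (\<sigma> * \<rho> * (sp u4 * sp u2)) + \<rho> * sp u2 * - (\<sigma> * (\<sigma> * (sp u3 * sp u2))) = \<sigma> * (\<rho> * sp u2)"
        unfolding det by simp
      have e3: "\<rho>' * sp u3 * (\<sigma> * (sp u4 * sp u1)) + sp u4 * - (\<sigma> * \<rho>' * (sp u3 * sp u1)) = 0"
        by (simp add: algebra_simps)
      have "\<rho>' * sp u3 * (\<sigma> * \<rho> * (sp u4 * sp u2)) + sp u4 * - (\<sigma> * (\<sigma> * (sp u3 * sp u2))) =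
          \<sigma> * (sp u4 * (sp u3 * sp u2)) * (\<rho> * \<rho>' - \<sigma>)" by (simp add: algebra_simps)
      then have e4: "\<rho>' * sp u3 * (\<sigma> * \<rho> * (sp u4 * sp u2)) + sp u4 * - (\<sigma> * (\<sigma> * (sp u3 * sp u2))) = 0"
        unfolding rr by simp
      have "P (U \<star> Gb) e d = P (path_elem (cb b) \<star> U) e d"
        unfolding PM[OF U(1) ed(1)] PM[OF cb_Cw[OF b(1)] ed(1)] using ed bc(1)
        by (elim insertE emptyE; simp only: U(3-6) AA e1 e2 e3 e4; simp add: P_cb[OF b(1)] U(3-6) \<sigma>_def m_def)
      then show "P (U \<star> Gb - path_elem (cb b) \<star> U) e d = 0" by (simp add: P_diff)
    qed
    then show ?thesis by simp
  qed
  have resb: "U \<star> Gb \<star> V = path_elem (cb b)"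
    unfolding UX by (simp add: mul_assoc UV Cw_right[OF cb_Cw[OF b(1)], unfolded b(2)])
  have resc: "U \<star> Gc \<star> V = path_elem (cb c)"
  proof -
    have "Gc = Zc b - Gb" using XX by (simp add: algebra_simps)
    moreover have "U \<star> Zc b \<star> V = Zc b"
      by (simp add: Zc_central[OF b(1) U(1), symmetric] mul_assoc UV Cw_right[OF Zc_Cw[OF b(1)], unfolded b(2)])
    ultimately have "U \<star> Gc \<star> V = Zc b - path_elem (cb b)"
      using resb by (simp add: mul_diff_left mul_diff_right)
    then show ?thesis unfolding Zc_def O using bc(1) by simp
  qed
  have "U \<star> g (path_elem (cb e)) \<star> V = path_elem (cb e)" if "cyc e" "tail Q e = w" for e
  proof -
    have "e = b \<or> e = c" using out3[of b c e] that cyc_arcs b cc bc(1) by metis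
    then show ?thesis using resb resc unfolding Gb_def Gc_def by blast
  qed
  moreover have "U - ?E \<in> MT cyc" "V - ?E \<in> MT cyc"
    using UE MT_mono thr_cyc b(1) by blast+
  ultimately show ?thesis
    using U(1) V(1) UV VU b(2) by (intro exI[of _ U] exI[of _ V]) auto
qed

end

section \<open>Conjugation by units\<close>

context gentle_quiver
begin

abbreviation ev :: "'v \<Rightarrow> (('v, 'a) qpath \<Rightarrow>\<^sub>0 'k::field)" where "ev v \<equiv> path_elem (v, [])"

text \<open>A pair of mutually inverse units congruent to one whose conjugation fixes the vertices.\<close>

definition UP :: "(('v, 'a) qpath \<Rightarrow>\<^sub>0 'k::field) \<Rightarrow> (('v, 'a) qpath \<Rightarrow>\<^sub>0 'k) \<Rightarrow> bool" where
  "UP y z \<longleftrightarrow> y \<in> M \<and> z \<in> M \<and> y \<star> z = unit \<and> z \<star> y = unit \<and> y - unit \<in> Mp \<and> z - unit \<in> Mp \<and>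
     (\<forall>v\<in>verts Q. y \<star> ev v \<star> z = ev v)"

lemma UP_vaut: "UP y z \<Longrightarrow> vaut (\<lambda>x. y \<star> x \<star> z)"
  unfolding UP_def by (intro inner_vaut) auto

lemma UP_inner: "UP y z \<Longrightarrow> inner (\<lambda>x. y \<star> x \<star> z)"
  unfolding UP_def inner_def by (intro bexI[of _ "z - unit"] bexI[of _ y]) auto

lemma UP_sym: assumes "UP y z" shows "UP z y"
proof -
  have "z \<star> ev v \<star> y = ev v" if "v \<in> verts Q" for v
  proof -
    have "z \<star> ev v \<star> y = z \<star> (y \<star> ev v \<star> z) \<star> y" using assms that by (simp add: UP_def)
    also have "\<dots> = (z \<star> y) \<star> ev v \<star> (z \<star> y)" by (simp only: mul_assoc)
    also have "\<dots> = ev v" using assms that by (simp add: UP_def)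
    finally show ?thesis .
  qed
  then show ?thesis using assms by (simp add: UP_def)
qed

lemma inner_id: "inner id"
  unfolding inner_def by (intro bexI[of _ 0] bexI[of _ unit]) auto

lemma inner_comp:
  fixes g :: "(('v, 'a) qpath \<Rightarrow>\<^sub>0 'k::field) \<Rightarrow> (('v, 'a) qpath \<Rightarrow>\<^sub>0 'k)"
  assumes "inner g" "inner h" shows "inner (g \<circ> h)"
proof -
  obtain y z where g: "y \<in> Mp" "z \<in> M" "(unit + y) \<star> z = unit" "z \<star> (unit + y) = unit" "\<And>x. x \<in> M \<Longrightarrow> g x = z \<star> x \<star> (unit + y)"
    using assms(1) unfolding inner_def by blast
  obtain y' z' where h: "y' \<in> Mp" "z' \<in> M" "(unit + y') \<star> z' = unit" "z' \<star> (unit + y') = unit" "\<And>x. x \<in> M \<Longrightarrow> h x = z' \<star> x \<star> (unit + y')"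
    using assms(2) unfolding inner_def by blast
  let ?u = "unit + y" and ?u' = "unit + y'"
  let ?w = "y' + y + y' \<star> y"
  have uu: "?u' \<star> ?u = unit + ?w"
    using Mp_M[OF g(1)] Mp_M[OF h(1)] by (simp add: mul_add_left mul_add_right)
  have M: "?u \<in> M" "?u' \<in> M" using Mp_M g(1) h(1) by auto
  show ?thesis
    unfolding inner_def
  proof (intro bexI conjI ballI)
    show "?w \<in> Mp" using g(1) h(1) by simp
    show "z \<star> z' \<in> M" by simp
    have "?u' \<star> ?u \<star> (z \<star> z') = ?u' \<star> (?u \<star> z) \<star> z'" by (simp only: mul_assoc)
    then show "(unit + ?w) \<star> (z \<star> z') = unit" using g(3) h(3) M by (simp add: uu[symmetric])
    have "z \<star> z' \<star> (?u' \<star> ?u) = z \<star> (z' \<star> ?u') \<star> ?u" by (simp only: mul_assoc)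
    then show "z \<star> z' \<star> (unit + ?w) = unit" using g(2,4) h(4) M by (simp add: uu[symmetric])
    fix x :: "('v, 'a) qpath \<Rightarrow>\<^sub>0 'k" assume "x \<in> M"
    then show "(g \<circ> h) x = z \<star> z' \<star> x \<star> (unit + ?w)"
      unfolding uu[symmetric] by (simp add: h(5) g(5) mul_assoc)
  qed
qed

lemma inner_inv:
  fixes g :: "(('v, 'a) qpath \<Rightarrow>\<^sub>0 'k::field) \<Rightarrow> (('v, 'a) qpath \<Rightarrow>\<^sub>0 'k)"
  assumes g: "vaut g" "inner g" shows "inner (inv_into M g)"
proof -
  obtain y z where y: "y \<in> Mp" "z \<in> M" "(unit + y) \<star> z = unit" "z \<star> (unit + y) = unit" "\<And>x. x \<in> M \<Longrightarrow> g x = z \<star> x \<star> (unit + y)"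
    using g(2) unfolding inner_def by blast
  let ?u = "unit + y"
  have M: "?u \<in> M" using Mp_M y(1) by auto
  have inv: "inv_into M g x = ?u \<star> x \<star> z" if x: "x \<in> M" for x
  proof -
    have "g (?u \<star> x \<star> z) = (z \<star> ?u) \<star> x \<star> (z \<star> ?u)" using y(5) by (simp only: M_closed(1) mul_assoc)
    then have "g (?u \<star> x \<star> z) = x" using y(4) x by simp
    then show ?thesis using vaut_inv_left[OF g(1), of "?u \<star> x \<star> z"] by simp
  qed
  have "z - unit = - (y \<star> z)"
    using y(2,3) by (simp add: mul_add_left algebra_simps)
  then have "z - unit \<in> Mp" using y(1) by simp
  then show ?thesis
    unfolding inner_def
  proof (intro bexI conjI ballI)
    show "inv_into M g x = ?u \<star> x \<star> (unit + (z - unit))" if "x \<in> M" for x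
      using inv[OF that] by simp
  qed (use y(2-4) M in simp_all)
qed

lemma inner_conj:
  fixes f :: "(('v, 'a) qpath \<Rightarrow>\<^sub>0 'k::field) \<Rightarrow> (('v, 'a) qpath \<Rightarrow>\<^sub>0 'k)"
  assumes f: "vaut f" and n: "inner n" shows "inner (f \<circ> n \<circ> inv_into M f)"
proof -
  obtain y z where y: "y \<in> Mp" "z \<in> M" "(unit + y) \<star> z = unit" "z \<star> (unit + y) = unit" "\<And>x. x \<in> M \<Longrightarrow> n x = z \<star> x \<star> (unit + y)"
    using n unfolding inner_def by blast
  have yM: "y \<in> M" "unit + y \<in> M" using Mp_M y(1) by auto
  have fu: "f (unit + y) = unit + f y" using yM by (simp add: vaut_add[OF f] vaut_unit[OF f])
  show ?thesis
    unfolding inner_def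
  proof (intro bexI conjI ballI)
    show "f y \<in> Mp" by (rule vaut_Mp[OF f y(1)])
    show "f z \<in> M" using f y(2) by simp
    have "f (unit + y) \<star> f z = f ((unit + y) \<star> z)" "f z \<star> f (unit + y) = f (z \<star> (unit + y))"
      using y(2) yM by (simp_all add: vaut_mul[OF f])
    then show "(unit + f y) \<star> f z = unit" "f z \<star> (unit + f y) = unit"
      using y(3,4) vaut_unit[OF f] by (simp_all add: fu)
    fix x :: "('v, 'a) qpath \<Rightarrow>\<^sub>0 'k" assume x: "x \<in> M"
    then have i: "inv_into M f x \<in> M" using vaut_M[OF vaut_inv[OF f]] by blast
    then show "(f \<circ> n \<circ> inv_into M f) x = f z \<star> x \<star> (unit + f y)"
      using y(2) yM x by (simp add: y(5) vaut_mul[OF f] vaut_inv_right[OF f] fu)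
  qed
qed

lemma conj_expand:
  assumes "UP y z" "x \<in> M"
  shows "y \<star> x \<star> z = x + (y - unit) \<star> x + x \<star> (z - unit) + (y - unit) \<star> x \<star> (z - unit)"
  using assms by (simp add: UP_def mul_diff_left mul_diff_right algebra_simps mul_assoc)

lemma coef_conj_arrow:
  assumes "UP y z" "x \<in> Mp"
  shows "coef (y \<star> x \<star> z) (ar b) = coef x (ar b)"
proof -
  have m: "y - unit \<in> Mge 1" "z - unit \<in> Mge 1" "x \<in> Mge 1" using assms by (auto simp: UP_def Mge_1)
  have "(y - unit) \<star> x \<in> Mge (1 + 1)" "x \<star> (z - unit) \<in> Mge (1 + 1)" "(y - unit) \<star> x \<star> (z - unit) \<in> Mge (1 + 1 + 1)"
    using m by (intro Mge_mul; simp)+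
  then show ?thesis
    unfolding conj_expand[OF assms(1) Mp_M[OF assms(2)]] by (simp add: lookup_add MgeD arrow_path_def)
qed

text \<open>Conjugation does not change the linear part and cannot produce terms on another thread.\<close>

lemma conj_nrm:
  assumes g: "nrm g" and u: "UP y z" shows "nrm (\<lambda>x. y \<star> g x \<star> z)"
proof -
  have "vaut ((\<lambda>x. y \<star> x \<star> z) \<circ> g)" by (rule vaut_comp[OF UP_vaut[OF u] nrm_vaut[OF g]])
  then have v: "vaut (\<lambda>x. y \<star> g x \<star> z)" by (simp add: comp_def)
  have "y \<star> im g a \<star> z \<in> MT (thr a)" if "a \<in> arcs Q" for a
    by (intro MT_mul_right MT_mul_left thrc_thr nrm_im_MT[OF g that])
  then have "coef (y \<star> im g a \<star> z) p = 0" if "a \<in> arcs Q" "\<not> thr a (hd (snd p))" for a p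
    using MTD that by blast
  then show ?thesis
    using v g coef_conj_arrow[OF u im_Mp[OF nrm_vaut[OF g]]] by (simp add: nrm_def lin_def)
qed

section \<open>Normalised automorphisms fix the cyclic threads up to conjugation\<close>

text \<open>The units found at the single vertices lie in different corners, so their sum is again a unit.\<close>

lemma cyc_unit:
  assumes g: "nrm g"
  obtains y z where "UP y z" "\<And>b. cyc b \<Longrightarrow> y \<star> g (path_elem (cb b)) \<star> z = path_elem (cb b)"
proof -
  let ?R = "\<lambda>w UV. fst UV \<in> Cw w \<and> snd UV \<in> Cw w \<and> fst UV \<star> snd UV = ev w \<and> snd UV \<star> fst UV = ev w \<and>
    fst UV - ev w \<in> MT cyc \<and> snd UV - ev w \<in> MT cyc \<and>
    (\<forall>b. cyc b \<and> tail Q b = w \<longrightarrow> fst UV \<star> g (path_elem (cb b)) \<star> snd UV = path_elem (cb b))"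
  have "\<forall>w\<in>verts Q. \<exists>UV. ?R w UV" using vertex_unit[OF g] by auto
  then obtain h where h: "\<And>w. w \<in> verts Q \<Longrightarrow> ?R w (h w)" by (metis (no_types, lifting) bchoice)
  define U V where "U = (\<lambda>w. fst (h w))" "V = (\<lambda>w. snd (h w))"
  note UVd = U_V_def
  have UV: "U w \<in> Cw w" "V w \<in> Cw w" "U w \<star> V w = ev w" "V w \<star> U w = ev w" "U w - ev w \<in> MT cyc" "V w - ev w \<in> MT cyc"
    "\<And>b. cyc b \<Longrightarrow> tail Q b = w \<Longrightarrow> U w \<star> g (path_elem (cb b)) \<star> V w = path_elem (cb b)" if "w \<in> verts Q" for w
    using h[OF that] by (auto simp: UVd)
  have orth: "x \<star> y = 0" if "x \<in> Cw v" "y \<in> Cw w" "v \<noteq> w" for x y :: "('v, 'a) qpath \<Rightarrow>\<^sub>0 'b" and v w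
  proof -
    have "x \<star> y = (x \<star> ev v) \<star> (ev w \<star> y)" using that by (simp add: Cw_left Cw_right)
    also have "\<dots> = x \<star> (ev v \<star> ev w) \<star> y" by (simp only: mul_assoc)
    also have "\<dots> = 0" using that by (simp add: mul_path_elem path_tgt_eq)
    finally show ?thesis .
  qed
  define y z where "y = (\<Sum>w\<in>verts Q. U w)" "z = (\<Sum>w\<in>verts Q. V w)"
  note yz = y_z_def
  have yx: "y \<star> x = U v \<star> x" and xz: "x \<star> z = x \<star> V v" and zx: "z \<star> x = V v \<star> x"
    if v: "v \<in> verts Q" and x: "x \<in> Cw v" for v x
  proof -
    have "y \<star> x = (\<Sum>w\<in>verts Q. if w = v then U v \<star> x else 0)"
      unfolding yz mul_sum_left using orth[OF UV(1) x] by (intro sum.cong refl) auto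
    then show "y \<star> x = U v \<star> x" using v by simp
    have "x \<star> z = (\<Sum>w\<in>verts Q. if w = v then x \<star> V v else 0)"
      unfolding yz mul_sum_right using orth[OF x UV(2)] by (intro sum.cong refl) auto
    then show "x \<star> z = x \<star> V v" using v by simp
    have "z \<star> x = (\<Sum>w\<in>verts Q. if w = v then V v \<star> x else 0)"
      unfolding yz mul_sum_left using orth[OF UV(2) x] by (intro sum.cong refl) auto
    then show "z \<star> x = V v \<star> x" using v by simp
  qed
  have yxz: "y \<star> x \<star> z = U v \<star> x \<star> V v" if v: "v \<in> verts Q" and x: "x \<in> Cw v" for v x
    using yx[OF v x] xz[OF v Cw_mul[OF UV(1)[OF v] x]] by simp
  have "UP y z"
    unfolding UP_def
  proof (intro conjI ballI)
    show "y \<in> M" "z \<in> M" unfolding yz using UV Cw_M by blast+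
    have "y \<star> z = (\<Sum>w\<in>verts Q. y \<star> V w)" unfolding yz(2) mul_sum_right ..
    also have "\<dots> = (\<Sum>w\<in>verts Q. ev w)" using yx UV by (intro sum.cong refl) simp
    finally show "y \<star> z = unit" by (simp add: unit_def)
    have "z \<star> y = (\<Sum>w\<in>verts Q. z \<star> U w)" unfolding yz(1) mul_sum_right ..
    also have "\<dots> = (\<Sum>w\<in>verts Q. ev w)" using zx UV by (intro sum.cong refl) simp
    finally show "z \<star> y = unit" by (simp add: unit_def)
    have "y - unit = (\<Sum>w\<in>verts Q. U w - ev w)" "z - unit = (\<Sum>w\<in>verts Q. V w - ev w)"
      by (simp_all add: yz unit_def sum_subtractf)
    then show "y - unit \<in> Mp" "z - unit \<in> Mp" using UV(5,6) MT_Mp by (auto intro!: Mp_sum)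
    show "y \<star> ev v \<star> z = ev v" if "v \<in> verts Q" for v
      using yxz[OF that Cw_vertex[OF that]] UV[OF that] by (simp add: Cw_right)
  qed
  moreover have "y \<star> g (path_elem (cb b)) \<star> z = path_elem (cb b)" if b: "cyc b" for b
  proof -
    have w: "tail Q b \<in> verts Q" using cyc_arcs[OF b] by simp
    show ?thesis
      using yxz[OF w vaut_Cw[OF nrm_vaut[OF g] w cb_Cw[OF b]]] UV(7)[OF w b] by simp
  qed
  ultimately show thesis by (rule that)
qed

lemma P_ar: "P (path_elem (ar a)) e d = (if e = a \<and> d = nx a then monom 1 1 else 0)"
proof -
  have "ar a = pth a 1" by (simp add: pth_def arrow_path_def)
  then show ?thesis using P_path[of 1 a e d] by auto
qed

lemma P_Zc_cb: "cyc a \<Longrightarrow> P (Zc a - path_elem (cb a)) b a = 0" "cyc a \<Longrightarrow> P (Zc a - path_elem (cb a)) a b = 0"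
  using Oc_self[of a] by (cases "b = a"; simp add: P_diff P_Zc P_cb)+

text \<open>
  The full cycle at \<open>a\<close> followed by \<open>a\<close> is \<open>a\<close> followed by the full cycle at the next arrow. As full
  cycles are fixed, comparing both products confines the image of \<open>a\<close> to one entry.
\<close>

lemma P_im_single:
  assumes g: "nrm g" and fx: "\<And>b. cyc b \<Longrightarrow> g (path_elem (cb b)) = path_elem (cb b)"
    and a: "cyc a" and e: "cyc e" and d: "cyc d"
  shows "P (im g a) e d = (if e = a \<and> d = nx a then P (im g a) a (nx a) else 0)"
proof (rule ccontr)
  note v = nrm_vaut[OF g]
  let ?E = "path_elem (ar a) :: ('v, 'a) qpath \<Rightarrow>\<^sub>0 'b"
  have aa: "a \<in> arcs Q" by (rule cyc_arcs[OF a])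
  assume "\<not> ?thesis"
  then have nz: "P (im g a) e d \<noteq> 0" and ne: "e \<noteq> a \<or> d \<noteq> nx a" by (auto split: if_splits)
  obtain n where "coeff (P (im g a) e d) n \<noteq> 0" using nz by (metis coeff_0 poly_eqI)
  then have n: "(nx ^^ n) e = d" "coef (im g a) (pth e n) \<noteq> 0" by (auto simp: coeff_P split: if_splits)
  obtain es where es: "pth e n = (tail Q e, es)" by (simp add: pth_def)
  have t: "tail Q e = tail Q a" "tail Q d = head Q a" "0 < n"
    using im_coefD[OF v aa, of "tail Q e" es] n es tgt_pth[OF e, of n] by (cases n; auto simp: pth_0)+
  have thr: "thr a e" using MTD[OF nrm_im_MT[OF g aa] n(2)] hd_pth[OF t(3), of e] by simp
  have thd: "thr a d" using thr_trans[OF thr thr_it[OF e, of n]] n by simp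
  have na: "nz a (nx a)" "cyc (nx a)" "thr a (nx a)" using cyc_nx[OF a] cyc_nx_cyc[OF a] nz_thr by auto
  have th: "head Q a = tail Q (nx a)" using nz_arcs[OF na(1)] by simp
  have eO: "e \<in> Oc a" using t thr cyc_arcs[OF e] by (auto simp: Oc_def)
  have dO: "d \<in> Oc (nx a)" using t th thr_trans[OF thr_sym[OF na(3)] thd] cyc_arcs[OF d] by (auto simp: Oc_def)
  have left: "(Zc a - path_elem (cb a)) \<star> im g a = 0"
  proof -
    have "(Zc a - path_elem (cb a)) \<star> ?E = 0"
    proof (rule MT_eq_0[of _ cyc])
      have "Zc a - path_elem (cb a) \<in> MT (thr a)"
        using Zc_MT[OF a] cb_MT[OF a, of "thr a"] by (intro MT_closed) auto
      then show "(Zc a - path_elem (cb a)) \<star> ?E \<in> MT cyc"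
        using MT_mul_right MT_mono[of _ "thr a" cyc] thr_cyc a by blast
      fix b c assume b: "cyc b" and "cyc c"
      have z: "P (Zc a - path_elem (cb a)) b f * P ?E f c = 0" for f
        by (cases "f = a") (simp_all add: P_ar P_Zc_cb[OF a])
      show "P ((Zc a - path_elem (cb a)) \<star> ?E) b c = 0" unfolding P_mul[OF b] using z by (intro sum.neutral) blast
    qed
    moreover have "g ((Zc a - path_elem (cb a)) \<star> ?E) = (Zc a - path_elem (cb a)) \<star> im g a"
      using aa
      by (simp add: vaut_mul[OF v] vaut_diff[OF v] nrm_Zc[OF g a] fx[OF a] Cw_M[OF Zc_Cw[OF a]] Cw_M[OF cb_Cw[OF a]])
    ultimately show ?thesis using vaut_zero[OF v] by simp
  qed
  have right: "im g a \<star> (Zc (nx a) - path_elem (cb (nx a))) = 0"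
  proof -
    have "?E \<star> (Zc (nx a) - path_elem (cb (nx a))) = 0"
    proof (rule MT_eq_0[of _ cyc])
      have "?E \<in> MT cyc" using a aa by (intro MT_path) (auto simp: arrow_path_def)
      then show "?E \<star> (Zc (nx a) - path_elem (cb (nx a))) \<in> MT cyc" by (rule MT_mul_right)
      fix b c assume b: "cyc b" and "cyc c"
      have z: "P ?E b f * P (Zc (nx a) - path_elem (cb (nx a))) f c = 0" for f
        by (cases "f = nx a") (simp_all add: P_ar P_Zc_cb[OF na(2)])
      show "P (?E \<star> (Zc (nx a) - path_elem (cb (nx a)))) b c = 0" unfolding P_mul[OF b] using z by (intro sum.neutral) blast
    qed
    moreover have "g (?E \<star> (Zc (nx a) - path_elem (cb (nx a)))) = im g a \<star> (Zc (nx a) - path_elem (cb (nx a)))"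
      using aa by (simp add: vaut_mul[OF v] vaut_diff[OF v] nrm_Zc[OF g na(2)] fx[OF na(2)]
          Cw_M[OF Zc_Cw[OF na(2)]] Cw_M[OF cb_Cw[OF na(2)]])
    ultimately show ?thesis using vaut_zero[OF v] by simp
  qed
  show False
  proof (cases "e = a")
    case False
    have "P ((Zc a - path_elem (cb a)) \<star> im g a) e d =
        (\<Sum>f\<in>{f \<in> arcs Q. cyc f}. if f = e then monom 1 (per a) * P (im g a) e d else 0)"
      unfolding P_mul[OF e] using eO False
      by (intro sum.cong refl) (auto simp: P_diff P_Zc[OF a] P_cb[OF a])
    then have "monom 1 (per a) * P (im g a) e d = 0" using e cyc_arcs left by simp
    then show False using nz by (simp add: monom_eq_0_iff)
  next
    case True
    then have "d \<noteq> nx a" using ne by simp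
    then have "P (im g a \<star> (Zc (nx a) - path_elem (cb (nx a)))) e d =
        (\<Sum>f\<in>{f \<in> arcs Q. cyc f}. if f = d then P (im g a) e d * monom 1 (per (nx a)) else 0)"
      unfolding P_mul[OF e] using dO
      by (intro sum.cong refl) (auto simp: P_diff P_Zc[OF na(2)] P_cb[OF na(2)])
    then have "P (im g a) e d * monom 1 (per (nx a)) = 0" using d cyc_arcs right by simp
    then show False using nz by (simp add: monom_eq_0_iff)
  qed
qed

text \<open>
  The product of the remaining entries along one period is the monomial of a full cycle. Each factor has
  degree at least one, so each of them has degree exactly one.
\<close>

lemma cyc_arrow_fixed:
  assumes g: "nrm g" and fx: "\<And>b. cyc b \<Longrightarrow> g (path_elem (cb b)) = path_elem (cb b)" and a: "cyc a"
  shows "im g a = path_elem (ar a)"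
proof -
  note v = nrm_vaut[OF g]
  define f where "f c = P (im g c) c (nx c)" for c
  have f1: "coeff (f c) 1 = 1" if c: "cyc c" for c
  proof -
    have "pth c 1 = ar c" by (simp add: pth_def arrow_path_def)
    then show ?thesis using g cyc_arcs[OF c] by (simp add: f_def coeff_P nrm_def lin_def)
  qed
  have f0: "coeff (f c) 0 = 0" if c: "cyc c" for c
    using im_Mp[OF v cyc_arcs[OF c]] by (simp add: f_def coeff_P pth_0 Mp_def)
  have prod: "P (g (path_elem (pth a n))) a d = (if d = (nx ^^ n) a then \<Prod>i<n. f ((nx ^^ i) a) else 0)" if d: "cyc d" for n d
    using d
  proof (induction n arbitrary: d)
    case 0
    then show ?case using cyc_arcs[OF a] by (simp add: pth_0 vaut_vertex[OF v] P_vertex)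
  next
    case (Suc n)
    let ?c = "(nx ^^ n) a"
    have c: "cyc ?c" by (rule cyc_it[OF a])
    have sp: "pth a (Suc n) = (fst (pth a n), snd (pth a n) @ snd (ar ?c))" by (simp add: pth_def arrow_path_def)
    have "path_elem (pth a n) \<star> path_elem (ar ?c) = (path_elem (pth a (Suc n)) :: _ \<Rightarrow>\<^sub>0 'b)"
      unfolding mul_path_elem sp[symmetric] using pth_B[OF a] tgt_pth[OF a] by (simp add: arrow_path_def)
    then have "P (g (path_elem (pth a (Suc n)))) a d = P (g (path_elem (pth a n)) \<star> im g ?c) a d"
      using pth_B[OF a, of n] cyc_arcs[OF c] vaut_mul[OF v, of "path_elem (pth a n)" "path_elem (ar ?c)"] by simp
    also have "\<dots> = (\<Sum>e\<in>{e \<in> arcs Q. cyc e}. if e = ?c then (\<Prod>i<n. f ((nx ^^ i) a)) * P (im g ?c) ?c d else 0)"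
      unfolding P_mul[OF a] using Suc.IH by (intro sum.cong refl) auto
    also have "\<dots> = (\<Prod>i<n. f ((nx ^^ i) a)) * P (im g ?c) ?c d" using c cyc_arcs by simp
    also have "\<dots> = (if d = (nx ^^ Suc n) a then \<Prod>i<Suc n. f ((nx ^^ i) a) else 0)"
      using P_im_single[OF g fx c c Suc.prems] by (auto simp: f_def)
    finally show ?case .
  qed
  have "monom 1 (per a) = (\<Prod>i<per a. f ((nx ^^ i) a))"
    using prod[OF a, of "per a"] fx[OF a] per(2)[OF a] by (simp add: cb_def[symmetric] P_cb[OF a])
  moreover have nz: "f ((nx ^^ i) a) \<noteq> 0" for i using f1[OF cyc_it[OF a, of i]] by auto
  ultimately have "per a = (\<Sum>i<per a. degree (f ((nx ^^ i) a)))"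
    using degree_prod_eq_sum_degree[of "{..<per a}" "\<lambda>i. f ((nx ^^ i) a)"] by (metis degree_monom_eq one_neq_zero)
  moreover have d1: "1 \<le> degree (f ((nx ^^ i) a))" for i
    using f1[OF cyc_it[OF a, of i]] by (intro le_degree) simp
  ultimately have "degree (f ((nx ^^ i) a)) = 1" if "i < per a" for i
  proof -
    have "(\<Sum>i<per a. degree (f ((nx ^^ i) a)) - 1) = 0"
      using \<open>per a = (\<Sum>i<per a. degree (f ((nx ^^ i) a)))\<close> d1 by (subst sum_subtractf_nat) auto
    then show ?thesis using that d1[of i] by (auto simp: le_antisym)
  qed
  from this[of 0] have deg: "degree (f a) = 1" using per(1)[OF a] by simp
  have fa: "f a = monom 1 1"
  proof (rule poly_eqI)
    fix n show "coeff (f a) n = coeff (monom 1 1) n"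
      using f0[OF a] f1[OF a] deg by (cases "n = 0 \<or> n = 1") (auto simp: coeff_eq_0)
  qed
  let ?E = "path_elem (ar a) :: ('v, 'a) qpath \<Rightarrow>\<^sub>0 'b"
  have "im g a - ?E = 0"
  proof (rule MT_eq_0[of _ cyc])
    have "im g a \<in> MT cyc" by (rule MT_mono[OF nrm_im_MT[OF g cyc_arcs[OF a]]]) (use thr_cyc a in blast)
    moreover have "?E \<in> MT cyc" using a cyc_arcs[OF a] by (intro MT_path) (auto simp: arrow_path_def)
    ultimately show "im g a - ?E \<in> MT cyc" by simp
    fix e d assume "cyc e" "cyc d"
    show "P (im g a - ?E) e d = 0"
      using P_im_single[OF g fx a \<open>cyc e\<close> \<open>cyc d\<close>] fa by (simp add: P_diff P_ar f_def)
  qed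
  then show ?thesis by simp
qed

end

section \<open>The standard automorphisms\<close>

context gentle_quiver
begin

definition hasg :: "'a \<Rightarrow> bool" where "hasg a \<longleftrightarrow> (\<exists>p. gbar a p)"

definition gp :: "'a \<Rightarrow> ('v, 'a) qpath" where "gp a = (SOME p. gbar a p)"

text \<open>Zero when there is no such maximal path, which lets all arrows be treated uniformly.\<close>

definition gb :: "'a \<Rightarrow> (('v, 'a) qpath \<Rightarrow>\<^sub>0 'k::field)" where "gb a = (if hasg a then path_elem (gp a) else 0)"

text \<open>The image \<open>\<lambda>\<^sub>a (a + \<mu>\<^sub>a \<gamma>\<^sub>a)\<close> of \<open>a\<close> under a standard automorphism.\<close>

definition eimg :: "('a \<Rightarrow> 'k::field) \<Rightarrow> ('a \<Rightarrow> 'k) \<Rightarrow> 'a \<Rightarrow> (('v, 'a) qpath \<Rightarrow>\<^sub>0 'k)" where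
  "eimg l m a = scale (l a) (path_elem (ar a)) + scale (l a * m a) (gb a)"

definition emap :: "('a \<Rightarrow> 'k::field) \<Rightarrow> ('a \<Rightarrow> 'k) \<Rightarrow> (('v, 'a) qpath \<Rightarrow>\<^sub>0 'k) \<Rightarrow> (('v, 'a) qpath \<Rightarrow>\<^sub>0 'k)" where
  "emap l m = ext (eimg l m)"

text \<open>The scalar by which a standard automorphism multiplies the maximal path attached to \<open>a\<close>.\<close>

definition wt :: "('a \<Rightarrow> 'k::field) \<Rightarrow> 'a \<Rightarrow> 'k" where "wt l a = prod_list (map l (snd (gp a)))"

lemma gp: "hasg a \<Longrightarrow> gbar a (gp a)"
  unfolding hasg_def gp_def by (rule someI_ex)

lemma gp_B: "hasg a \<Longrightarrow> gp a \<in> B \<and> snd (gp a) \<noteq> [] \<and> fst (gp a) = tail Q a \<and> tgt (gp a) = head Q a"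
  using gp by (auto simp: gbar_def maximal_def)

lemma ar_par: "a \<in> arcs Q \<Longrightarrow> path_elem (ar a) \<in> par a"
  by (rule vend_par[of "\<lambda>x. x"]) (auto simp: vend_def)

lemma par_path: "p \<in> B \<Longrightarrow> fst p = tail Q a \<Longrightarrow> tgt p = head Q a \<Longrightarrow> path_elem p \<in> par a"
  by (auto simp: par_def coef_path_elem split: if_splits)

lemma gb_par: "gb a \<in> par a"
  using gp_B[of a] par_path[of "gp a" a] by (auto simp: gb_def par_def)

lemma gb_Mp: "gb a \<in> Mp"
  using gp_B[of a] by (auto simp: gb_def intro: Mp_path_elem)

lemma par_closed: "x \<in> par a \<Longrightarrow> y \<in> par a \<Longrightarrow> x + y \<in> par a" "x \<in> par a \<Longrightarrow> scale c x \<in> par a"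
  by (rule parI; simp add: par_M par_tail par_head mul_add_left mul_add_right mul_scale_left mul_scale_right)+

lemma eimg_par: "a \<in> arcs Q \<Longrightarrow> eimg l m a \<in> par a"
  unfolding eimg_def by (intro par_closed ar_par gb_par)

text \<open>Nothing can be composed with a maximal path; so the terms added to the arrows never interact.\<close>

lemma maximal_mul:
  assumes p: "maximal p" and x: "x \<in> Mp"
  shows "x \<star> path_elem p = 0" "path_elem p \<star> x = 0"
proof -
  have pp: "snd p \<noteq> []" "\<And>c. \<not> nz (last (snd p)) c" "\<And>c. \<not> nz c (hd (snd p))"
    using p by (auto simp: maximal_def)
  have "coef (x \<star> path_elem p) (v, es) = 0" for v es
  proof (rule ccontr)
    assume nz: "coef (x \<star> path_elem p) (v, es) \<noteq> 0"
    obtain i where i: "i \<le> length es" "(v, es) \<in> B" "coef x (v, take i es) \<noteq> 0"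
      "coef (path_elem p :: _ \<Rightarrow>\<^sub>0 'b) (tgt (v, take i es), drop i es) \<noteq> 0"
      by (rule mul_coef_cut[OF nz])
    have i4: "p = (tgt (v, take i es), drop i es)" using i(4) by (simp add: coef_path_elem split: if_splits)
    have "take i es \<noteq> []"
    proof
      assume "take i es = []"
      then have "coef x (v, []) \<noteq> 0" using i(3) by metis
      then show False using x by (simp add: Mp_def)
    qed
    then show False using B_append[of v "take i es" "drop i es"] i(2) i4 pp by auto
  qed
  then show "x \<star> path_elem p = 0" by (intro poly_mapping_eqI) auto
  have "coef (path_elem p \<star> x) (v, es) = 0" for v es
  proof (rule ccontr)
    assume nz: "coef (path_elem p \<star> x) (v, es) \<noteq> 0"
    obtain i where i: "i \<le> length es" "(v, es) \<in> B" "coef (path_elem p :: _ \<Rightarrow>\<^sub>0 'b) (v, take i es) \<noteq> 0"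
      "coef x (tgt (v, take i es), drop i es) \<noteq> 0"
      by (rule mul_coef_cut[OF nz])
    have i3: "p = (v, take i es)" using i(3) by (simp add: coef_path_elem split: if_splits)
    have "drop i es \<noteq> []"
    proof
      assume "drop i es = []"
      then have "coef x (tgt (v, take i es), []) \<noteq> 0" using i(4) by metis
      then show False using x by (simp add: Mp_def)
    qed
    then show False using B_append[of v "take i es" "drop i es"] i(2) i3 pp by auto
  qed
  then show "path_elem p \<star> x = 0" by (intro poly_mapping_eqI) auto
qed

lemma gb_mul: "x \<in> Mp \<Longrightarrow> x \<star> gb a = 0" "x \<in> Mp \<Longrightarrow> gb a \<star> x = 0"
  using maximal_mul[of "gp a" x] gp[of a] by (auto simp: gb_def gbar_def)

lemma ar_Mp: "a \<in> arcs Q \<Longrightarrow> path_elem (ar a) \<in> Mp"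
  by (intro Mp_path_elem) (auto simp: arrow_path_def)

lemma ar_mul: "a \<in> arcs Q \<Longrightarrow> b \<in> arcs Q \<Longrightarrow> \<not> nz a b \<Longrightarrow> path_elem (ar a) \<star> path_elem (ar b) = 0"
  by (auto simp: mul_path_elem arrow_path_def path_tgt_eq B_iff)

lemma eimg_mul:
  assumes "a \<in> arcs Q" "b \<in> arcs Q"
  shows "eimg l m a \<star> eimg l m b = scale (l a * l b) (path_elem (ar a) \<star> path_elem (ar b))"
  unfolding eimg_def using assms
  by (simp add: mul_add_left mul_add_right mul_scale_left mul_scale_right gb_mul ar_Mp gb_Mp scale_scale mult.commute)

lemma emap_vend: "vend (emap l m)" and emap_arrow: "a \<in> arcs Q \<Longrightarrow> emap l m (path_elem (ar a)) = eimg l m a"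
  unfolding emap_def by (rule vend_ext; simp add: eimg_par eimg_mul ar_mul)+

lemma path_image_eimg:
  "(v, es) \<in> B \<Longrightarrow> 2 \<le> length es \<Longrightarrow> path_image (eimg l m) v es = scale (prod_list (map l es)) (path_elem (v, es))"
proof (induction es arbitrary: v)
  case (Cons a es)
  have a: "a \<in> arcs Q" "(head Q a, es) \<in> B" "v = tail Q a" using B_Cons[OF Cons.prems(1)] by auto
  show ?case
  proof (cases "length es = 1")
    case True
    then obtain b where es: "es = [b]" by (auto simp: length_Suc_conv)
    have b: "b \<in> arcs Q" "head Q a = tail Q b" using a es by auto
    have "path_image (eimg l m) v (a # es) = eimg l m a \<star> eimg l m b"
      by (simp add: es par_head[OF eimg_par[OF b(1)]])
    also have "\<dots> = scale (l a * l b) (path_elem (ar a) \<star> path_elem (ar b))"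
      using a b by (simp add: eimg_mul)
    also have "path_elem (ar a) \<star> path_elem (ar b) = (path_elem (v, a # es) :: _ \<Rightarrow>\<^sub>0 'b)"
      unfolding path_elem_Cons[OF Cons.prems(1)] by (simp add: es b arrow_path_def)
    finally show ?thesis by (simp add: es)
  next
    case False
    then have l: "2 \<le> length es" using Cons.prems(2) by simp
    then have E: "(path_elem (head Q a, es) :: _ \<Rightarrow>\<^sub>0 'b) \<in> Mp" using a(2) by (intro Mp_path_elem) auto
    have "path_image (eimg l m) v (a # es) = eimg l m a \<star> scale (prod_list (map l es)) (path_elem (head Q a, es))"
      using Cons.IH[OF a(2) l] by simp
    also have "\<dots> = scale (prod_list (map l (a # es))) (path_elem (ar a) \<star> path_elem (head Q a, es))"
      by (simp add: eimg_def mul_add_left mul_scale_left mul_scale_right scale_scale gb_mul(2)[OF E] mult.commute)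
    also have "path_elem (ar a) \<star> path_elem (head Q a, es) = (path_elem (v, a # es) :: _ \<Rightarrow>\<^sub>0 'b)"
      by (rule path_elem_Cons[OF Cons.prems(1), symmetric])
    finally show ?thesis .
  qed
qed simp

lemma emap_gb:
  assumes nk: "\<not> kron" and a: "a \<in> arcs Q"
  shows "emap l m (gb a) = scale (wt l a) (gb a)"
proof (cases "hasg a")
  case True
  obtain v es where p: "gp a = (v, es)" by fastforce
  have B: "(v, es) \<in> B" "es \<noteq> []" using gp_B[OF True] p by auto
  have "path_image (eimg l m) v es = scale (wt l a) (path_elem (v, es))"
  proof (cases "length es = 1")
    case one: True
    then obtain b where es: "es = [b]" by (auto simp: length_Suc_conv)
    have b: "b \<in> arcs Q" "v = tail Q b" using B es by auto
    have "gbar a (ar b)" using gp[OF True] p es b by (simp add: arrow_path_def)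
    then have "\<not> hasg b" using gbar_arrow[OF nk a b(1)] by (auto simp: hasg_def)
    then have "eimg l m b = scale (l b) (path_elem (ar b))" by (simp add: eimg_def gb_def)
    then show ?thesis using par_head[OF eimg_par[OF b(1)], of l m] p es b by (simp add: wt_def arrow_path_def)
  next
    case False
    then have "2 \<le> length es" using B(2) by (cases es rule: remdups_adj.cases) auto
    then show ?thesis using path_image_eimg[OF B(1)] p by (simp add: wt_def)
  qed
  then show ?thesis using True p by (simp add: gb_def emap_def ext_path_elem)
next
  case False
  then show ?thesis by (simp add: gb_def emap_def)
qed

lemma emap_comp_arrow:
  assumes nk: "\<not> kron" and a: "a \<in> arcs Q" "l a \<noteq> 0"
  shows "emap l m (emap l' m' (path_elem (ar a))) = eimg (\<lambda>a. l a * l' a) (\<lambda>a. m a + wt l a / l a * m' a) a"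
proof -
  have "emap l m (emap l' m' (path_elem (ar a))) = scale (l' a) (eimg l m a) + scale (l' a * m' a * wt l a) (gb a)"
  proof -
    have "emap l m (eimg l' m' a) = scale (l' a) (emap l m (path_elem (ar a))) + scale (l' a * m' a) (emap l m (gb a))"
      by (simp add: eimg_def[of l' m' a] emap_def ext_add ext_scale)
    then show ?thesis by (simp add: emap_arrow[OF a(1)] emap_gb[OF nk a(1)] scale_scale)
  qed
  also have "\<dots> = eimg (\<lambda>a. l a * l' a) (\<lambda>a. m a + wt l a / l a * m' a) a"
    using a(2) by (simp add: eimg_def scale_add scale_scale ac_simps ring_distribs flip: scale_add_left)
  finally show ?thesis .
qed

lemma eimg_cong: "l a = l' a \<Longrightarrow> m a = m' a \<Longrightarrow> eimg l m a = eimg l' m' a"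
  by (simp add: eimg_def)

text \<open>
  The composition law of the semidirect product: the additive parameter is twisted by the weight of the
  maximal path divided by that of the arrow.
\<close>

lemma emap_comp:
  assumes nk: "\<not> kron" and l: "\<And>a. a \<in> arcs Q \<Longrightarrow> l a \<noteq> 0" and x: "x \<in> M"
  shows "emap l m (emap l' m' x) = emap (\<lambda>a. l a * l' a) (\<lambda>a. m a + wt l a / l a * m' a) x"
  using vend_eqI[OF vend_comp[OF emap_vend emap_vend] emap_vend _ x, of l m l' m'] emap_comp_arrow[OF nk _ l]
  by (simp add: emap_arrow)

lemma emap_one: "x \<in> M \<Longrightarrow> emap (\<lambda>a. 1) (\<lambda>a. 0) x = x"
  by (rule vend_eqI[OF emap_vend, of "\<lambda>x. x"]) (auto simp: emap_arrow eimg_def vend_def)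

lemma emap_cong: "(\<And>a. a \<in> arcs Q \<Longrightarrow> l a = l' a) \<Longrightarrow> (\<And>a. a \<in> arcs Q \<Longrightarrow> m a = m' a) \<Longrightarrow> x \<in> M \<Longrightarrow> emap l m x = emap l' m' x"
  by (rule vend_eqI[OF emap_vend emap_vend]) (auto simp: emap_arrow intro: eimg_cong)

lemma wt_ne: "hasg a \<Longrightarrow> (\<And>a. a \<in> arcs Q \<Longrightarrow> l a \<noteq> 0) \<Longrightarrow> wt l a \<noteq> 0"
  using gp_B[of a] by (auto simp: wt_def prod_list_zero_iff B_def)

lemma wt_inverse: "wt (\<lambda>a. 1 / l a) a = 1 / wt l a"
proof -
  have "prod_list (map (\<lambda>a. 1 / l a) es) = 1 / prod_list (map l es)" for es by (induction es) auto
  then show ?thesis by (simp add: wt_def)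
qed

text \<open>The additive parameter of the inverse, solved from the composition law.\<close>

definition minv :: "('a \<Rightarrow> 'k::field) \<Rightarrow> ('a \<Rightarrow> 'k) \<Rightarrow> 'a \<Rightarrow> 'k" where
  "minv l m a = - (m a * l a / wt l a)"

lemma gb_zero: "\<not> hasg a \<Longrightarrow> gb a = 0" by (simp add: gb_def)

lemma emap_inverse:
  assumes nk: "\<not> kron" and l: "\<And>a. a \<in> arcs Q \<Longrightarrow> l a \<noteq> 0" and x: "x \<in> M"
  shows "emap l m (emap (\<lambda>a. 1 / l a) (minv l m) x) = x" "emap (\<lambda>a. 1 / l a) (minv l m) (emap l m x) = x"
proof -
  have id: "vend (\<lambda>x. x)" by (simp add: vend_def)
  have 1: "emap l m (emap (\<lambda>a. 1 / l a) (minv l m) (path_elem (ar a))) = path_elem (ar a)" if a: "a \<in> arcs Q" for a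
    unfolding emap_comp_arrow[of a l, OF nk a l[OF a]] using l[OF a] wt_ne[of a l] l
    by (cases "hasg a") (auto simp: eimg_def minv_def gb_zero)
  have 2: "emap (\<lambda>a. 1 / l a) (minv l m) (emap l m (path_elem (ar a))) = path_elem (ar a)" if a: "a \<in> arcs Q" for a
  proof -
    have "1 / l a \<noteq> 0" using l[OF a] by simp
    then show ?thesis
      unfolding emap_comp_arrow[of a "\<lambda>a. 1 / l a", OF nk a \<open>1 / l a \<noteq> 0\<close>] using l[OF a] wt_ne[of a l] l
      by (cases "hasg a") (auto simp: eimg_def minv_def wt_inverse gb_zero mult.commute)
  qed
  show "emap l m (emap (\<lambda>a. 1 / l a) (minv l m) x) = x"
    using vend_eqI[OF vend_comp[OF emap_vend emap_vend] id _ x, of l m "\<lambda>a. 1 / l a" "minv l m"] 1 by simp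
  show "emap (\<lambda>a. 1 / l a) (minv l m) (emap l m x) = x"
    using vend_eqI[OF vend_comp[OF emap_vend emap_vend] id _ x, of "\<lambda>a. 1 / l a" "minv l m" l m] 2 by simp
qed

lemma emap_M: "x \<in> M \<Longrightarrow> emap l m x \<in> M" using emap_vend by (auto simp: vend_def)

lemma emap_vaut:
  assumes nk: "\<not> kron" and l: "\<And>a. a \<in> arcs Q \<Longrightarrow> l a \<noteq> 0"
  shows "vaut (emap l m)"
  unfolding vaut_iff_vend
  by (intro conjI emap_vend bij_betw_byWitness[where f' = "emap (\<lambda>a. 1 / l a) (minv l m)"])
    (auto simp: emap_inverse[OF nk l] emap_M)

section \<open>Inner and standard automorphisms generate\<close>

text \<open>The automorphism is a standard one followed by an inner one.\<close>

definition dec :: "((('v, 'a) qpath \<Rightarrow>\<^sub>0 'k::field) \<Rightarrow> (('v, 'a) qpath \<Rightarrow>\<^sub>0 'k)) \<Rightarrow> bool" where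
  "dec g \<longleftrightarrow> (\<exists>l m n. (\<forall>a\<in>arcs Q. l a \<noteq> 0) \<and> vaut n \<and> inner n \<and> (\<forall>x\<in>M. g x = n (emap l m x)))"

lemma dec_unit:
  assumes g: "vaut g" and u: "UP y z" and d: "dec (\<lambda>x. y \<star> g x \<star> z)" shows "dec g"
proof -
  obtain l m n where d: "\<forall>a\<in>arcs Q. l a \<noteq> 0" "vaut n" "inner n" "\<forall>x\<in>M. y \<star> g x \<star> z = n (emap l m x)"
    using d unfolding dec_def by blast
  have "g x = z \<star> n (emap l m x) \<star> y" if "x \<in> M" for x
  proof -
    have "z \<star> (y \<star> g x \<star> z) \<star> y = (z \<star> y) \<star> g x \<star> (z \<star> y)" by (simp only: mul_assoc)
    also have "\<dots> = g x" using u vaut_M[OF g that] by (simp add: UP_def)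
    finally show ?thesis using d(4) that by simp
  qed
  moreover have "vaut ((\<lambda>x. z \<star> x \<star> y) \<circ> n)" "inner ((\<lambda>x. z \<star> x \<star> y) \<circ> n)"
    using UP_vaut[OF UP_sym[OF u]] UP_inner[OF UP_sym[OF u]] d by (auto intro: vaut_comp inner_comp)
  ultimately show ?thesis unfolding dec_def using d(1) by fastforce
qed

lemma dec_emap:
  assumes nk: "\<not> kron" and l: "\<And>a. a \<in> arcs Q \<Longrightarrow> l a \<noteq> 0" and d: "dec (\<lambda>x. g (emap l m x))" shows "dec g"
proof -
  obtain l' m' n where d: "\<forall>a\<in>arcs Q. l' a \<noteq> 0" "vaut n" "inner n" "\<forall>x\<in>M. g (emap l m x) = n (emap l' m' x)"
    using d unfolding dec_def by blast
  let ?li = "\<lambda>a. 1 / l a"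
  have "g x = n (emap (\<lambda>a. l' a * ?li a) (\<lambda>a. m' a + wt l' a / l' a * minv l m a) x)" if x: "x \<in> M" for x
  proof -
    have "g x = g (emap l m (emap ?li (minv l m) x))" using emap_inverse(1)[OF nk l x] by simp
    also have "\<dots> = n (emap l' m' (emap ?li (minv l m) x))" using d(4) emap_M[OF x] by blast
    also have "emap l' m' (emap ?li (minv l m) x) = emap (\<lambda>a. l' a * ?li a) (\<lambda>a. m' a + wt l' a / l' a * minv l m a) x"
      using emap_comp[OF nk _ x] d(1) by blast
    finally show ?thesis .
  qed
  then show ?thesis
    unfolding dec_def using d(1-3) l
    by (intro exI[of _ "\<lambda>a. l' a * ?li a"] exI[of _ "\<lambda>a. m' a + wt l' a / l' a * minv l m a"] exI[of _ n]
        conjI ballI) simp_all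
qed

lemma im_comp_emap:
  assumes "vaut g" "a \<in> arcs Q"
  shows "g (emap l m (path_elem (ar a))) = scale (l a) (im g a) + scale (l a * m a) (g (gb a))"
  using assms Mp_M[OF gb_Mp[of a]]
  by (simp add: emap_arrow eimg_def vaut_add[OF assms(1)] vaut_scale[OF assms(1)] Mp_M[OF gb_Mp])

lemma coef_gb_self:
  assumes g: "vaut g" and h: "hasg a" and p: "p \<in> B" "fst p = tail Q a" "length (snd p) = length (snd (gp a))"
  shows "coef (g (gb a)) p = (\<Prod>(x, y)\<leftarrow>zip (snd (gp a)) (snd p). lin g x y)"
proof -
  have "coef (g (path_elem (fst (gp a), snd (gp a)))) (fst p, snd p) = (\<Prod>(x, y)\<leftarrow>zip (snd (gp a)) (snd p). lin g x y)"
  proof (rule coef_vaut_lead[OF g])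
    show "(fst (gp a), snd (gp a)) \<in> B" "(fst p, snd p) \<in> B"
      using gp_B[OF h, THEN conjunct1] p(1) by (simp_all only: prod.collapse)
  qed (use gp_B[OF h] p in auto)
  then show ?thesis using h by (simp add: gb_def)
qed

lemma gb_Mge: assumes "vaut g" "hasg a" shows "g (gb a) \<in> Mge (length (snd (gp a)))"
  using vaut_path_Mge[OF assms(1), of "fst (gp a)" "snd (gp a)", unfolded prod.collapse] gp_B[OF assms(2)] assms(2)
  by (simp add: gb_def)

lemma prod_list_ne: "(\<And>x. x \<in> set es \<Longrightarrow> f x x \<noteq> (0 :: 'k::field)) \<Longrightarrow> (\<Prod>(x, y)\<leftarrow>zip es es. f x y) \<noteq> 0"
  by (induction es) auto

text \<open>
  Scaling makes the diagonal of the linear part one. Subtracting a multiple of the maximal path, whose image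
  has itself as leading term, clears the coefficient there.
\<close>

lemma nondeg_to_nrm:
  assumes nk: "\<not> kron" and g: "nondeg g"
  obtains l m where "\<And>a. a \<in> arcs Q \<Longrightarrow> l a \<noteq> 0" "nrm (\<lambda>x. g (emap l m x))"
proof -
  have v: "vaut g" and d: "\<And>a. a \<in> arcs Q \<Longrightarrow> lin g a a \<noteq> 0" using g by (auto simp: nondeg_def)
  define l where "l a = (if a \<in> arcs Q then 1 / lin g a a else 1)" for a
  define m where "m a = - (coef (im g a) (gp a) / coef (g (gb a)) (gp a))" for a
  have l: "l a \<noteq> 0" for a using d by (auto simp: l_def)
  have gg: "coef (g (gb a)) (gp a) \<noteq> 0" if "hasg a" for a
  proof -
    have "lin g x x \<noteq> 0" if "x \<in> set (snd (gp a))" for x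
      using that gp_B[OF \<open>hasg a\<close>] d by (auto simp: B_def)
    then show ?thesis
      using coef_gb_self[OF v that, of "gp a"] gp_B[OF that] prod_list_ne[of "snd (gp a)" "lin g"] by simp
  qed
  have ga: "coef (g (gb a)) (ar a) = 0" if a: "a \<in> arcs Q" for a
  proof (cases "hasg a")
    case True
    show ?thesis
    proof (cases "length (snd (gp a)) = 1")
      case True
      then obtain b where es: "snd (gp a) = [b]" by (auto simp: length_Suc_conv)
      have "gp a \<in> B" using gp_B[OF \<open>hasg a\<close>] by simp
      then have b: "b \<in> arcs Q" "gp a = ar b" using es by (auto simp: B_def arrow_path_def prod_eq_iff)
      have gbb: "gbar a (ar b)" using gp[OF \<open>hasg a\<close>] b by simp
      have "b \<noteq> a" using gbb by (auto simp: gbar_def arrow_path_def)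
      then have "lin g b a = 0"
        using lin_offdiag[OF g b(1)] gbar_arrow[OF nk a b(1) gbb] by blast
      then show ?thesis using \<open>hasg a\<close> b by (simp add: gb_def lin_def)
    next
      case False
      then have "length (snd (ar a)) < length (snd (gp a))"
        using gp_B[OF \<open>hasg a\<close>] by (cases "snd (gp a)" rule: remdups_adj.cases) (auto simp: arrow_path_def)
      then show ?thesis using MgeD[OF gb_Mge[OF v \<open>hasg a\<close>]] by blast
    qed
  next
    case False
    then show ?thesis using v by (simp add: gb_def)
  qed
  have "vaut (g \<circ> emap l m)" by (rule vaut_comp[OF v emap_vaut[OF nk l]])
  then have "vaut (\<lambda>x. g (emap l m x))" by (simp add: comp_def)
  moreover have "lin (\<lambda>x. g (emap l m x)) a a = 1" if "a \<in> arcs Q" for a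
    using im_comp_emap[OF v that, of l m] ga[OF that] d[OF that] that by (simp add: lin_def lookup_add l_def)
  moreover have "coef (g (emap l m (path_elem (ar a)))) p = 0" if "a \<in> arcs Q" "gbar a p" for a p
  proof -
    have h: "hasg a" unfolding hasg_def using that by blast
    have "p = gp a" using gbar_unique[OF that(1,2) gp[OF h]] .
    then show ?thesis using im_comp_emap[OF v that(1), of l m] gg[OF h] by (simp add: lookup_add m_def)
  qed
  ultimately have "nrm (\<lambda>x. g (emap l m x))" by (simp add: nrm_def)
  then show thesis using that l by blast
qed

end

section \<open>Straightening the finite threads\<close>

context gentle_quiver
begin

lemma chain_tranclp:
  assumes "successively nz es" "i < j" "j < length es" shows "nz\<^sup>+\<^sup>+ (es ! i) (es ! j)"
  using assms(2,3)
proof (induction j)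
  case (Suc j)
  have "nz (es ! j) (es ! Suc j)" using chain_nth[OF assms(1)] Suc.prems by simp
  then show ?case using Suc by (cases "i = j") auto
qed simp

text \<open>A repeated arrow would make the thread cyclic.\<close>

lemma finite_path_distinct:
  assumes p: "(v, es) \<in> B" "es \<noteq> []" "\<not> cyc (hd es)" shows "distinct es"
proof (rule ccontr)
  assume "\<not> distinct es"
  then obtain i j where ij: "i < j" "j < length es" "es ! i = es ! j"
    unfolding distinct_conv_nth by (metis nat_neq_iff)
  have "cyc (es ! i)" using chain_tranclp[OF B_chain[OF p(1)] ij(1,2)] ij(3) by (simp add: cyc_def)
  moreover have "thr (es ! i) (hd es)" by (rule path_thr2[OF p(1)]) (use ij p(2) in auto)
  ultimately show False using thr_cyc p(3) by blast
qed

lemma finite_path_length: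
  assumes "(v, es) \<in> B" "es \<noteq> []" "\<not> cyc (hd es)" shows "length es \<le> card (arcs Q)"
  using finite_path_distinct[OF assms] assms(1) by (metis B_iff card_mono distinct_card finite_arcs)

lemma drop_last: "es \<noteq> [] \<Longrightarrow> drop (length es - Suc 0) es = [last es]"
  by (induction es rule: rev_induct) auto

text \<open>The closed paths of length \<open>n\<close> on the finite threads.\<close>

definition CP :: "nat \<Rightarrow> ('v, 'a) qpath set" where
  "CP n = {p \<in> B. length (snd p) = n \<and> fst p = tgt p \<and> \<not> cyc (hd (snd p))}"

lemma finite_CP: "finite (CP n)"
proof (rule finite_subset)
  show "CP n \<subseteq> verts Q \<times> {es. set es \<subseteq> arcs Q \<and> length es = n}" by (auto simp: CP_def B_def)
qed (simp add: finite_lists_length_eq finite_verts)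

text \<open>
  Two such paths that compose lie on one finite thread, so their arrows are all distinct. As they pass
  the same vertex, the gentle condition then makes the last arrow of the product continue with the first
  one, so the thread would be cyclic.
\<close>

lemma CP_mul:
  assumes p: "p \<in> CP n" and q: "q \<in> CP n" and n: "0 < n"
  shows "path_elem p \<star> path_elem q = 0"
proof (rule ccontr)
  assume "\<not> ?thesis"
  then have c: "tgt p = fst q" "(fst p, snd p @ snd q) \<in> B" unfolding mul_path_elem by (auto split: if_splits)
  have ne: "snd p \<noteq> []" "snd q \<noteq> []" "p \<in> B" "q \<in> B" using p q n by (auto simp: CP_def)
  have nz: "nz (last (snd p)) (hd (snd q))" using c(2) ne B_append by auto
  have hp: "\<not> cyc (hd (snd p))" using p by (simp add: CP_def)
  have loopp: "fst p = tgt p" and loopq: "fst q = tgt q" using p q by (auto simp: CP_def)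
  note hp' = B_hd'[OF ne(3,1)] and hq' = B_hd'[OF ne(4,2)]
  have hlp: "hd (snd p) \<in> arcs Q" "last (snd p) \<in> arcs Q" using hp' by blast+
  have hlq: "hd (snd q) \<in> arcs Q" "last (snd q) \<in> arcs Q" using hq' by blast+
  have hcp: "head Q (last (snd p)) = tail Q (hd (snd p))" using hp' loopp by argo
  have hcq: "head Q (last (snd q)) = tail Q (hd (snd p))" using hp' hq' loopq loopp c(1) by argo
  have chains: "successively nz (snd p)" "successively nz (snd q)" "successively nz (snd p @ snd q)"
    using B_chain[of "fst p" "snd p"] B_chain[of "fst q" "snd q"] B_chain[OF c(2)] ne(3,4) by simp_all
  have len: "length (snd p) = length (snd q)" using p q by (simp add: CP_def)
  have d: "distinct (snd p @ snd q)"
    using finite_path_distinct[OF c(2)] ne hp by simp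
  show False
  proof (cases "hd (snd p) = hd (snd q)")
    case True
    then show False using d ne by (metis disjoint_iff distinct_append hd_in_set)
  next
    case False
    have "last (snd p) \<noteq> last (snd q)" using d ne by (metis disjoint_iff distinct_append last_in_set)
    moreover have "\<not> nz (last (snd p)) (hd (snd p))" using succ_unique nz False by metis
    ultimately have "nz (last (snd q)) (hd (snd p))"
      using two_in[of "hd (snd p)" "last (snd q)" "last (snd p)"] hlp hlq hcp hcq by metis
    moreover have "nz\<^sup>*\<^sup>* (hd (snd p)) (last (snd q))"
    proof -
      let ?es = "snd p @ snd q"
      have "?es ! 0 = hd (snd p)" "?es ! (length ?es - 1) = last (snd q)" "0 < length ?es - 1"
        using ne by (auto simp: hd_conv_nth nth_append last_conv_nth) (cases "snd p"; cases "snd q"; auto)+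
      then show ?thesis using chain_tranclp[OF chains(3), of 0 "length ?es - 1"] by (intro tranclp_into_rtranclp) simp
    qed
    ultimately have "cyc (hd (snd p))" unfolding cyc_def by (metis rtranclp_into_tranclp1)
    then show False using hp by simp
  qed
qed

text \<open>Normalised, with cyclic threads fixed, and with no correction terms of length below \<open>n\<close>.\<close>

definition stage :: "nat \<Rightarrow> ((('v, 'a) qpath \<Rightarrow>\<^sub>0 'k::field) \<Rightarrow> (('v, 'a) qpath \<Rightarrow>\<^sub>0 'k)) \<Rightarrow> bool" where
  "stage n g \<longleftrightarrow> nrm g \<and> (\<forall>a. cyc a \<longrightarrow> im g a = path_elem (ar a)) \<and>
     (\<forall>a\<in>arcs Q. \<forall>p. coef (im g a) p \<noteq> 0 \<longrightarrow> p = ar a \<or> n \<le> length (snd p))"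

lemma stageD:
  assumes "stage n g"
  shows "nrm g" "cyc a \<Longrightarrow> im g a = path_elem (ar a)"
    "a \<in> arcs Q \<Longrightarrow> coef (im g a) p \<noteq> 0 \<Longrightarrow> p = ar a \<or> n \<le> length (snd p)"
  using assms unfolding stage_def by blast+

lemma nrmD:
  assumes "nrm g"
  shows "vaut g" "a \<in> arcs Q \<Longrightarrow> lin g a a = 1"
    "a \<in> arcs Q \<Longrightarrow> gbar a p \<Longrightarrow> \<not> thr a (hd (snd p)) \<Longrightarrow> coef (im g a) p = 0"
  using assms unfolding nrm_def by blast+

text \<open>
  The coefficient of a closed path in the conjugating unit. It can be read off at the arrow preceding the
  path or at the one following it; the preceding arrow is preferred when it exists.
\<close>

definition kap :: "((('v, 'a) qpath \<Rightarrow>\<^sub>0 'k::field) \<Rightarrow> (('v, 'a) qpath \<Rightarrow>\<^sub>0 'k)) \<Rightarrow> ('v, 'a) qpath \<Rightarrow> 'k" where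
  "kap g p = (if \<exists>d. nz d (hd (snd p)) then (let d = THE d. nz d (hd (snd p)) in coef (im g d) (tail Q d, d # snd p))
     else if \<exists>c. nz (last (snd p)) c then - (let c = THE c. nz (last (snd p)) c in coef (im g c) (fst p, snd p @ [c]))
     else 0)"

lemma kap_left: "nz d (hd (snd p)) \<Longrightarrow> kap g p = coef (im g d) (tail Q d, d # snd p)"
proof -
  assume d: "nz d (hd (snd p))"
  then have "(THE d. nz d (hd (snd p))) = d" using pred_unique by blast
  then show ?thesis using d by (auto simp: kap_def)
qed

lemma kap_right: "(\<And>d. \<not> nz d (hd (snd p))) \<Longrightarrow> nz (last (snd p)) c \<Longrightarrow> kap g p = - coef (im g c) (fst p, snd p @ [c])"
proof -
  assume c: "nz (last (snd p)) c" and no: "\<And>d. \<not> nz d (hd (snd p))"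
  then have "(THE c. nz (last (snd p)) c) = c" using succ_unique by blast
  then show ?thesis using c no by (auto simp: kap_def)
qed

text \<open>
  One degree at a time: a path of length \<open>n\<close> in the image of \<open>a\<close> is \<open>a\<close> times a closed path, a
  closed path times \<open>a\<close>, or maximal. The relations force the coefficients at the two ends of a
  closed path to agree, so a single unit removes all of the first two kinds.
\<close>

lemma stage_unit:
  fixes g :: "(('v, 'a) qpath \<Rightarrow>\<^sub>0 'k::field) \<Rightarrow> (('v, 'a) qpath \<Rightarrow>\<^sub>0 'k)"
  assumes st: "stage n g" and n: "2 \<le> n"
  obtains y z where "UP y z" "stage n (\<lambda>x. y \<star> g x \<star> z)"
    "\<And>a p. a \<in> arcs Q \<Longrightarrow> length (snd p) = n \<Longrightarrow> coef (y \<star> im g a \<star> z) p \<noteq> 0 \<Longrightarrow> gbar a p"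
proof -
  have g: "nrm g" and cy: "\<And>a. cyc a \<Longrightarrow> im g a = path_elem (ar a)"
    and low: "\<And>a p. a \<in> arcs Q \<Longrightarrow> coef (im g a) p \<noteq> 0 \<Longrightarrow> p = ar a \<or> n \<le> length (snd p)"
    using stageD[OF st] by blast+
  note v = nrm_vaut[OF g]
  define C where "C = CP (n - 1)"
  define w where "w = (\<Sum>p\<in>C. scale (kap g p) (path_elem p))"
  have Cp: "p \<in> B" "snd p \<noteq> []" "length (snd p) = n - 1" "fst p = tgt p" "\<not> cyc (hd (snd p))" if "p \<in> C" for p
    using that n unfolding C_def by (auto simp: CP_def)
  have cw: "coef w p = (if p \<in> C then kap g p else 0)" for p
  proof -
    have "coef w p = (\<Sum>q\<in>C. if q = p then kap g p else 0)"
      unfolding w_def lookup_sum by (intro sum.cong refl) (auto simp: coef_path_elem)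
    then show ?thesis using finite_CP by (simp add: C_def)
  qed
  have wT: "w \<in> MT (\<lambda>a. \<not> cyc a)"
    unfolding w_def using Cp by (intro MT_sum MT_closed(5) MT_path) auto
  have wM: "w \<in> Mp" "w \<in> M" using MT_Mp[OF wT] MT_M[OF wT] by auto
  have wG: "w \<in> Mge (n - 1)"
    using wM(2) Cp by (auto simp: Mge_def cw split: if_splits)
  have ww: "w \<star> w = 0"
    unfolding w_def mul_sum_left mul_sum_right mul_scale_left mul_scale_right
    by (rule sum.neutral) (use n in \<open>simp add: C_def CP_mul mul_sum_left mul_scale_left\<close>)
  have wv: "w \<star> ev u = ev u \<star> w" for u
  proof (rule poly_mapping_eqI)
    fix p
    have "fst p = tgt p" if "coef w p \<noteq> 0" using that cw[of p] Cp(4)[of p] by metis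
    then show "coef (w \<star> ev u) p = coef (ev u \<star> w) p"
      using coef_vertex_mul[OF wM(2), of u "fst p" "snd p"] coef_mul_vertex[OF wM(2), of u p] unfolding prod.collapse by metis
  qed
  define y z where "y = unit + w" "z = unit - w"
  note yz = y_z_def
  have u: "UP y z"
    unfolding UP_def
  proof (intro conjI ballI)
    show "y \<in> M" "z \<in> M" "y - unit \<in> Mp" "z - unit \<in> Mp" using wM by (auto simp: yz)
    show "y \<star> z = unit" "z \<star> y = unit"
      using wM ww by (simp_all add: yz mul_add_left mul_add_right mul_diff_left mul_diff_right)
    fix x assume x: "x \<in> verts Q"
    have "w \<star> ev x \<star> w = ev x \<star> (w \<star> w)" by (simp add: wv mul_assoc)
    then show "y \<star> ev x \<star> z = ev x"
      using x wM ww wv[of x] by (simp add: yz mul_add_left mul_diff_right algebra_simps)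
  qed
  have ex: "y \<star> x \<star> z = x + w \<star> x - x \<star> w - w \<star> x \<star> w" if "x \<in> M" for x
    using conj_expand[OF u that] by (simp add: yz mul_minus_right algebra_simps)
  have g1: "nrm (\<lambda>x. y \<star> g x \<star> z)" by (rule conj_nrm[OF g u])
  have cy1: "y \<star> im g a \<star> z = path_elem (ar a)" if a: "cyc a" for a
  proof -
    have E: "(path_elem (ar a) :: _ \<Rightarrow>\<^sub>0 'k) \<in> MT cyc" using a cyc_arcs[OF a] by (intro MT_path) (auto simp: arrow_path_def)
    have "w \<star> path_elem (ar a) = 0" by (rule MT_mul_disjoint[OF wT E thrc_not[OF thrc_cyc]]) simp
    moreover have "path_elem (ar a) \<star> w = 0" by (rule MT_mul_disjoint[OF E wT thrc_cyc]) simp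
    ultimately show ?thesis
      using ex[OF MT_M[OF E]] by (simp add: cy[OF a])
  qed
  have cf: "coef (y \<star> im g a \<star> z) p = coef (im g a) p + coef (w \<star> im g a) p - coef (im g a \<star> w) p"
    if a: "a \<in> arcs Q" and l: "length (snd p) \<le> n" for a p
  proof -
    have "w \<star> im g a \<star> w \<in> Mge (n - 1 + 1 + (n - 1))"
      using wG im_Mp[OF v a] by (intro Mge_mul) (auto simp: Mge_1)
    then have "coef (w \<star> im g a \<star> w) p = 0" using l n by (intro MgeD) auto
    then show ?thesis using im_Mp[OF v a] by (simp add: ex Mp_M lookup_add lookup_minus)
  qed
  have G: "w \<star> im g a \<in> Mge (n - 1 + 1)" "im g a \<star> w \<in> Mge (1 + (n - 1))" if "a \<in> arcs Q" for a
    using Mge_mul[OF wG, of "im g a" 1] Mge_mul[OF _ wG, of "im g a" 1] im_Mp[OF v that] by (simp_all add: Mge_1)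
  have st1: "stage n (\<lambda>x. y \<star> g x \<star> z)"
    unfolding stage_def
  proof (intro conjI allI ballI impI g1 cy1)
    fix a p assume a: "a \<in> arcs Q" and nzp: "coef (y \<star> im g a \<star> z) p \<noteq> 0"
    show "p = ar a \<or> n \<le> length (snd p)"
    proof (rule ccontr)
      assume no: "\<not> ?thesis"
      then have "coef (im g a) p = 0" "coef (w \<star> im g a) p = 0" "coef (im g a \<star> w) p = 0"
        using low[OF a, of p] MgeD[OF G(1)[OF a], of p] MgeD[OF G(2)[OF a], of p] n by auto
      then show False using nzp cf[OF a, of p] no by simp
    qed
  qed
  moreover have "gbar a p" if a: "a \<in> arcs Q" and l: "length (snd p) = n" and nzp: "coef (y \<star> im g a \<star> z) p \<noteq> 0" for a p
  proof (rule ccontr)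
    assume ng: "\<not> gbar a p"
    obtain x es where p: "p = (x, es)" by fastforce
    have le: "length es = n" "es \<noteq> []" using l p n by auto
    note e = im_coefD[OF nrm_vaut[OF g1] a nzp[unfolded p]]
    have nc: "\<not> cyc a"
    proof
      assume "cyc a"
      then have "p = ar a" using nzp cy1 by (auto simp: coef_path_elem split: if_splits)
      then show False using l n by (simp add: arrow_path_def)
    qed
    have "thr a (hd es)" using MTD[OF nrm_im_MT[OF g1 a] nzp] p by simp
    then have nch: "\<not> cyc (hd es)" using nc thr_cyc thr_sym by blast
    have dist: "distinct es" by (rule finite_path_distinct[OF e(1,2) nch])
    have c1: "coef (w \<star> im g a) (x, es) = coef w (x, butlast es) * (if last es = a then 1 else 0)"
    proof -
      have "coef (w \<star> im g a) (x, es) = coef w (x, take (n - 1) es) * coef (im g a) (tgt (x, take (n - 1) es), drop (n - 1) es)"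
        by (rule coef_mul_lead[OF wG _ e(1), where m = 1]) (use im_Mp[OF v a] le n in \<open>auto simp: Mge_1\<close>)
      moreover have tk: "take (n - 1) es = butlast es" "drop (n - 1) es = [last es]"
        using le drop_last[OF le(2)] by (simp_all add: butlast_conv_take)
      moreover have "tgt (x, butlast es) = tail Q (last es)"
        using B_append[of x "butlast es" "[last es]"] e(1,2) by auto
      ultimately show ?thesis
        using nrm_lin[OF g a, of "last es"] by (auto simp: lin_def arrow_path_def)
    qed
    have c2: "coef (im g a \<star> w) (x, es) = (if hd es = a then 1 else 0) * coef w (head Q (hd es), tl es)"
    proof -
      have "coef (im g a \<star> w) (x, es) = coef (im g a) (x, take 1 es) * coef w (tgt (x, take 1 es), drop 1 es)"
        by (rule coef_mul_lead[OF _ wG e(1), where n = 1]) (use im_Mp[OF v a] le n in \<open>auto simp: Mge_1\<close>)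
      moreover have "take 1 es = [hd es]" "drop 1 es = tl es" using e(2) by (auto simp: take_Suc drop_Suc)
      moreover have "x = tail Q (hd es)" using B_hd[OF e(1,2)] by simp
      ultimately show ?thesis
        using nrm_lin[OF g a, of "hd es"] by (auto simp: lin_def arrow_path_def path_tgt_eq)
    qed
    have tot: "coef (im g a) (x, es) + coef w (x, butlast es) * (if last es = a then 1 else 0)
        - (if hd es = a then 1 else 0) * coef w (head Q (hd es), tl es) \<noteq> 0"
      using nzp cf[OF a, of p] l c1 c2 p by simp
    have hl: "hd es \<noteq> last es"
    proof -
      have "es ! 0 \<noteq> es ! (length es - 1)" using dist le n by (subst nth_eq_iff_index_eq) auto
      then show ?thesis using le by (simp add: hd_conv_nth last_conv_nth)
    qed
    consider "hd es = a" | "last es = a" "hd es \<noteq> a" | "hd es \<noteq> a" "last es \<noteq> a" by blast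
    then show False
    proof cases
      case 1
      let ?q = "(head Q a, tl es)"
      obtain b fs where es: "es = a # b # fs" using 1 le n by (cases es rule: remdups_adj.cases) auto
      have "nz a b" using e(1) es by (auto simp: B_iff)
      moreover have "?q \<in> C"
        using e(1,4) es le nch path_thr2[OF e(1), of a b] thr_cyc thr_sym nc B_Cons[of x a "b # fs"]
        by (auto simp: C_def CP_def path_tgt_eq)
      ultimately have "coef w ?q = coef (im g a) (x, es)"
        using kap_left[of a ?q g] e(3) es by (simp add: cw)
      then show False using tot 1 hl by auto
    next
      case 2
      let ?q = "(x, butlast es)"
      have esb: "es = butlast es @ [a]" using 2 e(2) by (metis append_butlast_last_id)
      have bl: "butlast es \<noteq> []" "length (butlast es) = n - 1" using le n by (cases es; auto)+
      have qB: "?q \<in> B" "tgt ?q = tail Q a" "nz (last (butlast es)) a"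
        using B_append[of x "butlast es" "[a]"] e(1) esb bl by auto
      have hq: "hd (butlast es) = hd es" using bl esb by (metis hd_append2)
      have qC: "?q \<in> C" using qB bl e(3) nch hq by (auto simp: C_def CP_def)
      have "coef w ?q = - coef (im g a) (x, es)"
      proof (cases "\<exists>d. nz d (hd (butlast es))")
        case True
        then obtain d where d: "nz d (hd es)" using hq by auto
        have dd: "d \<in> arcs Q" "head Q d = tail Q a" using nz_arcs[OF d] e(3) B_hd[OF e(1,2)] by auto
        have nda: "\<not> nz d a" using succ_unique[OF d] 2 by blast
        have dB: "(tail Q d, d # es) \<in> B" by (rule B_cons[OF e(1,2) d])
        have ncd: "\<not> cyc d" using cyc_next d nch by blast
        let ?f = "\<lambda>i. coef (im g d) (tail Q d, take i (d # es)) * coef (im g a) (tgt (tail Q d, take i (d # es)), drop i (d # es))"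
        have "0 = coef (im g d \<star> im g a) (tail Q d, d # es)"
          using im_rel[OF vaut_vend[OF v] dd(1) a nda] by simp
        also have "\<dots> = (\<Sum>i\<in>{0<..<length (d # es)}. ?f i)"
          by (rule coef_mul_Mp[OF im_Mp[OF v dd(1)] im_Mp[OF v a] dB])
        also have "\<dots> = (\<Sum>i\<in>{1, n}. ?f i)"
        proof (rule sum.mono_neutral_right)
          show "{1, n} \<subseteq> {0<..<length (d # es)}" using le n by auto
          show "\<forall>i\<in>{0<..<length (d # es)} - {1, n}. ?f i = 0"
          proof
            fix i assume i: "i \<in> {0<..<length (d # es)} - {1, n}"
            then have "1 < i" "i < n" using le by auto
            moreover have "length (take i (d # es)) = i" using calculation le by simp
            ultimately have "coef (im g d) (tail Q d, take i (d # es)) = 0"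
              using low[OF dd(1), of "(tail Q d, take i (d # es))"]
              by (metis One_nat_def arrow_path_def length_Cons less_irrefl linorder_not_le list.size(3) snd_conv)
            then show "?f i = 0" by simp
          qed
        qed simp
        also have "\<dots> = ?f 1 + ?f n" using n by simp
        also have "?f 1 = coef (im g a) (x, es)"
          using nrm_lin[OF g dd(1), of d] dd e(3) by (simp add: lin_def arrow_path_def path_tgt_eq)
        also have "?f n = coef (im g d) (tail Q d, d # butlast es)"
        proof -
          obtain k where k: "n = Suc k" using n by (cases n) auto
          have tk: "take n (d # es) = d # butlast es" "drop n (d # es) = [a]"
            using k le drop_last[OF le(2)] 2(1) by (simp_all add: butlast_conv_take)
          have "tgt (tail Q d, d # butlast es) = tail Q a"
            using qB(2) bl by (simp add: path_tgt_eq)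
          then show ?thesis unfolding tk using nrm_lin[OF g a, of a] by (simp add: lin_def arrow_path_def)
        qed
        finally have "coef (im g d) (tail Q d, d # butlast es) = - coef (im g a) (x, es)" by (simp add: eq_neg_iff_add_eq_0 add.commute)
        then show ?thesis
          using kap_left[of d ?q g] d hq qC by (simp add: cw)
      next
        case False
        then show ?thesis using kap_right[of ?q a g] qB(3) esb qC by (simp add: cw)
      qed
      then show False using tot 2 by simp
    next
      case 3
      then have X: "coef (im g a) (x, es) \<noteq> 0" using tot by simp
      have no: "coef (im g a) q = 0" if "length (snd q) < n" "hd (snd q) \<noteq> a \<or> last (snd q) \<noteq> a" for q
      proof (rule ccontr)
        assume "\<not> ?thesis"
        then have "q = ar a" using low[OF a] that(1) by (metis linorder_not_le)
        then show False using that(2) by (simp add: arrow_path_def)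
      qed
      have "\<not> maximal p" using ng 3 e p by (auto simp: gbar_def)
      then obtain c where "nz (last es) c \<or> nz c (hd es)" using e p by (auto simp: maximal_def)
      then show False
      proof
        assume c: "nz (last es) c"
        obtain i where i: "0 < i" "i < length es" "coef (im g a) (x, take i es) \<noteq> 0"
          using prolong_right[OF nrm_nondeg[OF g] a X 3(2) c] by blast
        then show False using no[of "(x, take i es)"] 3 le by auto
      next
        assume c: "nz c (hd es)"
        obtain i where i: "0 < i" "i < length es" "coef (im g a) (tgt (x, take i es), drop i es) \<noteq> 0"
          using prolong_left[OF nrm_nondeg[OF g] a X 3(1) c] by blast
        then show False using no[of "(tgt (x, take i es), drop i es)"] 3 le by auto
      qed
    qed
  qed
  ultimately show thesis using that u by blast
qed

lemma zip_delta: "length es = length fs \<Longrightarrow> (\<And>x y. x \<in> set es \<Longrightarrow> f x y = (if x = y then 1 else (0 :: 'k::field))) \<Longrightarrow>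
    (\<Prod>(x, y)\<leftarrow>zip es fs. f x y) = (if es = fs then 1 else 0)"
  by (induction es fs rule: list_induct2) auto

text \<open>The unit removes the commutators, and a standard automorphism the maximal paths of this length.\<close>

lemma stage_step:
  fixes g :: "(('v, 'a) qpath \<Rightarrow>\<^sub>0 'k::field) \<Rightarrow> (('v, 'a) qpath \<Rightarrow>\<^sub>0 'k)"
  assumes nk: "\<not> kron" and st: "stage n g" and n: "2 \<le> n"
  obtains y z m where "UP y z" "stage (Suc n) (\<lambda>x. y \<star> g (emap (\<lambda>a. 1) m x) \<star> z)"
proof -
  obtain y z where u: "UP y z" and st1: "stage n (\<lambda>x. y \<star> g x \<star> z)"
    and gb1: "\<And>a p. a \<in> arcs Q \<Longrightarrow> length (snd p) = n \<Longrightarrow> coef (y \<star> im g a \<star> z) p \<noteq> 0 \<Longrightarrow> gbar a p"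
    using stage_unit[OF st n] by metis
  define h where "h = (\<lambda>x. y \<star> g x \<star> z)"
  have h: "nrm h" and cy: "\<And>a. cyc a \<Longrightarrow> im h a = path_elem (ar a)"
    and low: "\<And>a p. a \<in> arcs Q \<Longrightarrow> coef (im h a) p \<noteq> 0 \<Longrightarrow> p = ar a \<or> n \<le> length (snd p)"
    using stageD[OF st1] unfolding h_def by blast+
  note v = nrm_vaut[OF h]
  define m where "m a = (if hasg a \<and> length (snd (gp a)) = n then - coef (im h a) (gp a) else 0)" for a
  have im: "h (emap (\<lambda>a. 1) m (path_elem (ar a))) = im h a + scale (m a) (h (gb a))" if "a \<in> arcs Q" for a
    using im_comp_emap[OF v that, of "\<lambda>a. 1" m] by simp
  have mg: "scale (m a) (h (gb a)) \<in> Mge n" for a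
  proof (cases "m a = 0")
    case False
    then have "hasg a" "length (snd (gp a)) = n" by (auto simp: m_def split: if_splits)
    then have "h (gb a) \<in> Mge n" using gb_Mge[OF v] by metis
    then show ?thesis by (auto simp: Mge_def)
  qed (simp add: Mge_def)
  have "vaut (h \<circ> emap (\<lambda>a. 1) m)" by (rule vaut_comp[OF v emap_vaut[OF nk]]) simp
  then have v2: "vaut (\<lambda>x. h (emap (\<lambda>a. 1) m x))" by (simp add: comp_def)
  have m0: "m a = 0" if "a \<in> arcs Q" "hasg a" "\<not> thr a (hd (snd (gp a)))" for a
  proof -
    have "coef (im h a) (gp a) = 0" by (rule nrmD(3)[OF h that(1) gp[OF that(2)] that(3)])
    then show ?thesis by (simp add: m_def)
  qed
  have "nrm (\<lambda>x. h (emap (\<lambda>a. 1) m x))"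
    unfolding nrm_def
  proof (intro conjI ballI allI impI v2)
    fix a assume a: "a \<in> arcs Q"
    have "coef (scale (m a) (h (gb a))) (ar a) = 0" by (rule MgeD[OF mg]) (use n in \<open>simp add: arrow_path_def\<close>)
    then show "lin (\<lambda>x. h (emap (\<lambda>a. 1) m x)) a a = 1"
      using h a im[OF a] by (simp add: lin_def nrm_def lookup_add)
    fix p assume p: "gbar a p" "\<not> thr a (hd (snd p))"
    have ha: "hasg a" unfolding hasg_def using p by blast
    have "p = gp a" using gbar_unique[OF a p(1) gp[OF ha]] .
    then show "coef (h (emap (\<lambda>a. 1) m (path_elem (ar a)))) p = 0"
      using m0[OF a ha] nrmD(3)[OF h a p] im[OF a] \<open>p = gp a\<close> p(2) by simp
  qed
  moreover have "h (emap (\<lambda>a. 1) m (path_elem (ar a))) = path_elem (ar a)" if a: "cyc a" for a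
  proof -
    have "m a = 0"
    proof (rule ccontr)
      assume "m a \<noteq> 0"
      then have "length (snd (gp a)) = n" "coef (im h a) (gp a) \<noteq> 0" by (auto simp: m_def split: if_splits)
      then have "gp a = ar a" using cy[OF a] by (auto simp: coef_path_elem split: if_splits)
      then show False using \<open>length (snd (gp a)) = n\<close> n by (simp add: arrow_path_def)
    qed
    then show ?thesis using im[OF cyc_arcs[OF a]] cy[OF a] by simp
  qed
  moreover have "p = ar a \<or> Suc n \<le> length (snd p)"
    if a: "a \<in> arcs Q" and nzp: "coef (h (emap (\<lambda>a. 1) m (path_elem (ar a)))) p \<noteq> 0" for a p
  proof (rule ccontr)
    assume no: "\<not> ?thesis"
    have tot: "coef (im h a) p + coef (scale (m a) (h (gb a))) p \<noteq> 0" using nzp im[OF a] by (simp add: lookup_add)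
    show False
    proof (cases "length (snd p) < n")
      case True
      then have "coef (scale (m a) (h (gb a))) p = 0" by (rule MgeD[OF mg])
      then show False using tot low[OF a, of p] True no by auto
    next
      case False
      then have l: "length (snd p) = n" using no by simp
      obtain x es where p: "p = (x, es)" by fastforce
      have px: "p \<in> B" "fst p = tail Q a" using im_coefD[OF v2 a, of x es] nzp p by auto
      show False
      proof (cases "hasg a \<and> length (snd (gp a)) = n")
        case True
        have "coef (h (gb a)) p = (\<Prod>(x, y)\<leftarrow>zip (snd (gp a)) (snd p). lin h x y)"
          by (rule coef_gb_self[OF v]) (use True px l in auto)
        also have "\<dots> = (if snd (gp a) = snd p then 1 else 0)"
          by (rule zip_delta) (use True l gp_B[of a] nrm_lin[OF h] in \<open>auto simp: B_def\<close>)
        finally have c: "coef (h (gb a)) p = (if snd (gp a) = snd p then 1 else 0)" .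
        show False
        proof (cases "p = gp a")
          case True
          then show False using tot c \<open>hasg a \<and> _\<close> by (simp add: m_def)
        next
          case False
          then have "snd (gp a) \<noteq> snd p" using px True gp_B[of a] by (auto simp: prod_eq_iff)
          then have "coef (im h a) p \<noteq> 0" using tot c by simp
          then have "gbar a p" using gb1[OF a l] by (simp add: h_def)
          then show False using gbar_unique[OF a _ gp] True False by blast
        qed
      next
        case False
        then have "m a = 0" by (auto simp: m_def)
        then have "coef (im h a) p \<noteq> 0" using tot by simp
        then have gbp: "gbar a p" using gb1[OF a l] by (simp add: h_def)
        then have ha: "hasg a" unfolding hasg_def by blast
        have "p = gp a" using gbar_unique[OF a gbp gp[OF ha]] .
        then show False using False ha l by simp
      qed
    qed
  qed
  ultimately have "stage (Suc n) (\<lambda>x. h (emap (\<lambda>a. 1) m x))" by (simp add: stage_def)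
  then show thesis using that[OF u, of m] by (simp add: h_def)
qed

text \<open>
  On a finite thread paths are no longer than the number of arrows, so after finitely many degrees no
  correction term is left and the automorphism is the identity.
\<close>

theorem decomposition:
  fixes g :: "(('v, 'a) qpath \<Rightarrow>\<^sub>0 'k::field) \<Rightarrow> (('v, 'a) qpath \<Rightarrow>\<^sub>0 'k)"
  assumes nk: "\<not> kron" and g: "nondeg g"
  shows "dec g"
proof -
  have fin: "dec g" if "stage n g" "2 \<le> n" for n and g :: "(('v, 'a) qpath \<Rightarrow>\<^sub>0 'k) \<Rightarrow> (('v, 'a) qpath \<Rightarrow>\<^sub>0 'k)"
    using that
  proof (induction "card (arcs Q) + 1 - n" arbitrary: n g)
    case 0
    then have g: "nrm g" and n: "card (arcs Q) < n" by (auto simp: stage_def)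
    have "im g a = path_elem (ar a)" if a: "a \<in> arcs Q" for a
    proof (cases "cyc a")
      case True
      then show ?thesis using 0 by (simp add: stage_def)
    next
      case False
      show ?thesis
      proof (rule poly_mapping_eqI)
        fix p
        have "p = ar a" if nz: "coef (im g a) p \<noteq> 0"
        proof (rule ccontr)
          assume "p \<noteq> ar a"
          then have l: "n \<le> length (snd p)" using stageD(3)[OF 0(2) a nz] by blast
          have "p \<in> B" "snd p \<noteq> []" "thr a (hd (snd p))" using MTD[OF nrm_im_MT[OF g a] nz] by auto
          moreover have "\<not> cyc (hd (snd p))" using calculation(3) False thr_cyc thr_sym by blast
          ultimately have "length (snd p) \<le> card (arcs Q)" using finite_path_length[of "fst p" "snd p"] by simp
          then show False using l n by simp
        qed
        then show "coef (im g a) p = coef (path_elem (ar a)) p"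
          using g a by (cases "p = ar a") (auto simp: coef_path_elem nrm_def lin_def)
      qed
    qed
    then have "g x = x" if "x \<in> M" for x
      using vend_eqI[OF vaut_vend[OF nrm_vaut[OF g]] vaut_vend[OF vaut_id(2)] _ that] by simp
    then show ?case
      unfolding dec_def
      by - (rule exI[where x = "\<lambda>a. 1"], rule exI[where x = "\<lambda>a. 0"], rule exI[where x = id], simp add: emap_one vaut_id(1) inner_id)
  next
    case (Suc k)
    obtain y z m where u: "UP y z" and st: "stage (Suc n) (\<lambda>x. y \<star> g (emap (\<lambda>a. 1) m x) \<star> z)"
      using stage_step[OF nk Suc.prems] by metis
    have "dec (\<lambda>x. y \<star> g (emap (\<lambda>a. 1) m x) \<star> z)"
      using Suc.hyps Suc.prems by (intro Suc.hyps(1)[OF _ st]) auto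
    moreover have "vaut (g \<circ> emap (\<lambda>a. 1) m)"
      using Suc.prems by (intro vaut_comp emap_vaut[OF nk]) (auto simp: stage_def nrm_vaut)
    ultimately have "dec (\<lambda>x. g (emap (\<lambda>a. 1) m x))"
      using dec_unit[OF _ u, of "g \<circ> emap (\<lambda>a. 1) m"] by (simp add: comp_def)
    then show ?case by (rule dec_emap[OF nk, rotated]) simp
  qed
  obtain l m where l: "\<And>a. a \<in> arcs Q \<Longrightarrow> l a \<noteq> 0" and h: "nrm (\<lambda>x. g (emap l m x))"
    using nondeg_to_nrm[OF nk g] by metis
  obtain y z where u: "UP y z" and fx: "\<And>b. cyc b \<Longrightarrow> y \<star> g (emap l m (path_elem (cb b))) \<star> z = path_elem (cb b)"
    using cyc_unit[OF h] by metis
  let ?h = "\<lambda>x. y \<star> g (emap l m x) \<star> z"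
  have h': "nrm ?h" by (rule conj_nrm[OF h u])
  have "stage 2 ?h"
    unfolding stage_def
  proof (intro conjI allI ballI impI h')
    show "im ?h a = path_elem (ar a)" if "cyc a" for a
      by (rule cyc_arrow_fixed[OF h' _ that]) (rule fx)
    fix a p assume a: "a \<in> arcs Q" and nz: "coef (im ?h a) p \<noteq> 0"
    show "p = ar a \<or> 2 \<le> length (snd p)"
    proof (rule ccontr)
      assume no: "\<not> ?thesis"
      obtain x es where p: "p = (x, es)" by fastforce
      note e = im_coefD[OF nrm_vaut[OF h'] a nz[unfolded p]]
      have "length es = 1" using no p e(2) by (cases es rule: remdups_adj.cases) auto
      then obtain b where "es = [b]" by (auto simp: length_Suc_conv)
      then have pb: "p = ar b" using e(1) p by (auto simp: arrow_path_def)
      then have "lin ?h a b \<noteq> 0" using nz by (simp add: lin_def)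
      then have "a = b" using nrm_lin[OF h' a, of b] by (auto split: if_splits)
      then show False using no pb by simp
    qed
  qed
  then have "dec ?h" by (rule fin) simp
  then have "dec (\<lambda>x. g (emap l m x))" by (rule dec_unit[OF nrm_vaut[OF h] u])
  then show ?thesis by (rule dec_emap[OF nk l, rotated])
qed

end

section \<open>Complements of normal subgroups\<close>

text \<open>The complement maps injectively to the quotient because it meets the normal subgroup trivially.\<close>

lemma complement_iso:
  assumes G: "group G" and H: "group H" and N: "N \<lhd> H" and f: "f \<in> hom G H"
    and disj: "\<And>x. x \<in> carrier G \<Longrightarrow> f x \<in> N \<Longrightarrow> x = \<one>\<^bsub>G\<^esub>"
    and gen: "\<And>h. h \<in> carrier H \<Longrightarrow> \<exists>n\<in>N. \<exists>x\<in>carrier G. h = n \<otimes>\<^bsub>H\<^esub> f x"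
  shows "H Mod N \<cong> G"
proof -
  interpret G: group G by fact
  interpret H: group H by fact
  interpret N: normal N H by fact
  interpret f: group_hom G H f by unfold_locales (rule f)
  define F where "F x = N #>\<^bsub>H\<^esub> f x" for x
  have F: "F \<in> hom G (H Mod N)"
    by (rule homI) (auto simp: F_def FactGroup_def RCOSETS_def N.rcos_sum)
  have inj: "inj_on F (carrier G)"
  proof (rule inj_onI)
    fix x y assume x: "x \<in> carrier G" and y: "y \<in> carrier G" and eq: "F x = F y"
    have "f x \<in> N #>\<^bsub>H\<^esub> f x" using x by (intro H.rcos_self) (auto intro: N.is_subgroup)
    then obtain n where n: "n \<in> N" "f x = n \<otimes>\<^bsub>H\<^esub> f y" using eq by (auto simp: F_def r_coset_def)
    have nc: "n \<in> carrier H" using n(1) N.subset by blast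
    have "f (x \<otimes>\<^bsub>G\<^esub> inv\<^bsub>G\<^esub> y) = n" using x y n(2) nc by (simp add: H.m_assoc)
    then have "x \<otimes>\<^bsub>G\<^esub> inv\<^bsub>G\<^esub> y = \<one>\<^bsub>G\<^esub>" using disj[of "x \<otimes>\<^bsub>G\<^esub> inv\<^bsub>G\<^esub> y"] x y n(1) by simp
    then show "x = y" using x y by (metis G.inv_closed G.inv_equality G.inv_inv)
  qed
  have "F ` carrier G = carrier (H Mod N)"
  proof
    show "F ` carrier G \<subseteq> carrier (H Mod N)" using F by (auto simp: hom_def)
    show "carrier (H Mod N) \<subseteq> F ` carrier G"
    proof
      fix Y assume "Y \<in> carrier (H Mod N)"
      then obtain h where h: "h \<in> carrier H" "Y = N #>\<^bsub>H\<^esub> h" by (auto simp: FactGroup_def RCOSETS_def)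
      obtain n x where n: "n \<in> N" "x \<in> carrier G" "h = n \<otimes>\<^bsub>H\<^esub> f x" using gen[OF h(1)] by blast
      have nc: "n \<in> carrier H" using n(1) N.subset by blast
      have "N #>\<^bsub>H\<^esub> h = (N #>\<^bsub>H\<^esub> n) #>\<^bsub>H\<^esub> f x"
        using n nc by (simp add: H.coset_mult_assoc N.subset)
      also have "N #>\<^bsub>H\<^esub> n = N" using n(1) nc by (simp add: H.coset_join2 N.is_subgroup)
      finally show "Y \<in> F ` carrier G" using h n(2) by (simp add: F_def)
    qed
  qed
  then have "F \<in> iso G (H Mod N)" using F inj by (simp add: iso_def bij_betw_def)
  then have "G \<cong> H Mod N" by (auto simp: is_iso_def)
  then show ?thesis by (rule G.iso_sym)
qed

lemma hom_AutoGroupI: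
  assumes V: "group V" and K: "group K"
    and hom: "\<And>k. k \<in> carrier K \<Longrightarrow> \<psi> k \<in> hom V V"
    and mult: "\<And>k k' x. k \<in> carrier K \<Longrightarrow> k' \<in> carrier K \<Longrightarrow> x \<in> carrier V \<Longrightarrow> \<psi> (k \<otimes>\<^bsub>K\<^esub> k') x = \<psi> k (\<psi> k' x)"
    and one: "\<And>x. x \<in> carrier V \<Longrightarrow> \<psi> \<one>\<^bsub>K\<^esub> x = x"
  shows "(\<lambda>k. restrict (\<psi> k) (carrier V)) \<in> hom K (AutoGroup V)"
proof -
  interpret K: group K by fact
  interpret V: group V by fact
  have cl: "\<psi> k x \<in> carrier V" if "k \<in> carrier K" "x \<in> carrier V" for k x
    using hom[OF that(1)] that(2) by (auto simp: hom_def)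
  have bij: "bij_betw (\<psi> k) (carrier V) (carrier V)" if k: "k \<in> carrier K" for k
  proof (rule bij_betw_byWitness[where f' = "\<psi> (inv\<^bsub>K\<^esub> k)"])
    show "\<forall>x\<in>carrier V. \<psi> (inv\<^bsub>K\<^esub> k) (\<psi> k x) = x" using mult[of "inv\<^bsub>K\<^esub> k" k] k one by simp
    show "\<forall>x\<in>carrier V. \<psi> k (\<psi> (inv\<^bsub>K\<^esub> k) x) = x" using mult[of k "inv\<^bsub>K\<^esub> k"] k one by simp
  qed (use cl k in auto)
  have B: "restrict (\<psi> k) (carrier V) \<in> Bij (carrier V)" if "k \<in> carrier K" for k
    using bij[OF that] by (simp add: Bij_def)
  moreover have "restrict (\<psi> k) (carrier V) \<in> hom V V" if k: "k \<in> carrier K" for k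
    using hom[OF k] cl[OF k] by (auto simp: hom_def)
  moreover have "restrict (\<psi> (k \<otimes>\<^bsub>K\<^esub> k')) (carrier V) =
      compose (carrier V) (restrict (\<psi> k) (carrier V)) (restrict (\<psi> k') (carrier V))"
    if "k \<in> carrier K" "k' \<in> carrier K" for k k'
    using that mult cl by (auto simp: compose_def intro!: restrict_ext)
  ultimately show ?thesis
    by (auto simp: hom_def[of K] AutoGroup_def BijGroup_def auto_def)
qed

lemma group_semidirect_product:
  assumes V: "group V" and K: "group K" and \<phi>: "\<phi> \<in> hom K (AutoGroup V)"
  shows "group (semidirect_product V K \<phi>)"
proof -
  interpret V: group V by fact
  interpret K: group K by fact
  interpret Au: group "AutoGroup V" by (rule V.AutoGroup)
  interpret \<phi>: group_hom K "AutoGroup V" \<phi> by unfold_locales (rule \<phi>)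
  have auto: "\<phi> k \<in> hom V V" "\<phi> k \<in> Bij (carrier V)" if "k \<in> carrier K" for k
    using \<phi>.hom_closed[OF that] by (auto simp: AutoGroup_def auto_def)
  have cl: "\<phi> k x \<in> carrier V" if "k \<in> carrier K" "x \<in> carrier V" for k x
    using auto(1)[OF that(1)] that(2) by (auto simp: hom_def)
  have hm: "\<phi> k (x \<otimes>\<^bsub>V\<^esub> y) = \<phi> k x \<otimes>\<^bsub>V\<^esub> \<phi> k y" if "k \<in> carrier K" "x \<in> carrier V" "y \<in> carrier V" for k x y
    using auto(1)[OF that(1)] that(2,3) by (auto simp: hom_def)
  have mu: "\<phi> (k \<otimes>\<^bsub>K\<^esub> k') x = \<phi> k (\<phi> k' x)" if "k \<in> carrier K" "k' \<in> carrier K" "x \<in> carrier V" for k k' x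
    using \<phi>.hom_mult[OF that(1,2)] auto that by (simp add: AutoGroup_def BijGroup_def compose_def)
  have one: "\<phi> \<one>\<^bsub>K\<^esub> x = x" if "x \<in> carrier V" for x
    using \<phi>.hom_one that by (simp add: AutoGroup_def BijGroup_def)
  have v1: "\<phi> k \<one>\<^bsub>V\<^esub> = \<one>\<^bsub>V\<^esub>" if "k \<in> carrier K" for k
  proof -
    have "\<phi> k \<one>\<^bsub>V\<^esub> \<otimes>\<^bsub>V\<^esub> \<phi> k \<one>\<^bsub>V\<^esub> = \<phi> k \<one>\<^bsub>V\<^esub>" using hm[OF that, of "\<one>\<^bsub>V\<^esub>" "\<one>\<^bsub>V\<^esub>"] by simp
    then show ?thesis using cl[OF that] by simp
  qed
  show ?thesis
  proof (rule groupI)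
    fix p assume "p \<in> carrier (semidirect_product V K \<phi>)"
    then obtain x k where p: "p = (x, k)" "x \<in> carrier V" "k \<in> carrier K" by (auto simp: semidirect_product_def)
    have "\<phi> (inv\<^bsub>K\<^esub> k) (inv\<^bsub>V\<^esub> x) \<otimes>\<^bsub>V\<^esub> \<phi> (inv\<^bsub>K\<^esub> k) x = \<one>\<^bsub>V\<^esub>"
      using hm[of "inv\<^bsub>K\<^esub> k" "inv\<^bsub>V\<^esub> x" x] p v1[of "inv\<^bsub>K\<^esub> k"] by simp
    then show "\<exists>q\<in>carrier (semidirect_product V K \<phi>). q \<otimes>\<^bsub>semidirect_product V K \<phi>\<^esub> p = \<one>\<^bsub>semidirect_product V K \<phi>\<^esub>"
      using p cl[of "inv\<^bsub>K\<^esub> k" "inv\<^bsub>V\<^esub> x"] by (intro bexI[of _ "(\<phi> (inv\<^bsub>K\<^esub> k) (inv\<^bsub>V\<^esub> x), inv\<^bsub>K\<^esub> k)"]) (auto simp: semidirect_product_def)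
  qed (auto simp: semidirect_product_def cl hm mu one V.m_assoc K.m_assoc simp del: \<phi>.hom_mult \<phi>.hom_one)
qed

lemma iso_to_semidirect_productI:
  assumes V: "group V" and K: "group K" and H: "group H" and N: "N \<lhd> H"
    and hom: "\<And>k. k \<in> carrier K \<Longrightarrow> \<psi> k \<in> hom V V"
    and mult: "\<And>k k' x. k \<in> carrier K \<Longrightarrow> k' \<in> carrier K \<Longrightarrow> x \<in> carrier V \<Longrightarrow> \<psi> (k \<otimes>\<^bsub>K\<^esub> k') x = \<psi> k (\<psi> k' x)"
    and one: "\<And>x. x \<in> carrier V \<Longrightarrow> \<psi> \<one>\<^bsub>K\<^esub> x = x"
    and f: "\<And>x k. x \<in> carrier V \<Longrightarrow> k \<in> carrier K \<Longrightarrow> f x k \<in> carrier H"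
    and f_mult: "\<And>x k y l. x \<in> carrier V \<Longrightarrow> k \<in> carrier K \<Longrightarrow> y \<in> carrier V \<Longrightarrow> l \<in> carrier K \<Longrightarrow>
      f x k \<otimes>\<^bsub>H\<^esub> f y l = f (x \<otimes>\<^bsub>V\<^esub> \<psi> k y) (k \<otimes>\<^bsub>K\<^esub> l)"
    and disj: "\<And>x k. x \<in> carrier V \<Longrightarrow> k \<in> carrier K \<Longrightarrow> f x k \<in> N \<Longrightarrow> x = \<one>\<^bsub>V\<^esub> \<and> k = \<one>\<^bsub>K\<^esub>"
    and gen: "\<And>h. h \<in> carrier H \<Longrightarrow> \<exists>n\<in>N. \<exists>x\<in>carrier V. \<exists>k\<in>carrier K. h = n \<otimes>\<^bsub>H\<^esub> f x k"
  shows "iso_to_semidirect_product (H Mod N) V K"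
proof -
  let ?\<phi> = "\<lambda>k. restrict (\<psi> k) (carrier V)"
  let ?S = "semidirect_product V K ?\<phi>"
  have \<phi>: "?\<phi> \<in> hom K (AutoGroup V)" by (rule hom_AutoGroupI[OF V K hom mult one])
  have "H Mod N \<cong> ?S"
  proof (rule complement_iso[OF group_semidirect_product[OF V K \<phi>] H N])
    show "(\<lambda>(x, k). f x k) \<in> hom ?S H"
      by (rule homI) (auto simp: semidirect_product_def f f_mult)
    show "\<exists>n\<in>N. \<exists>p\<in>carrier ?S. h = n \<otimes>\<^bsub>H\<^esub> (\<lambda>(x, k). f x k) p" if "h \<in> carrier H" for h
      using gen[OF that] by (fastforce simp: semidirect_product_def)
  qed (use disj in \<open>auto simp: semidirect_product_def\<close>)
  then show ?thesis using \<phi> by (auto simp: iso_to_semidirect_product_def)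
qed

section \<open>Inner automorphisms and arrows\<close>

context gentle_quiver
begin

text \<open>Clearing the inverse from the conjugation leaves an identity that involves only one unit.\<close>

lemma inner_intertwine:
  assumes "inner g"
  obtains z where "z \<in> M" "\<And>x. x \<in> M \<Longrightarrow> g x \<star> z = z \<star> x" "\<And>v. v \<in> verts Q \<Longrightarrow> coef z (v, []) = 1"
proof -
  obtain y z where y: "y \<in> Mp" "z \<in> M" "(unit + y) \<star> z = unit" "z \<star> (unit + y) = unit"
    "\<And>x. x \<in> M \<Longrightarrow> g x = z \<star> x \<star> (unit + y)"
    using assms unfolding inner_def by blast
  have yM: "y \<in> M" using y(1) by (rule Mp_M)
  have "g x \<star> z = z \<star> x" if x: "x \<in> M" for x
  proof -
    have "g x \<star> z = z \<star> x \<star> ((unit + y) \<star> z)" using y(5)[OF x] by (simp add: mul_assoc)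
    then show ?thesis using y(2,3) x by simp
  qed
  moreover have "coef z (v, []) = 1" if v: "v \<in> verts Q" for v
  proof -
    have "coef (z \<star> (unit + y)) (v, []) = coef z (v, []) * coef (unit + y) (v, [])"
      by (rule coef_mul_Nil[OF v])
    moreover have "coef y (v, []) = 0" using y(1) by (simp add: Mp_def)
    moreover have "coef (unit :: _ \<Rightarrow>\<^sub>0 'b) (v, []) = 1" using v by (simp add: coef_unit)
    ultimately show ?thesis using y(4) by (simp add: lookup_add)
  qed
  ultimately show thesis using that y(2) by blast
qed

lemma inner_lin:
  assumes g: "vaut g" "inner g" and a: "a \<in> arcs Q"
  shows "lin g a b = (if a = b then 1 else 0)"
proof -
  obtain z where z: "z \<in> M" "\<And>x. x \<in> M \<Longrightarrow> g x \<star> z = z \<star> x" "\<And>v. v \<in> verts Q \<Longrightarrow> coef z (v, []) = 1"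
    using inner_intertwine[OF g(2)] by metis
  show ?thesis
  proof (cases "b \<in> arcs Q")
    case b: True
    have bB: "(tail Q b, [b]) \<in> B" and v: "tail Q b \<in> verts Q" "head Q b \<in> verts Q" using b by auto
    have 1: "coef (im g a \<star> z) (tail Q b, [b]) = lin g a b"
      using coef_mul_lead[of "im g a" 1 z 0 "tail Q b" "[b]"] im_Mp[OF g(1) a] z(1) z(3)[OF v(2)] bB
      by (simp add: Mge_1 Mge_0 lin_def arrow_path_def path_tgt_eq)
    have "(path_elem (ar a) :: _ \<Rightarrow>\<^sub>0 'b) \<in> Mp" by (rule ar_Mp[OF a])
    then have 2: "coef (z \<star> path_elem (ar a)) (tail Q b, [b]) = coef (path_elem (ar a)) (ar b)"
      using coef_mul_lead[of z 0 "path_elem (ar a)" 1 "tail Q b" "[b]"] z(1) z(3)[OF v(1)] bB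
      by (simp add: Mge_1 Mge_0 arrow_path_def path_tgt_eq)
    show ?thesis using 1 2 z(2)[of "path_elem (ar a)"] a
      by (cases "a = b") (auto simp: coef_path_elem arrow_path_def)
  next
    case False
    then show ?thesis using lin_par[OF g(1) a, of b] a by auto
  qed
qed

text \<open>
  An inner automorphism intertwines \<open>a\<close> with its image through a unit \<open>z\<close>. Because the maximal path
  parallel to \<open>a\<close> neither starts nor ends with \<open>a\<close>, it occurs in neither of the two products.
\<close>

lemma inner_emap:
  assumes nk: "\<not> kron" and l: "\<And>a. a \<in> arcs Q \<Longrightarrow> l a \<noteq> 0" and i: "inner (emap l m)" and a: "a \<in> arcs Q"
  shows "l a = 1" "hasg a \<Longrightarrow> m a = 0"
proof -
  have v: "vaut (emap l m)" by (rule emap_vaut[OF nk l])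
  have neq: "coef (gb a :: _ \<Rightarrow>\<^sub>0 'b) (ar a) = 0"
    using gp[of a] by (auto simp: gb_def coef_path_elem gbar_def arrow_path_def)
  have "lin (emap l m) a a = l a"
    using neq by (simp add: lin_def emap_arrow[OF a] eimg_def lookup_add coef_path_elem)
  then show l1: "l a = 1" using inner_lin[OF v i a, of a] by simp
  assume h: "hasg a"
  obtain z where z: "z \<in> M" "\<And>x. x \<in> M \<Longrightarrow> emap l m x \<star> z = z \<star> x" "\<And>v. v \<in> verts Q \<Longrightarrow> coef z (v, []) = 1"
    using inner_intertwine[OF i] by metis
  have eq: "coef (eimg l m a \<star> z) (gp a) = coef (z \<star> path_elem (ar a)) (gp a)"
    using z(2)[of "path_elem (ar a)"] emap_arrow[OF a, of l m] a by simp
  obtain w es where p: "gp a = (w, es)" by fastforce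
  have pp: "(w, es) \<in> B" "es \<noteq> []" "hd es \<noteq> a" "last es \<noteq> a"
    using gp[OF h] p by (auto simp: gbar_def maximal_def)
  have 1: "coef (path_elem (ar a) \<star> z) (w, es) = 0"
  proof (rule ccontr)
    assume nzc: "coef (path_elem (ar a) \<star> z) (w, es) \<noteq> 0"
    obtain i where "i \<le> length es" "(w, es) \<in> B" "coef (path_elem (ar a) :: _ \<Rightarrow>\<^sub>0 'b) (w, take i es) \<noteq> 0"
      "coef z (tgt (w, take i es), drop i es) \<noteq> 0"
      by (rule mul_coef_cut[OF nzc])
    then have "take i es = [a]" by (auto simp: coef_path_elem arrow_path_def split: if_splits)
    then show False using pp(2,3) by (cases es; cases i) auto
  qed
  have 2: "coef (z \<star> path_elem (ar a)) (w, es) = 0"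
  proof (rule ccontr)
    assume nzc: "coef (z \<star> path_elem (ar a)) (w, es) \<noteq> 0"
    obtain i where "i \<le> length es" "(w, es) \<in> B" "coef z (w, take i es) \<noteq> 0"
      "coef (path_elem (ar a) :: _ \<Rightarrow>\<^sub>0 'b) (tgt (w, take i es), drop i es) \<noteq> 0"
      by (rule mul_coef_cut[OF nzc])
    then have "drop i es = [a]" by (auto simp: coef_path_elem arrow_path_def split: if_splits)
    then have "last es = a" by (metis last_drop last.simps drop_all linorder_not_le list.distinct(1))
    then show False using pp(4) by simp
  qed
  have 3: "coef (path_elem (gp a) \<star> z) (w, es) = 1"
  proof -
    have "(path_elem (gp a) :: _ \<Rightarrow>\<^sub>0 'b) \<in> Mge (length es)"
      using pp p by (auto simp: Mge_def coef_path_elem split: if_splits)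
    then have "coef (path_elem (gp a) \<star> z) (w, es) = coef z (tgt (w, es), [])"
      using coef_mul_lead[of "path_elem (gp a)" "length es" z 0 w es] z(1) pp(1) p by (simp add: Mge_0 coef_path_elem)
    moreover have "tgt (w, es) \<in> verts Q" using gp_B[OF h] p a head_in_verts by metis
    ultimately show ?thesis using z(3) by simp
  qed
  have "coef (eimg l m a \<star> z) (w, es) = l a * coef (path_elem (ar a) \<star> z) (w, es) + l a * m a * coef (path_elem (gp a) \<star> z) (w, es)"
    using h by (simp add: eimg_def gb_def mul_add_left mul_scale_left lookup_add)
  then show "m a = 0" using eq 1 2 3 l1 p by simp
qed

section \<open>Exchanging the arrows of each pair\<close>

definition tw :: "'a \<Rightarrow> 'a" where "tw a = (SOME b. partner a b)"

definition double :: bool where "double \<longleftrightarrow> (\<forall>a\<in>arcs Q. \<exists>b. partner a b)"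

lemma tw_partner: assumes double "a \<in> arcs Q" shows "partner a (tw a)"
  using assms unfolding tw_def double_def by (auto intro: someI_ex)

lemma tw: assumes double "a \<in> arcs Q"
  shows "tw a \<in> arcs Q" "tw a \<noteq> a" "tail Q (tw a) = tail Q a" "head Q (tw a) = head Q a" "tw (tw a) = a"
proof -
  note p = tw_partner[OF assms]
  show 1: "tw a \<in> arcs Q" "tw a \<noteq> a" "tail Q (tw a) = tail Q a" "head Q (tw a) = head Q a"
    using p by (auto simp: partner_def)
  show "tw (tw a) = a" using partner_unique[OF tw_partner[OF assms(1) 1(1)] partner_sym[OF p]] .
qed

text \<open>Each of the two gentle conditions negates the relation once, so exchanging both arrows preserves it.\<close>

lemma tw_nz:
  assumes d: double and a: "a \<in> arcs Q" "b \<in> arcs Q" "head Q a = tail Q b"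
  shows "nz (tw a) (tw b) \<longleftrightarrow> nz a b"
proof -
  have "nz a b \<longleftrightarrow> \<not> nz (tw a) b" using two_in[of b a "tw a"] tw[OF d a(1)] a by metis
  moreover have "nz (tw a) b \<longleftrightarrow> \<not> nz (tw a) (tw b)" using two_out[of "tw a" b "tw b"] tw[OF d a(1)] tw[OF d a(2)] a by metis
  ultimately show ?thesis by blast
qed

text \<open>
  A maximal path can only end at a sink, since one of the two arrows leaving any other vertex continues it, and
  likewise it starts at a source. Then \<open>a\<close> joins a source to a sink, and the quiver is the Kronecker quiver.
\<close>

lemma double_no_gbar:
  assumes nk: "\<not> kron" and d: double and a: "a \<in> arcs Q" shows "\<not> hasg a"
proof
  assume "hasg a"
  then have p: "maximal (gp a)" "fst (gp a) = tail Q a" "tgt (gp a) = head Q a" using gp by (auto simp: gbar_def)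
  have q: "gp a \<in> B" "snd (gp a) \<noteq> []" using p(1) by (auto simp: maximal_def)
  note h = B_hd'[OF q]
  have "tail Q c \<noteq> head Q a" if c: "c \<in> arcs Q" for c
  proof
    assume "tail Q c = head Q a"
    then have "nz (last (snd (gp a))) c \<or> nz (last (snd (gp a))) (tw c)"
      using two_out[of "last (snd (gp a))" c "tw c"] tw[OF d c] c h p by metis
    then show False using p(1) by (auto simp: maximal_def)
  qed
  moreover have "head Q c \<noteq> tail Q a" if c: "c \<in> arcs Q" for c
  proof
    assume "head Q c = tail Q a"
    then have "nz c (hd (snd (gp a))) \<or> nz (tw c) (hd (snd (gp a)))"
      using two_in[of "hd (snd (gp a))" c "tw c"] tw[OF d c] c h p by metis
    then show False using p(1) by (auto simp: maximal_def)
  qed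
  ultimately have kron by (intro kronI[OF tw_partner[OF d a]]) auto
  then show False using nk by simp
qed

text \<open>Scaling of the arrows, preceded by the exchange of the members of each pair when \<open>e\<close> holds.\<close>

definition dmap :: "('a \<Rightarrow> 'k::field) \<Rightarrow> bool \<Rightarrow> (('v, 'a) qpath \<Rightarrow>\<^sub>0 'k) \<Rightarrow> (('v, 'a) qpath \<Rightarrow>\<^sub>0 'k)" where
  "dmap l e = ext (\<lambda>a. let b = (if e then tw a else a) in scale (l b) (path_elem (ar b)))"

lemma dmap_vend:
  assumes d: double
  shows "vend (dmap l e)"
    "a \<in> arcs Q \<Longrightarrow> dmap l e (path_elem (ar a)) =
       (let b = (if e then tw a else a) in scale (l b) (path_elem (ar b)))"
proof -
  have 1: "(let b = (if e then tw a else a) in scale (l b) (path_elem (ar b))) \<in> par a" if a: "a \<in> arcs Q" for a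
  proof -
    let ?b = "if e then tw a else a"
    have "?b \<in> arcs Q" "tail Q ?b = tail Q a" "head Q ?b = head Q a" using tw[OF d a] a by auto
    then have "(path_elem (ar ?b) :: _ \<Rightarrow>\<^sub>0 'b) \<in> par a"
      by (intro par_path) (auto simp: arrow_path_def path_tgt_eq)
    then show ?thesis unfolding Let_def by (rule par_closed)
  qed
  have 2: "(let b = (if e then tw a else a) in scale (l b) (path_elem (ar b))) \<star>
      (let b = (if e then tw c else c) in scale (l b) (path_elem (ar b))) = 0"
    if "a \<in> arcs Q" "c \<in> arcs Q" "head Q a = tail Q c" "\<not> nz a c" for a c
    using that tw[OF d that(1)] tw[OF d that(2)] tw_nz[OF d that(1-3)]
    by (simp add: Let_def mul_scale_left mul_scale_right ar_mul)
  show "vend (dmap l e)" unfolding dmap_def by (rule vend_ext(1)[OF 1 2])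
  show "a \<in> arcs Q \<Longrightarrow> dmap l e (path_elem (ar a)) =
       (let b = (if e then tw a else a) in scale (l b) (path_elem (ar b)))"
    unfolding dmap_def by (rule vend_ext(2)[OF 1 2])
qed

lemma dmap_comp:
  assumes d: double and x: "x \<in> M"
  shows "dmap l e (dmap l' e' x) = dmap (\<lambda>a. l a * l' (if e then tw a else a)) (e \<noteq> e') x"
proof -
  have "dmap l e (dmap l' e' (path_elem (ar a))) = dmap (\<lambda>a. l a * l' (if e then tw a else a)) (e \<noteq> e') (path_elem (ar a))"
    if a: "a \<in> arcs Q" for a
    using dmap_vend(1)[OF d, of l e] tw[OF d a] a
    by (cases e; cases e') (simp_all add: dmap_vend(2)[OF d] Let_def vend_def scale_scale mult.commute)
  then show ?thesis
    using vend_eqI[OF vend_comp[OF dmap_vend(1)[OF d] dmap_vend(1)[OF d]] dmap_vend(1)[OF d] _ x, of l e l' e'] by simp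
qed

lemma dmap_one: assumes d: double and l: "\<And>a. a \<in> arcs Q \<Longrightarrow> l a = 1" and x: "x \<in> M" shows "dmap l False x = x"
  by (rule vend_eqI[OF dmap_vend(1)[OF d] _ _ x, where h = "\<lambda>x. x"]) (auto simp: dmap_vend(2)[OF d] Let_def vend_def l)

lemma dmap_cong:
  assumes d: double and l: "\<And>a. a \<in> arcs Q \<Longrightarrow> l a = l' a" and x: "x \<in> M" shows "dmap l e x = dmap l' e x"
  by (rule vend_eqI[OF dmap_vend(1)[OF d] dmap_vend(1)[OF d] _ x]) (auto simp: dmap_vend(2)[OF d] Let_def l tw[OF d])

lemma dmap_M: "double \<Longrightarrow> x \<in> M \<Longrightarrow> dmap l e x \<in> M"
  using dmap_vend(1)[of l e] by (simp add: vend_def)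

lemma dmap_vaut:
  assumes d: double and l: "\<And>a. a \<in> arcs Q \<Longrightarrow> l a \<noteq> 0" shows "vaut (dmap l e)"
proof -
  let ?l = "\<lambda>a. 1 / l (if e then tw a else a)"
  have "dmap l e (dmap ?l e x) = x" "dmap ?l e (dmap l e x) = x" if x: "x \<in> M" for x
    unfolding dmap_comp[OF d x] using l tw[OF d] by (auto intro!: dmap_one[OF d _ x])
  then show ?thesis
    unfolding vaut_iff_vend
    by (intro conjI dmap_vend(1)[OF d] bij_betw_byWitness[where f' = "dmap ?l e"]) (auto simp: dmap_M[OF d])
qed

lemma dmap_emap:
  assumes nk: "\<not> kron" and d: double and x: "x \<in> M" shows "emap l m x = dmap l False x"
  by (rule vend_eqI[OF emap_vend dmap_vend(1)[OF d] _ x])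
    (auto simp: emap_arrow dmap_vend(2)[OF d] eimg_def gb_zero double_no_gbar[OF nk d] Let_def)

lemma lin_dmap:
  assumes d: double and a: "a \<in> arcs Q"
  shows "lin (dmap l e) a b = (if b = (if e then tw a else a) then l b else 0)"
  unfolding lin_def dmap_vend(2)[OF d a] by (auto simp: Let_def coef_path_elem arrow_path_def)

lemma inner_dmap:
  assumes d: double and l: "\<And>a. a \<in> arcs Q \<Longrightarrow> l a \<noteq> 0" and i: "inner (dmap l e)"
  shows "\<not> e" "a \<in> arcs Q \<Longrightarrow> l a = 1"
proof -
  obtain c where c: "c \<in> arcs Q" using arcs_ne by blast
  show e: "\<not> e"
    using inner_lin[OF dmap_vaut[OF d l] i c, of c] lin_dmap[OF d c, of l e c] tw[OF d c] by auto
  show "l a = 1" if a: "a \<in> arcs Q"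
    using inner_lin[OF dmap_vaut[OF d l] i a, of a] lin_dmap[OF d a, of l e a] e by auto
qed

lemma not_double_nondeg: "\<not> double \<Longrightarrow> vaut g \<Longrightarrow> nondeg g"
  unfolding nondeg_def double_def using degenerate_all_partners by blast

text \<open>In the degenerate case the exchange moves the nonzero entries of the linear part to the diagonal.\<close>

lemma double_decomposition:
  fixes g :: "(('v, 'a) qpath \<Rightarrow>\<^sub>0 'k::field) \<Rightarrow> (('v, 'a) qpath \<Rightarrow>\<^sub>0 'k)"
  assumes nk: "\<not> kron" and d: double and g: "vaut g"
  shows "\<exists>n l e. vaut n \<and> inner n \<and> (\<forall>a\<in>arcs Q. l a \<noteq> 0) \<and> (\<forall>x\<in>M. g x = n (dmap l e x))"
proof (cases "nondeg g")
  case True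
  then have "dec g" by (rule decomposition[OF nk])
  then show ?thesis unfolding dec_def using dmap_emap[OF nk d] by metis
next
  case False
  then have deg: "lin g a a = 0" if "a \<in> arcs Q" for a
    using not_kron_degenerate[OF nk g _ _ that] g by (auto simp: nondeg_def)
  let ?t = "dmap (\<lambda>_. 1 :: 'k) True"
  have t: "vaut ?t" by (rule dmap_vaut[OF d]) simp
  have gt: "vaut (g \<circ> ?t)" by (rule vaut_comp[OF g t])
  have "lin (g \<circ> ?t) a a \<noteq> 0" if a: "a \<in> arcs Q" for a
  proof -
    have "lin (g \<circ> ?t) a a = lin g (tw a) a"
      by (simp add: lin_def dmap_vend(2)[OF d a] Let_def)
    moreover obtain b where b: "partner a b" "lin g a b \<noteq> 0" "lin g b a \<noteq> 0" by (rule lin_degenerate[OF g a deg[OF a]])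
    moreover have "b = tw a" by (rule partner_unique[OF b(1) tw_partner[OF d a]])
    ultimately show ?thesis by simp
  qed
  then have "dec (g \<circ> ?t)" using gt by (intro decomposition[OF nk]) (simp add: nondeg_def)
  then obtain l m n where D: "\<forall>a\<in>arcs Q. l a \<noteq> 0" "vaut n" "inner n" "\<forall>x\<in>M. (g \<circ> ?t) x = n (emap l m x)"
    unfolding dec_def by metis
  have "g x = n (dmap (\<lambda>a. l a) True x)" if x: "x \<in> M" for x
  proof -
    have "?t (?t x) = x" by (simp add: dmap_comp[OF d x] dmap_one[OF d _ x])
    then have "g x = n (emap l m (?t x))" using D(4) x t by (metis comp_apply vaut_M)
    also have "emap l m (?t x) = dmap l True x"
      using dmap_emap[OF nk d, of "?t x" l m] vaut_M[OF t x] by (simp add: dmap_comp[OF d x])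
    finally show ?thesis .
  qed
  then show ?thesis using D by blast
qed

end

section \<open>Quivers in which every arrow is doubled\<close>

context gentle_quiver
begin

lemma double_if_iso:
  fixes h :: "nat \<Rightarrow> nat"
  assumes iso: "digraph_iso Q \<lparr>verts = V, arcs = T \<times> (UNIV :: bool set), tail = fst, head = (\<lambda>a. h (fst a))\<rparr>"
  shows double
  unfolding double_def
proof
  fix a assume a: "a \<in> arcs Q"
  obtain f where f: "pre_digraph.digraph_isomorphism Q f"
    and eq: "\<lparr>verts = V, arcs = T \<times> (UNIV :: bool set), tail = fst, head = (\<lambda>a. h (fst a))\<rparr> = app_iso f Q"
    using iso unfolding digraph_iso_def by blast
  have im: "iso_arcs f ` arcs Q = T \<times> UNIV" and th: "iso_tail f = fst" "iso_head f = (\<lambda>a. h (fst a))"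
    using eq by (auto simp: app_iso_def)
  obtain i \<beta> where i: "iso_arcs f a = (i, \<beta>)" by fastforce
  have "iso_arcs f a \<in> T \<times> UNIV" using im a by blast
  then have "(i, \<not> \<beta>) \<in> iso_arcs f ` arcs Q" unfolding im using i by simp
  then obtain b where b: "b \<in> arcs Q" "iso_arcs f b = (i, \<not> \<beta>)" by auto
  have V: "tail Q a \<in> verts Q" "tail Q b \<in> verts Q" "head Q a \<in> verts Q" "head Q b \<in> verts Q" using a b by auto
  have "iso_verts f (tail Q a) = iso_verts f (tail Q b)" "iso_verts f (head Q a) = iso_verts f (head Q b)"
    "inj_on (iso_verts f) (verts Q)"
    using f a b i th unfolding digraph_isomorphism_def by auto
  then have "tail Q b = tail Q a" "head Q b = head Q a" using V by (auto dest: inj_onD)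
  moreover have "b \<noteq> a" using b i by auto
  ultimately show "\<exists>b. partner a b" using a b unfolding partner_def by blast
qed

text \<open>One arrow of each pair is chosen to carry the label \<open>False\<close>.\<close>

lemma iso_if_labelled:
  fixes L :: "'v \<Rightarrow> nat"
  assumes d: double and L: "inj_on L (verts Q)"
    and hd: "\<And>a. a \<in> arcs Q \<Longrightarrow> L (head Q a) = h (L (tail Q a))"
  shows "digraph_iso Q \<lparr>verts = L ` verts Q, arcs = (L ` tail Q ` arcs Q) \<times> (UNIV :: bool set),
    tail = fst, head = (\<lambda>a. h (fst a))\<rparr>"
proof -
  define \<alpha> where "\<alpha> u = (SOME a. a \<in> arcs Q \<and> tail Q a = u)" for u
  have \<alpha>: "\<alpha> (tail Q a) \<in> arcs Q \<and> tail Q (\<alpha> (tail Q a)) = tail Q a" if "a \<in> arcs Q" for a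
    unfolding \<alpha>_def by (rule someI[of _ a]) (use that in simp)
  define F where "F a = (L (tail Q a), a \<noteq> \<alpha> (tail Q a))" for a
  define f where "f = \<lparr>iso_verts = L, iso_arcs = F, iso_head = (\<lambda>a. h (fst a)), iso_tail = fst\<rparr>"
  have "inj_on F (arcs Q)"
  proof (rule inj_onI)
    fix a b assume ab: "a \<in> arcs Q" "b \<in> arcs Q" "F a = F b"
    then have t: "tail Q a = tail Q b" using L by (auto simp: F_def dest: inj_onD)
    then show "a = b" using out3[of a b "\<alpha> (tail Q a)"] \<alpha>[OF ab(1)] ab by (auto simp: F_def)
  qed
  moreover have "F ` arcs Q = (L ` tail Q ` arcs Q) \<times> UNIV"
  proof
    show "(L ` tail Q ` arcs Q) \<times> UNIV \<subseteq> F ` arcs Q"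
    proof
      fix x assume "x \<in> (L ` tail Q ` arcs Q) \<times> (UNIV :: bool set)"
      then obtain a \<beta> where a: "a \<in> arcs Q" "x = (L (tail Q a), \<beta>)" by auto
      note A = \<alpha>[OF a(1)]
      note T = tw[OF d conjunct1[OF A]]
      show "x \<in> F ` arcs Q"
        using a A T by (intro image_eqI[of _ _ "if \<beta> then tw (\<alpha> (tail Q a)) else \<alpha> (tail Q a)"]) (auto simp: F_def)
    qed
  qed (auto simp: F_def)
  ultimately show ?thesis
    unfolding digraph_iso_def
    by (intro exI[of _ f]) (auto simp: digraph_isomorphism_def f_def app_iso_def L hd F_def wf_digraph_axioms)
qed

definition nextv :: "'v \<Rightarrow> 'v" where "nextv u = head Q (SOME a. a \<in> arcs Q \<and> tail Q a = u)"

lemma double_same_tail: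
  assumes d: double and ab: "a \<in> arcs Q" "b \<in> arcs Q" "tail Q a = tail Q b" shows "head Q a = head Q b"
  using out3[of a "tw a" b] tw[OF d ab(1)] ab by metis

lemma double_same_head:
  assumes d: double and ab: "a \<in> arcs Q" "b \<in> arcs Q" "head Q a = head Q b" shows "tail Q a = tail Q b"
  using in3[of a "tw a" b] tw[OF d ab(1)] ab by metis

lemma nextv: assumes d: double and a: "a \<in> arcs Q" shows "nextv (tail Q a) = head Q a"
proof -
  have "(SOME b. b \<in> arcs Q \<and> tail Q b = tail Q a) \<in> arcs Q \<and> tail Q (SOME b. b \<in> arcs Q \<and> tail Q b = tail Q a) = tail Q a"
    by (rule someI[of _ a]) (use a in simp)
  then show ?thesis unfolding nextv_def using double_same_tail[OF d _ a] by blast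
qed

text \<open>The walk is also deterministic backwards, since arrows with the same head have the same tail.\<close>

lemma walk_cancel:
  assumes d: double and ij: "i \<le> j" and out: "\<And>m. m < j \<Longrightarrow> (nextv ^^ m) s \<in> tail Q ` arcs Q"
    and eq: "(nextv ^^ i) s = (nextv ^^ j) s"
  shows "(nextv ^^ (j - i)) s = s"
  using ij out eq
proof (induction i arbitrary: j)
  case (Suc i)
  then obtain k where k: "j = Suc k" by (cases j) auto
  obtain a b where ab: "a \<in> arcs Q" "tail Q a = (nextv ^^ i) s" "b \<in> arcs Q" "tail Q b = (nextv ^^ k) s"
    using Suc.prems(2)[of i] Suc.prems(2)[of k] Suc.prems(1) k by (metis Suc_le_lessD imageE lessI)
  then have "head Q a = head Q b" using Suc.prems(3) k nextv[OF d ab(1)] nextv[OF d ab(3)] by simp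
  then have "(nextv ^^ i) s = (nextv ^^ k) s" using double_same_head[OF d ab(1,3)] ab by simp
  then show ?case using Suc.IH[of k] Suc.prems k by simp
qed simp

lemma walk_returns:
  assumes d: double and s: "s \<in> verts Q" and out: "\<And>m. (nextv ^^ m) s \<in> tail Q ` arcs Q"
  shows "\<exists>n>0. (nextv ^^ n) s = s"
proof -
  have "\<not> inj (\<lambda>m. (nextv ^^ m) s)"
  proof
    assume i: "inj (\<lambda>m. (nextv ^^ m) s)"
    have "range (\<lambda>m. (nextv ^^ m) s) \<subseteq> tail Q ` arcs Q" using out by blast
    then have "finite (range (\<lambda>m. (nextv ^^ m) s))" by (rule finite_subset) simp
    then show False using i finite_imageD[of "\<lambda>m. (nextv ^^ m) s" UNIV] by simp
  qed
  then obtain i j where "(nextv ^^ i) s = (nextv ^^ j) s" "i < j"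
    unfolding inj_def by (metis nat_neq_iff)
  then show ?thesis using walk_cancel[OF d _ out, of i j] by (intro exI[of _ "j - i"]) auto
qed

text \<open>The walk from a source cannot return to it, so it runs into a sink; connectedness makes it exhaust the vertices.\<close>

lemma double_is_chain:
  assumes d: double and s: "s \<in> verts Q" and src: "\<And>a. a \<in> arcs Q \<Longrightarrow> head Q a \<noteq> s"
  shows "is_double_chain Q"
proof -
  define W where "W m = (nextv ^^ m) s" for m
  have WS: "W (Suc m) = head Q a" if "a \<in> arcs Q" "tail Q a = W m" for a m
    using nextv[OF d that(1)] that(2) by (simp add: W_def)
  have "\<exists>m. W m \<notin> tail Q ` arcs Q"
  proof (rule ccontr)
    assume "\<not> ?thesis"
    then have all: "W m \<in> tail Q ` arcs Q" for m by blast
    then obtain n where n: "0 < n" "W n = s" using walk_returns[OF d s] unfolding W_def by blast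
    then obtain k where k: "n = Suc k" by (cases n) auto
    obtain a where a: "a \<in> arcs Q" "tail Q a = W k" using all[of k] by (metis imageE)
    then show False using WS[OF a] src[OF a(1)] n k by simp
  qed
  define k where "k = (LEAST m. W m \<notin> tail Q ` arcs Q)"
  have k: "W k \<notin> tail Q ` arcs Q" unfolding k_def using \<open>\<exists>m. _\<close> by (rule LeastI_ex)
  have lt: "W m \<in> tail Q ` arcs Q" if "m < k" for m using that not_less_Least k_def by blast
  have WV: "W m \<in> verts Q" if "m \<le> k" for m
    using that
  proof (cases m)
    case (Suc i)
    then have "i < k" using \<open>m \<le> k\<close> by simp
    then obtain a where "a \<in> arcs Q" "tail Q a = W i" using lt[of i] by (metis imageE)
    then show ?thesis using WS Suc by auto
  qed (simp add: W_def s)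
  have inj: "inj_on W {..k}"
  proof (rule linorder_inj_onI)
    fix i j assume ij: "i < j" "i \<in> {..k}" "j \<in> {..k}"
    show "W i \<noteq> W j"
    proof
      assume "W i = W j"
      then have "W (j - i) = s" using walk_cancel[OF d, of i j s] ij lt unfolding W_def by auto
      moreover obtain m where m: "j - i = Suc m" using ij by (cases "j - i") auto
      moreover have "m < k" using m ij by auto
      then obtain a where "a \<in> arcs Q" "tail Q a = W m" using lt[of m] by (metis imageE)
      ultimately show False using WS[of a m] src[of a] by simp
    qed
  qed auto
  have V: "verts Q = W ` {..k}"
  proof
    show "verts Q \<subseteq> W ` {..k}"
    proof
      fix x assume "x \<in> verts Q"
      then show "x \<in> W ` {..k}"
      proof (rule verts_connected[of s, rotated 3])
        show "s \<in> W ` {..k}" by (rule image_eqI[of _ _ 0]) (auto simp: W_def)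
        fix a assume a: "a \<in> arcs Q"
        show "tail Q a \<in> W ` {..k} \<longleftrightarrow> head Q a \<in> W ` {..k}"
        proof
          assume "tail Q a \<in> W ` {..k}"
          then obtain i where i: "i \<le> k" "tail Q a = W i" by auto
          then have "i \<noteq> k" using k a by (metis image_eqI)
          then show "head Q a \<in> W ` {..k}" using WS[OF a i(2)] i(1) by (intro image_eqI[of _ _ "Suc i"]) auto
        next
          assume "head Q a \<in> W ` {..k}"
          then obtain i where i: "i \<le> k" "head Q a = W i" by auto
          have "W 0 = s" by (simp add: W_def)
          then have "i \<noteq> 0" using src[OF a] i by metis
          then obtain m where m: "i = Suc m" by (cases i) auto
          have "m < k" using m i(1) by simp
          then obtain b where b: "b \<in> arcs Q" "tail Q b = W m" using lt[of m] by (metis imageE)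
          have "tail Q a = W m" using double_same_head[OF d a b(1)] WS[OF b] b i m by simp
          then show "tail Q a \<in> W ` {..k}" using m i(1) by auto
        qed
      qed (rule s)
    qed
  qed (use WV in auto)
  have k1: "1 \<le> k"
  proof (rule ccontr)
    assume "\<not> ?thesis"
    then have "k = 0" by simp
    then have "verts Q = {W k}" using V by (simp add: atMost_0)
    moreover obtain a where "a \<in> arcs Q" using arcs_ne by blast
    ultimately show False using k by (metis imageI singletonD tail_in_verts)
  qed
  define L where "L x = Suc (inv_into {..k} W x)" for x
  have LW: "L (W i) = Suc i" if "i \<le> k" for i using that inj by (simp add: L_def inv_into_f_f)
  have tails: "tail Q ` arcs Q = W ` {..<k}"
  proof
    show "tail Q ` arcs Q \<subseteq> W ` {..<k}"
    proof
      fix x assume x: "x \<in> tail Q ` arcs Q"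
      then have "x \<in> W ` {..k}" using V by auto
      then obtain i where "i \<le> k" "x = W i" by auto
      then show "x \<in> W ` {..<k}" using k x by (cases "i = k") auto
    qed
  qed (use lt in auto)
  have "inj_on L (verts Q)" unfolding V by (auto simp: inj_on_def LW)
  moreover have "L (head Q a) = L (tail Q a) + 1" if a: "a \<in> arcs Q" for a
  proof -
    have "tail Q a \<in> W ` {..<k}" using tails a by blast
    then obtain i where i: "i < k" "tail Q a = W i" by auto
    then show ?thesis using WS[OF a i(2)] LW[of i] LW[of "Suc i"] by simp
  qed
  moreover have "L ` verts Q = {1..k + 1}"
    unfolding V image_image using LW by (auto simp: image_iff Bex_def) (metis Suc_le_D Suc_le_mono atMost_iff)
  moreover have "L ` tail Q ` arcs Q = {1..k}"
    unfolding tails image_image using LW by (auto simp: image_iff Bex_def) (metis Suc_le_D Suc_le_eq less_imp_le_nat)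
  ultimately have "digraph_iso Q (double_chain k)"
    using iso_if_labelled[OF d, of L "\<lambda>i. i + 1"] by (simp add: double_chain_def)
  then show ?thesis using k1 by (auto simp: is_double_chain_def)
qed

text \<open>
  Without a source the predecessor map on the vertices is injective, hence surjective by finiteness. So there is
  no sink either, the walk never stops, and it has to return to its start.
\<close>

lemma double_is_cycle:
  assumes d: double and nosrc: "\<And>v. v \<in> verts Q \<Longrightarrow> \<exists>a\<in>arcs Q. head Q a = v"
  shows "is_double_cycle Q"
proof -
  define \<pi> where "\<pi> v = tail Q (SOME a. a \<in> arcs Q \<and> head Q a = v)" for v
  have \<pi>: "\<exists>a\<in>arcs Q. head Q a = v \<and> tail Q a = \<pi> v" if "v \<in> verts Q" for v
  proof -
    have "\<exists>a. a \<in> arcs Q \<and> head Q a = v" using nosrc[OF that] by blast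
    from someI_ex[OF this] show ?thesis by (auto simp: \<pi>_def)
  qed
  have inj: "inj_on \<pi> (verts Q)"
    by (rule inj_onI) (metis \<pi> double_same_tail[OF d])
  have sub: "\<pi> ` verts Q \<subseteq> verts Q" using \<pi> by (metis image_subsetI tail_in_verts)
  have surj: "\<pi> ` verts Q = verts Q" by (rule endo_inj_surj[OF finite_verts sub inj])
  have sink: "v \<in> tail Q ` arcs Q" if v: "v \<in> verts Q" for v
  proof -
    obtain u where u: "u \<in> verts Q" "v = \<pi> u" using v surj by blast
    then obtain a where "a \<in> arcs Q" "tail Q a = v" using \<pi>[OF u(1)] by blast
    then show ?thesis by blast
  qed
  obtain s where s: "s \<in> verts Q" using arcs_ne tail_in_verts by blast
  define W where "W m = (nextv ^^ m) s" for m
  have WS: "W (Suc m) = head Q a" if "a \<in> arcs Q" "tail Q a = W m" for a m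
    using nextv[OF d that(1)] that(2) by (simp add: W_def)
  have WV: "W m \<in> verts Q" for m
  proof (induction m)
    case (Suc m)
    then obtain a where "a \<in> arcs Q" "tail Q a = W m" using sink by (metis imageE)
    then show ?case using WS by auto
  qed (simp add: W_def s)
  have out: "W m \<in> tail Q ` arcs Q" for m using sink[OF WV] .
  define k where "k = (LEAST n. 0 < n \<and> W n = s)"
  have "\<exists>n. 0 < n \<and> W n = s" using walk_returns[OF d s] out unfolding W_def by blast
  then have k: "0 < k" "W k = s" unfolding k_def by (metis (mono_tags, lifting) LeastI_ex)+
  have least: "W n \<noteq> s" if "0 < n" "n < k" for n using that not_less_Least[of n "\<lambda>n. 0 < n \<and> W n = s"] by (auto simp: k_def)
  have inj: "inj_on W {..<k}"
  proof (rule linorder_inj_onI)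
    fix i j assume ij: "i < j" "i \<in> {..<k}" "j \<in> {..<k}"
    show "W i \<noteq> W j"
    proof
      assume "W i = W j"
      then have "W (j - i) = s" using walk_cancel[OF d, of i j s] ij out unfolding W_def by auto
      moreover have "0 < j - i" "j - i < k" using ij by auto
      ultimately show False using least by blast
    qed
  qed auto
  have step: "\<exists>j<k. W (Suc i) = W j \<and> j = Suc i mod k" if "i < k" for i
    using that k by (cases "Suc i = k") (auto simp: W_def)
  have V: "verts Q = W ` {..<k}"
  proof
    show "verts Q \<subseteq> W ` {..<k}"
    proof
      fix x assume "x \<in> verts Q"
      then show "x \<in> W ` {..<k}"
      proof (rule verts_connected[of s, rotated 3])
        show "s \<in> W ` {..<k}" using k by (intro image_eqI[of _ _ 0]) (auto simp: W_def)
        fix a assume a: "a \<in> arcs Q"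
        show "tail Q a \<in> W ` {..<k} \<longleftrightarrow> head Q a \<in> W ` {..<k}"
        proof
          assume "tail Q a \<in> W ` {..<k}"
          then obtain i where i: "i < k" "tail Q a = W i" by auto
          then show "head Q a \<in> W ` {..<k}" using WS[OF a i(2)] step[OF i(1)] by auto
        next
          assume "head Q a \<in> W ` {..<k}"
          then obtain i where i: "i < k" "head Q a = W i" by auto
          then obtain m where m: "m < k" "head Q a = W (Suc m)"
          proof (cases i)
            case 0
            then show ?thesis using that[of "k - 1"] i k by (simp add: W_def)
          next
            case (Suc m)
            then show ?thesis using that[of m] i by simp
          qed
          obtain b where b: "b \<in> arcs Q" "tail Q b = W m" using out[of m] by (metis imageE)
          have "tail Q a = W m" using double_same_head[OF d a b(1)] WS[OF b] b m by simp
          then show "tail Q a \<in> W ` {..<k}" using m by auto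
        qed
      qed (rule s)
    qed
  qed (use WV in auto)
  define L where "L = inv_into {..<k} W"
  have LW: "L (W i) = i" if "i < k" for i using that inj by (simp add: L_def inv_into_f_f)
  have tails: "tail Q ` arcs Q = verts Q" using sink by auto
  have "inj_on L (verts Q)" unfolding V by (auto simp: inj_on_def LW)
  moreover have "L (head Q a) = (L (tail Q a) + 1) mod k" if a: "a \<in> arcs Q" for a
  proof -
    have "tail Q a \<in> W ` {..<k}" using V a by auto
    then obtain i where i: "i < k" "tail Q a = W i" by auto
    then obtain j where "j < k" "W (Suc i) = W j" "j = Suc i mod k" using step by blast
    then show ?thesis using WS[OF a i(2)] LW i by simp
  qed
  moreover have LV: "L ` verts Q = {0..<k}"
    unfolding V image_image using LW by (auto simp: image_iff)
  moreover have "L ` tail Q ` arcs Q = {0..<k}"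
    unfolding tails by (rule LV)
  ultimately have "digraph_iso Q (double_cycle k)"
    using iso_if_labelled[OF d, of L "\<lambda>i. (i + 1) mod k"] by (simp add: double_cycle_def)
  moreover have "1 \<le> k" using k(1) by simp
  ultimately show ?thesis unfolding is_double_cycle_def by blast
qed

lemma double_iff: "is_double_chain Q \<or> is_double_cycle Q \<longleftrightarrow> double"
proof
  assume "is_double_chain Q \<or> is_double_cycle Q"
  then show double
    by (auto simp: is_double_chain_def is_double_cycle_def double_chain_def double_cycle_def intro: double_if_iso)
next
  assume d: double
  show "is_double_chain Q \<or> is_double_cycle Q"
  proof (cases "\<exists>s\<in>verts Q. \<forall>a\<in>arcs Q. head Q a \<noteq> s")
    case True
    then show ?thesis using double_is_chain[OF d] by blast
  next
    case False
    then show ?thesis using double_is_cycle[OF d] by blast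
  qed
qed

end

section \<open>The polynomial algebra\<close>

context bound_quiver_ideal
begin

text \<open>The paths are the powers of the loop, and concatenation adds exponents.\<close>

lemma loop_isomorphic_polynomials:
  assumes V: "verts Q = {v}" and E: "arcs Q = {a}" and nza: "nz a a"
  shows "algebra_isomorphic A (polynomial_algebra :: ('k, 'k poly) module)"
proof -
  let ?p = "\<lambda>n. (v, replicate n a)"
  have ta: "tail Q a = v" using E V tail_in_verts[of a] by auto
  have chain: "successively nz (replicate n a)" for n using nza by (auto simp: successively_conv_nth)
  have pB: "?p n \<in> B" for n using V E ta chain[of n] by (auto simp: B_def)
  have Bp: "p = ?p (length (snd p))" if "p \<in> B" for p
  proof -
    have "fst p = v" "set (snd p) \<subseteq> {a}" using that V E by (auto simp: B_def)
    then show ?thesis using replicate_length_same[of "snd p" a] by (metis prod.collapse subsetD singletonD)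
  qed
  define \<theta> :: "(('v, 'a) qpath \<Rightarrow>\<^sub>0 'k) \<Rightarrow> 'k poly"
    where "\<theta> x = (\<Sum>p\<in>Poly_Mapping.keys x. monom (coef x p) (length (snd p)))" for x
  have co: "coeff (\<theta> x) n = coef x (?p n)" if x: "x \<in> M" for x n
  proof -
    have "coeff (\<theta> x) n = (\<Sum>p\<in>Poly_Mapping.keys x. if p = ?p n then coef x p else 0)"
      unfolding \<theta>_def coeff_sum
    proof (rule sum.cong[OF refl])
      fix p assume "p \<in> Poly_Mapping.keys x"
      then have "p = ?p (length (snd p))" using MD[OF x] Bp by (auto simp: in_keys_iff)
      then show "coeff (monom (coef x p) (length (snd p))) n = (if p = ?p n then coef x p else 0)"
        by (metis coeff_monom length_replicate snd_conv)
    qed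
    then show ?thesis by (simp add: in_keys_iff)
  qed
  have add: "\<theta> (x + y) = \<theta> x + \<theta> y" if "x \<in> M" "y \<in> M" for x y
    using that by (intro poly_eqI) (simp add: co lookup_add)
  have sc: "\<theta> (scale c x) = Polynomial.smult c (\<theta> x)" if "x \<in> M" for c x
    using that by (intro poly_eqI) (simp add: co)
  have mu: "\<theta> (x \<star> y) = \<theta> x * \<theta> y" if "x \<in> M" "y \<in> M" for x y
  proof (rule poly_eqI)
    fix n
    have t: "tgt (v, replicate i a) = v" for i using B_tgt[OF pB] V by simp
    have "coeff (\<theta> (x \<star> y)) n = (\<Sum>i\<le>n. coef x (?p i) * coef y (?p (n - i)))"
      using that pB[of n] by (simp add: co coef_mul t min_def cong: sum.cong_simp)
    then show "coeff (\<theta> (x \<star> y)) n = coeff (\<theta> x * \<theta> y) n" using that by (simp add: coeff_mult co)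
  qed
  have un: "\<theta> unit = 1"
    by (rule poly_eqI) (simp add: co coef_unit V)
  have inj: "x = y" if "x \<in> M" "y \<in> M" "\<theta> x = \<theta> y" for x y
  proof (rule poly_mapping_eqI)
    fix p show "coef x p = coef y p"
    proof (cases "p \<in> B")
      case True
      then show ?thesis using Bp[OF True] co[OF that(1)] co[OF that(2)] that(3) by metis
    next
      case False
      then show ?thesis using that M_coef by metis
    qed
  qed
  have surj: "\<exists>x\<in>M. \<theta> x = f" for f
  proof -
    define x where "x = (\<Sum>i\<le>degree f. scale (coeff f i) (path_elem (?p i) :: _ \<Rightarrow>\<^sub>0 'k))"
    have x: "x \<in> M" unfolding x_def using pB by auto
    have "coef x (?p n) = coeff f n" for n
    proof -
      have "coef x (?p n) = (\<Sum>i\<le>degree f. if i = n then coeff f i else 0)"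
        unfolding x_def lookup_sum by (intro sum.cong refl) (auto simp: coef_path_elem dest: arg_cong[where f = length])
      then show ?thesis by (simp add: coeff_eq_0)
    qed
    then have "\<theta> x = f" using x by (intro poly_eqI) (simp add: co)
    then show ?thesis using x by blast
  qed
  have "(\<lambda>Y. \<theta> (rep Y)) \<in> algebra_hom A polynomial_algebra"
    unfolding algebra_hom_def ring_hom_def
    by (auto simp: polynomial_algebra_def cls_mult cls_add cls_unit cls_smult mu add un sc elim!: carrier_A_cases)
  moreover have "bij_betw (\<lambda>Y. \<theta> (rep Y)) (carrier A) (carrier polynomial_algebra)"
  proof -
    have "bij_betw \<theta> M UNIV" unfolding bij_betw_def using inj surj by (auto simp: inj_on_def) (metis rangeI image_eqI)
    from bij_betw_trans[OF rep_bij this] show ?thesis by (simp add: polynomial_algebra_def comp_def)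
  qed
  ultimately show ?thesis unfolding algebra_isomorphic_def by blast
qed

end

section \<open>The Kronecker algebra\<close>

definition (in bound_quiver) kshape :: "'a \<Rightarrow> 'a \<Rightarrow> 'v \<Rightarrow> 'v \<Rightarrow> bool" where
  "kshape a b v w \<longleftrightarrow> verts Q = {v, w} \<and> arcs Q = {a, b} \<and> a \<noteq> b \<and> v \<noteq> w \<and>
     tail Q a = v \<and> tail Q b = v \<and> head Q a = w \<and> head Q b = w"

context bound_quiver
begin

lemma kshape_B:
  assumes k: "kshape a b v w" shows "B = {(v, []), (w, []), (v, [a]), (v, [b])}"
proof
  show "B \<subseteq> {(v, []), (w, []), (v, [a]), (v, [b])}"
  proof
    fix p assume p: "p \<in> B"
    obtain x es where p': "p = (x, es)" by fastforce
    show "p \<in> {(v, []), (w, []), (v, [a]), (v, [b])}"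
    proof (cases es rule: remdups_adj.cases)
      case (3 c d fs)
      then have "nz c d" using p p' by (auto simp: B_def)
      then show ?thesis using k nz_arcs[of c d] by (auto simp: kshape_def)
    qed (use p p' k in \<open>auto simp: kshape_def B_def\<close>)
  qed
  show "{(v, []), (w, []), (v, [a]), (v, [b])} \<subseteq> B"
    using k by (auto simp: kshape_def B_def)
qed

lemma kshape_mul:
  assumes k: "kshape a b v w"
  shows "coef (x \<star> y) (v, []) = coef x (v, []) * coef y (v, [])"
    "coef (x \<star> y) (w, []) = coef x (w, []) * coef y (w, [])"
    "coef (x \<star> y) (v, [a]) = coef x (v, []) * coef y (v, [a]) + coef x (v, [a]) * coef y (w, [])"
    "coef (x \<star> y) (v, [b]) = coef x (v, []) * coef y (v, [b]) + coef x (v, [b]) * coef y (w, [])"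
proof -
  have B: "(v, []) \<in> B" "(w, []) \<in> B" "(v, [a]) \<in> B" "(v, [b]) \<in> B" unfolding kshape_B[OF k] by simp_all
  have h: "head Q a = w" "head Q b = w" using k by (auto simp: kshape_def)
  show "coef (x \<star> y) (v, []) = coef x (v, []) * coef y (v, [])"
    "coef (x \<star> y) (w, []) = coef x (w, []) * coef y (w, [])"
    "coef (x \<star> y) (v, [a]) = coef x (v, []) * coef y (v, [a]) + coef x (v, [a]) * coef y (w, [])"
    "coef (x \<star> y) (v, [b]) = coef x (v, []) * coef y (v, [b]) + coef x (v, [b]) * coef y (w, [])"
    unfolding coef_mul using B h by (simp_all add: path_tgt_eq)
qed

lemma kshape_eqI:
  assumes k: "kshape a b v w" and xy: "x \<in> M" "y \<in> M"
    and c: "coef x (v, []) = coef y (v, [])" "coef x (w, []) = coef y (w, [])"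
      "coef x (v, [a]) = coef y (v, [a])" "coef x (v, [b]) = coef y (v, [b])"
  shows "x = y"
proof (rule poly_mapping_eqI)
  fix p show "coef x p = coef y p"
  proof (cases "p \<in> B")
    case True
    then show ?thesis using c unfolding kshape_B[OF k] by blast
  next
    case False
    then show ?thesis using xy M_coef by metis
  qed
qed

definition kelem :: "'a \<Rightarrow> 'a \<Rightarrow> 'v \<Rightarrow> 'v \<Rightarrow> 'k \<Rightarrow> 'k \<Rightarrow> 'k \<Rightarrow> 'k \<Rightarrow> (('v, 'a) qpath \<Rightarrow>\<^sub>0 'k::field)" where
  "kelem a b v w p q r s = scale p (path_elem (v, [])) + scale q (path_elem (w, [])) +
     scale r (path_elem (v, [a])) + scale s (path_elem (v, [b]))"

lemma kelem:
  assumes k: "kshape a b v w"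
  shows "kelem a b v w p q r s \<in> M"
    "coef (kelem a b v w p q r s) (v, []) = p" "coef (kelem a b v w p q r s) (w, []) = q"
    "coef (kelem a b v w p q r s) (v, [a]) = r" "coef (kelem a b v w p q r s) (v, [b]) = s"
proof -
  have ne: "v \<noteq> w" "w \<noteq> v" "a \<noteq> b" "b \<noteq> a" using k by (auto simp: kshape_def)
  have "(v, []) \<in> B" "(w, []) \<in> B" "(v, [a]) \<in> B" "(v, [b]) \<in> B" unfolding kshape_B[OF k] by simp_all
  then show "kelem a b v w p q r s \<in> M" unfolding kelem_def by (intro M_closed) auto
  show "coef (kelem a b v w p q r s) (v, []) = p" "coef (kelem a b v w p q r s) (w, []) = q"
    "coef (kelem a b v w p q r s) (v, [a]) = r" "coef (kelem a b v w p q r s) (v, [b]) = s"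
    using ne by (simp_all add: kelem_def lookup_add coef_path_elem)
qed

end

text \<open>Both algebras have the same four basis paths, so matching coordinates is an isomorphism.\<close>

lemma kshape_iso:
  assumes Q: "bound_quiver Q" and k: "bound_quiver.kshape Q a b v w"
    and Q': "bound_quiver Q'" and k': "bound_quiver.kshape Q' a' b' v' w'"
  obtains \<Theta> :: "(('v, 'a) qpath \<Rightarrow>\<^sub>0 'k::field) \<Rightarrow> (('w, 'b) qpath \<Rightarrow>\<^sub>0 'k)"
  where "bij_betw \<Theta> (bound_quiver.M Q S) (bound_quiver.M Q' S')"
    "\<And>x y. x \<in> bound_quiver.M Q S \<Longrightarrow> y \<in> bound_quiver.M Q S \<Longrightarrow> \<Theta> (x + y) = \<Theta> x + \<Theta> y"
    "\<And>x c. x \<in> bound_quiver.M Q S \<Longrightarrow> \<Theta> (scale c x) = scale c (\<Theta> x)"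
    "\<And>x y. x \<in> bound_quiver.M Q S \<Longrightarrow> y \<in> bound_quiver.M Q S \<Longrightarrow>
       \<Theta> (bound_quiver.mul Q S x y) = bound_quiver.mul Q' S' (\<Theta> x) (\<Theta> y)"
    "\<Theta> (bound_quiver.unit Q) = bound_quiver.unit Q'"
proof -
  interpret Q: bound_quiver Q S by fact
  interpret Q': bound_quiver Q' S' by fact
  let ?c = "\<lambda>x. Q'.kelem a' b' v' w' (coef x (v, [])) (coef x (w, [])) (coef x (v, [a])) (coef x (v, [b]))"
  let ?d = "\<lambda>x. Q.kelem a b v w (coef x (v', [])) (coef x (w', [])) (coef x (v', [a'])) (coef x (v', [b']))"
  note kq = Q.kelem[OF k] and kq' = Q'.kelem[OF k']
  have 1: "bij_betw ?c Q.M Q'.M"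
  proof (rule bij_betw_byWitness[where f' = ?d])
    show "\<forall>x\<in>Q.M. ?d (?c x) = x"
      by (intro ballI Q.kshape_eqI[OF k]) (simp_all add: kq kq')
    show "\<forall>x\<in>Q'.M. ?c (?d x) = x"
      by (intro ballI Q'.kshape_eqI[OF k']) (simp_all add: kq kq')
  qed (auto simp: kq kq')
  have 2: "?c (x + y) = ?c x + ?c y" for x y
    by (intro Q'.kshape_eqI[OF k']) (simp_all add: kq' lookup_add)
  have 3: "?c (scale c x) = scale c (?c x)" for c x
    by (intro Q'.kshape_eqI[OF k']) (simp_all add: kq')
  have 4: "?c (Q.mul x y) = Q'.mul (?c x) (?c y)" for x y
    by (intro Q'.kshape_eqI[OF k']) (simp_all add: kq' Q.kshape_mul[OF k] Q'.kshape_mul[OF k'])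
  have 5: "?c Q.unit = Q'.unit"
    using k k' by (intro Q'.kshape_eqI[OF k']) (simp_all add: kq' Q.coef_unit Q'.coef_unit Q.kshape_def Q'.kshape_def)
  show thesis by (rule that[of ?c]) (use 1 2 3 4 5 in auto)
qed

section \<open>Recognizing the Kronecker algebra\<close>

lemma path_elem_nonzero: "path_elem p \<noteq> (0 :: _ \<Rightarrow>\<^sub>0 'k::field)"
proof
  assume "path_elem p = (0 :: _ \<Rightarrow>\<^sub>0 'k)"
  then have "coef (path_elem p :: _ \<Rightarrow>\<^sub>0 'k) p = 0" by simp
  then show False by (simp add: path_elem_def)
qed

lemma kronecker_bound_quiver: "bound_quiver kronecker_quiver"
  unfolding bound_quiver_def
  by unfold_locales (auto simp: kronecker_quiver_def)

interpretation K: bound_quiver kronecker_quiver "{}" by (rule kronecker_bound_quiver)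

lemma kronecker_kshape: "K.kshape False True 0 (Suc 0)"
  unfolding K.kshape_def by (auto simp: kronecker_quiver_def)

lemma kronecker_M: "K.M = carrier (path_algebra kronecker_quiver)"
  by (simp add: K.free_M)


context gentle_quiver
begin

text \<open>Its powers lie in arbitrarily high degrees.\<close>

lemma Mp_idempotent: assumes x: "x \<in> Mp" "x \<star> x = x" shows "x = 0"
proof (rule poly_mapping_eqI)
  fix p
  have "x \<in> Mge n" for n
  proof (induction n)
    case (Suc n)
    then show ?case using Mge_mul[of x 1 x n] x by (simp add: Mge_1)
  qed (use x in \<open>simp add: Mge_0 Mp_M\<close>)
  then show "coef x p = coef 0 p" using MgeD[of x "Suc (length (snd p))" p] by simp
qed

text \<open>
  An isomorphism onto the Kronecker algebra sends the vertices to orthogonal idempotents. Such an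
  idempotent has diagonal entries \<open>0\<close> or \<open>1\<close>, not both \<open>0\<close>, and the corners they cut out force all
  arrows to be parallel.
\<close>

lemma kron_if_iso:
  fixes \<Psi> :: "(('v, 'a) qpath \<Rightarrow>\<^sub>0 'k::field) \<Rightarrow> ((nat, bool) qpath \<Rightarrow>\<^sub>0 'k)"
  assumes bij: "bij_betw \<Psi> M K.M"
    and add: "\<And>x y. x \<in> M \<Longrightarrow> y \<in> M \<Longrightarrow> \<Psi> (x + y) = \<Psi> x + \<Psi> y"
    and sc: "\<And>x c. x \<in> M \<Longrightarrow> \<Psi> (scale c x) = scale c (\<Psi> x)"
    and mul: "\<And>x y. x \<in> M \<Longrightarrow> y \<in> M \<Longrightarrow> \<Psi> (x \<star> y) = K.mul (\<Psi> x) (\<Psi> y)"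
  shows kron
proof -
  note KS = kronecker_kshape
  note km = K.kshape_mul[OF KS] and keq = K.kshape_eqI[OF KS]
  have PM: "\<Psi> x \<in> K.M" if "x \<in> M" for x using bij that by (auto simp: bij_betw_def)
  have inj: "x = y" if "x \<in> M" "y \<in> M" "\<Psi> x = \<Psi> y" for x y using bij that by (auto simp: bij_betw_def dest: inj_onD)
  have surj: "\<exists>x\<in>M. \<Psi> x = f" if "f \<in> K.M" for f
  proof -
    have "f \<in> \<Psi> ` M" using bij that by (simp add: bij_betw_def)
    then show ?thesis by auto
  qed
  have P0: "\<Psi> 0 = 0" using add[of 0 0] by simp
  define p q where "p v = coef (\<Psi> (ev v)) (0, [])" and "q v = coef (\<Psi> (ev v)) (Suc 0, [])" for v
  have eM: "ev v \<in> M" if "v \<in> verts Q" for v using that by simp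
  have ee: "ev v \<star> ev v = (ev v :: _ \<Rightarrow>\<^sub>0 'k)" if "v \<in> verts Q" for v
    using that by (simp add: mul_path_elem path_tgt_eq)
  have eo: "ev v \<star> ev w = (0 :: _ \<Rightarrow>\<^sub>0 'k)" if "v \<noteq> w" for v w
    using that by (simp add: mul_path_elem path_tgt_eq)
  have idem: "p v = 0 \<or> p v = 1" "q v = 0 \<or> q v = 1" if v: "v \<in> verts Q" for v
  proof -
    have E: "\<Psi> (ev v) = K.mul (\<Psi> (ev v)) (\<Psi> (ev v))" using mul[OF eM[OF v] eM[OF v]] ee[OF v] by simp
    have "p v = p v * p v" "q v = q v * q v" unfolding p_def q_def by (subst E, simp only: km)+
    then show "p v = 0 \<or> p v = 1" "q v = 0 \<or> q v = 1" by (metis mult_cancel_left2)+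
  qed
  have orth: "p v * p w = 0" "q v * q w = 0" if v: "v \<in> verts Q" "w \<in> verts Q" "v \<noteq> w" for v w
  proof -
    have E: "0 = K.mul (\<Psi> (ev v)) (\<Psi> (ev w))" using mul[OF eM[OF v(1)] eM[OF v(2)]] eo[OF v(3)] P0 by simp
    have "coef (0 :: (nat, bool) qpath \<Rightarrow>\<^sub>0 'k) (0, []) = p v * p w" "coef (0 :: (nat, bool) qpath \<Rightarrow>\<^sub>0 'k) (Suc 0, []) = q v * q w"
      unfolding p_def q_def by (subst E, simp only: km)+
    then show "p v * p w = 0" "q v * q w = 0" by simp_all
  qed
  have nonzero: "p v \<noteq> 0 \<or> q v \<noteq> 0" if v: "v \<in> verts Q" for v
  proof (rule ccontr)
    assume no: "\<not> ?thesis"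
    have E: "\<Psi> (ev v) = K.mul (\<Psi> (ev v)) (\<Psi> (ev v))" using mul[OF eM[OF v] eM[OF v]] ee[OF v] by simp
    have "K.mul (\<Psi> (ev v)) (\<Psi> (ev v)) = 0"
      by (rule keq) (use no PM[OF eM[OF v]] in \<open>simp_all add: km p_def q_def\<close>)
    then have "ev v = (0 :: _ \<Rightarrow>\<^sub>0 'k)" using inj[OF eM[OF v], of 0] E P0 by simp
    then show False using path_elem_nonzero by blast
  qed
  have one: False if V: "verts Q = {v}" for v
  proof -
    define f g where "f = (path_elem (0, []) :: (nat, bool) qpath \<Rightarrow>\<^sub>0 'k)" and "g = (path_elem (Suc 0, []) :: (nat, bool) qpath \<Rightarrow>\<^sub>0 'k)"
    have fg: "f \<in> K.M" "g \<in> K.M" "K.mul f f = f" "K.mul g g = g" "K.mul f g = 0" "f \<noteq> 0" "g \<noteq> 0"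
      by (simp_all add: f_def g_def K.mul_path_elem path_tgt_eq K.kshape_B[OF KS] path_elem_nonzero del: K.B_Nil)
    obtain x y where x: "x \<in> M" "\<Psi> x = f" and y: "y \<in> M" "\<Psi> y = g"
      using surj[OF fg(1)] surj[OF fg(2)] by blast
    have xx: "x \<star> x = x" "y \<star> y = y" "x \<star> y = 0"
      using inj[of "x \<star> x" x] inj[of "y \<star> y" y] inj[of "x \<star> y" 0] mul x y fg P0 by simp_all
    have "coef x (v, []) * coef y (v, []) = 0" using coef_mul_Nil[of v x y] xx(3) V by simp
    then have "x \<in> Mp \<or> y \<in> Mp"
      using x(1) y(1) V M_coef[OF x(1)] M_coef[OF y(1)] by (auto simp: Mp_def) (metis B_Nil singletonD)+
    then have "x = 0 \<or> y = 0" using Mp_idempotent xx by blast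
    then show False using x y fg P0 by auto
  qed
  have type: "(p v = 1 \<and> q v = 0) \<or> (p v = 0 \<and> q v = 1)" if v: "v \<in> verts Q" for v
  proof (rule ccontr)
    assume no: "\<not> ?thesis"
    then have 1: "p v = 1" "q v = 1" using idem[OF v] nonzero[OF v] by auto
    have "w = v" if w: "w \<in> verts Q" for w
      using orth[OF v w] 1 nonzero[OF w] by (cases "w = v") auto
    then have "verts Q = {v}" using v by blast
    then show False by (rule one)
  qed
  have arrow: "p (tail Q a) = 1 \<and> q (tail Q a) = 0 \<and> p (head Q a) = 0 \<and> q (head Q a) = 1" if a: "a \<in> arcs Q" for a
  proof (rule ccontr)
    assume no: "\<not> ?thesis"
    let ?t = "tail Q a" and ?h = "head Q a" and ?x = "path_elem (ar a) :: _ \<Rightarrow>\<^sub>0 'k"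
    have th: "?t \<in> verts Q" "?h \<in> verts Q" using a by auto
    have xM: "?x \<in> M" using a by simp
    have xx: "?x = ev ?t \<star> ?x \<star> ev ?h"
      by (simp add: par_tail[OF ar_par[OF a]] par_head[OF ar_par[OF a]])
    have E: "\<Psi> ?x = K.mul (K.mul (\<Psi> (ev ?t)) (\<Psi> ?x)) (\<Psi> (ev ?h))"
      using mul[of "ev ?t \<star> ?x" "ev ?h"] mul[OF eM[OF th(1)] xM] th xx by simp
    have "\<exists>c. \<Psi> ?x = scale c (\<Psi> (ev ?t))"
    proof (cases "?t = ?h")
      case True
      show ?thesis
      proof (cases "p ?t = 1")
        case p1: True
        then have q0: "q ?t = 0" using type[OF th(1)] by auto
        have "K.mul (K.mul (\<Psi> (ev ?t)) (\<Psi> ?x)) (\<Psi> (ev ?h)) = scale (coef (\<Psi> ?x) (0, [])) (\<Psi> (ev ?t))"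
          by (rule keq) (use True p1 q0 PM[OF eM[OF th(1)]] in \<open>simp_all add: km p_def q_def\<close>)
        then show ?thesis using E by metis
      next
        case False
        then have p0: "p ?t = 0" "q ?t = 1" using type[OF th(1)] by auto
        have "K.mul (K.mul (\<Psi> (ev ?t)) (\<Psi> ?x)) (\<Psi> (ev ?h)) = scale (coef (\<Psi> ?x) (Suc 0, [])) (\<Psi> (ev ?t))"
          by (rule keq) (use True p0 PM[OF eM[OF th(1)]] in \<open>simp_all add: km p_def q_def\<close>)
        then show ?thesis using E by metis
      qed
    next
      case False
      then have "p ?t = 0" "q ?t = 1" "p ?h = 1" "q ?h = 0"
        using no type[OF th(1)] type[OF th(2)] orth[OF th False] by auto
      then have "K.mul (K.mul (\<Psi> (ev ?t)) (\<Psi> ?x)) (\<Psi> (ev ?h)) = scale 0 (\<Psi> (ev ?t))"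
        by (intro keq) (use PM[OF eM[OF th(1)]] in \<open>simp_all add: km p_def q_def\<close>)
      then show ?thesis using E by metis
    qed
    then obtain c where "\<Psi> ?x = scale c (\<Psi> (ev ?t))" by blast
    then have "?x = scale c (ev ?t)" using inj[OF xM, of "scale c (ev ?t)"] sc[OF eM[OF th(1)]] th by simp
    then have "coef ?x (ar a) = coef (scale c (ev ?t)) (ar a)" by simp
    then show False by (simp add: coef_path_elem arrow_path_def)
  qed
  obtain a where a: "a \<in> arcs Q" using arcs_ne by blast
  let ?t = "tail Q a" and ?h = "head Q a"
  have th: "?t \<in> verts Q" "?h \<in> verts Q" using a by auto
  have par: "tail Q c = ?t" "head Q c = ?h" if c: "c \<in> arcs Q" for c
  proof -
    have V: "tail Q c \<in> verts Q" "head Q c \<in> verts Q" using c by auto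
    have "p ?t * p (tail Q c) \<noteq> 0" "q ?h * q (head Q c) \<noteq> 0" using arrow[OF a] arrow[OF c] by simp_all
    then show "tail Q c = ?t" "head Q c = ?h"
      using orth(1)[OF th(1) V(1)] orth(2)[OF th(2) V(2)] by argo+
  qed
  have tneh: "?t \<noteq> ?h" using arrow[OF a] by auto
  show kron
  proof (cases "\<exists>b\<in>arcs Q. b \<noteq> a")
    case True
    then obtain b where b: "b \<in> arcs Q" "b \<noteq> a" by blast
    have "c = a \<or> c = b" if c: "c \<in> arcs Q" for c
      using out3[OF a b(1) c] par(1)[OF b(1)] par(1)[OF c] b(2) by argo
    then have "arcs Q = {a, b}" using a b(1) by blast
    moreover have "partner a b" unfolding partner_def using a b par(1)[OF b(1)] par(2)[OF b(1)] by argo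
    ultimately show ?thesis unfolding kron_def using tneh by blast
  next
    case False
    then have arcs: "arcs Q = {a}" using a by blast
    have corner: "x = scale (coef x (ar a)) (path_elem (ar a))" if x: "x \<in> par a" for x :: "('v, 'a) qpath \<Rightarrow>\<^sub>0 'k"
    proof (rule poly_mapping_eqI)
      fix r
      have "r = ar a" if nz: "coef x r \<noteq> 0"
      proof -
        obtain w es where r: "r = (w, es)" by fastforce
        have P: "(w, es) \<in> B" "w = ?t" "tgt (w, es) = ?h" using parD[OF x, of w es] nz r by auto
        show ?thesis
        proof (cases es rule: remdups_adj.cases)
          case 1
          then show ?thesis using P tneh by (simp add: path_tgt_eq)
        next
          case (2 c)
          then have "c = a" using P(1) arcs by (simp add: B_iff)
          then show ?thesis using r 2 P(2) by (simp add: arrow_path_def)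
        next
          case (3 c d fs)
          then have "nz c d" using P(1) by (simp add: B_iff)
          note cd = nz_arcs[OF this]
          then have "c = a" "d = a" using arcs by blast+
          then show ?thesis using cd tneh by argo
        qed
      qed
      then show "coef x r = coef (scale (coef x (ar a)) (path_elem (ar a))) r"
        by (cases "r = ar a") (auto simp: coef_path_elem)
    qed
    define f g where "f = (path_elem (0, [False]) :: (nat, bool) qpath \<Rightarrow>\<^sub>0 'k)" and "g = (path_elem (0, [True]) :: (nat, bool) qpath \<Rightarrow>\<^sub>0 'k)"
    have fg: "f \<in> K.M" "g \<in> K.M" by (simp_all add: f_def g_def K.kshape_B[OF KS] del: K.B_arrow)
    obtain x y where x: "x \<in> M" "\<Psi> x = f" and y: "y \<in> M" "\<Psi> y = g"
      using surj[OF fg(1)] surj[OF fg(2)] by blast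
    have T: "p ?t = 1" "q ?t = 0" "p ?h = 0" "q ?h = 1" using arrow[OF a] by auto
    have in_par: "z \<in> par a" if z: "z \<in> M" "coef (\<Psi> z) (0, []) = 0" "coef (\<Psi> z) (Suc 0, []) = 0" for z
    proof (rule parI[OF z(1)])
      have "K.mul (\<Psi> (ev ?t)) (\<Psi> z) = \<Psi> z" "K.mul (\<Psi> z) (\<Psi> (ev ?h)) = \<Psi> z"
        by (rule keq; use T z(2,3) PM[OF z(1)] in \<open>simp add: km p_def q_def\<close>)+
      then show "ev ?t \<star> z = z" "z \<star> ev ?h = z"
        using inj[of "ev ?t \<star> z" z] inj[of "z \<star> ev ?h" z] mul[OF eM[OF th(1)] z(1)] mul[OF z(1) eM[OF th(2)]] z(1) th by simp_all
    qed
    have xy: "x \<in> par a" "y \<in> par a" using in_par[OF x(1)] in_par[OF y(1)] x y by (auto simp: f_def g_def coef_path_elem)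
    have "scale (coef y (ar a)) x = scale (coef x (ar a)) y"
      using corner[OF xy(1)] corner[OF xy(2)] by (metis mult.commute scale_scale)
    then have eq: "scale (coef y (ar a)) f = scale (coef x (ar a)) g" using sc x y by metis
    have "coef (scale (coef y (ar a)) f) (0, [True]) = coef (scale (coef x (ar a)) g) (0, [True])" using eq by simp
    then have "coef x (ar a) = 0" by (simp add: f_def g_def coef_path_elem)
    then have "x = 0" using corner[OF xy(1)] by (simp add: poly_mapping_eq_iff fun_eq_iff)
    then have "f = 0" using x P0 by simp
    then show ?thesis unfolding f_def using path_elem_nonzero by blast
  qed
qed

lemma kron_kshape:
  assumes kron obtains a b where "kshape a b (tail Q a) (head Q a)"
proof -
  obtain a b where ab: "arcs Q = {a, b}" "partner a b" "tail Q a \<noteq> head Q a" using assms unfolding kron_def by blast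
  have "x \<in> {tail Q a, head Q a}" if "x \<in> verts Q" for x
    by (rule verts_connected[of "tail Q a" "{tail Q a, head Q a}", OF _ _ _ that])
      (use ab in \<open>auto simp: partner_def\<close>)
  then have "verts Q = {tail Q a, head Q a}" using ab by auto
  then show thesis using that[of a b] ab unfolding kshape_def partner_def by auto
qed

end

section \<open>The automorphism group of a gentle algebra\<close>

locale gentle_algebra = gentle_quiver Q S + bound_quiver_ideal Q S I
  for Q :: "('v, 'a) pre_digraph" and S and I :: "(('v, 'a) qpath \<Rightarrow>\<^sub>0 'k::field) set"
begin

abbreviation H where "H \<equiv> H_group Q I"

abbreviation N where "N \<equiv> carrier H \<inter> Inn_star Q I"

lemma lift_N_iff: "vaut g \<Longrightarrow> lift g \<in> N \<longleftrightarrow> inner g"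
  by (simp add: lift_in_H lift_Inn_iff)

lemma N_cases:
  assumes "h \<in> N" obtains n where "vaut n" "inner n" "h = lift n"
proof -
  obtain n where "vaut n" "h = lift n" using assms H_cases[of h] by auto
  then show thesis using that assms lift_N_iff by blast
qed

lemma lift_inv: assumes g: "vaut g" shows "inv\<^bsub>H\<^esub> (lift g) = lift (inv_into M g)"
proof -
  interpret H: group H by (rule group_H)
  have "lift (inv_into M g) \<otimes>\<^bsub>H\<^esub> lift g = \<one>\<^bsub>H\<^esub>"
    unfolding lift_mult[OF vaut_inv[OF g] g] lift_one
    using lift_eq_iff[OF vaut_comp[OF vaut_inv[OF g] g] vaut_id(1)] vaut_inv_left[OF g] by simp
  then show ?thesis using lift_in_H g vaut_inv by (intro H.inv_equality) auto
qed

text \<open>The arrow ideal is preserved by automorphisms, so conjugates of units congruent to one are again of this kind.\<close>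

lemma normal_N: "N \<lhd> H"
proof -
  interpret H: group H by (rule group_H)
  have "subgroup N H"
  proof (rule H.subgroupI)
    show "N \<noteq> {}" using lift_N_iff[OF vaut_id(1)] inner_id by blast
    show "inv\<^bsub>H\<^esub> x \<in> N" if x: "x \<in> N" for x
    proof -
      obtain n where "vaut n" "inner n" "x = lift n" by (rule N_cases[OF x])
      then show ?thesis using lift_inv lift_N_iff vaut_inv inner_inv by metis
    qed
    show "x \<otimes>\<^bsub>H\<^esub> y \<in> N" if xy: "x \<in> N" "y \<in> N" for x y
    proof -
      obtain n where n: "vaut n" "inner n" "x = lift n" by (rule N_cases[OF xy(1)])
      obtain m where m: "vaut m" "inner m" "y = lift m" by (rule N_cases[OF xy(2)])
      show ?thesis unfolding n(3) m(3) lift_mult[OF n(1) m(1)]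
        using lift_N_iff[OF vaut_comp[OF n(1) m(1)]] inner_comp[OF n(2) m(2)] by blast
    qed
  qed simp
  moreover have "x \<otimes>\<^bsub>H\<^esub> h \<otimes>\<^bsub>H\<^esub> inv\<^bsub>H\<^esub> x \<in> N" if xh: "x \<in> carrier H" "h \<in> N" for x h
  proof -
    obtain g where g: "vaut g" "x = lift g" by (rule H_cases[OF xh(1)])
    obtain n where n: "vaut n" "inner n" "h = lift n" by (rule N_cases[OF xh(2)])
    note gi = vaut_inv[OF g(1)]
    have "x \<otimes>\<^bsub>H\<^esub> h \<otimes>\<^bsub>H\<^esub> inv\<^bsub>H\<^esub> x = lift (g \<circ> n \<circ> inv_into M g)"
      unfolding g(2) n(3) lift_inv[OF g(1)] lift_mult[OF g(1) n(1)] lift_mult[OF vaut_comp[OF g(1) n(1)] gi] ..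
    then show ?thesis
      using lift_N_iff[OF vaut_comp[OF vaut_comp[OF g(1) n(1)] gi]] inner_conj[OF g(1) n(2)] by simp
  qed
  ultimately show ?thesis unfolding H.normal_inv_iff by blast
qed

lemma lift_split:
  assumes g: "vaut g" and n: "vaut n" "inner n" and k: "vaut k" and eq: "\<And>x. x \<in> M \<Longrightarrow> g x = n (k x)"
  shows "\<exists>n\<in>N. lift g = n \<otimes>\<^bsub>H\<^esub> lift k"
proof (rule bexI[of _ "lift n"])
  show "lift g = lift n \<otimes>\<^bsub>H\<^esub> lift k"
    unfolding lift_mult[OF n(1) k] lift_eq_iff[OF g vaut_comp[OF n(1) k]] using eq by simp
  show "lift n \<in> N" using n lift_N_iff by blast
qed

lemma finite_maximal_path_iff:
  "finite_maximal_path Q I p \<longleftrightarrow> p \<in> B \<and> (\<forall>a\<in>arcs Q.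
     path_elem (ar a) \<star> path_elem p = (0 :: _ \<Rightarrow>\<^sub>0 'k) \<and> path_elem p \<star> path_elem (ar a) = (0 :: _ \<Rightarrow>\<^sub>0 'k))"
proof (cases "p \<in> B")
  case True
  then have pM: "(path_elem p :: _ \<Rightarrow>\<^sub>0 'k) \<in> M" by simp
  have "path_class Q I (ar a) \<otimes>\<^bsub>A\<^esub> path_class Q I p = \<zero>\<^bsub>A\<^esub> \<longleftrightarrow> path_elem (ar a) \<star> path_elem p = (0 :: _ \<Rightarrow>\<^sub>0 'k)"
    "path_class Q I p \<otimes>\<^bsub>A\<^esub> path_class Q I (ar a) = \<zero>\<^bsub>A\<^esub> \<longleftrightarrow> path_elem p \<star> path_elem (ar a) = (0 :: _ \<Rightarrow>\<^sub>0 'k)"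
    if a: "a \<in> arcs Q" for a
  proof -
    have aM: "(path_elem (ar a) :: _ \<Rightarrow>\<^sub>0 'k) \<in> M" using a by simp
    show "path_class Q I (ar a) \<otimes>\<^bsub>A\<^esub> path_class Q I p = \<zero>\<^bsub>A\<^esub> \<longleftrightarrow> path_elem (ar a) \<star> path_elem p = (0 :: _ \<Rightarrow>\<^sub>0 'k)"
      "path_class Q I p \<otimes>\<^bsub>A\<^esub> path_class Q I (ar a) = \<zero>\<^bsub>A\<^esub> \<longleftrightarrow> path_elem p \<star> path_elem (ar a) = (0 :: _ \<Rightarrow>\<^sub>0 'k)"
      unfolding path_class_eq cls_mult[OF aM pM] cls_mult[OF pM aM] cls_zero using aM pM by (simp_all add: cls_inj)
  qed
  then show ?thesis using True unfolding finite_maximal_path_def Let_def basis_paths_eq by auto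
next
  case False
  then show ?thesis by (simp add: finite_maximal_path_def basis_paths_eq)
qed

lemma path_mul_arrow:
  assumes p: "p \<in> B" "snd p \<noteq> []"
  shows "path_elem (ar a) \<star> path_elem p = (0 :: _ \<Rightarrow>\<^sub>0 'k) \<longleftrightarrow> \<not> nz a (hd (snd p))"
    "path_elem p \<star> path_elem (ar a) = (0 :: _ \<Rightarrow>\<^sub>0 'k) \<longleftrightarrow> \<not> nz (last (snd p)) a"
proof -
  have pB: "(fst p, snd p) \<in> B" using p(1) by simp
  have 1: "tgt (ar a) = fst p \<and> (tail Q a, a # snd p) \<in> B \<longleftrightarrow> nz a (hd (snd p))"
  proof
    assume "tgt (ar a) = fst p \<and> (tail Q a, a # snd p) \<in> B"
    then show "nz a (hd (snd p))" using B_append[of "tail Q a" "[a]" "snd p"] p by simp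
  next
    assume nz: "nz a (hd (snd p))"
    have "(tail Q a, a # snd p) \<in> B" by (rule B_cons[OF pB p(2) nz])
    moreover have "fst p = tail Q (hd (snd p))" using B_hd'[OF p] by blast
    ultimately show "tgt (ar a) = fst p \<and> (tail Q a, a # snd p) \<in> B"
      using nz_arcs[OF nz] by (simp add: arrow_path_def path_tgt_eq)
  qed
  have 2: "tgt p = tail Q a \<and> (fst p, snd p @ [a]) \<in> B \<longleftrightarrow> nz (last (snd p)) a"
  proof
    assume "tgt p = tail Q a \<and> (fst p, snd p @ [a]) \<in> B"
    then show "nz (last (snd p)) a" using B_append[of "fst p" "snd p" "[a]"] p by simp
  next
    assume nz: "nz (last (snd p)) a"
    have "(fst p, snd p @ [a]) \<in> B" by (rule B_snoc[OF pB p(2) nz])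
    moreover have "tgt p = head Q (last (snd p))" using B_hd'[OF p] by blast
    ultimately show "tgt p = tail Q a \<and> (fst p, snd p @ [a]) \<in> B"
      using nz_arcs[OF nz] by simp
  qed
  show "path_elem (ar a) \<star> path_elem p = (0 :: _ \<Rightarrow>\<^sub>0 'k) \<longleftrightarrow> \<not> nz a (hd (snd p))"
    unfolding 1[symmetric] by (simp add: mul_path_elem arrow_path_def path_elem_nonzero)
  show "path_elem p \<star> path_elem (ar a) = (0 :: _ \<Rightarrow>\<^sub>0 'k) \<longleftrightarrow> \<not> nz (last (snd p)) a"
    unfolding 2[symmetric] by (simp add: mul_path_elem arrow_path_def path_elem_nonzero)
qed

text \<open>A stationary path is never maximal when it is parallel to a loop \<open>a\<close>, because its product with \<open>a\<close> is \<open>a\<close>.\<close>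

lemma gamma_bar_iff: assumes a: "a \<in> arcs Q" shows "gamma_bar_exists Q I a \<longleftrightarrow> hasg a"
proof -
  have "finite_maximal_path Q I p \<and> parallel Q p (ar a) \<and> \<not> starts_with p a \<and> \<not> ends_with p a \<longleftrightarrow> gbar a p" for p
  proof (cases "snd p = []")
    case True
    have "\<not> (finite_maximal_path Q I p \<and> parallel Q p (ar a))"
    proof
      assume as: "finite_maximal_path Q I p \<and> parallel Q p (ar a)"
      obtain v where p: "p = (v, [])" using True by (metis prod.collapse)
      have "v = head Q a" using as p by (auto simp: parallel_def arrow_path_def path_tgt_eq)
      then have "path_elem (ar a) \<star> path_elem p = (path_elem (ar a) :: _ \<Rightarrow>\<^sub>0 'k)"
        using p a by (simp add: par_head[OF ar_par[OF a]])
      then show False using as a path_elem_nonzero unfolding finite_maximal_path_iff by metis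
    qed
    then show ?thesis using True by (auto simp: gbar_def maximal_def)
  next
    case False
    have "finite_maximal_path Q I p \<longleftrightarrow> maximal p"
      unfolding finite_maximal_path_iff maximal_def using path_mul_arrow[OF _ False] False nz_arcs by meson
    then show ?thesis using False
      by (auto simp: gbar_def parallel_def starts_with_def ends_with_def path_src_def arrow_path_def path_tgt_eq)
  qed
  then show ?thesis unfolding gamma_bar_exists_def hasg_def by blast
qed

lemma isomorphic_kronecker_iff:
  "algebra_isomorphic A (path_algebra kronecker_quiver :: ('k, (nat, bool) qpath \<Rightarrow>\<^sub>0 'k) module) \<longleftrightarrow> kron"
proof
  let ?KK = "path_algebra kronecker_quiver :: ('k, (nat, bool) qpath \<Rightarrow>\<^sub>0 'k) module"
  have cK: "carrier ?KK = K.M" by (simp add: kronecker_M)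
  have mK: "x \<otimes>\<^bsub>?KK\<^esub> y = K.mul x y" if "x \<in> K.M" "y \<in> K.M" for x y
    using K.free_mul[OF that] by simp
  have uK: "\<one>\<^bsub>?KK\<^esub> = K.unit" by (simp add: K.unit_def path_algebra_def path_elem_def)
  assume "algebra_isomorphic A ?KK"
  then obtain h where h: "h \<in> algebra_hom A ?KK" "bij_betw h (carrier A) K.M"
    unfolding algebra_isomorphic_def cK by blast
  have hM: "h Y \<in> K.M" if "Y \<in> carrier A" for Y using h(2) that by (auto simp: bij_betw_def)
  show kron
  proof (rule kron_if_iso[of "h \<circ> cls"])
    show "bij_betw (h \<circ> cls) M K.M" by (rule bij_betw_trans[OF cls_M h(2)])
    fix x y :: "('v, 'a) qpath \<Rightarrow>\<^sub>0 'k" and c assume x: "x \<in> M"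
    show "(h \<circ> cls) (scale c x) = scale c ((h \<circ> cls) x)"
      using h(1) x by (simp add: algebra_hom_def flip: cls_smult)
    assume y: "y \<in> M"
    show "(h \<circ> cls) (x + y) = (h \<circ> cls) x + (h \<circ> cls) y"
      using h(1) x y by (simp add: algebra_hom_def ring_hom_def flip: cls_add)
    show "(h \<circ> cls) (x \<star> y) = K.mul ((h \<circ> cls) x) ((h \<circ> cls) y)"
    proof -
      have "h (cls x \<otimes>\<^bsub>A\<^esub> cls y) = h (cls x) \<otimes>\<^bsub>?KK\<^esub> h (cls y)"
        using h(1) x y unfolding algebra_hom_def ring_hom_def by simp
      then show ?thesis using mK[OF hM hM, of "cls x" "cls y"] x y by (simp add: cls_mult)
    qed
  qed
next
  let ?KK = "path_algebra kronecker_quiver :: ('k, (nat, bool) qpath \<Rightarrow>\<^sub>0 'k) module"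
  have cK: "carrier ?KK = K.M" by (simp add: kronecker_M)
  have mK: "x \<otimes>\<^bsub>?KK\<^esub> y = K.mul x y" if "x \<in> K.M" "y \<in> K.M" for x y
    using K.free_mul[OF that] by simp
  have uK: "\<one>\<^bsub>?KK\<^esub> = K.unit" by (simp add: K.unit_def path_algebra_def path_elem_def)
  assume kron
  then obtain a b where ab: "kshape a b (tail Q a) (head Q a)" by (rule kron_kshape)
  obtain \<Theta> :: "(('v, 'a) qpath \<Rightarrow>\<^sub>0 'k) \<Rightarrow> ((nat, bool) qpath \<Rightarrow>\<^sub>0 'k)"
    where \<Theta>: "bij_betw \<Theta> M K.M" "\<And>x y. x \<in> M \<Longrightarrow> y \<in> M \<Longrightarrow> \<Theta> (x + y) = \<Theta> x + \<Theta> y"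
      "\<And>x c. x \<in> M \<Longrightarrow> \<Theta> (scale c x) = scale c (\<Theta> x)"
      "\<And>x y. x \<in> M \<Longrightarrow> y \<in> M \<Longrightarrow> \<Theta> (x \<star> y) = K.mul (\<Theta> x) (\<Theta> y)" "\<Theta> unit = K.unit"
    using kshape_iso[OF bound_quiver_axioms ab kronecker_bound_quiver kronecker_kshape, of S "{}"] by metis
  have \<Theta>M: "\<Theta> x \<in> K.M" if "x \<in> M" for x using \<Theta>(1) that by (auto simp: bij_betw_def)
  have "(\<lambda>Y. \<Theta> (rep Y)) \<in> algebra_hom A ?KK"
    unfolding algebra_hom_def ring_hom_def cK uK
    using \<Theta>M by (auto simp: cls_mult cls_add cls_unit cls_smult \<Theta>(2-5) mK simp del: path_algebra_simps(2)
      elim!: carrier_A_cases)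
  moreover have "bij_betw (\<lambda>Y. \<Theta> (rep Y)) (carrier A) (carrier ?KK)"
    using bij_betw_trans[OF rep_bij \<Theta>(1)] unfolding cK comp_def .
  ultimately show "algebra_isomorphic A ?KK" unfolding algebra_isomorphic_def by blast
qed

end

section \<open>The three groups\<close>

lemma group_mult_power: "group (mult_group_power TYPE('k::field) m)"
proof -
  have "group \<lparr>carrier = UNIV - {0 :: 'k}, monoid.mult = (*), one = 1\<rparr>"
  proof (rule groupI)
    fix x assume "x \<in> carrier \<lparr>carrier = UNIV - {0 :: 'k}, monoid.mult = (*), one = 1\<rparr>"
    then show "\<exists>y\<in>carrier \<lparr>carrier = UNIV - {0 :: 'k}, monoid.mult = (*), one = 1\<rparr>.
        y \<otimes>\<^bsub>\<lparr>carrier = UNIV - {0 :: 'k}, monoid.mult = (*), one = 1\<rparr>\<^esub> x = \<one>\<^bsub>\<lparr>carrier = UNIV - {0 :: 'k}, monoid.mult = (*), one = 1\<rparr>\<^esub>"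
      by (intro bexI[of _ "inverse x"]) auto
  qed auto
  then show ?thesis by (simp add: mult_group_power_def)
qed

lemma group_add_power: "group (add_group_power TYPE('k::field) m)"
proof -
  have "group \<lparr>carrier = UNIV :: 'k set, monoid.mult = (+), one = 0\<rparr>"
  proof (rule groupI)
    fix x :: 'k
    show "\<exists>y\<in>carrier \<lparr>carrier = UNIV :: 'k set, monoid.mult = (+), one = 0\<rparr>.
        y \<otimes>\<^bsub>\<lparr>carrier = UNIV :: 'k set, monoid.mult = (+), one = 0\<rparr>\<^esub> x = \<one>\<^bsub>\<lparr>carrier = UNIV :: 'k set, monoid.mult = (+), one = 0\<rparr>\<^esub>"
      by (intro bexI[of _ "- x"]) auto
  qed auto
  then show ?thesis by (simp add: add_group_power_def)
qed

lemma power_simps: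
  "carrier (mult_group_power TYPE('k::field) m) = (\<Pi>\<^sub>E i\<in>{..<m}. UNIV - {0})"
  "x \<otimes>\<^bsub>mult_group_power TYPE('k) m\<^esub> y = (\<lambda>i\<in>{..<m}. x i * y i)"
  "\<one>\<^bsub>mult_group_power TYPE('k) m\<^esub> = (\<lambda>i\<in>{..<m}. 1)"
  "carrier (add_group_power TYPE('k) m) = (\<Pi>\<^sub>E i\<in>{..<m}. UNIV)"
  "u \<otimes>\<^bsub>add_group_power TYPE('k) m\<^esub> v = (\<lambda>i\<in>{..<m}. u i + v i)"
  "\<one>\<^bsub>add_group_power TYPE('k) m\<^esub> = (\<lambda>i\<in>{..<m}. 0)"
  by (simp_all add: mult_group_power_def add_group_power_def)

text \<open>A bijection with an initial segment together with its inverse, to pass between arrows and coordinates.\<close>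

definition enumerates :: "'x set \<Rightarrow> (nat \<Rightarrow> 'x) \<Rightarrow> ('x \<Rightarrow> nat) \<Rightarrow> bool" where
  "enumerates T e \<iota> \<longleftrightarrow> (\<forall>i<card T. e i \<in> T \<and> \<iota> (e i) = i) \<and> (\<forall>x\<in>T. \<iota> x < card T \<and> e (\<iota> x) = x)"

lemma enumeratesD:
  assumes "enumerates T e \<iota>"
  shows "i < card T \<Longrightarrow> e i \<in> T \<and> \<iota> (e i) = i" "x \<in> T \<Longrightarrow> \<iota> x < card T \<and> e (\<iota> x) = x"
  using assms by (auto simp: enumerates_def)

lemma enumerates_exists:
  assumes "finite T" shows "\<exists>e \<iota>. enumerates T e \<iota>"
proof -
  obtain e where e: "bij_betw e {0..<card T} T" using ex_bij_betw_nat_finite[OF assms] by blast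
  let ?i = "inv_into {0..<card T} e"
  have "e i \<in> T \<and> ?i (e i) = i" if "i < card T" for i
    using e that by (auto simp: bij_betw_def inv_into_f_f)
  moreover have "?i x < card T \<and> e (?i x) = x" if x: "x \<in> T" for x
  proof -
    have "x \<in> e ` {0..<card T}" using e x by (simp add: bij_betw_def)
    then show ?thesis using inv_into_into[of x e "{0..<card T}"] f_inv_into_f[of x e "{0..<card T}"] by simp
  qed
  ultimately have "enumerates T e ?i" by (simp add: enumerates_def)
  then show ?thesis by blast
qed

lemma PiE_eq_const:
  assumes "x \<in> (\<Pi>\<^sub>E i\<in>{..<m}. T)" "\<And>i. i < m \<Longrightarrow> x i = c" shows "x = (\<lambda>i\<in>{..<m}. c)"
  using assms by (auto simp: PiE_def extensional_def fun_eq_iff)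

context gentle_algebra
begin

lemma wt_mult: "wt (\<lambda>a. l a * l' a) a = wt l a * wt (l' :: 'a \<Rightarrow> 'k) a"
proof -
  have "prod_list (map (\<lambda>a. l a * l' a) es) = prod_list (map l es) * prod_list (map l' es)" for es
    by (induction es) (auto simp: ac_simps)
  then show ?thesis by (simp add: wt_def)
qed

lemma wt_cong: assumes "hasg a" "\<And>b. b \<in> arcs Q \<Longrightarrow> l b = (l' b :: 'k)" shows "wt l a = wt l' a"
proof -
  have "set (snd (gp a)) \<subseteq> arcs Q" using gp_B[OF assms(1)] by (auto simp: B_def)
  then have "map l (snd (gp a)) = map l' (snd (gp a))" using assms(2) by auto
  then show ?thesis unfolding wt_def by (rule arg_cong)
qed

text \<open>
  No pair exchange occurs, so every automorphism is nondegenerate and the standard automorphisms are a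
  complement.
\<close>

lemma generic_case:
  assumes nk: "\<not> kron" and nd: "\<not> double"
  shows "iso_to_semidirect_product (H Mod N)
    (add_group_power TYPE('k) (card {a \<in> arcs Q. hasg a})) (mult_group_power TYPE('k) (card (arcs Q)))"
proof -
  let ?Y = "{a \<in> arcs Q. hasg a}"
  let ?V = "add_group_power TYPE('k) (card ?Y)" and ?K = "mult_group_power TYPE('k) (card (arcs Q))"
  obtain e \<iota> where "enumerates (arcs Q) e \<iota>" using enumerates_exists[OF finite_arcs] by blast
  note e = enumeratesD[OF this]
  have "finite ?Y" by simp
  then obtain d \<kappa> where "enumerates ?Y d \<kappa>" using enumerates_exists by blast
  note d = enumeratesD[OF this]
  define L :: "(nat \<Rightarrow> 'k) \<Rightarrow> 'a \<Rightarrow> 'k" where "L k a = k (\<iota> a)" for k a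
  define Mu :: "(nat \<Rightarrow> 'k) \<Rightarrow> 'a \<Rightarrow> 'k" where "Mu x a = (if a \<in> ?Y then x (\<kappa> a) else 0)" for x a
  define \<psi> where "\<psi> k x = (\<lambda>i\<in>{..<card ?Y}. wt (L k) (d i) / L k (d i) * x i)" for k x
  define f where "f x k = lift (emap (L k) (Mu x))" for x k
  have L0: "L k a \<noteq> 0" if "k \<in> carrier ?K" "a \<in> arcs Q" for k a
    using that(1) e(2)[OF that(2)] by (auto simp: L_def power_simps PiE_iff)
  have LV: "vaut (emap (L k) m)" if "k \<in> carrier ?K" for k m by (rule emap_vaut[OF nk L0[OF that]])
  have LM: "L (k \<otimes>\<^bsub>?K\<^esub> l) a = L k a * L l a" if "a \<in> arcs Q" for k l a
    using e(2)[OF that] by (simp add: L_def power_simps)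
  have LW: "wt (L (k \<otimes>\<^bsub>?K\<^esub> l)) a = wt (L k) a * wt (L l) a" if "hasg a" for k l a
    using wt_cong[OF that, of "L (k \<otimes>\<^bsub>?K\<^esub> l)" "\<lambda>a. L k a * L l a"] LM by (simp add: wt_mult)
  show ?thesis
  proof (rule iso_to_semidirect_productI[OF group_add_power group_mult_power group_H normal_N, where \<psi> = \<psi> and f = f])
    fix k assume k: "k \<in> carrier ?K"
    show "\<psi> k \<in> hom ?V ?V"
    proof (rule homI)
      fix x y assume "x \<in> carrier ?V" "y \<in> carrier ?V"
      show "\<psi> k x \<in> carrier ?V" by (simp add: power_simps \<psi>_def)
      show "\<psi> k (x \<otimes>\<^bsub>?V\<^esub> y) = \<psi> k x \<otimes>\<^bsub>?V\<^esub> \<psi> k y"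
        unfolding power_simps(5) \<psi>_def by (intro restrict_ext) (simp add: distrib_left)
    qed
    fix l x assume l: "l \<in> carrier ?K"
    show "\<psi> (k \<otimes>\<^bsub>?K\<^esub> l) x = \<psi> k (\<psi> l x)"
      unfolding \<psi>_def
    proof (rule restrict_ext)
      fix i assume i: "i \<in> {..<card ?Y}"
      then have "d i \<in> arcs Q" "hasg (d i)" using d(1)[of i] by auto
      then show "wt (L (k \<otimes>\<^bsub>?K\<^esub> l)) (d i) / L (k \<otimes>\<^bsub>?K\<^esub> l) (d i) * x i =
          wt (L k) (d i) / L k (d i) * (\<lambda>i\<in>{..<card ?Y}. wt (L l) (d i) / L l (d i) * x i) i"
        using i by (simp only: LM LW restrict_apply' times_divide_times_eq mult.assoc[symmetric])
    qed
  next
    fix x assume x: "x \<in> carrier ?V"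
    have w1: "L \<one>\<^bsub>?K\<^esub> a = 1" if "a \<in> arcs Q" for a using e(2)[OF that] by (simp add: L_def power_simps)
    have "wt (L \<one>\<^bsub>?K\<^esub>) a = 1" if "hasg a" for a
    proof -
      have "prod_list (map (\<lambda>a. 1 :: 'k) es) = 1" for es :: "'a list" by (induction es) auto
      then show ?thesis using wt_cong[OF that, of "L \<one>\<^bsub>?K\<^esub>" "\<lambda>a. 1"] w1 by (simp add: wt_def)
    qed
    then have "\<psi> \<one>\<^bsub>?K\<^esub> x = restrict x {..<card ?Y}"
      unfolding \<psi>_def
    proof (intro restrict_ext)
      fix i assume "i \<in> {..<card ?Y}"
      then have "d i \<in> arcs Q" "hasg (d i)" using d(1)[of i] by auto
      then show "wt (L \<one>\<^bsub>?K\<^esub>) (d i) / L \<one>\<^bsub>?K\<^esub> (d i) * x i = x i"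
        using w1[of "d i"] \<open>\<And>a. hasg a \<Longrightarrow> wt (L \<one>\<^bsub>?K\<^esub>) a = 1\<close>[of "d i"] by (simp only: div_by_1 mult_1)
    qed
    then show "\<psi> \<one>\<^bsub>?K\<^esub> x = x" using x by (simp add: power_simps PiE_restrict)
  next
    fix x k assume x: "x \<in> carrier ?V" and k: "k \<in> carrier ?K"
    show "f x k \<in> carrier H" unfolding f_def by (rule lift_in_H[OF LV[OF k]])
    show "x = \<one>\<^bsub>?V\<^esub> \<and> k = \<one>\<^bsub>?K\<^esub>" if "f x k \<in> N"
    proof
      have inn: "inner (emap (L k) (Mu x))" using that lift_N_iff[OF LV[OF k]] unfolding f_def by blast
      have "k i = 1" if "i < card (arcs Q)" for i
        using inner_emap(1)[OF nk L0[OF k] inn, of "e i"] e(1)[OF that] by (simp add: L_def)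
      then show "k = \<one>\<^bsub>?K\<^esub>" unfolding power_simps by (rule PiE_eq_const[OF k[unfolded power_simps]])
      have "x i = 0" if "i < card ?Y" for i
        using inner_emap(2)[OF nk L0[OF k] inn, of "d i"] d(1)[OF that] by (simp add: Mu_def)
      then show "x = \<one>\<^bsub>?V\<^esub>" unfolding power_simps by (rule PiE_eq_const[OF x[unfolded power_simps]])
    qed
    fix y l assume y: "y \<in> carrier ?V" and l: "l \<in> carrier ?K"
    have "emap (L k) (Mu x) (emap (L l) (Mu y) z) = emap (L (k \<otimes>\<^bsub>?K\<^esub> l)) (Mu (x \<otimes>\<^bsub>?V\<^esub> \<psi> k y)) z" if z: "z \<in> M" for z
    proof -
      have "emap (L k) (Mu x) (emap (L l) (Mu y) z) =
          emap (\<lambda>a. L k a * L l a) (\<lambda>a. Mu x a + wt (L k) a / L k a * Mu y a) z"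
        by (rule emap_comp[OF nk _ z]) (rule L0[OF k])
      also have "\<dots> = emap (L (k \<otimes>\<^bsub>?K\<^esub> l)) (Mu (x \<otimes>\<^bsub>?V\<^esub> \<psi> k y)) z"
      proof (rule emap_cong[OF _ _ z])
        fix a assume a: "a \<in> arcs Q"
        show "L k a * L l a = L (k \<otimes>\<^bsub>?K\<^esub> l) a" using LM[OF a] by simp
        show "Mu x a + wt (L k) a / L k a * Mu y a = Mu (x \<otimes>\<^bsub>?V\<^esub> \<psi> k y) a"
          using d(2)[of a] a by (simp add: Mu_def power_simps \<psi>_def)
      qed
      finally show ?thesis .
    qed
    then show "f x k \<otimes>\<^bsub>H\<^esub> f y l = f (x \<otimes>\<^bsub>?V\<^esub> \<psi> k y) (k \<otimes>\<^bsub>?K\<^esub> l)"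
      unfolding f_def lift_mult[OF LV[OF k] LV[OF l]]
      using lift_eq_iff[OF vaut_comp[OF LV[OF k] LV[OF l]]
          LV[OF monoid.m_closed[OF group.is_monoid[OF group_mult_power] k l]]] by simp
  next
    fix h assume "h \<in> carrier H"
    then obtain g where g: "vaut g" "h = lift g" by (rule H_cases)
    obtain l m n where D: "\<forall>a\<in>arcs Q. l a \<noteq> 0" "vaut n" "inner n" "\<forall>x\<in>M. g x = n (emap l m x)"
      using decomposition[OF nk not_double_nondeg[OF nd g(1)]] unfolding dec_def by blast
    define k where "k = (\<lambda>i\<in>{..<card (arcs Q)}. l (e i))"
    define x where "x = (\<lambda>i\<in>{..<card ?Y}. m (d i))"
    have k: "k \<in> carrier ?K" using D(1) e(1) by (auto simp: k_def power_simps)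
    have x: "x \<in> carrier ?V" by (auto simp: x_def power_simps)
    have "emap l m z = emap (L k) (Mu x) z" if z: "z \<in> M" for z
    proof (rule vend_eqI[OF emap_vend emap_vend _ z])
      fix a assume a: "a \<in> arcs Q"
      show "im (emap l m) a = im (emap (L k) (Mu x)) a"
        using e(2)[OF a] d(2)[of a] a by (simp add: emap_arrow eimg_def L_def Mu_def k_def x_def gb_zero)
    qed
    note E = this
    show "\<exists>n\<in>N. \<exists>x\<in>carrier ?V. \<exists>k\<in>carrier ?K. h = n \<otimes>\<^bsub>H\<^esub> f x k"
    proof -
      have "g z = n (emap (L k) (Mu x) z)" if "z \<in> M" for z using D(4) E[OF that] that by simp
      from lift_split[OF g(1) D(2,3) LV[OF k] this] show ?thesis using k x unfolding f_def g(2) by blast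
    qed
  qed
qed

text \<open>There are no maximal paths to add, and the exchange of the pairs provides the factor of order two.\<close>

lemma double_case:
  assumes nk: "\<not> kron" and db: double
  shows "iso_to_semidirect_product (H Mod N) (mult_group_power TYPE('k) (card (arcs Q))) (integer_mod_group 2)"
proof -
  let ?V = "mult_group_power TYPE('k) (card (arcs Q))" and ?K = "integer_mod_group 2"
  obtain e \<iota> where "enumerates (arcs Q) e \<iota>" using enumerates_exists[OF finite_arcs] by blast
  note e = enumeratesD[OF this]
  define L :: "(nat \<Rightarrow> 'k) \<Rightarrow> 'a \<Rightarrow> 'k" where "L k a = k (\<iota> a)" for k a
  define t where "t k a = (if k = (1 :: int) then tw a else a)" for k a
  define \<psi> where "\<psi> k x = (\<lambda>i\<in>{..<card (arcs Q)}. L x (t k (e i)))" for k x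
  define f where "f x k = lift (dmap (L x) (k = (1 :: int)))" for x k
  have tA: "t k a \<in> arcs Q" if "a \<in> arcs Q" for k a using that tw[OF db that] by (simp add: t_def)
  have K: "k = 0 \<or> k = 1" if "k \<in> carrier ?K" for k
    using that by (auto simp: carrier_integer_mod_group)
  have tt: "t (k \<otimes>\<^bsub>?K\<^esub> l) a = t k (t l a)" "t (k \<otimes>\<^bsub>?K\<^esub> l) a = t l (t k a)"
    "(k \<otimes>\<^bsub>?K\<^esub> l = 1) = ((k = 1) \<noteq> (l = 1))"
    if "k \<in> carrier ?K" "l \<in> carrier ?K" "a \<in> arcs Q" for k l a
    using K[OF that(1)] K[OF that(2)] tw[OF db that(3)] by (auto simp: t_def)
  have L0: "L x a \<noteq> 0" if "x \<in> carrier ?V" "a \<in> arcs Q" for x a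
    using that(1) e(2)[OF that(2)] by (auto simp: L_def power_simps PiE_iff)
  have LV: "vaut (dmap (L x) b)" if "x \<in> carrier ?V" for x b by (rule dmap_vaut[OF db L0[OF that]])
  have LM: "L (x \<otimes>\<^bsub>?V\<^esub> y) a = L x a * L y a" if "a \<in> arcs Q" for x y a
    using e(2)[OF that] by (simp add: L_def power_simps)
  have L\<psi>: "L (\<psi> k x) a = L x (t k a)" if "a \<in> arcs Q" for k x a
    using e(2)[OF that] by (simp add: L_def \<psi>_def)
  have \<psi>V: "\<psi> k x \<in> carrier ?V" if "x \<in> carrier ?V" for k x
    using L0[OF that] tA e(1) by (auto simp: power_simps \<psi>_def)
  obtain a\<^sub>0 where a\<^sub>0: "a\<^sub>0 \<in> arcs Q" using arcs_ne by blast
  show ?thesis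
  proof (rule iso_to_semidirect_productI[OF group_mult_power group_integer_mod_group group_H normal_N, where \<psi> = \<psi> and f = f])
    fix k assume k: "k \<in> carrier ?K"
    show "\<psi> k \<in> hom ?V ?V"
    proof (rule homI)
      fix x y assume "x \<in> carrier ?V" "y \<in> carrier ?V"
      show "\<psi> k (x \<otimes>\<^bsub>?V\<^esub> y) = \<psi> k x \<otimes>\<^bsub>?V\<^esub> \<psi> k y"
        unfolding power_simps(2)[of _ "\<psi> k x"] unfolding \<psi>_def using LM[OF tA] e(1) by (intro restrict_ext) simp
    qed (rule \<psi>V)
    fix l x assume l: "l \<in> carrier ?K"
    show "\<psi> (k \<otimes>\<^bsub>?K\<^esub> l) x = \<psi> k (\<psi> l x)"
      unfolding \<psi>_def[of "k \<otimes>\<^bsub>?K\<^esub> l"] \<psi>_def[of k]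
    proof (rule restrict_ext)
      fix i assume "i \<in> {..<card (arcs Q)}"
      then have ei: "e i \<in> arcs Q" using e(1) by simp
      show "L x (t (k \<otimes>\<^bsub>?K\<^esub> l) (e i)) = L (\<psi> l x) (t k (e i))"
        unfolding L\<psi>[OF tA[OF ei]] tt(2)[OF k l ei] ..
    qed
  next
    fix x assume x: "x \<in> carrier ?V"
    have "\<psi> \<one>\<^bsub>?K\<^esub> x = restrict x {..<card (arcs Q)}"
      unfolding \<psi>_def using e(1) by (intro restrict_ext) (simp add: t_def L_def)
    then show "\<psi> \<one>\<^bsub>?K\<^esub> x = x" using x by (simp add: power_simps PiE_restrict)
  next
    fix x k assume x: "x \<in> carrier ?V" and k: "k \<in> carrier ?K"
    show "f x k \<in> carrier H" unfolding f_def by (rule lift_in_H[OF LV[OF x]])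
    show "x = \<one>\<^bsub>?V\<^esub> \<and> k = \<one>\<^bsub>?K\<^esub>" if "f x k \<in> N"
    proof
      have inn: "inner (dmap (L x) (k = 1))" using that lift_N_iff[OF LV[OF x]] unfolding f_def by blast
      show "k = \<one>\<^bsub>?K\<^esub>" using inner_dmap(1)[OF db L0[OF x] inn] K[OF k] by simp
      have "x i = 1" if "i < card (arcs Q)" for i
        using inner_dmap(2)[OF db L0[OF x] inn, of "e i"] e(1)[OF that] by (simp add: L_def)
      then show "x = \<one>\<^bsub>?V\<^esub>" unfolding power_simps by (rule PiE_eq_const[OF x[unfolded power_simps]])
    qed
    fix y l assume y: "y \<in> carrier ?V" and l: "l \<in> carrier ?K"
    have xy: "x \<otimes>\<^bsub>?V\<^esub> \<psi> k y \<in> carrier ?V"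
      by (rule monoid.m_closed[OF group.is_monoid[OF group_mult_power] x \<psi>V[OF y]])
    have "dmap (L x) (k = 1) (dmap (L y) (l = 1) z) = dmap (L (x \<otimes>\<^bsub>?V\<^esub> \<psi> k y)) (k \<otimes>\<^bsub>?K\<^esub> l = 1) z" if z: "z \<in> M" for z
      unfolding dmap_comp[OF db z] tt(3)[OF k l a\<^sub>0]
    proof (rule dmap_cong[OF db _ z])
      fix a assume a: "a \<in> arcs Q"
      show "L x a * L y (if k = 1 then tw a else a) = L (x \<otimes>\<^bsub>?V\<^esub> \<psi> k y) a"
        using LM[OF a] L\<psi>[OF a] by (simp add: t_def)
    qed
    then show "f x k \<otimes>\<^bsub>H\<^esub> f y l = f (x \<otimes>\<^bsub>?V\<^esub> \<psi> k y) (k \<otimes>\<^bsub>?K\<^esub> l)"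
      unfolding f_def lift_mult[OF LV[OF x] LV[OF y]] lift_eq_iff[OF vaut_comp[OF LV[OF x] LV[OF y]] LV[OF xy]]
      by (simp del: mult_integer_mod_group)
  next
    fix h assume "h \<in> carrier H"
    then obtain g where g: "vaut g" "h = lift g" by (rule H_cases)
    obtain n l b where D: "vaut n" "inner n" "\<forall>a\<in>arcs Q. l a \<noteq> 0" "\<forall>x\<in>M. g x = n (dmap l b x)"
      using double_decomposition[OF nk db g(1)] by blast
    define x where "x = (\<lambda>i\<in>{..<card (arcs Q)}. l (e i))"
    define k :: int where "k = (if b then 1 else 0)"
    have x: "x \<in> carrier ?V" using D(3) e(1) by (auto simp: x_def power_simps)
    have k: "k \<in> carrier ?K" by (simp add: k_def carrier_integer_mod_group)
    have "dmap l b z = dmap (L x) (k = 1) z" if z: "z \<in> M" for z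
    proof -
      have "dmap l b z = dmap (L x) b z"
        by (rule dmap_cong[OF db _ z]) (use e(2) in \<open>simp add: L_def x_def\<close>)
      then show ?thesis by (simp add: k_def)
    qed
    note E = this
    show "\<exists>n\<in>N. \<exists>x\<in>carrier ?V. \<exists>k\<in>carrier ?K. h = n \<otimes>\<^bsub>H\<^esub> f x k"
    proof -
      have "g z = n (dmap (L x) (k = 1) z)" if "z \<in> M" for z using D(4) E[OF that] that by simp
      from lift_split[OF g(1) D(1,2) LV[OF x] this] show ?thesis using k x unfolding f_def g(2) by blast
    qed
  qed
qed

section \<open>The Kronecker case\<close>

text \<open>The columns of the matrix are the coordinates of the images of the two arrows.\<close>

definition kimg :: "'a \<Rightarrow> 'a \<Rightarrow> 'k mat \<Rightarrow> 'a \<Rightarrow> (('v, 'a) qpath \<Rightarrow>\<^sub>0 'k)" where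
  "kimg a b m c = (let j = (if c = a then 0 else 1) in
     scale (m $$ (0, j)) (path_elem (ar a)) + scale (m $$ (1, j)) (path_elem (ar b)))"

text \<open>
  No two arrows compose, so every invertible substitution of the two arrows is an automorphism, and no
  correction terms exist.
\<close>

lemma kron_case:
  assumes kr: kron shows "H Mod N \<cong> GL2 TYPE('k)"
proof -
  obtain a b where ks: "kshape a b (tail Q a) (head Q a)" using kron_kshape[OF kr] .
  have ab: "arcs Q = {a, b}" "a \<noteq> b" "tail Q b = tail Q a" "head Q b = head Q a" "tail Q a \<noteq> head Q a"
    using ks by (auto simp: kshape_def)
  have aA: "a \<in> arcs Q" "b \<in> arcs Q" using ab by auto
  let ?R = "ring_mat TYPE('k) 2 ()"
  interpret R: ring ?R by (rule ring_mat)
  let ?k = "\<lambda>m. ext (kimg a b m)"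
  have pp: "(path_elem (ar d) :: _ \<Rightarrow>\<^sub>0 'k) \<in> par c" if "c \<in> arcs Q" "d \<in> arcs Q" for c d
    using that ab by (intro par_path) (auto simp: arrow_path_def path_tgt_eq)
  have img: "kimg a b m c \<in> par c" if "c \<in> arcs Q" for m c
    unfolding kimg_def Let_def using pp[OF that] aA by (intro par_closed)
  have rel: "kimg a b m c \<star> kimg a b m d = 0" if "c \<in> arcs Q" "d \<in> arcs Q" "head Q c = tail Q d" for m c d
    using that ab by auto
  have kv: "vend (?k m)" for m by (rule vend_ext(1)[OF img rel])
  have ka: "?k m (path_elem (ar c)) = kimg a b m c" if "c \<in> arcs Q" for m c
    by (rule vend_ext(2)[OF img rel that])
  have kM: "?k m x \<in> M" if "x \<in> M" for m x using kv that by (simp add: vend_def)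
  have cm: "?k m (?k m' x) = ?k (m * m') x" if m: "m \<in> carrier_mat 2 2" "m' \<in> carrier_mat 2 2" and x: "x \<in> M" for m m' x
  proof -
    have ix: "(m * m') $$ (i, j) = m $$ (i, 0) * m' $$ (0, j) + m $$ (i, 1) * m' $$ (1, j)" if "i < 2" "j < 2" for i j
      using m that by (simp add: scalar_prod_def numeral_2_eq_2)
    have ex: "?k m (scale r (path_elem (ar a)) + scale s (path_elem (ar b))) = scale r (kimg a b m a) + scale s (kimg a b m b)" for r s
      by (simp only: ext_add ext_scale ka[OF aA(1)] ka[OF aA(2)])
    have "?k m (?k m' (path_elem (ar c))) = ?k (m * m') (path_elem (ar c))" if c: "c \<in> arcs Q" for c
    proof -
      let ?j = "if c = a then 0 else 1 :: nat"
      have j: "?j < 2" by simp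
      have ix0: "(m * m') $$ (0, ?j) = m $$ (0, 0) * m' $$ (0, ?j) + m $$ (0, 1) * m' $$ (1, ?j)"
        and ix1: "(m * m') $$ (1, ?j) = m $$ (1, 0) * m' $$ (0, ?j) + m $$ (1, 1) * m' $$ (1, ?j)"
        by (rule ix[OF _ j]; simp)+
      have E: "kimg a b m a = scale (m $$ (0, 0)) (path_elem (ar a)) + scale (m $$ (1, 0)) (path_elem (ar b))"
        "kimg a b m b = scale (m $$ (0, 1)) (path_elem (ar a)) + scale (m $$ (1, 1)) (path_elem (ar b))"
        using ab(2) by (simp_all add: kimg_def)
      have "?k m (?k m' (path_elem (ar c))) = scale (m' $$ (0, ?j)) (kimg a b m a) + scale (m' $$ (1, ?j)) (kimg a b m b)"
        unfolding ka[OF c] kimg_def[of a b m' c] Let_def by (rule ex)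
      also have "\<dots> = scale ((m * m') $$ (0, ?j)) (path_elem (ar a)) + scale ((m * m') $$ (1, ?j)) (path_elem (ar b))"
        unfolding E ix0 ix1
        by (rule poly_mapping_eqI) (simp add: lookup_add algebra_simps)
      also have "\<dots> = ?k (m * m') (path_elem (ar c))"
        unfolding ka[OF c] kimg_def Let_def ..
      finally show ?thesis .
    qed
    then show ?thesis using vend_eqI[OF vend_comp[OF kv kv] kv _ x, of m m' "m * m'"] by simp
  qed
  have k1: "?k (1\<^sub>m 2) x = x" if x: "x \<in> M" for x
    by (rule vend_eqI[OF kv _ _ x, where h = "\<lambda>x. x"]) (use ab in \<open>auto simp: ka kimg_def vend_def\<close>)
  have units: "m \<in> carrier (GL2 TYPE('k)) \<longleftrightarrow> m \<in> carrier_mat 2 2 \<and> (\<exists>m'\<in>carrier_mat 2 2. m' * m = 1\<^sub>m 2 \<and> m * m' = 1\<^sub>m 2)" for m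
    by (simp add: GL2_def units_of_def Units_def ring_mat_simps)
  have va: "vaut (?k m)" if mG: "m \<in> carrier (GL2 TYPE('k))" for m
  proof -
    obtain m' where m: "m \<in> carrier_mat 2 2" "m' \<in> carrier_mat 2 2" "m' * m = 1\<^sub>m 2" "m * m' = 1\<^sub>m 2"
      using mG units[of m] by blast
    show ?thesis unfolding vaut_iff_vend
      by (intro conjI kv bij_betw_byWitness[where f' = "?k m'"]) (auto simp: cm m k1 kM)
  qed
  have lk: "lin (?k m) a a = m $$ (0, 0)" "lin (?k m) a b = m $$ (1, 0)" "lin (?k m) b a = m $$ (0, 1)" "lin (?k m) b b = m $$ (1, 1)" for m
    using ab(2) unfolding lin_def ka[OF aA(1)] ka[OF aA(2)] kimg_def Let_def
    by (auto simp: lookup_add coef_path_elem arrow_path_def)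
  have less2: "i < 2 \<longleftrightarrow> i = 0 \<or> i = (1::nat)" for i by auto
  show ?thesis
  proof (rule complement_iso[OF _ group_H normal_N, where f = "\<lambda>m. lift (?k m)"])
    show "group (GL2 TYPE('k))" unfolding GL2_def by (rule R.units_group)
    show "(\<lambda>m. lift (?k m)) \<in> hom (GL2 TYPE('k)) H"
    proof (rule homI)
      fix m m' assume m: "m \<in> carrier (GL2 TYPE('k))" "m' \<in> carrier (GL2 TYPE('k))"
      have mm: "m \<otimes>\<^bsub>GL2 TYPE('k)\<^esub> m' = m * m'" by (simp add: GL2_def units_of_def ring_mat_simps)
      have "m * m' \<in> carrier (GL2 TYPE('k))"
        using m mm group.is_monoid[OF R.units_group] by (metis GL2_def monoid.m_closed)
      then show "lift (?k (m \<otimes>\<^bsub>GL2 TYPE('k)\<^esub> m')) = lift (?k m) \<otimes>\<^bsub>H\<^esub> lift (?k m')"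
        unfolding mm lift_mult[OF va[OF m(1)] va[OF m(2)]]
        using lift_eq_iff[OF va vaut_comp[OF va[OF m(1)] va[OF m(2)]]] cm m units by simp
    qed (rule lift_in_H[OF va])
    show "m = \<one>\<^bsub>GL2 TYPE('k)\<^esub>" if m: "m \<in> carrier (GL2 TYPE('k))" "lift (?k m) \<in> N" for m
    proof -
      have "inner (?k m)" using m lift_N_iff[OF va[OF m(1)]] by blast
      note il = inner_lin[OF va[OF m(1)] this]
      have "m = 1\<^sub>m 2"
        using m(1) il[OF aA(1), of a] il[OF aA(1), of b] il[OF aA(2), of a] il[OF aA(2), of b] ab(2) units
        by (intro eq_matI) (auto simp: lk less2)
      then show ?thesis by (simp add: GL2_def units_of_def ring_mat_simps)
    qed
    fix h assume "h \<in> carrier H"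
    then obtain g where g: "vaut g" "h = lift g" by (rule H_cases)
    define s where "s i = (if i = 0 then a else b)" for i :: nat
    define mat where "mat g = Matrix.mat 2 2 (\<lambda>(i, j). lin g (s j) (s i))" for g :: "(('v, 'a) qpath \<Rightarrow>\<^sub>0 'k) \<Rightarrow> (('v, 'a) qpath \<Rightarrow>\<^sub>0 'k)"
    have mc: "mat g \<in> carrier_mat 2 2" for g by (simp add: mat_def)
    have mm: "mat g * mat g' = mat (g \<circ> g')" if "vaut g" "vaut g'" for g g'
    proof (rule eq_matI)
      fix i j assume ij: "i < dim_row (mat (g \<circ> g'))" "j < dim_col (mat (g \<circ> g'))"
      then have "i < 2" "j < 2" by (simp_all add: mat_def)
      moreover have "s j \<in> arcs Q" "s i \<in> arcs Q" using aA by (auto simp: s_def)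
      then have "lin (g \<circ> g') (s j) (s i) = lin g' (s j) a * lin g a (s i) + lin g' (s j) b * lin g b (s i)"
        using lin_comp[OF that, of "s j" "s i"] ab(1,2) by simp
      ultimately show "(mat g * mat g') $$ (i, j) = mat (g \<circ> g') $$ (i, j)"
        by (simp add: mat_def scalar_prod_def numeral_2_eq_2) (simp add: s_def mult.commute)
    qed (simp_all add: mat_def)
    have mid: "mat g = 1\<^sub>m 2" if "\<And>x. x \<in> M \<Longrightarrow> g x = x" for g
    proof (rule eq_matI)
      fix i j assume "i < dim_row (1\<^sub>m 2 :: 'k mat)" "j < dim_col (1\<^sub>m 2 :: 'k mat)"
      moreover have "lin g (s j) (s i) = (if s j = s i then 1 else 0)"
        using lin_cong[of g "\<lambda>x. x" "s j" "s i"] that aA by (simp add: lin_id s_def)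
      ultimately show "mat g $$ (i, j) = 1\<^sub>m 2 $$ (i, j)" using ab(2) by (auto simp: mat_def s_def less2)
    qed (simp_all add: mat_def)
    note gi = vaut_inv[OF g(1)]
    have G: "mat g \<in> carrier (GL2 TYPE('k))"
      unfolding units using mc mm[OF g(1) gi] mm[OF gi g(1)] mid[of "g \<circ> inv_into M g"] mid[of "inv_into M g \<circ> g"]
        vaut_inv_right[OF g(1)] vaut_inv_left[OF g(1)]
      by (intro conjI bexI[of _ "mat (inv_into M g)"]) simp_all
    have "im g c = kimg a b (mat g) c" if c: "c \<in> arcs Q" for c
    proof (rule kshape_eqI[OF ks])
      have "kimg a b (mat g) c \<in> Mp" unfolding kimg_def Let_def using ar_Mp aA by (intro Mp_closed)
      then show "kimg a b (mat g) c \<in> M" "coef (im g c) (tail Q a, []) = coef (kimg a b (mat g) c) (tail Q a, [])"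
        "coef (im g c) (head Q a, []) = coef (kimg a b (mat g) c) (head Q a, [])"
        using im_Mp[OF g(1) c] by (auto simp: Mp_def)
      show "im g c \<in> M" using im_Mp[OF g(1) c] by (rule Mp_M)
      show "coef (im g c) (tail Q a, [a]) = coef (kimg a b (mat g) c) (tail Q a, [a])"
        "coef (im g c) (tail Q a, [b]) = coef (kimg a b (mat g) c) (tail Q a, [b])"
        using c ab by (auto simp: kimg_def mat_def s_def lookup_add coef_path_elem arrow_path_def lin_def)
    qed
    then have gk: "g x = ?k (mat g) x" if "x \<in> M" for x
      using vend_eqI[OF vaut_vend[OF g(1)] kv _ that] ka by simp
    show "\<exists>n\<in>N. \<exists>m\<in>carrier (GL2 TYPE('k)). h = n \<otimes>\<^bsub>H\<^esub> lift (?k m)"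
      using lift_split[OF g(1) vaut_id(1) inner_id va[OF G]] gk G unfolding g(2) by auto
  qed
qed

end

text \<open>A lone loop without relation would give the polynomial algebra, which is excluded.\<close>

lemma gentle_algebraI:
  fixes Q :: "('v, 'a) pre_digraph" and I :: "(('v, 'a) qpath \<Rightarrow>\<^sub>0 'k::field) set"
  assumes gc: "gentle_conditions Q I"
    and np: "\<not> algebra_isomorphic (bound_quiver_algebra Q I) polynomial_algebra"
  obtains S where "gentle_algebra Q S I"
proof -
  have "\<exists>S \<subseteq> {p \<in> paths Q. path_length p = 2}.
      I = Idl\<^bsub>path_algebra Q :: ('k, ('v, 'a) qpath \<Rightarrow>\<^sub>0 'k) module\<^esub> (path_elem ` S)"
    using gc unfolding gentle_conditions_def by (elim conjE)
  then obtain S where S: "S \<subseteq> {p \<in> paths Q. path_length p = 2}"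
    "I = Idl\<^bsub>path_algebra Q :: ('k, ('v, 'a) qpath \<Rightarrow>\<^sub>0 'k) module\<^esub> (path_elem ` S)"
    by blast
  have q: "fin_digraph Q" "connected Q" "arcs Q \<noteq> {}" using gc by (auto simp: gentle_conditions_def quiver_def)
  interpret bound_quiver_ideal Q S I
    unfolding bound_quiver_ideal_def bound_quiver_ideal_axioms_def bound_quiver_def using q(1) S by blast
  have cond: "\<forall>a\<in>arcs Q. \<forall>b\<in>arcs Q. \<forall>b'\<in>arcs Q.
      b \<noteq> b' \<and> tail Q a = head Q b \<and> tail Q a = head Q b' \<longrightarrow>
      (path_elem (tail Q b, [b, a]) \<in> I) \<noteq> (path_elem (tail Q b', [b', a]) \<in> I)"
    by (rule gc[unfolded gentle_conditions_def, THEN conjunct2, THEN conjunct2, THEN conjunct1])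
  have cond': "\<forall>a\<in>arcs Q. \<forall>b\<in>arcs Q. \<forall>b'\<in>arcs Q.
      b \<noteq> b' \<and> head Q a = tail Q b \<and> head Q a = tail Q b' \<longrightarrow>
      (path_elem (tail Q a, [a, b]) \<in> I) \<noteq> (path_elem (tail Q a, [a, b']) \<in> I)"
    by (rule gc[unfolded gentle_conditions_def, THEN conjunct2, THEN conjunct2, THEN conjunct2, THEN conjunct1])
  have deg: "\<forall>v\<in>verts Q. in_degree Q v \<le> 2 \<and> out_degree Q v \<le> 2"
    by (rule gc[unfolded gentle_conditions_def, THEN conjunct2, THEN conjunct1])
  have "gentle_quiver Q S"
  proof
    show "connected Q" "arcs Q \<noteq> {}" using q by auto
    show "in_degree Q v \<le> 2" "out_degree Q v \<le> 2" if "v \<in> verts Q" for v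
      using deg that by blast+
    show "nz b a \<longleftrightarrow> \<not> nz b' a" if ab: "a \<in> arcs Q" "b \<in> arcs Q" "b' \<in> arcs Q" "b \<noteq> b'" "head Q b = tail Q a" "head Q b' = tail Q a" for a b b'
    proof -
      have "(path_elem (tail Q b, [b, a]) \<in> I) \<noteq> (path_elem (tail Q b', [b', a]) \<in> I)"
        using cond ab by metis
      then show ?thesis unfolding nz_iff using ab by blast
    qed
    show "nz a b \<longleftrightarrow> \<not> nz a b'" if ab: "a \<in> arcs Q" "b \<in> arcs Q" "b' \<in> arcs Q" "b \<noteq> b'" "head Q a = tail Q b" "head Q a = tail Q b'" for a b b'
    proof -
      have "(path_elem (tail Q a, [a, b]) \<in> I) \<noteq> (path_elem (tail Q a, [a, b']) \<in> I)"
        using cond' ab by metis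
      then show ?thesis unfolding nz_iff using ab by blast
    qed
    show "\<not> nz a a" if "verts Q = {v}" "arcs Q = {a}" for v a
      using loop_isomorphic_polynomials[OF that] np by blast
  qed
  then have "gentle_algebra Q S I" using bound_quiver_ideal_axioms by (simp add: gentle_algebra_def)
  then show thesis by (rule that)
qed

theorem theorem6p8:
  fixes Q :: "('v, 'a) pre_digraph"
    and I :: "(('v, 'a) qpath \<Rightarrow>\<^sub>0 'k::field) set"
  assumes "gentle Q I \<or> locally_gentle Q I"
    and "\<not> algebra_isomorphic (bound_quiver_algebra Q I) polynomial_algebra"
  shows
    "let A = bound_quiver_algebra Q I;
         H = H_group Q I;
         N = carrier H \<inter> Inn_star Q I;
         KK = (path_algebra kronecker_quiver :: ('k, (nat, bool) qpath \<Rightarrow>\<^sub>0 'k) module);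
         double = is_double_chain Q \<or> is_double_cycle Q;
         n = card {a \<in> arcs Q. gamma_bar_exists Q I a}
     in N \<lhd> H \<and>
        (algebra_isomorphic A KK \<longrightarrow> H Mod N \<cong> GL2 TYPE('k)) \<and>
        (\<not> algebra_isomorphic A KK \<and> double \<longrightarrow>
           iso_to_semidirect_product (H Mod N)
             (mult_group_power TYPE('k) (card (arcs Q))) (integer_mod_group 2)) \<and>
        (\<not> algebra_isomorphic A KK \<and> \<not> double \<longrightarrow>
           iso_to_semidirect_product (H Mod N)
             (add_group_power TYPE('k) n) (mult_group_power TYPE('k) (card (arcs Q))))"
proof -
  have "gentle_conditions Q I" using assms(1) by (auto simp: gentle_def locally_gentle_def)
  then obtain S where "gentle_algebra Q S I" using gentle_algebraI[OF _ assms(2)] by blast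
  then interpret gentle_algebra Q S I .
  have n: "{a \<in> arcs Q. gamma_bar_exists Q I a} = {a \<in> arcs Q. hasg a}" using gamma_bar_iff by blast
  show ?thesis
    unfolding Let_def isomorphic_kronecker_iff double_iff n
    using normal_N kron_case double_case generic_case by blast
qed

end
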